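(* Let $K$ be a field and let $S$ be a commutative $K$-algebra that is finite dimensional as a $K$-vector space. If $\operatorname{HH}^n(S|K;S)=0$ for two non-negative values of $n$ of different parity, then $S$ is a product of separable field extensions of $K$.
   Context: $\operatorname{HH}^n(S|K;S)$ denotes the $n$th Hochschild cohomology of the $K$-algebra $S$ with coefficients in $S$; since $K$ is a field, $\operatorname{HH}^n(S|K;S)=\operatorname{Ext}^n_{S\otimes_K S}(S,S)$, where $S$ is a module over $S\otimes_KS$ via the multiplication map. *)

theory Defs
  imports "HOL-Algebra.Algebra"
begin

section \<open>Finite-dimensional algebras\<close>

definition finite_dimensional ::
    "('k, 'r) ring_scheme \<Rightarrow> ('k, 'a, 'm) module_scheme \<Rightarrow> bool" where
  "finite_dimensional K S \<longleftrightarrow>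
     (\<exists>B. finite B \<and> B \<subseteq> carrier S \<and>
        (\<forall>x \<in> carrier S. \<exists>!c. c \<in> B \<rightarrow>\<^sub>E carrier K \<and> x = (\<Oplus>\<^bsub>S\<^esub>b\<in>B. c b \<odot>\<^bsub>S\<^esub> b)))"

definition algebra_iso ::
    "('k, 'r) ring_scheme \<Rightarrow> ('k, 'a, 'm) module_scheme \<Rightarrow> ('k, 'b, 'n) module_scheme
      \<Rightarrow> ('a \<Rightarrow> 'b) set" where
  "algebra_iso K S T =
     {h \<in> ring_iso S T. \<forall>c \<in> carrier K. \<forall>x \<in> carrier S. h (c \<odot>\<^bsub>S\<^esub> x) = c \<odot>\<^bsub>T\<^esub> h x}"

definition product_algebra ::
    "'i set \<Rightarrow> ('i \<Rightarrow> ('k, 'a, 'm) module_scheme) \<Rightarrow> ('k, 'i \<Rightarrow> 'a) module" where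
  "product_algebra I L =
     \<lparr>carrier = (\<Pi>\<^sub>E i\<in>I. carrier (L i)),
      monoid.mult = (\<lambda>x y. \<lambda>i\<in>I. x i \<otimes>\<^bsub>L i\<^esub> y i),
      one = (\<lambda>i\<in>I. \<one>\<^bsub>L i\<^esub>),
      ring.zero = (\<lambda>i\<in>I. \<zero>\<^bsub>L i\<^esub>),
      add = (\<lambda>x y. \<lambda>i\<in>I. x i \<oplus>\<^bsub>L i\<^esub> y i),
      smult = (\<lambda>c x. \<lambda>i\<in>I. c \<odot>\<^bsub>L i\<^esub> x i)\<rparr>"


section \<open>Separable field extensions\<close>

context ring
begin

text \<open>Polynomials are coefficient lists with the leading coefficient first.\<close>

definition formal_derivative :: "'a list \<Rightarrow> 'a list" where
  "formal_derivative p = normalize (map (\<lambda>i. add_pow R (degree p - i) (p ! i)) [0..<degree p])"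

definition separable_polynomial :: "'a set \<Rightarrow> 'a list \<Rightarrow> bool" where
  "separable_polynomial F p \<longleftrightarrow>
     (\<forall>d \<in> carrier (F[X]). d divides\<^bsub>F[X]\<^esub> p \<and> d divides\<^bsub>F[X]\<^esub> formal_derivative p
        \<longrightarrow> d \<in> Units (F[X]))"

definition separable_over :: "'a set \<Rightarrow> 'a \<Rightarrow> bool" where
  "separable_over F x \<longleftrightarrow> (algebraic over F) x \<and> separable_polynomial F (Irr F x)"

end

text \<open>
  A field extension of \<open>K\<close> is given by its structure map, that is, as a \<open>K\<close>-algebra which is a
  field; the copy of \<open>K\<close> inside it is the image of that map.
\<close>

definition separable_field_extension ::
    "('k, 'r) ring_scheme \<Rightarrow> ('k, 'a, 'm) module_scheme \<Rightarrow> bool" where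
  "separable_field_extension K L \<longleftrightarrow>
     field L \<and> algebra K L \<and>
     (\<forall>x \<in> carrier L. ring.separable_over L ((\<lambda>c. c \<odot>\<^bsub>L\<^esub> \<one>\<^bsub>L\<^esub>) ` carrier K) x)"

text \<open>
  The factors may be taken with elements in the type of \<open>S\<close>, since every factor of a product
  of rings is in bijection with an ideal of that product. The empty product is the zero ring.
\<close>

definition product_of_separable_field_extensions ::
    "('k, 'r) ring_scheme \<Rightarrow> ('k, 'a, 'm) module_scheme \<Rightarrow> bool" where
  "product_of_separable_field_extensions K S \<longleftrightarrow>
     (\<exists>(n::nat) (L :: nat \<Rightarrow> ('k, 'a) module).
        (\<forall>i<n. separable_field_extension K (L i)) \<and>
        algebra_iso K S (product_algebra {..<n} L) \<noteq> {})"


section \<open>Hochschild cohomology of \<open>S\<close> with coefficients in \<open>S\<close>\<close>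

text \<open>
  The \<open>n\<close>-cochains are the \<open>K\<close>-multilinear maps \<open>S\<^sup>n \<rightarrow> S\<close>, that is, the \<open>K\<close>-linear maps
  \<open>S \<otimes>\<^sub>K \<dots> \<otimes>\<^sub>K S \<rightarrow> S\<close>; an \<open>n\<close>-tuple is a function on \<open>{..<n}\<close>, extended by \<open>undefined\<close>.
\<close>

definition hochschild_cochains ::
    "('k, 'r) ring_scheme \<Rightarrow> ('k, 'a, 'm) module_scheme \<Rightarrow> nat \<Rightarrow> ((nat \<Rightarrow> 'a) \<Rightarrow> 'a) set" where
  "hochschild_cochains K S n =
     {f \<in> ({..<n} \<rightarrow>\<^sub>E carrier S) \<rightarrow>\<^sub>E carrier S.
        \<forall>a \<in> {..<n} \<rightarrow>\<^sub>E carrier S. \<forall>i<n.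
          (\<forall>x \<in> carrier S. \<forall>y \<in> carrier S. f (a(i := x \<oplus>\<^bsub>S\<^esub> y)) = f (a(i := x)) \<oplus>\<^bsub>S\<^esub> f (a(i := y))) \<and>
          (\<forall>c \<in> carrier K. \<forall>x \<in> carrier S. f (a(i := c \<odot>\<^bsub>S\<^esub> x)) = c \<odot>\<^bsub>S\<^esub> f (a(i := x)))}"

definition hochschild_cochain_group ::
    "('k, 'r) ring_scheme \<Rightarrow> ('k, 'a, 'm) module_scheme \<Rightarrow> nat \<Rightarrow> ((nat \<Rightarrow> 'a) \<Rightarrow> 'a) monoid" where
  "hochschild_cochain_group K S n =
     \<lparr>carrier = hochschild_cochains K S n,
      monoid.mult = (\<lambda>f g. \<lambda>a \<in> {..<n} \<rightarrow>\<^sub>E carrier S. f a \<oplus>\<^bsub>S\<^esub> g a),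
      one = (\<lambda>a \<in> {..<n} \<rightarrow>\<^sub>E carrier S. \<zero>\<^bsub>S\<^esub>)\<rparr>"

text \<open>
  With arguments numbered from \<open>0\<close>, the differential of an \<open>n\<close>-cochain \<open>f\<close> sends
  \<open>(a\<^sub>0, \<dots>, a\<^sub>n)\<close> to
  \<open>a\<^sub>0 f(a\<^sub>1, \<dots>, a\<^sub>n) + (\<Sum>i<n. (-1)\<^sup>i\<^sup>+\<^sup>1 f(\<dots>, a\<^sub>i a\<^sub>i\<^sub>+\<^sub>1, \<dots>)) + (-1)\<^sup>n\<^sup>+\<^sup>1 f(a\<^sub>0, \<dots>, a\<^sub>n\<^sub>-\<^sub>1) a\<^sub>n\<close>.
\<close>

definition hochschild_differential ::
    "('k, 'a, 'm) module_scheme \<Rightarrow> nat \<Rightarrow> ((nat \<Rightarrow> 'a) \<Rightarrow> 'a) \<Rightarrow> (nat \<Rightarrow> 'a) \<Rightarrow> 'a" where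
  "hochschild_differential S n f =
     (\<lambda>a \<in> {..<Suc n} \<rightarrow>\<^sub>E carrier S.
        a 0 \<otimes>\<^bsub>S\<^esub> f (\<lambda>j\<in>{..<n}. a (Suc j))
        \<oplus>\<^bsub>S\<^esub> (\<Oplus>\<^bsub>S\<^esub>i\<in>{..<n}. ((\<ominus>\<^bsub>S\<^esub> \<one>\<^bsub>S\<^esub>) [^]\<^bsub>S\<^esub> Suc i) \<otimes>\<^bsub>S\<^esub>
              f (\<lambda>j\<in>{..<n}. if j < i then a j
                            else if j = i then a i \<otimes>\<^bsub>S\<^esub> a (Suc i)
                            else a (Suc j)))
        \<oplus>\<^bsub>S\<^esub> ((\<ominus>\<^bsub>S\<^esub> \<one>\<^bsub>S\<^esub>) [^]\<^bsub>S\<^esub> Suc n) \<otimes>\<^bsub>S\<^esub> (f (restrict a {..<n}) \<otimes>\<^bsub>S\<^esub> a n))"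

definition hochschild_cocycles ::
    "('k, 'r) ring_scheme \<Rightarrow> ('k, 'a, 'm) module_scheme \<Rightarrow> nat \<Rightarrow> ((nat \<Rightarrow> 'a) \<Rightarrow> 'a) set" where
  "hochschild_cocycles K S n =
     {f \<in> hochschild_cochains K S n.
        hochschild_differential S n f = \<one>\<^bsub>hochschild_cochain_group K S (Suc n)\<^esub>}"

fun hochschild_coboundaries ::
    "('k, 'r) ring_scheme \<Rightarrow> ('k, 'a, 'm) module_scheme \<Rightarrow> nat \<Rightarrow> ((nat \<Rightarrow> 'a) \<Rightarrow> 'a) set" where
  "hochschild_coboundaries K S 0 = {\<one>\<^bsub>hochschild_cochain_group K S 0\<^esub>}"
| "hochschild_coboundaries K S (Suc n) = hochschild_differential S n ` hochschild_cochains K S n"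

definition hochschild_cohomology ::
    "('k, 'r) ring_scheme \<Rightarrow> ('k, 'a, 'm) module_scheme \<Rightarrow> nat \<Rightarrow> ((nat \<Rightarrow> 'a) \<Rightarrow> 'a) set monoid" where
  "hochschild_cohomology K S n =
     (hochschild_cochain_group K S n)\<lparr>carrier := hochschild_cocycles K S n\<rparr>
       Mod hochschild_coboundaries K S n"

end

(*
  S is a product of local algebras, cut out by primitive idempotents, and the cohomology of every
  factor embeds into that of S. So let R be one of the factors, with residue field k.

  Suppose first that there is a nonzero K-linear derivation R -> k. Let e be the maximal number of
  derivations D_1, ..., D_e that are dual to elements a_1, ..., a_e. Since R is finite-dimensional,
  a Hasse-Schmidt derivation R -> k[t]/(t^N) with nonzero linear term cannot be prolonged for ever,
  and the obstruction at the last step is a symmetric 2-cocycle G with values in k that is not a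
  coboundary. For s in the socle of R, the cup products s D_1 ... D_n (n <= e) and
  s D_1 ... D_e G^i are cocycles. Evaluating on the shuffle product of a_1, ..., a_e with divided
  powers of a 2-chain W, whose boundary is supported on a_1, ..., a_e and on which G is nonzero,
  annihilates all coboundaries but not these cocycles. Hence HH^n is nonzero whenever n <= e or
  n - e is even, which covers one of any two degrees of different parity.

  If there is no such derivation, then R is a separable field extension of K. A functional on R
  that is annihilated by powers of all commutators with multiplications is a differential operator,
  and an operator of positive order yields a derivation by taking commutators. Fitting's lemma
  provides such a functional when R is not reduced; a projection of R onto the span of the p-th
  powers is one when R is a field with K R^p different from R.
*)

theory Submission
  imports Defs
begin

section \<open>Cochains as functions on lists\<close>

text \<open>The obstacle is to see that an explicit cocycle is no coboundary without computing the
  cohomology. The test chains are shuffle products because these are compatible with the Hochschild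
  boundary of a commutative ring: a single element is a cycle and shuffles with itself to zero, so a
  chain with boundary supported on a_1, ..., a_e becomes a cycle once it is shuffled with all of
  them. Maximality of e makes such chains available: the a_j then generate the differentials, and
  every 1-chain is homologous to one supported on them. The powers of W are divided because an
  ordinary power carries the factor i!, which may vanish in K. Hasse-Schmidt derivations produce the
  class of degree 2 uniformly in all characteristics. The socle element s turns k-valued cochains
  into R-valued ones: s is killed by the maximal ideal, so arbitrary representatives of residue
  classes may be used in the products.\<close>

context cring
begin

text \<open>A cochain is a function on argument lists of all lengths at once, so that recursion can
  peel off the first argument without tracking a degree. Partial application is a named constant in
  order that terms such as \<open>ins y (lp b f) bs\<close> stay atoms for
  \<open>algebra\<close>.\<close>

fun lp :: "'a \<Rightarrow> ('a list \<Rightarrow> 'a) \<Rightarrow> 'a list \<Rightarrow> 'a" where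
  "lp b f cs = f (b # cs)"

declare lp.simps [simp del]

lemma lp_apply [simp]: "set cs \<subseteq> carrier R \<Longrightarrow> lp b f cs = f (b # cs)"
  by (simp add: lp.simps)

text \<open>
  \<open>ins y\<close> is dual to the signed shuffle product with \<open>y\<close>, and \<open>pdiff x f\<close> consists of the three
  terms of the differential in which the first argument \<open>x\<close> meets its neighbour.
\<close>

fun ins :: "'a \<Rightarrow> ('a list \<Rightarrow> 'a) \<Rightarrow> 'a list \<Rightarrow> 'a" where
  "ins y f [] = f [y]"
| "ins y f (b # bs) = f (y # b # bs) \<ominus> ins y (lp b f) bs"

definition leib :: "'a \<Rightarrow> 'a \<Rightarrow> ('a \<Rightarrow> 'a) \<Rightarrow> 'a" where
  "leib x y h = x \<otimes> h y \<ominus> h (x \<otimes> y) \<oplus> y \<otimes> h x"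

fun pdiff :: "'a \<Rightarrow> ('a list \<Rightarrow> 'a) \<Rightarrow> 'a list \<Rightarrow> 'a" where
  "pdiff x f [] = \<zero>"
| "pdiff x f (b # bs) = x \<otimes> f (b # bs) \<ominus> f ((x \<otimes> b) # bs) \<oplus> b \<otimes> f (x # bs)"

text \<open>A telescoping form of the Hochschild differential: the summand
  \<open>b \<otimes> f (x # bs)\<close> of \<open>pdiff\<close> cancels the leading term of
  \<open>ldiff (lp x f) (b # bs)\<close>. On a single argument x the two outer terms, x times the
  value at the empty list, cancel by commutativity.\<close>

fun ldiff :: "('a list \<Rightarrow> 'a) \<Rightarrow> 'a list \<Rightarrow> 'a" where
  "ldiff f [] = \<zero>"
| "ldiff f [x] = \<zero>"
| "ldiff f (x # b # bs) = pdiff x f (b # bs) \<ominus> ldiff (lp x f) (b # bs)"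

definition lfun :: "('a list \<Rightarrow> 'a) set" where
  "lfun = {f. \<forall>bs. set bs \<subseteq> carrier R \<longrightarrow> f bs \<in> carrier R}"

lemma lfunI: "(\<And>bs. set bs \<subseteq> carrier R \<Longrightarrow> f bs \<in> carrier R) \<Longrightarrow> f \<in> lfun"
  by (simp add: lfun_def)

lemma lfunD [simp]: "f \<in> lfun \<Longrightarrow> set bs \<subseteq> carrier R \<Longrightarrow> f bs \<in> carrier R"
  by (simp add: lfun_def)

lemma lp_lfun [simp]: "f \<in> lfun \<Longrightarrow> b \<in> carrier R \<Longrightarrow> lp b f \<in> lfun"
  by (auto intro!: lfunI)

lemma ins_closed [simp]:
  "f \<in> lfun \<Longrightarrow> y \<in> carrier R \<Longrightarrow> set bs \<subseteq> carrier R \<Longrightarrow> ins y f bs \<in> carrier R"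
  by (induction bs arbitrary: f) auto

lemma ins_lfun [simp]: "f \<in> lfun \<Longrightarrow> y \<in> carrier R \<Longrightarrow> ins y f \<in> lfun"
  by (auto intro!: lfunI)

lemma pdiff_closed [simp]:
  "f \<in> lfun \<Longrightarrow> y \<in> carrier R \<Longrightarrow> set bs \<subseteq> carrier R \<Longrightarrow> pdiff y f bs \<in> carrier R"
  by (cases bs) auto

lemma pdiff_lfun [simp]: "f \<in> lfun \<Longrightarrow> y \<in> carrier R \<Longrightarrow> pdiff y f \<in> lfun"
  by (auto intro!: lfunI)

lemma ldiff_closed [simp]: "f \<in> lfun \<Longrightarrow> set bs \<subseteq> carrier R \<Longrightarrow> ldiff f bs \<in> carrier R"
  by (induction f bs rule: ldiff.induct) auto

lemma ldiff_lfun [simp]: "f \<in> lfun \<Longrightarrow> ldiff f \<in> lfun"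
  by (auto intro!: lfunI)

section \<open>Linearity of insertion in the cochain\<close>

lemma ins_cong:
  "(\<And>cs. set cs \<subseteq> carrier R \<Longrightarrow> f cs = g cs) \<Longrightarrow> y \<in> carrier R \<Longrightarrow> set bs \<subseteq> carrier R
    \<Longrightarrow> ins y f bs = ins y g bs"
proof (induction bs arbitrary: f g)
  case (Cons b bs)
  have "ins y (lp b f) bs = ins y (lp b g) bs"
    using Cons.prems by (intro Cons.IH) auto
  then show ?case using Cons.prems by simp
qed auto

lemma ins_add:
  assumes "\<And>cs. set cs \<subseteq> carrier R \<Longrightarrow> h cs = f cs \<oplus> g cs"
    and "f \<in> lfun" "g \<in> lfun" "y \<in> carrier R" "set bs \<subseteq> carrier R"
  shows "ins y h bs = ins y f bs \<oplus> ins y g bs"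
  using assms
proof (induction bs arbitrary: h f g)
  case (Cons b bs)
  have *: "ins y (lp b h) bs = ins y (lp b f) bs \<oplus> ins y (lp b g) bs"
    using Cons.prems by (intro Cons.IH) auto
  have **: "h (y # b # bs) = f (y # b # bs) \<oplus> g (y # b # bs)"
    using Cons.prems by simp
  have c: "ins y (lp b f) bs \<in> carrier R" "ins y (lp b g) bs \<in> carrier R"
    "f (y # b # bs) \<in> carrier R" "g (y # b # bs) \<in> carrier R"
    using Cons.prems by auto
  show ?case unfolding ins.simps * ** using c by algebra
qed auto

lemma ins_minus:
  assumes "\<And>cs. set cs \<subseteq> carrier R \<Longrightarrow> h cs = f cs \<ominus> g cs"
    and "f \<in> lfun" "g \<in> lfun" "y \<in> carrier R" "set bs \<subseteq> carrier R"
  shows "ins y h bs = ins y f bs \<ominus> ins y g bs"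
  using assms
proof (induction bs arbitrary: h f g)
  case (Cons b bs)
  have *: "ins y (lp b h) bs = ins y (lp b f) bs \<ominus> ins y (lp b g) bs"
    using Cons.prems by (intro Cons.IH) auto
  have **: "h (y # b # bs) = f (y # b # bs) \<ominus> g (y # b # bs)"
    using Cons.prems by simp
  have c: "ins y (lp b f) bs \<in> carrier R" "ins y (lp b g) bs \<in> carrier R"
    "f (y # b # bs) \<in> carrier R" "g (y # b # bs) \<in> carrier R"
    using Cons.prems by auto
  show ?case unfolding ins.simps * ** using c by algebra
qed auto

lemma ins_smult:
  assumes "\<And>cs. set cs \<subseteq> carrier R \<Longrightarrow> h cs = c \<otimes> f cs"
    and "f \<in> lfun" "c \<in> carrier R" "y \<in> carrier R" "set bs \<subseteq> carrier R"
  shows "ins y h bs = c \<otimes> ins y f bs"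
  using assms
proof (induction bs arbitrary: h f)
  case (Cons b bs)
  have *: "ins y (lp b h) bs = c \<otimes> ins y (lp b f) bs"
    using Cons.prems by (intro Cons.IH) auto
  have **: "h (y # b # bs) = c \<otimes> f (y # b # bs)"
    using Cons.prems by simp
  have c: "ins y (lp b f) bs \<in> carrier R" "f (y # b # bs) \<in> carrier R" "c \<in> carrier R"
    using Cons.prems by auto
  show ?case unfolding ins.simps * ** using c by algebra
qed auto

lemma ins_zero:
  assumes "\<And>cs. set cs \<subseteq> carrier R \<Longrightarrow> f cs = \<zero>" "y \<in> carrier R" "set bs \<subseteq> carrier R"
  shows "ins y f bs = \<zero>"
  using assms
proof (induction bs arbitrary: f)
  case (Cons b bs)
  have "ins y (lp b f) bs = \<zero>" using Cons.prems by (intro Cons.IH) auto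
  then show ?case using Cons.prems by simp
qed auto

section \<open>Anticommutation of insertions and their compatibility with the differential\<close>

lemma ins_ins_step:
  assumes "f \<in> lfun" "y \<in> carrier R" "z \<in> carrier R" "b \<in> carrier R" "set bs \<subseteq> carrier R"
  shows "ins y (ins z f) (b # bs) = f (z # y # b # bs) \<ominus> f (y # z # b # bs)
    \<oplus> ins z (lp b (lp y f)) bs \<ominus> ins y (lp b (lp z f)) bs \<oplus> ins y (ins z (lp b f)) bs"
proof -
  have *: "ins y (lp b (ins z f)) bs = ins y (lp b (lp z f)) bs \<ominus> ins y (ins z (lp b f)) bs"
    using assms by (intro ins_minus) auto
  have c: "f (z # y # b # bs) \<in> carrier R" "f (y # z # b # bs) \<in> carrier R"
    "ins z (lp b (lp y f)) bs \<in> carrier R" "ins y (lp b (lp z f)) bs \<in> carrier R"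
    "ins y (ins z (lp b f)) bs \<in> carrier R"
    using assms by simp_all
  show ?thesis
    unfolding ins.simps(2)[of y "ins z f"] * unfolding ins.simps(2)[of z] lp.simps[of y f "z # b # bs"]
    using c by algebra
qed

text \<open>Single elements have odd degree, and the shuffle product is graded commutative.\<close>

lemma ins_anticomm:
  assumes "f \<in> lfun" "y \<in> carrier R" "z \<in> carrier R" "set bs \<subseteq> carrier R"
  shows "ins y (ins z f) bs = \<ominus> ins z (ins y f) bs"
  using assms
proof (induction bs arbitrary: f)
  case Nil
  have c: "f [y, z] \<in> carrier R" "f [z, y] \<in> carrier R" using Nil by auto
  show ?case unfolding ins.simps lp.simps[of _ f "[_]"] lp.simps[of _ f "[]"] using c by algebra
next
  case (Cons b bs)
  have b: "b \<in> carrier R" "set bs \<subseteq> carrier R" using Cons.prems by auto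
  have IH: "ins y (ins z (lp b f)) bs = \<ominus> ins z (ins y (lp b f)) bs"
    using Cons.prems by (intro Cons.IH) auto
  have c: "f (z # y # b # bs) \<in> carrier R" "f (y # z # b # bs) \<in> carrier R"
    "ins z (lp b (lp y f)) bs \<in> carrier R" "ins y (lp b (lp z f)) bs \<in> carrier R"
    "ins z (ins y (lp b f)) bs \<in> carrier R"
    using Cons.prems by simp_all
  show ?case
    unfolding ins_ins_step[OF Cons.prems(1-3) b] ins_ins_step[OF Cons.prems(1,3,2) b] IH
    using c by algebra
qed

text \<open>A separate induction: in characteristic 2 this does not follow from
  \<open>ins_anticomm\<close>.\<close>

lemma ins_self:
  assumes "f \<in> lfun" "y \<in> carrier R" "set bs \<subseteq> carrier R"
  shows "ins y (ins y f) bs = \<zero>"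
  using assms
proof (induction bs arbitrary: f)
  case Nil
  have c: "f [y, y] \<in> carrier R" using Nil by auto
  show ?case unfolding ins.simps lp.simps[of _ f "[_]"] lp.simps[of _ f "[]"] using c by algebra
next
  case (Cons b bs)
  have b: "b \<in> carrier R" "set bs \<subseteq> carrier R" using Cons.prems by auto
  have IH: "ins y (ins y (lp b f)) bs = \<zero>"
    using Cons.prems by (intro Cons.IH) auto
  have c: "f (y # y # b # bs) \<in> carrier R" "ins y (lp b (lp y f)) bs \<in> carrier R"
    using Cons.prems by simp_all
  show ?case
    unfolding ins_ins_step[OF Cons.prems(1,2,2) b] IH using c by algebra
qed

text \<open>The combination is the one that \<open>pdiff\<close> and \<open>leib\<close> have in
  common.\<close>

lemma ins_lin3:
  assumes "\<And>ds. set ds \<subseteq> carrier R \<Longrightarrow> h ds = x \<otimes> f1 ds \<ominus> f2 ds \<oplus> c \<otimes> f3 ds"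
    and "f1 \<in> lfun" "f2 \<in> lfun" "f3 \<in> lfun" "x \<in> carrier R" "c \<in> carrier R" "y \<in> carrier R"
    and "set cs \<subseteq> carrier R"
  shows "ins y h cs = x \<otimes> ins y f1 cs \<ominus> ins y f2 cs \<oplus> c \<otimes> ins y f3 cs"
proof -
  define g1 g3 g12 where g: "g1 = (\<lambda>ds. x \<otimes> f1 ds)" "g3 = (\<lambda>ds. c \<otimes> f3 ds)" "g12 = (\<lambda>ds. g1 ds \<ominus> f2 ds)"
  have l: "g1 \<in> lfun" "g3 \<in> lfun" "g12 \<in> lfun"
    using assms by (auto intro!: lfunI simp: g)
  have "ins y h cs = ins y g12 cs \<oplus> ins y g3 cs"
    using assms l by (intro ins_add) (auto simp: g)
  also have "ins y g12 cs = ins y g1 cs \<ominus> ins y f2 cs"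
    using assms l by (intro ins_minus) (auto simp: g)
  also have "ins y g1 cs = x \<otimes> ins y f1 cs"
    using assms l by (intro ins_smult) (auto simp: g)
  also have "ins y g3 cs = c \<otimes> ins y f3 cs"
    using assms l by (intro ins_smult) (auto simp: g)
  finally show ?thesis .
qed

text \<open>The first summand has y in front. In the others y stands further right:
  \<open>ins y f\<close> runs over all positions behind the removed x, and \<open>lp y f\<close>
  takes back the position directly in front.\<close>

lemma ins_pdiff:
  assumes "f \<in> lfun" "x \<in> carrier R" "y \<in> carrier R" "set bs \<subseteq> carrier R"
  shows "ins y (pdiff x f) bs = pdiff x f (y # bs) \<oplus> pdiff x (ins y f) bs \<ominus> pdiff x (lp y f) bs"
proof (cases bs)
  case Nil
  then show ?thesis using assms by (auto simp: a_minus_def)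
next
  case (Cons c cs)
  have cs: "c \<in> carrier R" "set cs \<subseteq> carrier R" and xc: "x \<otimes> c \<in> carrier R" using assms Cons by auto
  have *: "ins y (lp c (pdiff x f)) cs = x \<otimes> ins y (lp c f) cs
     \<ominus> ins y (lp (x \<otimes> c) f) cs \<oplus> c \<otimes> ins y (lp x f) cs"
    using assms cs by (intro ins_lin3) auto
  have c: "ins y (lp c f) cs \<in> carrier R" "ins y (lp (x \<otimes> c) f) cs \<in> carrier R"
    "ins y (lp x f) cs \<in> carrier R" "f (y # c # cs) \<in> carrier R" "f (y # (x \<otimes> c) # cs) \<in> carrier R"
    "f (y # x # cs) \<in> carrier R" "pdiff x f (y # c # cs) \<in> carrier R"
    using assms cs xc by simp_all
  show ?thesis unfolding Cons
    unfolding ins.simps(2)[of y "pdiff x f"] *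
    unfolding pdiff.simps(2)[of x "ins y f"] pdiff.simps(2)[of x "lp y f"] ins.simps(2)
      lp.simps[of y f "c # cs"] lp.simps[of y f "(x \<otimes> c) # cs"] lp.simps[of y f "x # cs"]
    using c cs(1) assms(2) by algebra
qed

text \<open>This symmetry rests on commutativity of the ring and is the reason why shuffling is
  compatible with the differential.\<close>

lemma pdiff_comm:
  assumes "f \<in> lfun" "x \<in> carrier R" "y \<in> carrier R" "set bs \<subseteq> carrier R"
  shows "pdiff x f (y # bs) = pdiff y f (x # bs)"
proof -
  have c: "f (y # bs) \<in> carrier R" "f (x # bs) \<in> carrier R" "f ((y \<otimes> x) # bs) \<in> carrier R"
    using assms by auto
  have *: "x \<otimes> y = y \<otimes> x" using assms by (simp add: m_comm)
  show ?thesis unfolding pdiff.simps * using c assms(2,3) by algebra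
qed

lemma ldiff_minus:
  assumes "\<And>cs. set cs \<subseteq> carrier R \<Longrightarrow> k cs = g cs \<ominus> h cs"
    and "g \<in> lfun" "h \<in> lfun" "set bs \<subseteq> carrier R"
  shows "ldiff k bs = ldiff g bs \<ominus> ldiff h bs"
  using assms
proof (induction k bs arbitrary: g h rule: ldiff.induct)
  case (3 f x d bs)
  have *: "ldiff (lp x f) (d # bs) = ldiff (lp x g) (d # bs) \<ominus> ldiff (lp x h) (d # bs)"
    using "3.prems" by (intro "3.IH") auto
  have e: "f (d # bs) = g (d # bs) \<ominus> h (d # bs)" "f ((x \<otimes> d) # bs) = g ((x \<otimes> d) # bs) \<ominus> h ((x \<otimes> d) # bs)"
    "f (x # bs) = g (x # bs) \<ominus> h (x # bs)"
    using "3.prems" by auto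
  have c: "ldiff (lp x g) (d # bs) \<in> carrier R" "ldiff (lp x h) (d # bs) \<in> carrier R"
    "x \<in> carrier R" "d \<in> carrier R" "g (d # bs) \<in> carrier R" "h (d # bs) \<in> carrier R"
    "g ((x \<otimes> d) # bs) \<in> carrier R" "h ((x \<otimes> d) # bs) \<in> carrier R" "g (x # bs) \<in> carrier R" "h (x # bs) \<in> carrier R"
    using "3.prems" by simp_all
  show ?case unfolding ldiff.simps * pdiff.simps e using c by algebra
qed (auto simp: a_minus_def)

lemma lp_ldiff: "lp b (ldiff f) cs = pdiff b f cs \<ominus> ldiff (lp b f) cs"
  by (cases cs) (auto simp: a_minus_def lp.simps)

lemma lp_ins: "lp b (ins y f) cs = lp b (lp y f) cs \<ominus> ins y (lp b f) cs"
  by (simp add: lp.simps)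

text \<open>Dual form of the Leibniz rule of the Hochschild boundary for shuffle products: y is a
  cycle of odd degree, so shuffling with y anticommutes with the boundary.\<close>

lemma ins_ldiff:
  assumes "f \<in> lfun" "y \<in> carrier R" "set bs \<subseteq> carrier R"
  shows "ins y (ldiff f) bs = \<ominus> ldiff (ins y f) bs"
  using assms
proof (induction bs arbitrary: f)
  case Nil then show ?case by simp
next
  case (Cons b bs')
  then have b: "b \<in> carrier R" and bs': "set bs' \<subseteq> carrier R" by auto
  show ?case
  proof (cases bs')
    case Nil
    have c: "pdiff b f [y] \<in> carrier R" using Cons.prems b by (simp del: pdiff.simps)
    have "pdiff y f [b] = pdiff b f [y]" using Cons.prems b by (intro pdiff_comm) auto
    then have "ins y (ldiff f) [b] = (pdiff b f [y] \<ominus> \<zero>) \<ominus> (pdiff b f [y] \<ominus> \<zero>)"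
      using b by (simp del: pdiff.simps add: lp.simps[of b "ldiff f" "[y]"])
    also have "\<dots> = \<zero>" using c by algebra
    finally show ?thesis using Nil by simp
  next
    case bs'2: (Cons c bs)
    have 0: "ins y (lp b (ldiff f)) bs' = ins y (pdiff b f) bs' \<ominus> ins y (ldiff (lp b f)) bs'"
      using Cons.prems b bs' by (intro ins_minus lp_ldiff) auto
    have 1: "ins y (ldiff (lp b f)) bs' = \<ominus> ldiff (ins y (lp b f)) bs'"
      using Cons.prems b bs' by (intro Cons.IH) auto
    have 2: "ins y (pdiff b f) bs' = pdiff b f (y # bs') \<oplus> pdiff b (ins y f) bs' \<ominus> pdiff b (lp y f) bs'"
      using Cons.prems b bs' by (intro ins_pdiff) auto
    have 3: "ldiff (lp b (ins y f)) bs' = ldiff (lp b (lp y f)) bs' \<ominus> ldiff (ins y (lp b f)) bs'"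
      using Cons.prems b bs' by (intro ldiff_minus lp_ins) auto
    \<comment> \<open>The terms in which y and b are multiplied occur once for each order of the
      two, with opposite signs, and cancel by symmetry.\<close>
    have 4: "pdiff y f (b # bs') = pdiff b f (y # bs')"
      using Cons.prems b bs' by (intro pdiff_comm) auto
    have 5: "ldiff f (y # b # bs') = pdiff y f (b # bs') \<ominus> (pdiff b (lp y f) bs' \<ominus> ldiff (lp b (lp y f)) bs')"
      and 6: "ldiff (ins y f) (b # bs') = pdiff b (ins y f) bs' \<ominus> ldiff (lp b (ins y f)) bs'"
      unfolding bs'2 by (simp_all only: ldiff.simps)
    have c: "pdiff b f (y # bs') \<in> carrier R" "pdiff b (lp y f) bs' \<in> carrier R"
      "ldiff (lp b (lp y f)) bs' \<in> carrier R" "pdiff b (ins y f) bs' \<in> carrier R"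
      "ldiff (ins y (lp b f)) bs' \<in> carrier R"
      using Cons.prems b bs' by (simp_all del: pdiff.simps)
    show ?thesis
      unfolding ins.simps(2)[of y "ldiff f"] 0 1 2 5 6 3 4 using c by algebra
  qed
qed

end

section \<open>Evaluation on powers of a 2-chain\<close>

context cring
begin

section \<open>Formal 2-chains, given as lists of triples (coefficient, x, y)\<close>

fun wsum :: "('a \<times> 'a \<times> 'a) list \<Rightarrow> ('a \<Rightarrow> 'a \<Rightarrow> 'a) \<Rightarrow> 'a" where
  "wsum [] g = \<zero>"
| "wsum ((s, x, y) # W) g = s \<otimes> g x y \<oplus> wsum W g"

abbreviation chain2 :: "('a \<times> 'a \<times> 'a) list \<Rightarrow> bool" where
  "chain2 W \<equiv> set W \<subseteq> carrier R \<times> carrier R \<times> carrier R"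

lemma wsum_closed [simp]:
  "chain2 W \<Longrightarrow> (\<And>x y. x \<in> carrier R \<Longrightarrow> y \<in> carrier R \<Longrightarrow> g x y \<in> carrier R) \<Longrightarrow> wsum W g \<in> carrier R"
  by (induction W) auto

lemma wsum_cong:
  "chain2 W \<Longrightarrow> (\<And>x y. x \<in> carrier R \<Longrightarrow> y \<in> carrier R \<Longrightarrow> g x y = h x y) \<Longrightarrow> wsum W g = wsum W h"
  by (induction W) auto

lemma wsum_zero:
  "chain2 W \<Longrightarrow> (\<And>x y. x \<in> carrier R \<Longrightarrow> y \<in> carrier R \<Longrightarrow> g x y = \<zero>) \<Longrightarrow> wsum W g = \<zero>"
  by (induction W) auto

lemma wsum_add:
  assumes "chain2 W"
    and "\<And>x y. x \<in> carrier R \<Longrightarrow> y \<in> carrier R \<Longrightarrow> f x y \<in> carrier R"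
    and "\<And>x y. x \<in> carrier R \<Longrightarrow> y \<in> carrier R \<Longrightarrow> g x y \<in> carrier R"
    and "\<And>x y. x \<in> carrier R \<Longrightarrow> y \<in> carrier R \<Longrightarrow> h x y = f x y \<oplus> g x y"
  shows "wsum W h = wsum W f \<oplus> wsum W g"
  using assms(1)
proof (induction W)
  case (Cons q W)
  obtain s x y where q: "q = (s, x, y)" by (cases q)
  have c: "s \<in> carrier R" "f x y \<in> carrier R" "g x y \<in> carrier R" "wsum W f \<in> carrier R" "wsum W g \<in> carrier R"
    and e: "h x y = f x y \<oplus> g x y" and IH: "wsum W h = wsum W f \<oplus> wsum W g"
    using Cons assms(2-4) q by auto
  show ?case unfolding q wsum.simps IH e using c by algebra
qed auto

lemma wsum_smult:
  assumes "chain2 W" and "c \<in> carrier R"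
    and "\<And>x y. x \<in> carrier R \<Longrightarrow> y \<in> carrier R \<Longrightarrow> f x y \<in> carrier R"
    and "\<And>x y. x \<in> carrier R \<Longrightarrow> y \<in> carrier R \<Longrightarrow> h x y = c \<otimes> f x y"
  shows "wsum W h = c \<otimes> wsum W f"
  using assms(1)
proof (induction W)
  case (Cons q W)
  obtain s x y where q: "q = (s, x, y)" by (cases q)
  have c: "s \<in> carrier R" "f x y \<in> carrier R" "wsum W f \<in> carrier R" "c \<in> carrier R"
    and e: "h x y = c \<otimes> f x y" and IH: "wsum W h = c \<otimes> wsum W f"
    using Cons assms(2-4) q by auto
  show ?case unfolding q wsum.simps IH e using c by algebra
qed (use assms in auto)

lemma wsum_uminus:
  assumes "chain2 W"
    and "\<And>x y. x \<in> carrier R \<Longrightarrow> y \<in> carrier R \<Longrightarrow> f x y \<in> carrier R"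
    and "\<And>x y. x \<in> carrier R \<Longrightarrow> y \<in> carrier R \<Longrightarrow> h x y = \<ominus> f x y"
  shows "wsum W h = \<ominus> wsum W f"
proof -
  have "wsum W h = (\<ominus> \<one>) \<otimes> wsum W f"
    using assms by (intro wsum_smult) (auto simp: l_minus)
  then show ?thesis using assms by (simp add: l_minus)
qed

lemma wsum_append:
  "chain2 V \<Longrightarrow> chain2 W \<Longrightarrow> (\<And>x y. x \<in> carrier R \<Longrightarrow> y \<in> carrier R \<Longrightarrow> g x y \<in> carrier R)
    \<Longrightarrow> wsum (V @ W) g = wsum V g \<oplus> wsum W g"
  by (induction V) (auto simp: a_assoc)

lemma wsum_scale:
  assumes "chain2 W" "c \<in> carrier R"
    and g: "\<And>x y. x \<in> carrier R \<Longrightarrow> y \<in> carrier R \<Longrightarrow> g x y \<in> carrier R"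
  shows "wsum (map (\<lambda>(s, p). (c \<otimes> s, p)) W) g = c \<otimes> wsum W g"
  using assms(1)
proof (induction W)
  case (Cons q W)
  obtain s x y where q: "q = (s, x, y)" by (cases q)
  have "s \<in> carrier R" "g x y \<in> carrier R" "wsum W g \<in> carrier R"
    using Cons g q by auto
  then show ?case using Cons q assms(2) by (simp add: r_distr m_assoc)
qed (use assms in auto)

lemma wsum_swap:
  assumes "chain2 V" "chain2 W"
    and g: "\<And>x y u v. \<lbrakk>x \<in> carrier R; y \<in> carrier R; u \<in> carrier R; v \<in> carrier R\<rbrakk> \<Longrightarrow> g x y u v \<in> carrier R"
  shows "wsum V (\<lambda>x y. wsum W (\<lambda>u v. g x y u v)) = wsum W (\<lambda>u v. wsum V (\<lambda>x y. g x y u v))"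
  using assms(1)
proof (induction V)
  case Nil
  then show ?case using assms by (auto intro!: wsum_zero[symmetric])
next
  case (Cons q V)
  obtain s x y where q: "q = (s, x, y)" by (cases q)
  have c: "s \<in> carrier R" "x \<in> carrier R" "y \<in> carrier R" "chain2 V" using Cons q by auto
  have "wsum W (\<lambda>u v. wsum (q # V) (\<lambda>x y. g x y u v))
     = wsum W (\<lambda>u v. s \<otimes> g x y u v) \<oplus> wsum W (\<lambda>u v. wsum V (\<lambda>x y. g x y u v))"
    using assms c unfolding q by (intro wsum_add) auto
  also have "wsum W (\<lambda>u v. s \<otimes> g x y u v) = s \<otimes> wsum W (\<lambda>u v. g x y u v)"
    using assms c by (intro wsum_smult) auto
  finally show ?case using Cons q by simp
qed

text \<open>An alternating form vanishes on (W, W). The diagonal is a separate assumption, so that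
  the argument covers characteristic 2; off the diagonal the terms cancel in pairs as the list grows
  by one triple.\<close>

lemma wsum_antisym:
  assumes "chain2 W"
    and g: "\<And>x y u v. \<lbrakk>x \<in> carrier R; y \<in> carrier R; u \<in> carrier R; v \<in> carrier R\<rbrakk> \<Longrightarrow> g x y u v \<in> carrier R"
    and a: "\<And>x y u v. \<lbrakk>x \<in> carrier R; y \<in> carrier R; u \<in> carrier R; v \<in> carrier R\<rbrakk> \<Longrightarrow> g u v x y = \<ominus> g x y u v"
    and z: "\<And>x y. \<lbrakk>x \<in> carrier R; y \<in> carrier R\<rbrakk> \<Longrightarrow> g x y x y = \<zero>"
  shows "wsum W (\<lambda>x y. wsum W (g x y)) = \<zero>"
  using assms(1)
proof (induction W)
  case (Cons q W)
  obtain s x y where q: "q = (s, x, y)" by (cases q)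
  have c: "s \<in> carrier R" "x \<in> carrier R" "y \<in> carrier R" "chain2 W" using Cons q by auto
  have "wsum W (\<lambda>u v. wsum (q # W) (g u v))
     = wsum W (\<lambda>u v. s \<otimes> g u v x y) \<oplus> wsum W (\<lambda>u v. wsum W (g u v))"
    using g c unfolding q by (intro wsum_add) auto
  also have "wsum W (\<lambda>u v. wsum W (g u v)) = \<zero>" using Cons by simp
  also have "wsum W (\<lambda>u v. s \<otimes> g u v x y) = (\<ominus> s) \<otimes> wsum W (g x y)"
  proof (intro wsum_smult)
    fix u v assume uv: "u \<in> carrier R" "v \<in> carrier R"
    show "s \<otimes> g u v x y = (\<ominus> s) \<otimes> g x y u v"
      unfolding a[OF c(2,3) uv] using c g uv by (simp add: l_minus r_minus)
  qed (use g c in auto)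
  finally have e: "wsum W (\<lambda>u v. wsum (q # W) (g u v)) = (\<ominus> s) \<otimes> wsum W (g x y) \<oplus> \<zero>" .
  obtain w where w: "w = wsum W (g x y)" "w \<in> carrier R" using g c by auto
  have "wsum (q # W) (\<lambda>x y. wsum (q # W) (g x y))
      = s \<otimes> wsum (q # W) (g x y) \<oplus> wsum W (\<lambda>u v. wsum (q # W) (g u v))"
    unfolding q by (rule wsum.simps(2))
  also have "wsum (q # W) (g x y) = s \<otimes> \<zero> \<oplus> w"
    unfolding q w(1) using z c by simp
  also have "wsum W (\<lambda>u v. wsum (q # W) (g u v)) = (\<ominus> s) \<otimes> w \<oplus> \<zero>"
    unfolding e w(1) ..
  also have "s \<otimes> (s \<otimes> \<zero> \<oplus> w) \<oplus> ((\<ominus> s) \<otimes> w \<oplus> \<zero>) = \<zero>" using w(2) c(1) by algebra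
  finally show ?case .
qed auto

lemma leib_closed [simp]:
  "\<lbrakk>x \<in> carrier R; y \<in> carrier R; \<And>u. u \<in> carrier R \<Longrightarrow> h u \<in> carrier R\<rbrakk> \<Longrightarrow> leib x y h \<in> carrier R"
  by (simp add: leib_def)

text \<open>
  \<open>dpow W i\<close> evaluates cochains on the \<open>i\<close>-th divided shuffle power of \<open>W\<close>: keeping \<open>x\<close> in front
  and shuffling only \<open>y\<close> avoids the factor \<open>i!\<close>, which may vanish in characteristic \<open>p\<close>.
\<close>

fun dpow :: "('a \<times> 'a \<times> 'a) list \<Rightarrow> nat \<Rightarrow> ('a list \<Rightarrow> 'a) \<Rightarrow> 'a" where
  "dpow W 0 f = f []"
| "dpow W (Suc i) f = wsum W (\<lambda>x y. dpow W i (ins y (lp x f)))"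

context
  fixes W :: "('a \<times> 'a \<times> 'a) list"
  assumes W: "chain2 W"
begin

lemma dpow_closed [simp]: "f \<in> lfun \<Longrightarrow> dpow W i f \<in> carrier R"
  using W by (induction i arbitrary: f) auto

lemma dpow_cong:
  "(\<And>cs. set cs \<subseteq> carrier R \<Longrightarrow> f cs = g cs) \<Longrightarrow> dpow W i f = dpow W i g"
proof (induction i arbitrary: f g)
  case (Suc i)
  show ?case unfolding dpow.simps
    by (intro wsum_cong W Suc.IH ins_cong) (simp_all add: Suc.prems)
qed auto

lemma dpow_add:
  "f \<in> lfun \<Longrightarrow> g \<in> lfun \<Longrightarrow> (\<And>cs. set cs \<subseteq> carrier R \<Longrightarrow> h cs = f cs \<oplus> g cs)
    \<Longrightarrow> dpow W i h = dpow W i f \<oplus> dpow W i g"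
proof (induction i arbitrary: f g h)
  case (Suc i)
  show ?case unfolding dpow.simps using Suc.prems
    by (intro wsum_add W Suc.IH ins_add) simp_all
qed auto

lemma dpow_smult:
  "f \<in> lfun \<Longrightarrow> c \<in> carrier R \<Longrightarrow> (\<And>cs. set cs \<subseteq> carrier R \<Longrightarrow> h cs = c \<otimes> f cs)
    \<Longrightarrow> dpow W i h = c \<otimes> dpow W i f"
proof (induction i arbitrary: f h)
  case (Suc i)
  show ?case unfolding dpow.simps using Suc.prems
    by (intro wsum_smult W Suc.IH ins_smult) simp_all
qed auto

lemma dpow_uminus:
  "f \<in> lfun \<Longrightarrow> (\<And>cs. set cs \<subseteq> carrier R \<Longrightarrow> h cs = \<ominus> f cs) \<Longrightarrow> dpow W i h = \<ominus> dpow W i f"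
  using dpow_smult[of f "\<ominus> \<one>" h i] by (simp add: l_minus)

lemma dpow_zero: "(\<And>cs. set cs \<subseteq> carrier R \<Longrightarrow> f cs = \<zero>) \<Longrightarrow> dpow W i f = \<zero>"
proof (induction i arbitrary: f)
  case (Suc i)
  show ?case unfolding dpow.simps
    by (intro wsum_zero W Suc.IH ins_zero) (simp_all add: Suc.prems)
qed auto

lemma dpow_wsum:
  assumes "chain2 V"
    and F: "\<And>x y. x \<in> carrier R \<Longrightarrow> y \<in> carrier R \<Longrightarrow> F x y \<in> lfun"
  shows "dpow W i (\<lambda>bs. wsum V (\<lambda>x y. F x y bs)) = wsum V (\<lambda>x y. dpow W i (F x y))"
  using assms(1)
proof (induction V)
  case (Cons q V)
  obtain s x y where q: "q = (s, x, y)" by (cases q)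
  have c: "s \<in> carrier R" "x \<in> carrier R" "y \<in> carrier R" "chain2 V" using Cons q by auto
  have "dpow W i (\<lambda>bs. wsum (q # V) (\<lambda>x y. F x y bs))
      = dpow W i (\<lambda>bs. s \<otimes> F x y bs) \<oplus> dpow W i (\<lambda>bs. wsum V (\<lambda>x y. F x y bs))"
    using c F unfolding q by (intro dpow_add) (auto intro!: lfunI wsum_closed)
  also have "dpow W i (\<lambda>bs. s \<otimes> F x y bs) = s \<otimes> dpow W i (F x y)"
    using c F by (intro dpow_smult) auto
  finally show ?case using Cons q by simp
qed (auto intro!: dpow_zero)

text \<open>Contraction with the boundary of W: the Hochschild boundary of (x, y) is x [y] - [x y] +
  y [x], which \<open>leib\<close> evaluates.\<close>

definition bins :: "('a list \<Rightarrow> 'a) \<Rightarrow> 'a list \<Rightarrow> 'a" where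
  "bins f bs = wsum W (\<lambda>x y. leib x y (\<lambda>u. ins u f bs))"

text \<open>These are the terms of the boundary of a divided power in which the leading x meets an
  entry other than its partner y. That entry is the leading u of another pair (u, v) of W, and
  exchanging the two pairs changes the sign. For i = 0 there is no such entry.\<close>

lemma dpow_pdiff_zero:
  assumes g: "g \<in> lfun"
  shows "wsum W (\<lambda>x y. dpow W i (pdiff x (\<lambda>bs. ins y g bs \<ominus> lp y g bs))) = \<zero>"
proof (cases i)
  case 0
  then show ?thesis using W by (auto intro!: wsum_zero)
next
  case (Suc j)
  \<comment> \<open>The part of the differential in which x and u meet, with both removed from the
    argument list; it is symmetric in x and u.\<close>
  define Q where "Q x u bs = leib x u (\<lambda>v. g (v # bs))" for x u bs
  have Ql: "Q x u \<in> lfun" if "x \<in> carrier R" "u \<in> carrier R" for x u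
    using that g by (auto intro!: lfunI simp: Q_def)
  define t where "t x y u v = dpow W j (ins v (\<lambda>bs. \<ominus> ins y (Q x u) bs))" for x y u v
  have tl: "(\<lambda>bs. \<ominus> ins y (Q x u) bs) \<in> lfun" if "x \<in> carrier R" "u \<in> carrier R" "y \<in> carrier R" for x u y
    using that Ql by (auto intro!: lfunI)
  have t2: "t x y u v = \<ominus> dpow W j (ins v (ins y (Q x u)))"
    if "x \<in> carrier R" "u \<in> carrier R" "y \<in> carrier R" "v \<in> carrier R" for x u y v
  proof -
    have "ins v (\<lambda>bs. \<ominus> ins y (Q x u) bs) cs = (\<ominus> \<one>) \<otimes> ins v (ins y (Q x u)) cs"
      if "set cs \<subseteq> carrier R" for cs
      using that \<open>x \<in> carrier R\<close> \<open>u \<in> carrier R\<close> \<open>y \<in> carrier R\<close> \<open>v \<in> carrier R\<close> Ql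
      by (intro ins_smult) (auto simp: l_minus)
    then show ?thesis
      unfolding t_def using that Ql by (intro dpow_uminus) (auto simp: l_minus)
  qed
  have "wsum W (\<lambda>x y. dpow W i (pdiff x (\<lambda>bs. ins y g bs \<ominus> lp y g bs))) = wsum W (\<lambda>x y. wsum W (t x y))"
  proof (intro wsum_cong W)
    fix x y assume xy: "x \<in> carrier R" "y \<in> carrier R"
    show "dpow W i (pdiff x (\<lambda>bs. ins y g bs \<ominus> lp y g bs)) = wsum W (t x y)"
      unfolding Suc dpow.simps t_def
    proof (intro wsum_cong W dpow_cong ins_cong)
      fix u v cs assume a: "u \<in> carrier R" "v \<in> carrier R" "set cs \<subseteq> carrier R"
      have k: "ins y g (w # cs) \<ominus> lp y g (w # cs) = \<ominus> ins y (lp w g) cs" if "w \<in> carrier R" for w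
      proof -
        have c: "ins y (lp w g) cs \<in> carrier R" "g (y # w # cs) \<in> carrier R"
          using that xy a g by auto
        have e: "lp y g (w # cs) = g (y # w # cs)" using that a by simp
        show ?thesis unfolding ins.simps e using c by algebra
      qed
      have c: "ins y (lp u g) cs \<in> carrier R" "ins y (lp (x \<otimes> u) g) cs \<in> carrier R" "ins y (lp x g) cs \<in> carrier R"
        using xy a g by auto
      have i: "ins y (Q x u) cs = x \<otimes> ins y (lp u g) cs \<ominus> ins y (lp (x \<otimes> u) g) cs \<oplus> u \<otimes> ins y (lp x g) cs"
        using xy a g by (intro ins_lin3) (auto simp: Q_def leib_def)
      have "lp u (pdiff x (\<lambda>bs. ins y g bs \<ominus> lp y g bs)) cs
          = x \<otimes> (\<ominus> ins y (lp u g) cs) \<ominus> (\<ominus> ins y (lp (x \<otimes> u) g) cs) \<oplus> u \<otimes> (\<ominus> ins y (lp x g) cs)"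
        using a xy k[of u] k[of "x \<otimes> u"] k[of x] by (simp del: ins.simps add: lp.simps)
      also have "\<dots> = \<ominus> ins y (Q x u) cs"
        unfolding i using c xy a by algebra
      finally show "lp u (pdiff x (\<lambda>bs. ins y g bs \<ominus> lp y g bs)) cs = \<ominus> ins y (Q x u) cs" .
    qed
  qed
  also have "\<dots> = \<zero>"
  proof (rule wsum_antisym[OF W])
    fix x y u v assume a: "x \<in> carrier R" "y \<in> carrier R" "u \<in> carrier R" "v \<in> carrier R"
    show "t x y u v \<in> carrier R" unfolding t_def using a tl by simp
    \<comment> \<open>Exchanging (x, y) with (u, v) leaves \<open>Q\<close> unchanged and swaps the
      insertions of y and v, which anticommute.\<close>
    have "dpow W j (ins y (ins v (Q u x))) = \<ominus> dpow W j (ins v (ins y (Q x u)))"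
    proof (rule dpow_uminus)
      fix cs assume cs: "set cs \<subseteq> carrier R"
      have "ins y (ins v (Q u x)) cs = ins y (ins v (Q x u)) cs"
      proof (intro ins_cong)
        fix bs assume "set bs \<subseteq> carrier R"
        then show "Q u x bs = Q x u bs"
          using pdiff_comm[OF g a(3,1), of bs] unfolding Q_def leib_def by simp
      qed (use a cs in auto)
      also have "\<dots> = \<ominus> ins v (ins y (Q x u)) cs"
        using a cs Ql by (intro ins_anticomm) auto
      finally show "ins y (ins v (Q u x)) cs = \<ominus> ins v (ins y (Q x u)) cs" .
    qed (use a Ql in auto)
    then show "t u v x y = \<ominus> t x y u v" using a t2 Ql by simp
  next
    fix x y assume a: "x \<in> carrier R" "y \<in> carrier R"
    have "dpow W j (ins y (ins y (Q x x))) = \<zero>"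
      using a Ql by (intro dpow_zero ins_self) auto
    then show "t x y x y = \<zero>" using a t2 by simp
  qed
  finally show ?thesis .
qed

text \<open>The chain rule for divided powers: the boundary of the (i+1)-st divided power of W is
  its i-th divided power shuffled with the boundary of W.\<close>

lemma dpow_ldiff:
  assumes "g \<in> lfun"
  shows "dpow W (Suc i) (ldiff g) = dpow W i (bins g)"
  using assms
proof (induction i arbitrary: g)
  case 0
  show ?case unfolding dpow.simps bins_def
  proof (intro wsum_cong W)
    fix x y assume xy: "x \<in> carrier R" "y \<in> carrier R"
    have "pdiff x g [y] \<in> carrier R" using xy 0 by (simp del: pdiff.simps)
    then show "ins y (lp x (ldiff g)) [] = leib x y (\<lambda>u. ins u g [])"
      using xy by (simp add: leib_def a_minus_def)
  qed
next
  case (Suc i)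
  note g = Suc.prems
  \<comment> \<open>For a pair (x, y) of W, \<open>A\<close> has the boundary of the pair at the
    front of the list, and \<open>k\<close> accounts for x meeting another entry. \<open>M\<close>
    inserts the boundary of the pair at all positions, \<open>N\<close> only behind the first entry.
    In \<open>H u v x y\<close> the boundary is that of (x, y), while (u, v) is a pair that the
    divided power has already consumed.\<close>
  define A where "A x y = lp y (pdiff x g)" for x y
  define k where "k y bs = ins y g bs \<ominus> lp y g bs" for y bs
  define N where "N x y bs = (case bs of [] \<Rightarrow> \<zero> | b # cs \<Rightarrow> leib x y (\<lambda>u. ins u (lp b g) cs))" for x y bs
  define M where "M x y bs = leib x y (\<lambda>u. ins u g bs)" for x y bs
  define H where "H u v x y bs = leib x y (\<lambda>w. ins w (ins v (lp u g)) bs)" for u v x y bs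
  have kl: "k y \<in> lfun" if "y \<in> carrier R" for y
    using that g by (auto intro!: lfunI simp: k_def)
  have Al: "A x y \<in> lfun" if "x \<in> carrier R" "y \<in> carrier R" for x y
    using that g by (auto simp: A_def)
  have Nl: "N x y \<in> lfun" if "x \<in> carrier R" "y \<in> carrier R" for x y
    using that g by (auto intro!: lfunI simp: N_def split: list.split)
  have Ml: "M x y \<in> lfun" if "x \<in> carrier R" "y \<in> carrier R" for x y
    using that g by (auto intro!: lfunI simp: M_def)
  have Hl: "H u v x y \<in> lfun" if "x \<in> carrier R" "y \<in> carrier R" "u \<in> carrier R" "v \<in> carrier R" for x y u v
    using that g by (auto intro!: lfunI simp: H_def)
  define XA where "XA = wsum W (\<lambda>x y. dpow W (Suc i) (A x y))"
  define YH where "YH = wsum W (\<lambda>u v. wsum W (\<lambda>x y. dpow W i (H u v x y)))"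
  have XAc: "XA \<in> carrier R" and YHc: "YH \<in> carrier R"
    using W Al Hl by (auto simp del: dpow.simps intro!: wsum_closed simp: XA_def YH_def)
  have l1: "dpow W (Suc i) (ins y (lp x (ldiff g)))
      = dpow W (Suc i) (A x y) \<oplus> dpow W (Suc i) (pdiff x (k y)) \<oplus> wsum W (\<lambda>u v. dpow W i (H x y u v))"
    if xy: "x \<in> carrier R" "y \<in> carrier R" for x y
  proof -
    define a1 where "a1 bs = A x y bs \<oplus> pdiff x (k y) bs" for bs
    have a1l: "a1 \<in> lfun" using xy Al kl by (auto intro!: lfunI simp: a1_def)
    have "dpow W (Suc i) (ins y (lp x (ldiff g))) = dpow W (Suc i) a1 \<oplus> dpow W (Suc i) (ldiff (ins y (lp x g)))"
    proof (rule dpow_add[OF a1l])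
      fix cs assume cs: "set cs \<subseteq> carrier R"
      have 1: "ins y (lp x (ldiff g)) cs = ins y (pdiff x g) cs \<ominus> ins y (ldiff (lp x g)) cs"
        using g xy cs by (intro ins_minus lp_ldiff) auto
      have 2: "ins y (ldiff (lp x g)) cs = \<ominus> ldiff (ins y (lp x g)) cs"
        using g xy cs by (intro ins_ldiff) auto
      have 3: "ins y (pdiff x g) cs = pdiff x g (y # cs) \<oplus> pdiff x (ins y g) cs \<ominus> pdiff x (lp y g) cs"
        using g xy cs by (intro ins_pdiff) auto
      have 4: "pdiff x (k y) cs = pdiff x (ins y g) cs \<ominus> pdiff x (lp y g) cs"
      proof (cases cs)
        case (Cons c ds)
        have c: "ins y g (c # ds) \<in> carrier R" "ins y g ((x \<otimes> c) # ds) \<in> carrier R" "ins y g (x # ds) \<in> carrier R"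
          "lp y g (c # ds) \<in> carrier R" "lp y g ((x \<otimes> c) # ds) \<in> carrier R" "lp y g (x # ds) \<in> carrier R"
          "x \<in> carrier R" "c \<in> carrier R"
          using g xy cs Cons by (simp_all del: ins.simps lp_apply)
        show ?thesis unfolding Cons pdiff.simps k_def using c by algebra
      qed (auto simp: a_minus_def)
      have 5: "A x y cs = pdiff x g (y # cs)" unfolding A_def using cs by (simp del: pdiff.simps)
      have c: "pdiff x g (y # cs) \<in> carrier R" "pdiff x (ins y g) cs \<in> carrier R" "pdiff x (lp y g) cs \<in> carrier R"
        "ldiff (ins y (lp x g)) cs \<in> carrier R"
        using g xy cs by (simp_all del: pdiff.simps)
      show "ins y (lp x (ldiff g)) cs = a1 cs \<oplus> ldiff (ins y (lp x g)) cs"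
        unfolding 1 2 3 a1_def 4 5 using c by algebra
    qed (use xy g in auto)
    also have "dpow W (Suc i) a1 = dpow W (Suc i) (A x y) \<oplus> dpow W (Suc i) (pdiff x (k y))"
      using xy Al kl by (intro dpow_add) (auto simp: a1_def)
    also have "dpow W (Suc i) (ldiff (ins y (lp x g))) = dpow W i (bins (ins y (lp x g)))"
      using xy g by (intro Suc.IH) auto
    also have "dpow W i (bins (ins y (lp x g))) = dpow W i (\<lambda>bs. wsum W (\<lambda>u v. H x y u v bs))"
      unfolding bins_def H_def ..
    also have "\<dots> = wsum W (\<lambda>u v. dpow W i (H x y u v))"
      using xy Hl by (intro dpow_wsum W) auto
    finally show ?thesis .
  qed
  have "dpow W (Suc (Suc i)) (ldiff g) = wsum W (\<lambda>x y. dpow W (Suc i) (ins y (lp x (ldiff g))))"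
    by (simp only: dpow.simps(2)[of W "Suc i"])
  also have "\<dots> = wsum W (\<lambda>x y. dpow W (Suc i) (A x y) \<oplus> dpow W (Suc i) (pdiff x (k y))) \<oplus> YH"
    unfolding YH_def using l1 W Al kl Hl by (intro wsum_add) (auto simp del: dpow.simps)
  also have "wsum W (\<lambda>x y. dpow W (Suc i) (A x y) \<oplus> dpow W (Suc i) (pdiff x (k y)))
     = XA \<oplus> wsum W (\<lambda>x y. dpow W (Suc i) (pdiff x (k y)))"
    unfolding XA_def using W Al kl by (intro wsum_add) (auto simp del: dpow.simps)
  also have "wsum W (\<lambda>x y. dpow W (Suc i) (pdiff x (k y))) = \<zero>"
    unfolding k_def using g by (rule dpow_pdiff_zero)
  finally have L: "dpow W (Suc (Suc i)) (ldiff g) = XA \<oplus> \<zero> \<oplus> YH" .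
  \<comment> \<open>Splitting by the position of the boundary of (x, y): if it is not in front, the
    leading entry is the u of another pair (u, v), and moving the insertion of v past it costs a
    sign.\<close>
  have MN: "dpow W (Suc i) (M x y) = dpow W (Suc i) (A x y) \<oplus> wsum W (\<lambda>u v. dpow W i (H u v x y))"
    if xy: "x \<in> carrier R" "y \<in> carrier R" for x y
  proof -
    have xy': "x \<otimes> y \<in> carrier R" using xy by simp
    have 1: "dpow W (Suc i) (A x y) = dpow W (Suc i) (M x y) \<oplus> dpow W (Suc i) (N x y)"
    proof (rule dpow_add)
      fix cs assume cs: "set cs \<subseteq> carrier R"
      show "A x y cs = M x y cs \<oplus> N x y cs"
      proof (cases cs)
        case Nil
        then show ?thesis using xy g by (auto simp: A_def M_def N_def leib_def lp.simps)
      next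
        case (Cons c ds)
        have c: "x \<in> carrier R" "y \<in> carrier R" "g (y # c # ds) \<in> carrier R" "g ((x \<otimes> y) # c # ds) \<in> carrier R"
          "g (x # c # ds) \<in> carrier R" "ins y (lp c g) ds \<in> carrier R" "ins x (lp c g) ds \<in> carrier R"
          "ins (x \<otimes> y) (lp c g) ds \<in> carrier R"
          using xy xy' g cs Cons by simp_all
        have e: "A x y (c # ds) = pdiff x g (y # c # ds)" unfolding A_def using cs Cons by (simp del: pdiff.simps)
        have n: "N x y (c # ds) = leib x y (\<lambda>u. ins u (lp c g) ds)" by (simp add: N_def)
        show ?thesis unfolding Cons e n M_def leib_def pdiff.simps ins.simps using c by algebra
      qed
    qed (use xy Ml Nl in auto)
    have "dpow W (Suc i) (N x y) = \<ominus> wsum W (\<lambda>u v. dpow W i (H u v x y))"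
      unfolding dpow.simps
    proof (intro wsum_uminus W dpow_uminus)
      fix u v cs assume uv: "u \<in> carrier R" "v \<in> carrier R" and cs: "set cs \<subseteq> carrier R"
      have i: "ins v (lp u (N x y)) cs = x \<otimes> ins v (ins y (lp u g)) cs \<ominus> ins v (ins (x \<otimes> y) (lp u g)) cs
          \<oplus> y \<otimes> ins v (ins x (lp u g)) cs"
        using xy uv cs g by (intro ins_lin3) (auto simp: N_def leib_def)
      have j: "ins v (ins w (lp u g)) cs = \<ominus> ins w (ins v (lp u g)) cs" if "w \<in> carrier R" for w
        using that uv cs g by (intro ins_anticomm) auto
      have c: "ins y (ins v (lp u g)) cs \<in> carrier R" "ins x (ins v (lp u g)) cs \<in> carrier R"
        "ins (x \<otimes> y) (ins v (lp u g)) cs \<in> carrier R" 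
        using xy xy' uv cs g by simp_all
      show "ins v (lp u (N x y)) cs = \<ominus> H u v x y cs"
        unfolding i j[OF xy(1)] j[OF xy(2)] j[OF xy'] H_def leib_def using c xy by algebra
    qed (use xy Hl W in auto)
    moreover obtain a b where "a = dpow W (Suc i) (M x y)" "b = wsum W (\<lambda>u v. dpow W i (H u v x y))"
       and ab: "a \<in> carrier R" "b \<in> carrier R" using xy Ml Hl W by (auto simp del: dpow.simps)
    ultimately have "dpow W (Suc i) (A x y) \<oplus> b = a \<oplus> (\<ominus> b) \<oplus> b" using 1 by simp
    also have "\<dots> = a" using ab by algebra
    finally show ?thesis using \<open>a = _\<close> \<open>b = _\<close> by simp
  qed
  have "dpow W (Suc i) (bins g) = dpow W (Suc i) (\<lambda>bs. wsum W (\<lambda>x y. M x y bs))"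
    unfolding bins_def M_def ..
  also have "\<dots> = wsum W (\<lambda>x y. dpow W (Suc i) (M x y))"
    using Ml by (intro dpow_wsum W) auto
  also have "\<dots> = XA \<oplus> wsum W (\<lambda>x y. wsum W (\<lambda>u v. dpow W i (H u v x y)))"
    unfolding XA_def using MN W Al Hl by (intro wsum_add) (auto simp del: dpow.simps)
  also have "wsum W (\<lambda>x y. wsum W (\<lambda>u v. dpow W i (H u v x y))) = YH"
    unfolding YH_def using W Hl by (intro wsum_swap) auto
  finally show ?case using L XAc YHc by simp
qed

end

end

section \<open>Cup products of derivations and 2-cocycles\<close>

context cring
begin

section \<open>Linear and multilinear functions\<close>

definition lin :: "'a set \<Rightarrow> ('a \<Rightarrow> 'a) set" where
  "lin F = {h. (\<forall>x \<in> carrier R. h x \<in> carrier R) \<and>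
     (\<forall>x \<in> carrier R. \<forall>y \<in> carrier R. h (x \<oplus> y) = h x \<oplus> h y) \<and>
     (\<forall>c \<in> F. \<forall>x \<in> carrier R. h (c \<otimes> x) = c \<otimes> h x)}"

definition mlin :: "'a set \<Rightarrow> ('a list \<Rightarrow> 'a) set" where
  "mlin F = {f \<in> lfun. \<forall>bs cs. set bs \<subseteq> carrier R \<longrightarrow> set cs \<subseteq> carrier R \<longrightarrow> (\<lambda>u. f (bs @ u # cs)) \<in> lin F}"

lemma linI:
  assumes "\<And>x. x \<in> carrier R \<Longrightarrow> h x \<in> carrier R"
    and "\<And>x y. x \<in> carrier R \<Longrightarrow> y \<in> carrier R \<Longrightarrow> h (x \<oplus> y) = h x \<oplus> h y"
    and "\<And>c x. c \<in> F \<Longrightarrow> x \<in> carrier R \<Longrightarrow> h (c \<otimes> x) = c \<otimes> h x"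
  shows "h \<in> lin F"
  using assms by (simp add: lin_def)

lemma linD:
  assumes "h \<in> lin F"
  shows "x \<in> carrier R \<Longrightarrow> h x \<in> carrier R"
    and "x \<in> carrier R \<Longrightarrow> y \<in> carrier R \<Longrightarrow> h (x \<oplus> y) = h x \<oplus> h y"
    and "c \<in> F \<Longrightarrow> x \<in> carrier R \<Longrightarrow> h (c \<otimes> x) = c \<otimes> h x"
  using assms by (simp_all add: lin_def)

lemma mlinI:
  assumes "f \<in> lfun"
    and "\<And>bs cs. set bs \<subseteq> carrier R \<Longrightarrow> set cs \<subseteq> carrier R \<Longrightarrow> (\<lambda>u. f (bs @ u # cs)) \<in> lin F"
  shows "f \<in> mlin F"
  unfolding mlin_def by (intro CollectI conjI allI impI assms)

lemma mlinD: "f \<in> mlin F \<Longrightarrow> set bs \<subseteq> carrier R \<Longrightarrow> set cs \<subseteq> carrier R \<Longrightarrow> (\<lambda>u. f (bs @ u # cs)) \<in> lin F"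
  by (simp add: mlin_def)

lemma mlin_lfun [simp]: "f \<in> mlin F \<Longrightarrow> f \<in> lfun"
  by (simp add: mlin_def)

lemma mlin_lp:
  assumes "f \<in> mlin F" "b \<in> carrier R"
  shows "lp b f \<in> mlin F"
proof -
  have "(\<lambda>u. lp b f (bs @ u # cs)) \<in> lin F" if "set bs \<subseteq> carrier R" "set cs \<subseteq> carrier R" for bs cs
  proof -
    have "set (b # bs) \<subseteq> carrier R" using that assms by simp
    from mlinD[OF assms(1) this that(2)] show ?thesis by (simp only: lp.simps append_Cons)
  qed
  then show ?thesis using assms by (intro mlinI) simp_all
qed

lemma lin_minus:
  assumes "F \<subseteq> carrier R" "h \<in> lin F" "k \<in> lin F" "\<And>x. x \<in> carrier R \<Longrightarrow> l x = h x \<ominus> k x"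
  shows "l \<in> lin F"
proof (rule linI)
  note h = linD[OF assms(2)] and k = linD[OF assms(3)]
  fix x assume x: "x \<in> carrier R"
  then show "l x \<in> carrier R" using assms(4) h k by simp
  {
    fix y assume y: "y \<in> carrier R"
    have c: "h x \<in> carrier R" "h y \<in> carrier R" "k x \<in> carrier R" "k y \<in> carrier R" using x y h k by auto
    show "l (x \<oplus> y) = l x \<oplus> l y"
      unfolding assms(4)[OF x] assms(4)[OF y] assms(4)[OF a_closed[OF x y]] h(2)[OF x y] k(2)[OF x y]
      using c by algebra
  }
  {
    fix c assume c: "c \<in> F"
    then have c': "c \<in> carrier R" using assms(1) by auto
    have cc: "h x \<in> carrier R" "k x \<in> carrier R" using x h k by auto
    show "l (c \<otimes> x) = c \<otimes> l x"
      unfolding assms(4)[OF x] assms(4)[OF m_closed[OF c' x]] h(3)[OF c x] k(3)[OF c x]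
      using c' cc by algebra
  }
qed

context
  fixes F :: "'a set"
  assumes F: "F \<subseteq> carrier R"
begin

lemma ins_lin:
  assumes "f \<in> mlin F" "set bs \<subseteq> carrier R"
  shows "(\<lambda>u. ins u f bs) \<in> lin F"
  using assms
proof (induction bs arbitrary: f)
  case Nil
  then show ?case using mlinD[of f F "[]" "[]"] by simp
next
  case (Cons b bs)
  have "(\<lambda>u. f (u # b # bs)) \<in> lin F" using mlinD[of f F "[]" "b # bs"] Cons.prems by simp
  moreover have "(\<lambda>u. ins u (lp b f) bs) \<in> lin F"
    using Cons.prems by (intro Cons.IH mlin_lp) auto
  ultimately show ?case by (rule lin_minus[OF F]) simp
qed

lemma mlin_ins:
  assumes "f \<in> mlin F" "a \<in> carrier R"
  shows "ins a f \<in> mlin F"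
proof -
  have "(\<lambda>u. ins a f (bs @ u # cs)) \<in> lin F"
    if "f \<in> mlin F" "set bs \<subseteq> carrier R" "set cs \<subseteq> carrier R" for bs cs f
    using that
  proof (induction bs arbitrary: f)
    case Nil
    have "(\<lambda>u. f (a # u # cs)) \<in> lin F" using mlinD[of f F "[a]" "cs"] Nil.prems assms(2) by simp
    moreover have "(\<lambda>u. ins a (lp u f) cs) \<in> lin F"
    proof (rule linI)
      fix x y assume xy: "x \<in> carrier R" "y \<in> carrier R"
      show "ins a (lp (x \<oplus> y) f) cs = ins a (lp x f) cs \<oplus> ins a (lp y f) cs"
      proof (rule ins_add)
        fix ds assume "set ds \<subseteq> carrier R"
        then show "lp (x \<oplus> y) f ds = lp x f ds \<oplus> lp y f ds"
          using linD(2)[OF mlinD[OF Nil.prems(1), of "[]" ds]] xy by simp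
      qed (use xy Nil assms in auto)
    next
      fix c x assume cx: "c \<in> F" "x \<in> carrier R"
      show "ins a (lp (c \<otimes> x) f) cs = c \<otimes> ins a (lp x f) cs"
      proof (rule ins_smult)
        fix ds assume "set ds \<subseteq> carrier R"
        then show "lp (c \<otimes> x) f ds = c \<otimes> lp x f ds"
          using linD(3)[OF mlinD[OF Nil.prems(1), of "[]" ds]] cx by simp
      qed (use cx Nil assms F in auto)
    qed (use Nil assms in auto)
    ultimately show ?case by (rule lin_minus[OF F]) simp
  next
    case (Cons b bs)
    have "(\<lambda>u. f (a # b # bs @ u # cs)) \<in> lin F"
      using mlinD[of f F "a # b # bs" "cs"] Cons.prems assms(2) by simp
    moreover have "(\<lambda>u. ins a (lp b f) (bs @ u # cs)) \<in> lin F"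
      using Cons.prems by (intro Cons.IH mlin_lp) auto
    ultimately show ?case by (rule lin_minus[OF F]) simp
  qed
  from mlinI[OF ins_lfun[OF mlin_lfun[OF assms(1)] assms(2)] this[OF assms(1)]] show ?thesis .
qed

end

section \<open>Evaluation on shuffle products of several elements\<close>

fun insl :: "'a list \<Rightarrow> ('a list \<Rightarrow> 'a) \<Rightarrow> 'a list \<Rightarrow> 'a" where
  "insl [] f = f"
| "insl (a # as) f = insl as (ins a f)"

lemma insl_lfun [simp]: "f \<in> lfun \<Longrightarrow> set as \<subseteq> carrier R \<Longrightarrow> insl as f \<in> lfun"
  by (induction as arbitrary: f) auto

lemma mlin_insl: "F \<subseteq> carrier R \<Longrightarrow> f \<in> mlin F \<Longrightarrow> set as \<subseteq> carrier R \<Longrightarrow> insl as f \<in> mlin F"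
  by (induction as arbitrary: f) (auto intro: mlin_ins)

lemma insl_cong:
  "(\<And>cs. set cs \<subseteq> carrier R \<Longrightarrow> f cs = g cs) \<Longrightarrow> set as \<subseteq> carrier R \<Longrightarrow> set bs \<subseteq> carrier R
    \<Longrightarrow> insl as f bs = insl as g bs"
proof (induction as arbitrary: f g)
  case (Cons a as)
  have "insl as (ins a f) bs = insl as (ins a g) bs"
    using Cons.prems by (intro Cons.IH ins_cong) auto
  then show ?case by simp
qed auto

lemma insl_uminus:
  "(\<And>cs. set cs \<subseteq> carrier R \<Longrightarrow> f cs = \<ominus> g cs) \<Longrightarrow> g \<in> lfun \<Longrightarrow> set as \<subseteq> carrier R \<Longrightarrow> set bs \<subseteq> carrier R
    \<Longrightarrow> insl as f bs = \<ominus> insl as g bs"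
proof (induction as arbitrary: f g)
  case (Cons a as)
  have "insl as (ins a f) bs = \<ominus> insl as (ins a g) bs"
  proof (rule Cons.IH)
    fix cs assume cs: "set cs \<subseteq> carrier R"
    have "ins a f cs = (\<ominus> \<one>) \<otimes> ins a g cs"
      using Cons.prems cs by (intro ins_smult) (auto simp: l_minus)
    then show "ins a f cs = \<ominus> ins a g cs" using cs Cons.prems by (simp add: l_minus)
  qed (use Cons.prems in auto)
  then show ?case by simp
qed auto

lemma ins_insl_zero:
  "f \<in> lfun \<Longrightarrow> (\<And>cs. set cs \<subseteq> carrier R \<Longrightarrow> ins a f cs = \<zero>) \<Longrightarrow> a \<in> carrier R \<Longrightarrow> set as \<subseteq> carrier R
    \<Longrightarrow> set bs \<subseteq> carrier R \<Longrightarrow> ins a (insl as f) bs = \<zero>"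
proof (induction as arbitrary: f)
  case (Cons b as)
  have "ins a (insl as (ins b f)) bs = \<zero>"
  proof (rule Cons.IH)
    fix cs assume cs: "set cs \<subseteq> carrier R"
    have "ins a (ins b f) cs = \<ominus> ins b (ins a f) cs"
      using Cons.prems cs by (intro ins_anticomm) auto
    also have "ins b (ins a f) cs = \<zero>"
      by (rule ins_zero) (use Cons.prems cs in auto)
    finally show "ins a (ins b f) cs = \<zero>" by simp
  qed (use Cons.prems in auto)
  then show ?case by simp
qed auto

text \<open>The relation of an exterior algebra: a repeated factor gives zero, after it has been
  moved past the others by anticommutation.\<close>

lemma ins_insl_mem:
  "f \<in> lfun \<Longrightarrow> a \<in> set as \<Longrightarrow> set as \<subseteq> carrier R \<Longrightarrow> set bs \<subseteq> carrier R \<Longrightarrow> ins a (insl as f) bs = \<zero>"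
proof (induction as arbitrary: f)
  case (Cons b as)
  show ?case
  proof (cases "a = b")
    case True
    have "ins a (insl as (ins b f)) bs = \<zero>"
      unfolding True using Cons.prems by (intro ins_insl_zero ins_self) auto
    then show ?thesis by simp
  next
    case False
    then show ?thesis using Cons by simp
  qed
qed auto

fun vsum :: "('a \<times> 'a) list \<Rightarrow> ('a \<Rightarrow> 'a) \<Rightarrow> 'a" where
  "vsum [] h = \<zero>"
| "vsum ((s, a) # V) h = s \<otimes> h a \<oplus> vsum V h"

lemma vsum_zero: "set V \<subseteq> carrier R \<times> Z \<Longrightarrow> (\<And>a. a \<in> Z \<Longrightarrow> h a = \<zero>) \<Longrightarrow> vsum V h = \<zero>"
  by (induction V) auto

text \<open>The test chain is the shuffle product of \<open>as\<close> with a divided power of W.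
  Its boundary contains the boundary of W, an R-combination of members of \<open>as\<close> by the
  relation between W and V, and every such member occurs a second time in the product.\<close>

lemma dpow_insl_ldiff_zero:
  assumes F: "F \<subseteq> carrier R" and W: "chain2 W" and as: "set as \<subseteq> carrier R"
    and V: "set V \<subseteq> carrier R \<times> set as"
    and WV: "\<And>h. h \<in> lin F \<Longrightarrow> wsum W (\<lambda>x y. leib x y h) = vsum V h"
    and g: "g \<in> mlin F"
  shows "dpow W i (insl as (ldiff g)) = \<zero>"
proof -
  define h where "h = insl as g"
  have h: "h \<in> mlin F" unfolding h_def by (intro mlin_insl F g as)
  have z: "dpow W i (ldiff h) = \<zero>"
  proof (cases i)
    case (Suc j)
    have "dpow W j (bins W h) = \<zero>"
    proof (intro dpow_zero W)
      fix bs assume bs: "set bs \<subseteq> carrier R"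
      have "bins W h bs = vsum V (\<lambda>u. ins u h bs)"
        unfolding bins_def[OF W] by (intro WV ins_lin F h bs)
      also have "\<dots> = \<zero>"
        using V by (rule vsum_zero) (use ins_insl_mem g as bs in \<open>auto simp: h_def\<close>)
      finally show "bins W h bs = \<zero>" .
    qed
    then show ?thesis using dpow_ldiff[OF W mlin_lfun[OF h]] Suc by simp
  qed simp
  have *: "insl as (ldiff g) = (\<lambda>bs. insl as (ldiff g) bs)" by simp
  \<comment> \<open>Every insertion passes \<open>ldiff\<close> at the cost of one sign. Since the
    target is zero, only the alternative is recorded and not the parity of the length of
    \<open>as\<close>.\<close>
  have "(\<forall>bs. set bs \<subseteq> carrier R \<longrightarrow> insl as (ldiff g) bs = ldiff h bs) \<or>
        (\<forall>bs. set bs \<subseteq> carrier R \<longrightarrow> insl as (ldiff g) bs = \<ominus> ldiff h bs)"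
    unfolding h_def using mlin_lfun[OF g] as
  proof (induction as arbitrary: g)
    case (Cons a as)
    have 1: "insl as (ins a (ldiff g)) bs = \<ominus> insl as (ldiff (ins a g)) bs" if "set bs \<subseteq> carrier R" for bs
      using Cons.prems that by (intro insl_uminus ins_ldiff) auto
    have 2: "ins a g \<in> lfun" "set as \<subseteq> carrier R" using Cons.prems by auto
    show ?case using Cons.IH[OF 2] 1 2 by auto
  qed auto
  then show ?thesis
  proof
    assume "\<forall>bs. set bs \<subseteq> carrier R \<longrightarrow> insl as (ldiff g) bs = ldiff h bs"
    then have "dpow W i (insl as (ldiff g)) = dpow W i (ldiff h)"
      by (intro dpow_cong W) auto
    then show ?thesis using z by simp
  next
    assume "\<forall>bs. set bs \<subseteq> carrier R \<longrightarrow> insl as (ldiff g) bs = \<ominus> ldiff h bs"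
    then have "dpow W i (insl as (ldiff g)) = \<ominus> dpow W i (ldiff h)"
      using h by (intro dpow_uminus W) auto
    then show ?thesis using z by simp
  qed
qed

section \<open>Cup products with a factor of degree one or two on the left\<close>

fun cup1 :: "('a \<Rightarrow> 'a) \<Rightarrow> ('a list \<Rightarrow> 'a) \<Rightarrow> 'a list \<Rightarrow> 'a" where
  "cup1 D f [] = \<zero>"
| "cup1 D f (b # bs) = D b \<otimes> f bs"

fun cup2 :: "('a \<Rightarrow> 'a \<Rightarrow> 'a) \<Rightarrow> ('a list \<Rightarrow> 'a) \<Rightarrow> 'a list \<Rightarrow> 'a" where
  "cup2 G f [] = \<zero>"
| "cup2 G f [b] = \<zero>"
| "cup2 G f (b # c # bs) = G b c \<otimes> f bs"

definition point :: "'a \<Rightarrow> 'a list \<Rightarrow> 'a" where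
  "point s bs = (if bs = [] then s else \<zero>)"

lemma ldiff_smult:
  assumes "\<And>cs. set cs \<subseteq> carrier R \<Longrightarrow> k cs = c \<otimes> g cs"
    and "g \<in> lfun" "c \<in> carrier R" "set bs \<subseteq> carrier R"
  shows "ldiff k bs = c \<otimes> ldiff g bs"
  using assms
proof (induction k bs arbitrary: g rule: ldiff.induct)
  case (3 f x d bs)
  have *: "ldiff (lp x f) (d # bs) = c \<otimes> ldiff (lp x g) (d # bs)"
    using "3.prems" by (intro "3.IH") auto
  have e: "f (d # bs) = c \<otimes> g (d # bs)" "f ((x \<otimes> d) # bs) = c \<otimes> g ((x \<otimes> d) # bs)"
    "f (x # bs) = c \<otimes> g (x # bs)"
    using "3.prems" by auto
  have c: "ldiff (lp x g) (d # bs) \<in> carrier R" "c \<in> carrier R"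
    "x \<in> carrier R" "d \<in> carrier R" "g (d # bs) \<in> carrier R"
    "g ((x \<otimes> d) # bs) \<in> carrier R" "g (x # bs) \<in> carrier R" 
    using "3.prems" by simp_all
  show ?case unfolding ldiff.simps * pdiff.simps e using c by algebra
qed auto

context
  fixes F A :: "'a set"
  assumes F: "F \<subseteq> carrier R" and A: "A \<subseteq> carrier R"
    and Am: "\<And>r z. r \<in> carrier R \<Longrightarrow> z \<in> A \<Longrightarrow> r \<otimes> z \<in> A"
begin

text \<open>
  Think of \<open>A\<close> as the annihilator of the maximal ideal: equations between functions into the
  residue field become equations after multiplication by the elements of \<open>A\<close>.
\<close>

definition dermod :: "('a \<Rightarrow> 'a) set" where
  "dermod = {D. (\<forall>x \<in> carrier R. D x \<in> carrier R) \<and> (\<forall>z \<in> A.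
     (\<forall>x \<in> carrier R. \<forall>y \<in> carrier R. D (x \<oplus> y) \<otimes> z = D x \<otimes> z \<oplus> D y \<otimes> z) \<and>
     (\<forall>c \<in> F. \<forall>x \<in> carrier R. D (c \<otimes> x) \<otimes> z = c \<otimes> (D x \<otimes> z)) \<and>
     (\<forall>x \<in> carrier R. \<forall>y \<in> carrier R. D (x \<otimes> y) \<otimes> z = (x \<otimes> D y \<oplus> y \<otimes> D x) \<otimes> z))}"

text \<open>Linearity is stated for the first argument only and reaches the second by symmetry; the
  last clause is the Hochschild cocycle identity.\<close>

definition cocmod :: "('a \<Rightarrow> 'a \<Rightarrow> 'a) set" where
  "cocmod = {G. (\<forall>x \<in> carrier R. \<forall>y \<in> carrier R. G x y \<in> carrier R) \<and> (\<forall>z \<in> A.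
     (\<forall>x \<in> carrier R. \<forall>y \<in> carrier R. G x y \<otimes> z = G y x \<otimes> z) \<and>
     (\<forall>x \<in> carrier R. \<forall>y \<in> carrier R. \<forall>w \<in> carrier R. G (x \<oplus> y) w \<otimes> z = G x w \<otimes> z \<oplus> G y w \<otimes> z) \<and>
     (\<forall>c \<in> F. \<forall>x \<in> carrier R. \<forall>w \<in> carrier R. G (c \<otimes> x) w \<otimes> z = c \<otimes> (G x w \<otimes> z)) \<and>
     (\<forall>x \<in> carrier R. \<forall>y \<in> carrier R. \<forall>w \<in> carrier R.
        (x \<otimes> G y w \<oplus> G x (y \<otimes> w)) \<otimes> z = (G (x \<otimes> y) w \<oplus> w \<otimes> G x y) \<otimes> z))}"

text \<open>The conditions on D and G hold only after multiplication by elements of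
  \<open>A\<close>; cup products are therefore built from the right, starting with a value in
  \<open>A\<close>.\<close>

definition afun :: "('a list \<Rightarrow> 'a) set" where
  "afun = {f. \<forall>bs. set bs \<subseteq> carrier R \<longrightarrow> f bs \<in> A}"

lemma afunI: "(\<And>bs. set bs \<subseteq> carrier R \<Longrightarrow> f bs \<in> A) \<Longrightarrow> f \<in> afun"
  by (simp add: afun_def)

lemma afunD: "f \<in> afun \<Longrightarrow> set bs \<subseteq> carrier R \<Longrightarrow> f bs \<in> A"
  by (simp add: afun_def)

lemma afun_lfun [simp]: "f \<in> afun \<Longrightarrow> f \<in> lfun"
  using A by (auto intro!: lfunI dest: afunD)

lemma zero_A: "z \<in> A \<Longrightarrow> \<zero> \<in> A"
  using Am[of \<zero> z] A by auto

lemma dermodI: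
  assumes "\<And>x. x \<in> carrier R \<Longrightarrow> D x \<in> carrier R"
    and "\<And>x y z. \<lbrakk>x \<in> carrier R; y \<in> carrier R; z \<in> A\<rbrakk> \<Longrightarrow> D (x \<oplus> y) \<otimes> z = D x \<otimes> z \<oplus> D y \<otimes> z"
    and "\<And>x c z. \<lbrakk>x \<in> carrier R; c \<in> F; z \<in> A\<rbrakk> \<Longrightarrow> D (c \<otimes> x) \<otimes> z = c \<otimes> (D x \<otimes> z)"
    and "\<And>x y z. \<lbrakk>x \<in> carrier R; y \<in> carrier R; z \<in> A\<rbrakk> \<Longrightarrow> D (x \<otimes> y) \<otimes> z = (x \<otimes> D y \<oplus> y \<otimes> D x) \<otimes> z"
  shows "D \<in> dermod"
  unfolding dermod_def by (intro CollectI conjI ballI assms)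

lemma cocmodI:
  assumes "\<And>x y. \<lbrakk>x \<in> carrier R; y \<in> carrier R\<rbrakk> \<Longrightarrow> G x y \<in> carrier R"
    and "\<And>x y z. \<lbrakk>x \<in> carrier R; y \<in> carrier R; z \<in> A\<rbrakk> \<Longrightarrow> G x y \<otimes> z = G y x \<otimes> z"
    and "\<And>x y w z. \<lbrakk>x \<in> carrier R; y \<in> carrier R; w \<in> carrier R; z \<in> A\<rbrakk> \<Longrightarrow> G (x \<oplus> y) w \<otimes> z = G x w \<otimes> z \<oplus> G y w \<otimes> z"
    and "\<And>x c w z. \<lbrakk>x \<in> carrier R; c \<in> F; w \<in> carrier R; z \<in> A\<rbrakk> \<Longrightarrow> G (c \<otimes> x) w \<otimes> z = c \<otimes> (G x w \<otimes> z)"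
    and "\<And>x y w z. \<lbrakk>x \<in> carrier R; y \<in> carrier R; w \<in> carrier R; z \<in> A\<rbrakk> \<Longrightarrow>
        (x \<otimes> G y w \<oplus> G x (y \<otimes> w)) \<otimes> z = (G (x \<otimes> y) w \<oplus> w \<otimes> G x y) \<otimes> z"
  shows "G \<in> cocmod"
  unfolding cocmod_def by (intro CollectI conjI ballI assms)

lemma dermodD:
  assumes "D \<in> dermod"
  shows "x \<in> carrier R \<Longrightarrow> D x \<in> carrier R"
    and "z \<in> A \<Longrightarrow> x \<in> carrier R \<Longrightarrow> y \<in> carrier R \<Longrightarrow> D (x \<oplus> y) \<otimes> z = D x \<otimes> z \<oplus> D y \<otimes> z"
    and "z \<in> A \<Longrightarrow> c \<in> F \<Longrightarrow> x \<in> carrier R \<Longrightarrow> D (c \<otimes> x) \<otimes> z = c \<otimes> (D x \<otimes> z)"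
    and "z \<in> A \<Longrightarrow> x \<in> carrier R \<Longrightarrow> y \<in> carrier R \<Longrightarrow> D (x \<otimes> y) \<otimes> z = (x \<otimes> D y \<oplus> y \<otimes> D x) \<otimes> z"
  using assms by (simp_all add: dermod_def)

lemma cocmodD:
  assumes "G \<in> cocmod"
  shows "x \<in> carrier R \<Longrightarrow> y \<in> carrier R \<Longrightarrow> G x y \<in> carrier R"
    and "z \<in> A \<Longrightarrow> x \<in> carrier R \<Longrightarrow> y \<in> carrier R \<Longrightarrow> G x y \<otimes> z = G y x \<otimes> z"
    and "z \<in> A \<Longrightarrow> x \<in> carrier R \<Longrightarrow> y \<in> carrier R \<Longrightarrow> w \<in> carrier R \<Longrightarrow> G (x \<oplus> y) w \<otimes> z = G x w \<otimes> z \<oplus> G y w \<otimes> z"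
    and "z \<in> A \<Longrightarrow> c \<in> F \<Longrightarrow> x \<in> carrier R \<Longrightarrow> w \<in> carrier R \<Longrightarrow> G (c \<otimes> x) w \<otimes> z = c \<otimes> (G x w \<otimes> z)"
    and "z \<in> A \<Longrightarrow> x \<in> carrier R \<Longrightarrow> y \<in> carrier R \<Longrightarrow> w \<in> carrier R \<Longrightarrow>
        (x \<otimes> G y w \<oplus> G x (y \<otimes> w)) \<otimes> z = (G (x \<otimes> y) w \<oplus> w \<otimes> G x y) \<otimes> z"
  using assms unfolding cocmod_def by blast+

lemma cup1_afun:
  assumes "\<And>x. x \<in> carrier R \<Longrightarrow> D x \<in> carrier R" "f \<in> afun"
  shows "cup1 D f \<in> afun"
proof (rule afunI)
  fix bs assume bs: "set bs \<subseteq> carrier R"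
  show "cup1 D f bs \<in> A"
  proof (cases bs)
    case Nil
    then show ?thesis using zero_A afunD[OF assms(2), of "[]"] by simp
  next
    case (Cons b cs)
    then show ?thesis using Am[OF assms(1) afunD[OF assms(2), of cs], of b] bs by simp
  qed
qed

lemma cup2_afun:
  assumes "G \<in> cocmod" "f \<in> afun"
  shows "cup2 G f \<in> afun"
proof (rule afunI)
  fix bs assume bs: "set bs \<subseteq> carrier R"
  have z: "\<zero> \<in> A" using zero_A afunD[OF assms(2), of "[]"] by simp
  show "cup2 G f bs \<in> A"
  proof (cases "(G, f, bs)" rule: cup2.cases)
    case (3 G' f' b c cs)
    then show ?thesis using Am[OF cocmodD(1)[OF assms(1)] afunD[OF assms(2), of cs], of b c] bs by simp
  qed (use z in auto)
qed

lemma point_afun: "s \<in> A \<Longrightarrow> point s \<in> afun"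
  using zero_A[of s] by (intro afunI) (simp add: point_def)

lemma lin_smult:
  assumes "h \<in> lin F" "c \<in> carrier R" "\<And>x. x \<in> carrier R \<Longrightarrow> l x = c \<otimes> h x"
  shows "l \<in> lin F"
  using assms F by (intro linI) (auto simp: linD r_distr m_lcomm subset_iff)

lemma lin_zero: "(\<And>x. x \<in> carrier R \<Longrightarrow> l x = \<zero>) \<Longrightarrow> l \<in> lin F"
  using F by (intro linI) auto

lemma cup1_mlin:
  assumes D: "D \<in> dermod" and f: "f \<in> afun" "f \<in> mlin F"
  shows "cup1 D f \<in> mlin F"
proof -
  have "(\<lambda>u. cup1 D f (bs @ u # cs)) \<in> lin F" if bc: "set bs \<subseteq> carrier R" "set cs \<subseteq> carrier R" for bs cs
  proof (cases bs)
    case Nil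
    have z: "f cs \<in> A" "f cs \<in> carrier R" using afunD f bc by auto
    show ?thesis unfolding Nil using dermodD[OF D] z by (intro linI) auto
  next
    case (Cons b bs')
    have "(\<lambda>u. f (bs' @ u # cs)) \<in> lin F" using bc Cons mlinD[OF f(2)] by simp
    then show ?thesis unfolding Cons
      by (rule lin_smult[where c = "D b"]) (use bc Cons dermodD[OF D] in auto)
  qed
  from mlinI[OF afun_lfun[OF cup1_afun[OF dermodD(1)[OF D] f(1)]] this] show ?thesis .
qed

lemma cup2_mlin:
  assumes G: "G \<in> cocmod" and f: "f \<in> afun" "f \<in> mlin F"
  shows "cup2 G f \<in> mlin F"
proof -
  have "(\<lambda>u. cup2 G f (bs @ u # cs)) \<in> lin F" if bc: "set bs \<subseteq> carrier R" "set cs \<subseteq> carrier R" for bs cs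
  proof (cases bs)
    case Nil
    show ?thesis
    proof (cases cs)
      case (Cons c cs')
      have z: "f cs' \<in> A" "f cs' \<in> carrier R" using afunD f bc Cons by auto
      show ?thesis unfolding Nil Cons using cocmodD[OF G] z bc Cons by (intro linI) auto
    qed (auto intro!: lin_zero simp: Nil)
  next
    case bs: (Cons b bs')
    show ?thesis
    proof (cases bs')
      case Nil
      have z: "f cs \<in> A" "f cs \<in> carrier R" using afunD f bc by auto
      have "G b u \<otimes> f cs = G u b \<otimes> f cs" if "u \<in> carrier R" for u
        using cocmodD(2)[OF G z(1), of b u] that bs bc by auto
      then show ?thesis unfolding bs Nil using cocmodD[OF G] z bc bs F
        by (intro linI) (auto simp: subset_iff)
    next
      case (Cons b' bs'')
      have "(\<lambda>u. f (bs'' @ u # cs)) \<in> lin F" using bc bs Cons mlinD[OF f(2)] by simp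
      then show ?thesis unfolding bs Cons
        by (rule lin_smult[where c = "G b b'"]) (use bc bs Cons cocmodD[OF G] in auto)
    qed
  qed
  from mlinI[OF afun_lfun[OF cup2_afun[OF G f(1)]] this] show ?thesis .
qed

lemma point_mlin: "s \<in> carrier R \<Longrightarrow> point s \<in> mlin F"
  by (rule mlinI) (auto simp: point_def intro!: lin_zero lfunI)

text \<open>The product rule for D cancels the three terms at the front, and what remains is D x
  times the differential of f.\<close>

lemma ldiff_cup1:
  assumes D: "D \<in> dermod" and f: "f \<in> afun"
    and z: "\<And>bs. set bs \<subseteq> carrier R \<Longrightarrow> ldiff f bs = \<zero>"
    and bs: "set bs \<subseteq> carrier R"
  shows "ldiff (cup1 D f) bs = \<zero>"
proof (cases "(f, bs)" rule: ldiff.cases)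
  case (3 f' x b cs)
  then have e: "bs = x # b # cs" and c: "x \<in> carrier R" "b \<in> carrier R" "set cs \<subseteq> carrier R" using bs by auto
  have "ldiff (lp x (cup1 D f)) (b # cs) = D x \<otimes> ldiff f (b # cs)"
    using c dermodD[OF D] f by (intro ldiff_smult) auto
  also have "\<dots> = \<zero>" using z c dermodD[OF D] by simp
  finally have 1: "ldiff (lp x (cup1 D f)) (b # cs) = \<zero>" .
  have fA: "f cs \<in> A" "f cs \<in> carrier R" using f c afunD by auto
  have cc: "D x \<in> carrier R" "D b \<in> carrier R" "f cs \<in> carrier R" using fA c dermodD[OF D] by auto
  show ?thesis unfolding e ldiff.simps 1 pdiff.simps cup1.simps dermodD(4)[OF D fA(1) c(1,2)]
    using c(1,2) cc by algebra
qed auto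

text \<open>After the first two arguments are peeled off, the remaining differential is G x b times
  that of f; the front terms add up to the cocycle identity.\<close>

lemma ldiff_cup2:
  assumes G: "G \<in> cocmod" and f: "f \<in> afun"
    and z: "\<And>bs. set bs \<subseteq> carrier R \<Longrightarrow> ldiff f bs = \<zero>"
    and bs: "set bs \<subseteq> carrier R"
  shows "ldiff (cup2 G f) bs = \<zero>"
proof (cases "(f, bs)" rule: ldiff.cases)
  case (3 f' x b ds)
  then have e: "bs = x # b # ds" and c: "x \<in> carrier R" "b \<in> carrier R" "set ds \<subseteq> carrier R" using bs by auto
  show ?thesis
  proof (cases ds)
    case Nil
    then show ?thesis unfolding e using c by (simp add: a_minus_def)
  next
    case (Cons d cs)
    then have c3: "d \<in> carrier R" "set cs \<subseteq> carrier R" using c by auto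
    have "ldiff (lp b (lp x (cup2 G f))) (d # cs) = G x b \<otimes> ldiff f (d # cs)"
      using c c3 cocmodD(1)[OF G] f by (intro ldiff_smult) auto
    also have "\<dots> = \<zero>" using z c c3 cocmodD(1)[OF G] by simp
    finally have 1: "ldiff (lp b (lp x (cup2 G f))) (d # cs) = \<zero>" .
    have fA: "f cs \<in> A" "f cs \<in> carrier R" using f c3 afunD by auto
    have cc: "G b d \<in> carrier R" "G (x \<otimes> b) d \<in> carrier R" "G x d \<in> carrier R" "G x b \<in> carrier R"
      "G x (b \<otimes> d) \<in> carrier R"
      using c c3 cocmodD(1)[OF G] by auto
    \<comment> \<open>The cocycle identity is solved for one of its terms so that it can be used as
      a rewrite rule before \<open>algebra\<close>.\<close>
    have "G (x \<otimes> b) d \<otimes> f cs = (G (x \<otimes> b) d \<oplus> d \<otimes> G x b) \<otimes> f cs \<ominus> (d \<otimes> G x b) \<otimes> f cs"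
      using cc fA c c3 by algebra
    also have "\<dots> = (x \<otimes> G b d \<oplus> G x (b \<otimes> d)) \<otimes> f cs \<ominus> (d \<otimes> G x b) \<otimes> f cs"
      by (simp only: cocmodD(5)[OF G fA(1) c(1,2) c3(1)])
    finally have 2: "G (x \<otimes> b) d \<otimes> f cs = (x \<otimes> G b d \<oplus> G x (b \<otimes> d)) \<otimes> f cs \<ominus> (d \<otimes> G x b) \<otimes> f cs" .
    show ?thesis unfolding e Cons ldiff.simps 1 pdiff.simps lp.simps cup2.simps 2
      using c(1,2) c3(1) cc fA(2) by algebra
  qed
qed auto

lemma ldiff_point: "s \<in> carrier R \<Longrightarrow> set bs \<subseteq> carrier R \<Longrightarrow> ldiff (point s) bs = \<zero>"
proof (induction "point s" bs rule: ldiff.induct)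
  case (3 x b bs)
  have "ldiff (lp x (point s)) (b # bs) = \<zero> \<otimes> ldiff (point s) (b # bs)"
    using 3 by (intro ldiff_smult) (auto simp: point_def intro!: lfunI)
  moreover have "point s \<in> lfun" using 3 by (auto simp: point_def intro!: lfunI)
  ultimately show ?case using 3 by (simp add: point_def a_minus_def)
qed auto

text \<open>Insertion is an antiderivation of the cup product: a goes into the slot of D, or past it
  into f with a sign.\<close>

lemma ins_cup1:
  assumes "D a \<in> carrier R" "a \<in> carrier R" "f \<in> afun" "set bs \<subseteq> carrier R"
    and D: "\<And>x. x \<in> carrier R \<Longrightarrow> D x \<in> carrier R"
  shows "ins a (cup1 D f) bs = D a \<otimes> f bs \<ominus> cup1 D (ins a f) bs"
proof (cases bs)
  case Nil
  then show ?thesis using assms by (simp add: a_minus_def)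
next
  case (Cons b cs)
  have "ins a (lp b (cup1 D f)) cs = D b \<otimes> ins a f cs"
    using assms Cons by (intro ins_smult) auto
  then show ?thesis using Cons by simp
qed

text \<open>Inserting a before or behind the first argument of G gives terms of opposite sign that
  agree by symmetry. Only insertions into f survive, unsigned since G has even degree.\<close>

lemma ins_cup2:
  assumes G: "G \<in> cocmod" and a: "a \<in> carrier R" and f: "f \<in> afun" and bs: "set bs \<subseteq> carrier R"
  shows "ins a (cup2 G f) bs = cup2 G (ins a f) bs"
proof (cases "(G, f, bs)" rule: cup2.cases)
  case (1 G f)
  then show ?thesis by simp
next
  case (2 G' f' b)
  have "f [] \<in> A" using f by (simp add: afunD)
  then have "G a b \<otimes> f [] = G b a \<otimes> f []" "G b a \<otimes> f [] \<in> carrier R"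
    using cocmodD[OF G] a bs 2 A by auto
  then show ?thesis using 2 bs by (simp add: lp.simps)
next
  case (3 G' f' b c cs)
  then have bc: "b \<in> carrier R" "c \<in> carrier R" "set cs \<subseteq> carrier R" using bs by auto
  have fA: "f (c # cs) \<in> A" using f bc by (simp add: afunD)
  have s: "G a b \<otimes> f (c # cs) = G b a \<otimes> f (c # cs)" 
    using cocmodD(2)[OF G fA] a bc by auto
  have i: "ins a (lp c (lp b (cup2 G f))) cs = G b c \<otimes> ins a f cs"
    using a bc f cocmodD(1)[OF G] by (intro ins_smult) auto
  have cc: "G b a \<in> carrier R" "G b c \<in> carrier R" "f (c # cs) \<in> carrier R" "ins a f cs \<in> carrier R"
    using a bc f cocmodD(1)[OF G] by auto
  have e: "bs = b # c # cs" using 3 by simp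
  show ?thesis unfolding e ins.simps cup2.simps i lp.simps s using cc by algebra
qed

lemma cup2_zero: "(\<And>cs. set cs \<subseteq> carrier R \<Longrightarrow> f cs = \<zero>) \<Longrightarrow> G \<in> cocmod \<Longrightarrow> set bs \<subseteq> carrier R \<Longrightarrow> cup2 G f bs = \<zero>"
  using cocmodD(1)[of G] by (cases "(G, f, bs)" rule: cup2.cases) auto

lemma cup1_zero: "(\<And>cs. set cs \<subseteq> carrier R \<Longrightarrow> f cs = \<zero>) \<Longrightarrow> (\<And>x. x \<in> carrier R \<Longrightarrow> D x \<in> carrier R)
    \<Longrightarrow> set bs \<subseteq> carrier R \<Longrightarrow> cup1 D f bs = \<zero>"
  by (cases bs) auto

fun gpow :: "('a \<Rightarrow> 'a \<Rightarrow> 'a) \<Rightarrow> 'a \<Rightarrow> nat \<Rightarrow> 'a list \<Rightarrow> 'a" where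
  "gpow G s 0 = point s"
| "gpow G s (Suc i) = cup2 G (gpow G s i)"

fun cupl :: "('a \<Rightarrow> 'a) list \<Rightarrow> ('a list \<Rightarrow> 'a) \<Rightarrow> 'a list \<Rightarrow> 'a" where
  "cupl [] f = f"
| "cupl (D # Ds) f = cup1 D (cupl Ds f)"

text \<open>The fourth property separates the two kinds of factors: insertions annihilate the powers
  of G, so in a mixed product they act on the derivations alone.\<close>

lemma gpow_props:
  assumes "G \<in> cocmod" "s \<in> A"
  shows "gpow G s i \<in> afun" "gpow G s i \<in> mlin F"
    and "set bs \<subseteq> carrier R \<Longrightarrow> ldiff (gpow G s i) bs = \<zero>"
    and "a \<in> carrier R \<Longrightarrow> set bs \<subseteq> carrier R \<Longrightarrow> ins a (gpow G s i) bs = \<zero>"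
    and "length bs \<noteq> 2 * i \<Longrightarrow> set bs \<subseteq> carrier R \<Longrightarrow> gpow G s i bs = \<zero>"
proof -
  have s: "s \<in> carrier R" using assms A by auto
  show 1: "gpow G s i \<in> afun" for i using assms by (induction i) (auto intro: point_afun cup2_afun)
  show 2: "gpow G s i \<in> mlin F" for i using assms 1 s by (induction i) (auto intro: point_mlin cup2_mlin)
  show "ldiff (gpow G s i) bs = \<zero>" if "set bs \<subseteq> carrier R" for bs
    using that assms 1 s by (induction i arbitrary: bs) (auto intro: ldiff_point ldiff_cup2)
  show "ins a (gpow G s i) bs = \<zero>" if "a \<in> carrier R" "set bs \<subseteq> carrier R" for bs
    using that(2)
  proof (induction i arbitrary: bs)
    case 0
    have "ins a (lp b (point s)) cs = \<zero>" if "b \<in> carrier R" "set cs \<subseteq> carrier R" for b cs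
      using that \<open>a \<in> carrier R\<close> by (intro ins_zero) (auto simp: point_def)
    moreover have "point s (x # cs) = \<zero>" for x cs by (simp add: point_def)
    ultimately show ?case using 0 by (cases bs) auto
  next
    case (Suc i)
    show ?case using Suc assms \<open>a \<in> carrier R\<close> 1 by (simp add: ins_cup2 cup2_zero)
  qed
  show "gpow G s i bs = \<zero>" if "length bs \<noteq> 2 * i" "set bs \<subseteq> carrier R" for bs
    using that
  proof (induction i arbitrary: bs)
    case 0
    then show ?case by (auto simp: point_def)
  next
    case (Suc i)
    show ?case using Suc cocmodD(1)[OF assms(1)]
      by (cases "(G, gpow G s i, bs)" rule: cup2.cases) auto
  qed
qed

text \<open>With x in the first slot of G, an inserted y contributes only in the second slot,
  because everything further right is a power of G. Each pair thus yields exactly one factor G(W),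
  without any factorial.\<close>

lemma dpow_gpow:
  assumes G: "G \<in> cocmod" and s: "s \<in> A" and W: "chain2 W"
  shows "dpow W i (gpow G s i) = (wsum W G [^] i) \<otimes> s"
proof (induction i)
  case 0
  then show ?case using s A by (auto simp: point_def)
next
  case (Suc i)
  have w: "wsum W G \<in> carrier R" using W cocmodD(1)[OF G] by auto
  have "dpow W (Suc i) (gpow G s (Suc i)) = wsum W (\<lambda>x y. dpow W i (ins y (lp x (cup2 G (gpow G s i)))))"
    by simp
  also have "\<dots> = wsum W (\<lambda>x y. G x y \<otimes> dpow W i (gpow G s i))"
  proof (intro wsum_cong W dpow_smult)
    fix x y cs assume a: "x \<in> carrier R" "y \<in> carrier R" "set cs \<subseteq> carrier R"
    have "ins y (lp x (cup2 G (gpow G s i))) cs = ins y (cup1 (G x) (gpow G s i)) cs"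
    proof (rule ins_cong)
      fix ds show "set ds \<subseteq> carrier R \<Longrightarrow> lp x (cup2 G (gpow G s i)) ds = cup1 (G x) (gpow G s i) ds"
        by (cases ds) auto
    qed (use a in auto)
    also have "\<dots> = G x y \<otimes> gpow G s i cs \<ominus> cup1 (G x) (ins y (gpow G s i)) cs"
      using a cocmodD(1)[OF G] gpow_props(1)[OF G s] by (intro ins_cup1) auto
    also have "cup1 (G x) (ins y (gpow G s i)) cs = \<zero>"
      using a cocmodD(1)[OF G] gpow_props(4)[OF G s] by (intro cup1_zero) auto
    finally show "ins y (lp x (cup2 G (gpow G s i))) cs = G x y \<otimes> gpow G s i cs"
      using a cocmodD(1)[OF G] gpow_props(1)[OF G s] by (simp add: a_minus_def)
  qed (use gpow_props(1)[OF G s] cocmodD(1)[OF G] in auto)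
  also have "\<dots> = dpow W i (gpow G s i) \<otimes> wsum W G"
    using W cocmodD(1)[OF G] gpow_props(1)[OF G s] by (intro wsum_smult) (auto simp: m_comm)
  also have "\<dots> = (wsum W G [^] Suc i) \<otimes> s"
    unfolding Suc using w s A by (simp add: m_ac subset_iff)
  finally show ?case .
qed

text \<open>Up to multiplication by \<open>A\<close>, the matrix of the values of the D on the a is
  unitriangular. Its determinant, which is the value of the cup product on the shuffle product, is
  then 1.\<close>

fun triang :: "'a list \<Rightarrow> ('a \<Rightarrow> 'a) list \<Rightarrow> bool" where
  "triang [] [] \<longleftrightarrow> True"
| "triang (a # as) (D # Ds) \<longleftrightarrow> (\<forall>z \<in> A. D a \<otimes> z = z) \<and> (\<forall>D' \<in> set Ds. \<forall>z \<in> A. D' a \<otimes> z = \<zero>) \<and> triang as Ds"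
| "triang _ _ \<longleftrightarrow> False"

lemma triang_snoc:
  "triang as Ds \<Longrightarrow> (\<And>z. z \<in> A \<Longrightarrow> D a \<otimes> z = z) \<Longrightarrow> (\<And>b z. b \<in> set as \<Longrightarrow> z \<in> A \<Longrightarrow> D b \<otimes> z = \<zero>)
    \<Longrightarrow> triang (as @ [a]) (Ds @ [D])"
  by (induction as Ds rule: triang.induct) auto

lemma cupl_props:
  assumes "set Ds \<subseteq> dermod" "f \<in> afun" "f \<in> mlin F" "\<And>bs. set bs \<subseteq> carrier R \<Longrightarrow> ldiff f bs = \<zero>"
    and "\<And>bs. length bs \<noteq> k \<Longrightarrow> set bs \<subseteq> carrier R \<Longrightarrow> f bs = \<zero>"
  shows "cupl Ds f \<in> afun \<and> cupl Ds f \<in> mlin F \<and> (\<forall>bs. set bs \<subseteq> carrier R \<longrightarrow> ldiff (cupl Ds f) bs = \<zero>)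
    \<and> (\<forall>bs. length bs \<noteq> length Ds + k \<longrightarrow> set bs \<subseteq> carrier R \<longrightarrow> cupl Ds f bs = \<zero>)"
  using assms(1)
proof (induction Ds)
  case (Cons D Ds)
  then have D: "D \<in> dermod" by auto
  have 1: "cupl (D # Ds) f \<in> afun" "cupl (D # Ds) f \<in> mlin F"
    "\<forall>bs. set bs \<subseteq> carrier R \<longrightarrow> ldiff (cupl (D # Ds) f) bs = \<zero>"
    using Cons D dermodD(1)[OF D] by (auto intro: cup1_afun cup1_mlin ldiff_cup1)
  have 2: "cupl (D # Ds) f bs = \<zero>" if "length bs \<noteq> length (D # Ds) + k" "set bs \<subseteq> carrier R" for bs
    using that Cons dermodD(1)[OF D] by (cases bs) auto
  show ?case using 1 2 by blast
qed (use assms in auto)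

lemma ins_cupl:
  assumes "set Ds \<subseteq> dermod" "f \<in> afun" "a \<in> carrier R" "\<And>bs. set bs \<subseteq> carrier R \<Longrightarrow> ins a f bs = \<zero>"
    and "\<And>D z. D \<in> set Ds \<Longrightarrow> z \<in> A \<Longrightarrow> D a \<otimes> z = \<zero>" and "set bs \<subseteq> carrier R"
  shows "ins a (cupl Ds f) bs = \<zero> \<and> cupl Ds f \<in> afun"
  using assms(1,5,6)
proof (induction Ds arbitrary: bs)
  case (Cons D Ds)
  then have D: "D \<in> dermod" by auto
  have c: "cupl Ds f \<in> afun" and i: "\<And>bs. set bs \<subseteq> carrier R \<Longrightarrow> ins a (cupl Ds f) bs = \<zero>"
    using Cons.IH Cons.prems by auto
  have "ins a (cupl (D # Ds) f) bs = D a \<otimes> cupl Ds f bs \<ominus> cup1 D (ins a (cupl Ds f)) bs"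
    unfolding cupl.simps using Cons.prems c assms(3) dermodD(1)[OF D] by (intro ins_cup1) auto
  also have "cup1 D (ins a (cupl Ds f)) bs = \<zero>"
    using Cons.prems i dermodD(1)[OF D] by (intro cup1_zero) auto
  also have "D a \<otimes> cupl Ds f bs = \<zero>"
    using Cons.prems afunD[OF c] by auto
  finally show ?case using c cup1_afun[OF dermodD(1)[OF D]] by (simp add: a_minus_def)
qed (use assms in auto)

text \<open>Expansion of the determinant along the first row: the first a meets only the first D,
  for the later ones vanish on it by triangularity and f is annihilated by insertions.\<close>

lemma insl_cupl:
  assumes "triang as Ds" "set Ds \<subseteq> dermod" "f \<in> afun" "set as \<subseteq> carrier R"
    "\<And>a bs. a \<in> carrier R \<Longrightarrow> set bs \<subseteq> carrier R \<Longrightarrow> ins a f bs = \<zero>" and "set bs \<subseteq> carrier R"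
  shows "insl as (cupl Ds f) bs = f bs"
  using assms(1,2,4)
proof (induction as Ds rule: triang.induct)
  case (2 a as D Ds)
  then have D: "D \<in> dermod" and a: "a \<in> carrier R" by auto
  have *: "ins a (cupl Ds f) bs = \<zero>" "cupl Ds f \<in> afun" if "set bs \<subseteq> carrier R" for bs
    using ins_cupl[of Ds f a bs] 2 assms that by auto
  have "insl (a # as) (cupl (D # Ds) f) bs = insl as (ins a (cup1 D (cupl Ds f))) bs" by simp
  also have "\<dots> = insl as (cupl Ds f) bs"
  proof (rule insl_cong)
    fix cs assume cs: "set cs \<subseteq> carrier R"
    have "ins a (cup1 D (cupl Ds f)) cs = D a \<otimes> cupl Ds f cs \<ominus> cup1 D (ins a (cupl Ds f)) cs"
      using * cs a dermodD(1)[OF D] by (intro ins_cup1) auto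
    also have "cup1 D (ins a (cupl Ds f)) cs = \<zero>"
      using cs * dermodD(1)[OF D] by (intro cup1_zero) auto
    also have "D a \<otimes> cupl Ds f cs = cupl Ds f cs"
      using 2 afunD[OF *(2) cs] by auto
    finally show "ins a (cup1 D (cupl Ds f)) cs = cupl Ds f cs"
      using *(2) cs by (simp add: a_minus_def)
  qed (use 2 assms in auto)
  also have "\<dots> = f bs" using 2 by auto
  finally show ?case .
qed auto

text \<open>The test chain is evaluated in two ways: on the cup product it gives G(W)^i s, on a
  coboundary it gives zero.\<close>

lemma cup_not_coboundary:
  assumes "triang as Ds" "set Ds \<subseteq> dermod" "set as \<subseteq> carrier R"
    and "G \<in> cocmod" "s \<in> A" "chain2 W" "set V \<subseteq> carrier R \<times> set as"
    and "\<And>h. h \<in> lin F \<Longrightarrow> wsum W (\<lambda>x y. leib x y h) = vsum V h"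
    and "g \<in> mlin F" "\<And>bs. set bs \<subseteq> carrier R \<Longrightarrow> ldiff g bs = cupl Ds (gpow G s i) bs"
  shows "(wsum W G [^] i) \<otimes> s = \<zero>"
proof -
  have "(wsum W G [^] i) \<otimes> s = dpow W i (gpow G s i)"
    using dpow_gpow assms by simp
  also have "\<dots> = dpow W i (insl as (cupl Ds (gpow G s i)))"
    using assms gpow_props[OF assms(4,5)]
    by (intro dpow_cong insl_cupl[symmetric]) auto
  also have "\<dots> = dpow W i (insl as (ldiff g))"
    using assms by (intro dpow_cong insl_cong) auto
  also have "\<dots> = \<zero>"
    using dpow_insl_ldiff_zero[OF F] assms by blast
  finally show ?thesis .
qed

end

end

section \<open>Local algebras and their functionals\<close>

lemma (in abelian_monoid) finsum_eq_zero: "(\<And>x. x \<in> A \<Longrightarrow> f x = \<zero>) \<Longrightarrow> finsum G f A = \<zero>"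
  using finsum_cong'[of A A "\<lambda>_. \<zero>" f] by (simp add: Pi_def)

lemma (in domain) nat_pow_nonzero: "x \<in> carrier R \<Longrightarrow> x \<noteq> \<zero> \<Longrightarrow> x [^] (n :: nat) \<noteq> \<zero>"
  by (induction n) (auto simp: integral_iff)

section \<open>Lowest coefficients of products of polynomials\<close>

lemma (in UP_ring) coeff_mult_low:
  assumes p: "p \<in> carrier P" and q: "q \<in> carrier P"
    and pm: "\<And>i. i < m \<Longrightarrow> up_ring.coeff P p i = \<zero>" and qn: "\<And>i. i < n \<Longrightarrow> up_ring.coeff P q i = \<zero>"
  shows "i < m + n \<Longrightarrow> up_ring.coeff P (p \<otimes>\<^bsub>P\<^esub> q) i = \<zero>"
    and "up_ring.coeff P (p \<otimes>\<^bsub>P\<^esub> q) (m + n) = up_ring.coeff P p m \<otimes> up_ring.coeff P q n"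
proof -
  show "up_ring.coeff P (p \<otimes>\<^bsub>P\<^esub> q) i = \<zero>" if "i < m + n"
  proof -
    have "up_ring.coeff P p j \<otimes> up_ring.coeff P q (i - j) = \<zero>" if "j \<in> {..i}" for j
    proof (cases "j < m")
      case False
      then have "i - j < n" using that \<open>i < m + n\<close> by auto
      then show ?thesis using qn p by simp
    qed (use pm q in simp)
    then show ?thesis unfolding coeff_mult[OF p q] by (intro R.finsum_eq_zero)
  qed
  have "up_ring.coeff P (p \<otimes>\<^bsub>P\<^esub> q) (m + n)
      = (\<Oplus>j\<in>{..m + n}. if m = j then up_ring.coeff P p j \<otimes> up_ring.coeff P q (m + n - j) else \<zero>)"
    unfolding coeff_mult[OF p q]
  proof (intro R.finsum_cong' refl)
    fix j assume j: "j \<in> {..m + n}"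
    show "up_ring.coeff P p j \<otimes> up_ring.coeff P q (m + n - j) = (if m = j then up_ring.coeff P p j \<otimes> up_ring.coeff P q (m + n - j) else \<zero>)"
    proof (cases j m rule: linorder_cases)
      case greater
      then have "m + n - j < n" using j by auto
      then show ?thesis using qn p greater by simp
    qed (use pm q in auto)
  qed (use p q in auto)
  also have "\<dots> = up_ring.coeff P p m \<otimes> up_ring.coeff P q (m + n - m)"
    using p q by (intro R.add.finprod_singleton) auto
  finally show "up_ring.coeff P (p \<otimes>\<^bsub>P\<^esub> q) (m + n) = up_ring.coeff P p m \<otimes> up_ring.coeff P q n" by simp
qed

lemma (in UP_cring) coeff_pow_low:
  assumes p: "p \<in> carrier P" and p0: "up_ring.coeff P p 0 = \<zero>"
  shows "(\<forall>i<j. up_ring.coeff P (p [^]\<^bsub>P\<^esub> j) i = \<zero>) \<and> up_ring.coeff P (p [^]\<^bsub>P\<^esub> j) j = up_ring.coeff P p 1 [^] j"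
proof (induction j)
  case (Suc j)
  have pj: "p [^]\<^bsub>P\<^esub> j \<in> carrier P" using p by (rule P.nat_pow_closed)
  have 1: "\<And>i. i < 1 \<Longrightarrow> up_ring.coeff P p i = \<zero>" using p0 by simp
  have 2: "\<And>i. i < j \<Longrightarrow> up_ring.coeff P (p [^]\<^bsub>P\<^esub> j) i = \<zero>" using Suc by blast
  show ?case
    using coeff_mult_low[OF pj p, where m = j and n = 1, OF 2 1] Suc by simp
qed simp

text \<open>A local F-algebra: all elements outside the kernel of \<pi> are units, so this kernel is
  the maximal ideal. The residue field has a type of its own, which permits a quotient ring of
  cosets as an instance.\<close>

locale residue_alg = R?: cring R + k: field k
  for R :: "('a, 'r) ring_scheme" (structure) and k :: "('b, 's) ring_scheme" +
  fixes F :: "'a set" and \<pi> :: "'a \<Rightarrow> 'b"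
  assumes sf: "subfield F R" and fd: "finite_dimension F (carrier R)"
    and hom: "\<pi> \<in> ring_hom R k" and surj: "\<pi> ` carrier R = carrier k"
    and unit: "\<And>x. x \<in> carrier R \<Longrightarrow> \<pi> x \<noteq> \<zero>\<^bsub>k\<^esub> \<Longrightarrow> x \<in> Units R"
begin

sublocale pi: ring_hom_cring R k \<pi>
  by (rule ring_hom_cringI[OF is_cring k.is_cring hom])

sublocale U: UP_cring k "UP k"
  by unfold_locales simp

abbreviation cf :: "(nat \<Rightarrow> 'b) \<Rightarrow> nat \<Rightarrow> 'b" where "cf \<equiv> up_ring.coeff (UP k)"

lemma FC: "F \<subseteq> carrier R" using sf by (rule subfieldE(3))

section \<open>Functionals and derivations with values in the residue field\<close>

definition linK :: "('a \<Rightarrow> 'b) set" where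
  "linK = {f. (\<forall>x \<in> carrier R. f x \<in> carrier k) \<and>
     (\<forall>x \<in> carrier R. \<forall>y \<in> carrier R. f (x \<oplus> y) = f x \<oplus>\<^bsub>k\<^esub> f y) \<and>
     (\<forall>c \<in> F. \<forall>x \<in> carrier R. f (c \<otimes> x) = \<pi> c \<otimes>\<^bsub>k\<^esub> f x)}"

definition derK :: "('a \<Rightarrow> 'b) set" where
  "derK = {D \<in> linK. \<forall>x \<in> carrier R. \<forall>y \<in> carrier R.
     D (x \<otimes> y) = \<pi> x \<otimes>\<^bsub>k\<^esub> D y \<oplus>\<^bsub>k\<^esub> \<pi> y \<otimes>\<^bsub>k\<^esub> D x}"

lemma linKI:
  assumes "\<And>x. x \<in> carrier R \<Longrightarrow> f x \<in> carrier k"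
    and "\<And>x y. x \<in> carrier R \<Longrightarrow> y \<in> carrier R \<Longrightarrow> f (x \<oplus> y) = f x \<oplus>\<^bsub>k\<^esub> f y"
    and "\<And>c x. c \<in> F \<Longrightarrow> x \<in> carrier R \<Longrightarrow> f (c \<otimes> x) = \<pi> c \<otimes>\<^bsub>k\<^esub> f x"
  shows "f \<in> linK"
  using assms by (simp add: linK_def)

lemma linKD:
  assumes "f \<in> linK"
  shows "x \<in> carrier R \<Longrightarrow> f x \<in> carrier k"
    and "x \<in> carrier R \<Longrightarrow> y \<in> carrier R \<Longrightarrow> f (x \<oplus> y) = f x \<oplus>\<^bsub>k\<^esub> f y"
    and "c \<in> F \<Longrightarrow> x \<in> carrier R \<Longrightarrow> f (c \<otimes> x) = \<pi> c \<otimes>\<^bsub>k\<^esub> f x"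
  using assms by (simp_all add: linK_def)

lemma pi_linK: "\<pi> \<in> linK"
  using FC by (intro linKI) auto

lemma linK_comb:
  assumes "f \<in> linK" "g \<in> linK" "c \<in> carrier k" "\<And>x. x \<in> carrier R \<Longrightarrow> h x = f x \<oplus>\<^bsub>k\<^esub> c \<otimes>\<^bsub>k\<^esub> g x"
  shows "h \<in> linK"
proof (rule linKI)
  note f = linKD[OF assms(1)] and g = linKD[OF assms(2)]
  fix x assume x: "x \<in> carrier R"
  show "h x \<in> carrier k" using assms(3,4) x f(1) g(1) by simp
  { fix y assume y: "y \<in> carrier R"
    have c: "f x \<in> carrier k" "f y \<in> carrier k" "g x \<in> carrier k" "g y \<in> carrier k" "c \<in> carrier k"
      using x y f(1) g(1) assms by auto
    show "h (x \<oplus> y) = h x \<oplus>\<^bsub>k\<^esub> h y"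
      unfolding assms(4)[OF x] assms(4)[OF y] assms(4)[OF a_closed[OF x y]] f(2)[OF x y] g(2)[OF x y]
      using c by algebra }
  { fix d assume d: "d \<in> F"
    then have d': "d \<in> carrier R" using FC by auto
    have c: "f x \<in> carrier k" "g x \<in> carrier k" "c \<in> carrier k" "\<pi> d \<in> carrier k"
      using x d' f(1) g(1) assms by auto
    show "h (d \<otimes> x) = \<pi> d \<otimes>\<^bsub>k\<^esub> h x"
      unfolding assms(4)[OF x] assms(4)[OF m_closed[OF d' x]] f(3)[OF d x] g(3)[OF d x]
      using c by algebra }
qed

lemma linK_zero: "(\<And>x. x \<in> carrier R \<Longrightarrow> h x = \<zero>\<^bsub>k\<^esub>) \<Longrightarrow> h \<in> linK"
  using FC by (intro linKI) auto

lemma linK_finsum: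
  "finite I \<Longrightarrow> (\<And>i. i \<in> I \<Longrightarrow> \<phi> i \<in> linK) \<Longrightarrow> l \<in> I \<rightarrow> carrier k
    \<Longrightarrow> (\<lambda>x. \<Oplus>\<^bsub>k\<^esub>i\<in>I. l i \<otimes>\<^bsub>k\<^esub> \<phi> i x) \<in> linK"
proof (induction I rule: finite_induct)
  case (insert i I)
  have "(\<Oplus>\<^bsub>k\<^esub>i\<in>insert i I. l i \<otimes>\<^bsub>k\<^esub> \<phi> i x) = (\<Oplus>\<^bsub>k\<^esub>i\<in>I. l i \<otimes>\<^bsub>k\<^esub> \<phi> i x) \<oplus>\<^bsub>k\<^esub> l i \<otimes>\<^bsub>k\<^esub> \<phi> i x"
    if "x \<in> carrier R" for x
  proof -
    have "\<phi> j x \<in> carrier k" "l j \<in> carrier k" if "j \<in> insert i I" for j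
      using linKD(1)[OF insert.prems(1)] that insert.prems(2) \<open>x \<in> carrier R\<close> by auto
    then show ?thesis
      using insert.hyps by (subst k.finsum_insert) (auto intro!: k.a_comm k.finsum_closed)
  qed
  moreover have "(\<lambda>x. \<Oplus>\<^bsub>k\<^esub>i\<in>I. l i \<otimes>\<^bsub>k\<^esub> \<phi> i x) \<in> linK"
    using insert.prems by (intro insert.IH) blast+
  moreover have "\<phi> i \<in> linK" "l i \<in> carrier k" using insert.prems by blast+
  ultimately show ?case by (rule linK_comb[rotated -1])
qed (auto intro: linK_zero)

lemma kernel_subalgebra:
  assumes "f \<in> linK"
  shows "subalgebra F {x \<in> carrier R. f x = \<zero>\<^bsub>k\<^esub>} R"
proof -
  note f = linKD[OF assms]
  have 0: "f \<zero> = \<zero>\<^bsub>k\<^esub>" using f(3)[of \<zero> \<zero>] subringE(2)[OF subfieldE(1)[OF sf]] f(1)[of \<zero>] by simp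
  have m: "f (\<ominus> x) = \<ominus>\<^bsub>k\<^esub> f x" if "x \<in> carrier R" for x
  proof -
    have "f x \<oplus>\<^bsub>k\<^esub> f (\<ominus> x) = \<zero>\<^bsub>k\<^esub>" using f(2)[of x "\<ominus> x"] that 0 by (simp add: r_neg)
    then show ?thesis using f(1) that by (simp add: k.add.inv_unique' k.sum_zero_eq_neg k.a_comm)
  qed
  show ?thesis
    unfolding subalgebra_def subalgebra_axioms_def
  proof (intro conjI allI impI)
    show "subgroup {x \<in> carrier R. f x = \<zero>\<^bsub>k\<^esub>} (add_monoid R)"
      using 0 f m by (intro add.subgroupI) (auto simp: a_inv_def[symmetric])
    show "c \<otimes> v \<in> {x \<in> carrier R. f x = \<zero>\<^bsub>k\<^esub>}" if "c \<in> F" "v \<in> {x \<in> carrier R. f x = \<zero>\<^bsub>k\<^esub>}" for c v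
      using that f FC by auto
  qed
qed

lemma linK_Span_zero:
  assumes "f \<in> linK" "set us \<subseteq> carrier R" "\<And>u. u \<in> set us \<Longrightarrow> f u = \<zero>\<^bsub>k\<^esub>" "x \<in> Span F us"
  shows "f x = \<zero>\<^bsub>k\<^esub>"
  using subalgebra_Span_incl[OF sf kernel_subalgebra[OF assms(1)], of us] assms by auto

lemma independent_bound:
  assumes "independent F us"
  shows "length us \<le> (dim over F) (carrier R)"
  using independent_length_le_dimension[OF sf finite_dimensionE[OF sf fd] assms independent_in_carrier[OF assms]] .

text \<open>
  Interpolation: linearly independent functionals attain arbitrary values at suitable points,
  and these points are themselves linearly independent.
\<close>

lemma linK_interpolate:
  assumes "\<And>i. i < r \<Longrightarrow> \<phi> i \<in> linK"
    and "\<And>j l. \<lbrakk>j < r; l \<in> {..<j} \<rightarrow> carrier k\<rbrakk> \<Longrightarrow> \<exists>x \<in> carrier R. \<phi> j x \<noteq> (\<Oplus>\<^bsub>k\<^esub>i\<in>{..<j}. l i \<otimes>\<^bsub>k\<^esub> \<phi> i x)"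
  shows "\<exists>us. length us = r \<and> independent F us \<and>
    (\<forall>\<psi> \<in> linK. \<exists>l \<in> {..<r} \<rightarrow> carrier k. \<forall>u \<in> set us. \<psi> u = (\<Oplus>\<^bsub>k\<^esub>i\<in>{..<r}. l i \<otimes>\<^bsub>k\<^esub> \<phi> i u))"
  using assms
proof (induction r)
  case 0
  then show ?case by auto
next
  case (Suc r)
  have "\<exists>us. length us = r \<and> independent F us \<and>
    (\<forall>\<psi> \<in> linK. \<exists>l \<in> {..<r} \<rightarrow> carrier k. \<forall>u \<in> set us. \<psi> u = (\<Oplus>\<^bsub>k\<^esub>i\<in>{..<r}. l i \<otimes>\<^bsub>k\<^esub> \<phi> i u))"
    by (rule Suc.IH) (use Suc.prems less_SucI in blast)+
  then obtain us where us: "length us = r" "independent F us"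
    and int: "\<And>\<psi>. \<psi> \<in> linK \<Longrightarrow> \<exists>l \<in> {..<r} \<rightarrow> carrier k. \<forall>u \<in> set us. \<psi> u = (\<Oplus>\<^bsub>k\<^esub>i\<in>{..<r}. l i \<otimes>\<^bsub>k\<^esub> \<phi> i u)"
    by blast
  define S where "S l x = (\<Oplus>\<^bsub>k\<^esub>i\<in>{..<r}. l i \<otimes>\<^bsub>k\<^esub> \<phi> i x)" for l x
  have Sl: "S l \<in> linK" if "l \<in> {..<r} \<rightarrow> carrier k" for l
    unfolding S_def using Suc.prems(1) that by (intro linK_finsum) auto
  note usC = independent_in_carrier[OF us(2)]
  obtain l where l: "l \<in> {..<r} \<rightarrow> carrier k" "\<And>u. u \<in> set us \<Longrightarrow> \<phi> r u = S l u"
    using int[of "\<phi> r"] Suc.prems(1) unfolding S_def by blast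
  obtain x where x: "x \<in> carrier R" "\<phi> r x \<noteq> S l x"
    using Suc.prems(2)[of r l] l(1) unfolding S_def by auto
  \<comment> \<open>The new functional minus its interpolation at the points found so far vanishes
    at these points; a point where it does not vanish lies outside their span.\<close>
  define \<phi>' where "\<phi>' y = \<phi> r y \<ominus>\<^bsub>k\<^esub> S l y" for y
  have cl: "\<phi> r y \<in> carrier k" "S m y \<in> carrier k" if "y \<in> carrier R" "m \<in> {..<r} \<rightarrow> carrier k" for y m
    using linKD(1)[OF Suc.prems(1)] linKD(1)[OF Sl] that by auto
  have \<phi>': "\<phi>' \<in> linK"
  proof (rule linK_comb)
    show "\<phi> r \<in> linK" using Suc.prems(1) by blast
    show "S l \<in> linK" using Sl l(1) by blast
    show "\<ominus>\<^bsub>k\<^esub> \<one>\<^bsub>k\<^esub> \<in> carrier k" by simp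
    show "\<phi>' y = \<phi> r y \<oplus>\<^bsub>k\<^esub> \<ominus>\<^bsub>k\<^esub> \<one>\<^bsub>k\<^esub> \<otimes>\<^bsub>k\<^esub> S l y" if "y \<in> carrier R" for y
      using cl[OF that l(1)] by (simp add: \<phi>'_def k.l_minus k.minus_eq)
  qed
  have \<phi>'0: "\<phi>' u = \<zero>\<^bsub>k\<^esub>" if "u \<in> set us" for u
    using l that usC cl[OF _ l(1)] by (auto simp: \<phi>'_def k.r_neg k.minus_eq)
  have d: "\<phi>' x \<noteq> \<zero>\<^bsub>k\<^esub>" "\<phi>' x \<in> carrier k"
    using x cl[OF x(1) l(1)] by (auto simp: \<phi>'_def k.r_right_minus_eq)
  have "x \<notin> Span F us" using linK_Span_zero[OF \<phi>' usC \<phi>'0] d by blast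
  then have ind: "independent F (x # us)" using x us(2) by (intro independent.li_Cons)
  have "\<exists>m \<in> {..<Suc r} \<rightarrow> carrier k. \<forall>u \<in> set (x # us). \<psi> u = (\<Oplus>\<^bsub>k\<^esub>i\<in>{..<Suc r}. m i \<otimes>\<^bsub>k\<^esub> \<phi> i u)"
    if \<psi>: "\<psi> \<in> linK" for \<psi>
  proof -
    obtain m where m: "m \<in> {..<r} \<rightarrow> carrier k" "\<And>u. u \<in> set us \<Longrightarrow> \<psi> u = S m u"
      using int[OF \<psi>] unfolding S_def by blast
    \<comment> \<open>As in Newton interpolation, adding e times \<phi>' corrects the value at the
      new point and changes nothing at the old ones.\<close>
    define e where "e = (\<psi> x \<ominus>\<^bsub>k\<^esub> S m x) \<otimes>\<^bsub>k\<^esub> inv\<^bsub>k\<^esub> (\<phi>' x)"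
    have \<psi>x: "\<psi> x \<in> carrier k" using linKD(1)[OF \<psi> x(1)] .
    have ix: "inv\<^bsub>k\<^esub> (\<phi>' x) \<in> carrier k" using d by (simp add: k.field_Units)
    have e: "e \<in> carrier k" unfolding e_def using \<psi>x ix cl x m by auto
    have ed: "e \<otimes>\<^bsub>k\<^esub> \<phi>' x = \<psi> x \<ominus>\<^bsub>k\<^esub> S m x"
      unfolding e_def using \<psi>x ix cl(2)[OF x(1) m(1)] d by (simp add: k.m_assoc k.field_Units)
    define n where "n i = (if i < r then m i \<ominus>\<^bsub>k\<^esub> e \<otimes>\<^bsub>k\<^esub> l i else e)" for i
    have nc: "n \<in> {..<Suc r} \<rightarrow> carrier k" using m(1) l(1) e by (auto simp: n_def Pi_def)
    have key: "(\<Oplus>\<^bsub>k\<^esub>i\<in>{..<Suc r}. n i \<otimes>\<^bsub>k\<^esub> \<phi> i u) = S m u \<oplus>\<^bsub>k\<^esub> e \<otimes>\<^bsub>k\<^esub> \<phi>' u" if u: "u \<in> carrier R" for u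
    proof -
      have pc: "\<phi> i u \<in> carrier k" if "i \<le> r" for i using linKD(1)[OF Suc.prems(1)] u that by auto
      have mc: "m i \<in> carrier k" "l i \<in> carrier k" if "i < r" for i using m(1) l(1) that by auto
      have "(\<Oplus>\<^bsub>k\<^esub>i\<in>{..<Suc r}. n i \<otimes>\<^bsub>k\<^esub> \<phi> i u)
          = e \<otimes>\<^bsub>k\<^esub> \<phi> r u \<oplus>\<^bsub>k\<^esub> (\<Oplus>\<^bsub>k\<^esub>i\<in>{..<r}. n i \<otimes>\<^bsub>k\<^esub> \<phi> i u)"
        unfolding lessThan_Suc using nc pc e by (subst k.finsum_insert) (auto simp: n_def mc)
      also have "(\<Oplus>\<^bsub>k\<^esub>i\<in>{..<r}. n i \<otimes>\<^bsub>k\<^esub> \<phi> i u)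
          = (\<Oplus>\<^bsub>k\<^esub>i\<in>{..<r}. m i \<otimes>\<^bsub>k\<^esub> \<phi> i u \<oplus>\<^bsub>k\<^esub> (\<ominus>\<^bsub>k\<^esub> e) \<otimes>\<^bsub>k\<^esub> (l i \<otimes>\<^bsub>k\<^esub> \<phi> i u))"
        using pc mc e by (intro k.finsum_cong') (auto simp: n_def k.minus_eq k.l_distr k.m_assoc k.l_minus)
      also have "\<dots> = S m u \<oplus>\<^bsub>k\<^esub> (\<Oplus>\<^bsub>k\<^esub>i\<in>{..<r}. (\<ominus>\<^bsub>k\<^esub> e) \<otimes>\<^bsub>k\<^esub> (l i \<otimes>\<^bsub>k\<^esub> \<phi> i u))"
        unfolding S_def using pc mc e by (intro k.finsum_addf) auto
      also have "(\<Oplus>\<^bsub>k\<^esub>i\<in>{..<r}. (\<ominus>\<^bsub>k\<^esub> e) \<otimes>\<^bsub>k\<^esub> (l i \<otimes>\<^bsub>k\<^esub> \<phi> i u)) = (\<ominus>\<^bsub>k\<^esub> e) \<otimes>\<^bsub>k\<^esub> S l u"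
        unfolding S_def using pc mc e by (intro k.finsum_rdistr[symmetric]) auto
      finally have *: "(\<Oplus>\<^bsub>k\<^esub>i\<in>{..<Suc r}. n i \<otimes>\<^bsub>k\<^esub> \<phi> i u)
        = e \<otimes>\<^bsub>k\<^esub> \<phi> r u \<oplus>\<^bsub>k\<^esub> (S m u \<oplus>\<^bsub>k\<^esub> (\<ominus>\<^bsub>k\<^esub> e) \<otimes>\<^bsub>k\<^esub> S l u)" .
      have c: "S m u \<in> carrier k" "S l u \<in> carrier k" "\<phi> r u \<in> carrier k"
        using cl u m(1) l(1) by auto
      show ?thesis unfolding * \<phi>'_def using c e by algebra
    qed
    have "\<forall>u \<in> set (x # us). \<psi> u = (\<Oplus>\<^bsub>k\<^esub>i\<in>{..<Suc r}. n i \<otimes>\<^bsub>k\<^esub> \<phi> i u)"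
    proof
      fix u assume u: "u \<in> set (x # us)"
      show "\<psi> u = (\<Oplus>\<^bsub>k\<^esub>i\<in>{..<Suc r}. n i \<otimes>\<^bsub>k\<^esub> \<phi> i u)"
      proof (cases "u \<in> set us")
        case True
        then have "u \<in> carrier R" using usC by auto
        then show ?thesis using key \<phi>'0[OF True] e m(2)[OF True] cl(2)[OF _ m(1)] by simp
      next
        case False
        then have [simp]: "u = x" using u by simp
        have "S m x \<oplus>\<^bsub>k\<^esub> (\<psi> x \<ominus>\<^bsub>k\<^esub> S m x) = \<psi> x"
          using \<psi>x cl(2)[OF x(1) m(1)] by algebra
        then show ?thesis using key[OF x(1)] ed by simp
      qed
    qed
    then show ?thesis using nc by blast
  qed
  then show ?case using ind us(1) by (intro exI[of _ "x # us"]) auto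
qed

text \<open>Truncated power series are stored as polynomials of degree at most N, and
  multiplicativity is required only through t^N. The coefficient of t^(N+1) in the product of two
  values is then the obstruction to prolongation.\<close>

definition hasse_schmidt :: "nat \<Rightarrow> ('a \<Rightarrow> nat \<Rightarrow> 'b) \<Rightarrow> bool" where
  "hasse_schmidt N \<Phi> \<longleftrightarrow>
     (\<forall>a \<in> carrier R. \<Phi> a \<in> carrier (UP k) \<and> cf (\<Phi> a) 0 = \<pi> a \<and> (\<forall>n>N. cf (\<Phi> a) n = \<zero>\<^bsub>k\<^esub>)) \<and>
     (\<forall>n. (\<lambda>a. cf (\<Phi> a) n) \<in> linK) \<and>
     (\<forall>a \<in> carrier R. \<forall>b \<in> carrier R. \<forall>n\<le>N. cf (\<Phi> (a \<otimes> b)) n = cf (\<Phi> a \<otimes>\<^bsub>UP k\<^esub> \<Phi> b) n)"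

text \<open>A linear relation among the coefficients of order at most j would persist after
  multiplication by \<open>\<Phi> a\<close> minus its constant term. This series has order exactly
  one, so its j-th power begins with t^j, on which the relation does not vanish.\<close>

lemma hasse_schmidt_independent:
  assumes hs: "hasse_schmidt N \<Phi>" and a: "a \<in> carrier R" "cf (\<Phi> a) 1 \<noteq> \<zero>\<^bsub>k\<^esub>"
    and j: "j \<le> N" and l: "l \<in> {..<j} \<rightarrow> carrier k"
  shows "\<exists>x \<in> carrier R. cf (\<Phi> x) j \<noteq> (\<Oplus>\<^bsub>k\<^esub>i\<in>{..<j}. l i \<otimes>\<^bsub>k\<^esub> cf (\<Phi> x) i)"
proof (rule ccontr)
  assume "\<not> ?thesis"
  then have dep: "cf (\<Phi> x) j = (\<Oplus>\<^bsub>k\<^esub>i\<in>{..<j}. l i \<otimes>\<^bsub>k\<^esub> cf (\<Phi> x) i)" if "x \<in> carrier R" for x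
    using that by blast
  have \<Phi>: "\<Phi> x \<in> carrier (UP k)" "cf (\<Phi> x) 0 = \<pi> x" if "x \<in> carrier R" for x
    using hs that by (auto simp: hasse_schmidt_def)
  \<comment> \<open>The assumed relation as a functional on polynomials; it has coefficient 1 at t^j
    and ignores higher powers.\<close>
  define L where "L p = cf p j \<ominus>\<^bsub>k\<^esub> (\<Oplus>\<^bsub>k\<^esub>i\<in>{..<j}. l i \<otimes>\<^bsub>k\<^esub> cf p i)" for p
  have lc: "l i \<in> carrier k" if "i < j" for i using l that by auto
  have Lcong: "L p = L q" if "\<And>i. i \<le> j \<Longrightarrow> cf p i = cf q i" "q \<in> carrier (UP k)" for p q
  proof -
    have "(\<Oplus>\<^bsub>k\<^esub>i\<in>{..<j}. l i \<otimes>\<^bsub>k\<^esub> cf p i) = (\<Oplus>\<^bsub>k\<^esub>i\<in>{..<j}. l i \<otimes>\<^bsub>k\<^esub> cf q i)"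
      using that lc by (intro k.finsum_cong') auto
    then show ?thesis using that(1)[of j] by (simp add: L_def)
  qed
  have Sc: "(\<Oplus>\<^bsub>k\<^esub>i\<in>{..<j}. l i \<otimes>\<^bsub>k\<^esub> cf p i) \<in> carrier k" if "p \<in> carrier (UP k)" for p
    using lc that by (intro k.finsum_closed) auto
  have Lc: "L p \<in> carrier k" if "p \<in> carrier (UP k)" for p
    unfolding L_def using Sc that by auto
  have Ladd: "L (p \<oplus>\<^bsub>UP k\<^esub> c \<odot>\<^bsub>UP k\<^esub> q) = L p \<oplus>\<^bsub>k\<^esub> c \<otimes>\<^bsub>k\<^esub> L q"
    if "p \<in> carrier (UP k)" "q \<in> carrier (UP k)" "c \<in> carrier k" for p q c
  proof -
    have "(\<Oplus>\<^bsub>k\<^esub>i\<in>{..<j}. l i \<otimes>\<^bsub>k\<^esub> cf (p \<oplus>\<^bsub>UP k\<^esub> c \<odot>\<^bsub>UP k\<^esub> q) i)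
       = (\<Oplus>\<^bsub>k\<^esub>i\<in>{..<j}. l i \<otimes>\<^bsub>k\<^esub> cf p i \<oplus>\<^bsub>k\<^esub> c \<otimes>\<^bsub>k\<^esub> (l i \<otimes>\<^bsub>k\<^esub> cf q i))"
      using that lc by (intro k.finsum_cong') (auto simp: k.r_distr k.m_lcomm)
    also have "\<dots> = (\<Oplus>\<^bsub>k\<^esub>i\<in>{..<j}. l i \<otimes>\<^bsub>k\<^esub> cf p i) \<oplus>\<^bsub>k\<^esub> (\<Oplus>\<^bsub>k\<^esub>i\<in>{..<j}. c \<otimes>\<^bsub>k\<^esub> (l i \<otimes>\<^bsub>k\<^esub> cf q i))"
      using that lc by (intro k.finsum_addf) auto
    also have "(\<Oplus>\<^bsub>k\<^esub>i\<in>{..<j}. c \<otimes>\<^bsub>k\<^esub> (l i \<otimes>\<^bsub>k\<^esub> cf q i)) = c \<otimes>\<^bsub>k\<^esub> (\<Oplus>\<^bsub>k\<^esub>i\<in>{..<j}. l i \<otimes>\<^bsub>k\<^esub> cf q i)"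
      using that lc by (intro k.finsum_rdistr[symmetric]) auto
    finally have *: "(\<Oplus>\<^bsub>k\<^esub>i\<in>{..<j}. l i \<otimes>\<^bsub>k\<^esub> cf (p \<oplus>\<^bsub>UP k\<^esub> c \<odot>\<^bsub>UP k\<^esub> q) i)
       = (\<Oplus>\<^bsub>k\<^esub>i\<in>{..<j}. l i \<otimes>\<^bsub>k\<^esub> cf p i) \<oplus>\<^bsub>k\<^esub> c \<otimes>\<^bsub>k\<^esub> (\<Oplus>\<^bsub>k\<^esub>i\<in>{..<j}. l i \<otimes>\<^bsub>k\<^esub> cf q i)" .
    define s t where st0: "s = (\<Oplus>\<^bsub>k\<^esub>i\<in>{..<j}. l i \<otimes>\<^bsub>k\<^esub> cf p i)" "t = (\<Oplus>\<^bsub>k\<^esub>i\<in>{..<j}. l i \<otimes>\<^bsub>k\<^esub> cf q i)"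
    have st: "s \<in> carrier k" "t \<in> carrier k" unfolding st0 using Sc that by blast+
    have c: "cf p j \<in> carrier k" "cf q j \<in> carrier k" using that by auto
    have e: "cf (p \<oplus>\<^bsub>UP k\<^esub> c \<odot>\<^bsub>UP k\<^esub> q) j = cf p j \<oplus>\<^bsub>k\<^esub> c \<otimes>\<^bsub>k\<^esub> cf q j" using that by simp
    show ?thesis unfolding L_def * e st0[symmetric] using c st that(3) by algebra
  qed
  \<comment> \<open>Multiples by all values of \<Phi> are included so that the set becomes stable
    under multiplication by \<tau>; the product rule for \<Phi> is used only up to t^j, where it
    holds.\<close>
  define Z where "Z = {p \<in> carrier (UP k). \<forall>b \<in> carrier R. L (p \<otimes>\<^bsub>UP k\<^esub> \<Phi> b) = \<zero>\<^bsub>k\<^esub>}"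
  have L0: "L (\<Phi> b) = \<zero>\<^bsub>k\<^esub>" if "b \<in> carrier R" for b
    using dep[OF that] Sc[OF \<Phi>(1)[OF that]] by (simp add: L_def k.r_right_minus_eq)
  have Zone: "\<one>\<^bsub>UP k\<^esub> \<in> Z" using L0 \<Phi> by (auto simp: Z_def)
  define \<tau> where "\<tau> = \<Phi> a \<oplus>\<^bsub>UP k\<^esub> (\<ominus>\<^bsub>k\<^esub> \<pi> a) \<odot>\<^bsub>UP k\<^esub> \<one>\<^bsub>UP k\<^esub>"
  have \<tau>c: "\<tau> \<in> carrier (UP k)" using \<Phi> a by (simp add: \<tau>_def)
  have Zmult: "p \<otimes>\<^bsub>UP k\<^esub> \<tau> \<in> Z" if p: "p \<in> Z" for p
  proof -
    have pc: "p \<in> carrier (UP k)" using p by (simp add: Z_def)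
    have "L ((p \<otimes>\<^bsub>UP k\<^esub> \<tau>) \<otimes>\<^bsub>UP k\<^esub> \<Phi> b) = \<zero>\<^bsub>k\<^esub>" if b: "b \<in> carrier R" for b
    proof -
      have fb: "\<Phi> b \<in> carrier (UP k)" "\<Phi> a \<in> carrier (UP k)" "\<Phi> (a \<otimes> b) \<in> carrier (UP k)" using \<Phi> a b by auto
      have eq: "(p \<otimes>\<^bsub>UP k\<^esub> \<tau>) \<otimes>\<^bsub>UP k\<^esub> \<Phi> b
          = p \<otimes>\<^bsub>UP k\<^esub> (\<Phi> a \<otimes>\<^bsub>UP k\<^esub> \<Phi> b) \<oplus>\<^bsub>UP k\<^esub> (\<ominus>\<^bsub>k\<^esub> \<pi> a) \<odot>\<^bsub>UP k\<^esub> (p \<otimes>\<^bsub>UP k\<^esub> \<Phi> b)"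
      proof -
        have c: "\<ominus>\<^bsub>k\<^esub> \<pi> a \<in> carrier k" using a by simp
        have "p \<otimes>\<^bsub>UP k\<^esub> ((\<ominus>\<^bsub>k\<^esub> \<pi> a) \<odot>\<^bsub>UP k\<^esub> \<one>\<^bsub>UP k\<^esub>) = (\<ominus>\<^bsub>k\<^esub> \<pi> a) \<odot>\<^bsub>UP k\<^esub> p"
          using U.UP_m_comm[OF pc U.UP_smult_closed[OF c U.UP_one_closed]]
            U.UP_smult_assoc2[OF c U.UP_one_closed pc] U.UP_l_one[OF pc] by simp
        then have "p \<otimes>\<^bsub>UP k\<^esub> \<tau> = p \<otimes>\<^bsub>UP k\<^esub> \<Phi> a \<oplus>\<^bsub>UP k\<^esub> (\<ominus>\<^bsub>k\<^esub> \<pi> a) \<odot>\<^bsub>UP k\<^esub> p"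
          unfolding \<tau>_def using U.UP_r_distr[OF fb(2) U.UP_smult_closed[OF c U.UP_one_closed] pc] by simp
        then show ?thesis
          using U.UP_l_distr[OF U.UP_mult_closed[OF pc fb(2)] U.UP_smult_closed[OF c pc] fb(1)]
            U.UP_m_assoc[OF pc fb(2,1)] U.UP_smult_assoc2[OF c pc fb(1)] by simp
      qed
      have "L ((p \<otimes>\<^bsub>UP k\<^esub> \<tau>) \<otimes>\<^bsub>UP k\<^esub> \<Phi> b) = L (p \<otimes>\<^bsub>UP k\<^esub> (\<Phi> a \<otimes>\<^bsub>UP k\<^esub> \<Phi> b)) \<oplus>\<^bsub>k\<^esub> (\<ominus>\<^bsub>k\<^esub> \<pi> a) \<otimes>\<^bsub>k\<^esub> L (p \<otimes>\<^bsub>UP k\<^esub> \<Phi> b)"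
        unfolding eq using pc fb a by (intro Ladd) auto
      also have "L (p \<otimes>\<^bsub>UP k\<^esub> \<Phi> b) = \<zero>\<^bsub>k\<^esub>" using p b by (simp add: Z_def)
      also have "L (p \<otimes>\<^bsub>UP k\<^esub> (\<Phi> a \<otimes>\<^bsub>UP k\<^esub> \<Phi> b)) = L (p \<otimes>\<^bsub>UP k\<^esub> \<Phi> (a \<otimes> b))"
      proof (rule Lcong)
        fix i assume i: "i \<le> j"
        show "cf (p \<otimes>\<^bsub>UP k\<^esub> (\<Phi> a \<otimes>\<^bsub>UP k\<^esub> \<Phi> b)) i = cf (p \<otimes>\<^bsub>UP k\<^esub> \<Phi> (a \<otimes> b)) i"
          unfolding U.coeff_mult[OF pc fb(3)] U.coeff_mult[OF pc U.UP_mult_closed[OF fb(2,1)]]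
        proof (intro k.finsum_cong' refl)
          fix i' assume "i' \<in> {..i}"
          then have "i - i' \<le> N" using i j by auto
          then have "cf (\<Phi> (a \<otimes> b)) (i - i') = cf (\<Phi> a \<otimes>\<^bsub>UP k\<^esub> \<Phi> b) (i - i')"
            using hs a b by (auto simp: hasse_schmidt_def)
          then show "cf p i' \<otimes>\<^bsub>k\<^esub> cf (\<Phi> a \<otimes>\<^bsub>UP k\<^esub> \<Phi> b) (i - i') = cf p i' \<otimes>\<^bsub>k\<^esub> cf (\<Phi> (a \<otimes> b)) (i - i')"
            by simp
        qed (use pc fb in auto)
      qed (use pc fb in auto)
      also have "\<dots> = \<zero>\<^bsub>k\<^esub>" using p a b by (simp add: Z_def)
      finally show ?thesis using a by simp
    qed
    then show ?thesis using pc \<tau>c by (simp add: Z_def)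
  qed
  have "\<tau> [^]\<^bsub>UP k\<^esub> n \<in> Z" for n :: nat
    by (induction n) (use Zone Zmult in auto)
  then have Lz: "L (\<tau> [^]\<^bsub>UP k\<^esub> j \<otimes>\<^bsub>UP k\<^esub> \<Phi> \<one>) = \<zero>\<^bsub>k\<^esub>" by (auto simp: Z_def)
  define q where "q = \<tau> [^]\<^bsub>UP k\<^esub> j \<otimes>\<^bsub>UP k\<^esub> \<Phi> \<one>"
  have \<tau>j: "\<tau> [^]\<^bsub>UP k\<^esub> j \<in> carrier (UP k)" using \<tau>c by simp
  have q: "q \<in> carrier (UP k)" unfolding q_def using \<tau>j \<Phi> by simp
  have \<tau>0: "cf \<tau> 0 = \<zero>\<^bsub>k\<^esub>" unfolding \<tau>_def using \<Phi> a by (simp add: k.r_neg)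
  have \<tau>1: "cf \<tau> 1 = cf (\<Phi> a) 1" unfolding \<tau>_def using \<Phi> a by simp
  note pow = U.coeff_pow_low[OF \<tau>c \<tau>0, of j]
  have z: "\<And>i. i < 0 \<Longrightarrow> cf (\<Phi> \<one>) i = \<zero>\<^bsub>k\<^esub>" by simp
  have p1: "\<And>i. i < j \<Longrightarrow> cf (\<tau> [^]\<^bsub>UP k\<^esub> j) i = \<zero>\<^bsub>k\<^esub>" using pow by blast
  have q1: "cf q i = \<zero>\<^bsub>k\<^esub>" if "i < j" for i
    unfolding q_def using U.coeff_mult_low(1)[OF \<tau>j \<Phi>(1)[OF one_closed], where m = j and n = 0, OF p1 z] that by simp
  have q2: "cf q j = cf (\<Phi> a) 1 [^]\<^bsub>k\<^esub> j"
    unfolding q_def using U.coeff_mult_low(2)[OF \<tau>j \<Phi>(1)[OF one_closed], where m = j and n = 0, OF p1 z] pow \<Phi> a \<tau>1 by simp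
  have "(\<Oplus>\<^bsub>k\<^esub>i\<in>{..<j}. l i \<otimes>\<^bsub>k\<^esub> cf q i) = \<zero>\<^bsub>k\<^esub>"
    by (rule k.finsum_eq_zero) (use q1 lc in auto)
  then have "L q = cf (\<Phi> a) 1 [^]\<^bsub>k\<^esub> j" using q2 \<Phi> a by (simp add: L_def k.minus_eq)
  moreover have "cf (\<Phi> a) 1 [^]\<^bsub>k\<^esub> j \<noteq> \<zero>\<^bsub>k\<^esub>"
    using a \<Phi> by (intro k.nat_pow_nonzero) auto
  ultimately show False using Lz q_def by simp
qed

text \<open>The coefficients of order 0 to N are N + 1 functionals independent over k; interpolation
  converts them into N + 1 elements of R independent over F.\<close>

lemma hasse_schmidt_bound:
  assumes hs: "hasse_schmidt N \<Phi>" and a: "a \<in> carrier R" "cf (\<Phi> a) 1 \<noteq> \<zero>\<^bsub>k\<^esub>"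
  shows "N < (dim over F) (carrier R)"
proof -
  have "\<exists>us. length us = Suc N \<and> independent F us \<and>
    (\<forall>\<psi> \<in> linK. \<exists>l \<in> {..<Suc N} \<rightarrow> carrier k. \<forall>u \<in> set us. \<psi> u = (\<Oplus>\<^bsub>k\<^esub>i\<in>{..<Suc N}. l i \<otimes>\<^bsub>k\<^esub> cf (\<Phi> u) i))"
    using hs hasse_schmidt_independent[OF hs a]
    by (intro linK_interpolate[where \<phi> = "\<lambda>i u. cf (\<Phi> u) i"]) (auto simp: hasse_schmidt_def)
  then show ?thesis using independent_bound by fastforce
qed

end

section \<open>Hasse-Schmidt derivations\<close>

context cring
begin

lemma vsum_closed [simp]:
  "set V \<subseteq> carrier R \<times> carrier R \<Longrightarrow> (\<And>x. x \<in> carrier R \<Longrightarrow> h x \<in> carrier R) \<Longrightarrow> vsum V h \<in> carrier R"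
  by (induction V) auto

lemma vsum_append:
  "set V \<subseteq> carrier R \<times> carrier R \<Longrightarrow> set W \<subseteq> carrier R \<times> carrier R
    \<Longrightarrow> (\<And>x. x \<in> carrier R \<Longrightarrow> h x \<in> carrier R) \<Longrightarrow> vsum (V @ W) h = vsum V h \<oplus> vsum W h"
  by (induction V) (auto simp: a_assoc)

lemma vsum_scale:
  assumes "set V \<subseteq> carrier R \<times> carrier R" "c \<in> carrier R" and h: "\<And>x. x \<in> carrier R \<Longrightarrow> h x \<in> carrier R"
  shows "vsum (map (\<lambda>(s, p). (c \<otimes> s, p)) V) h = c \<otimes> vsum V h"
  using assms(1)
proof (induction V)
  case (Cons q V)
  obtain s x where q: "q = (s, x)" by (cases q)
  have "s \<in> carrier R" "h x \<in> carrier R" "vsum V h \<in> carrier R"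
    using Cons h q by auto
  then show ?case using Cons q assms(2) by (simp add: r_distr m_assoc)
qed (use assms in auto)

end

context residue_alg
begin

section \<open>Representatives of residue classes and the socle\<close>

lemma one_k: "\<one>\<^bsub>k\<^esub> \<noteq> \<zero>\<^bsub>k\<^esub>" by simp

text \<open>A mere choice, compatible with no operation; identities between residue classes become
  identities between representatives after multiplication by elements of \<open>ann\<close>.\<close>

definition rep :: "'b \<Rightarrow> 'a" where "rep c = inv_into (carrier R) \<pi> c"

lemma rep: "c \<in> carrier k \<Longrightarrow> rep c \<in> carrier R \<and> \<pi> (rep c) = c"
  unfolding rep_def using surj by (metis f_inv_into_f inv_into_into)

definition ann :: "'a set" where
  "ann = {z \<in> carrier R. \<forall>y \<in> carrier R. \<pi> y = \<zero>\<^bsub>k\<^esub> \<longrightarrow> y \<otimes> z = \<zero>}"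

lemma ann_carrier: "ann \<subseteq> carrier R" by (auto simp: ann_def)

lemma ann_mult: "r \<in> carrier R \<Longrightarrow> z \<in> ann \<Longrightarrow> r \<otimes> z \<in> ann"
  by (auto simp: ann_def m_lcomm[of _ r])

lemma ann_cong:
  assumes "x \<in> carrier R" "y \<in> carrier R" "\<pi> x = \<pi> y" "z \<in> ann"
  shows "x \<otimes> z = y \<otimes> z"
proof -
  have z: "z \<in> carrier R" using assms ann_carrier by auto
  have "\<pi> (x \<ominus> y) = \<zero>\<^bsub>k\<^esub>" using assms by (simp add: minus_eq k.r_neg)
  then have "(x \<ominus> y) \<otimes> z = \<zero>" using assms by (auto simp: ann_def)
  moreover have "x \<otimes> z = (x \<ominus> y) \<otimes> z \<oplus> y \<otimes> z" using assms z by algebra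
  ultimately show ?thesis using assms z by simp
qed

lemma one_minus_unit:
  assumes "y \<in> carrier R" "\<pi> y = \<zero>\<^bsub>k\<^esub>" shows "\<one> \<ominus> y \<in> Units R"
  using assms unit[of "\<one> \<ominus> y"] by (simp add: minus_eq)

lemma unit_mult_zero: "u \<in> Units R \<Longrightarrow> z \<in> carrier R \<Longrightarrow> u \<otimes> z = \<zero> \<Longrightarrow> z = \<zero>"
  by (metis Units_closed Units_l_cancel r_null zero_closed)

text \<open>
  If every \<open>t \<in> Q\<close> had a multiple \<open>y t \<in> Q\<close> with \<open>\<pi> y = 0\<close>, iterating would give
  arbitrarily long linearly independent lists.
\<close>

lemma socle_element:
  assumes "Q \<subseteq> carrier R" "Q \<noteq> {}" "\<zero> \<notin> Q"
  shows "\<exists>t \<in> Q. \<forall>y \<in> carrier R. \<pi> y = \<zero>\<^bsub>k\<^esub> \<longrightarrow> y \<otimes> t \<notin> Q"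
proof (rule ccontr)
  assume "\<not> ?thesis"
  then have ex: "\<exists>y \<in> carrier R. \<pi> y = \<zero>\<^bsub>k\<^esub> \<and> y \<otimes> t \<in> Q" if "t \<in> Q" for t using that by blast
  have "\<exists>us. length us = r \<and> independent F us \<and> set us \<subseteq> PIdl t" if "t \<in> Q" for r t
    using that
  proof (induction r arbitrary: t)
    case (Suc r)
    obtain y where y: "y \<in> carrier R" "\<pi> y = \<zero>\<^bsub>k\<^esub>" "y \<otimes> t \<in> Q" using ex Suc.prems by blast
    have t: "t \<in> carrier R" "t \<noteq> \<zero>" using Suc.prems assms by auto
    have yt: "y \<otimes> t \<in> carrier R" using y t by simp
    obtain us where us: "length us = r" "independent F us" "set us \<subseteq> PIdl (y \<otimes> t)"
      using Suc.IH[OF y(3)] by auto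
    have "Span F us \<subseteq> PIdl (y \<otimes> t)"
      by (rule subalgebra_Span_incl[OF sf ideal_is_subalgebra[OF FC cgenideal_ideal[OF yt]] us(3)])
    \<comment> \<open>This is where locality enters: t = x y t means that the unit 1 - x y
      annihilates t.\<close>
    moreover have "t \<notin> PIdl (y \<otimes> t)"
    proof
      assume "t \<in> PIdl (y \<otimes> t)"
      then obtain x where x: "x \<in> carrier R" "t = x \<otimes> (y \<otimes> t)" by (auto simp: cgenideal_def)
      have "(\<one> \<ominus> x \<otimes> y) \<otimes> t = t \<ominus> x \<otimes> (y \<otimes> t)" using x y t by algebra
      then have "(\<one> \<ominus> x \<otimes> y) \<otimes> t = \<zero>" using x(2) t by (simp add: minus_eq r_neg)
      moreover have "\<one> \<ominus> x \<otimes> y \<in> Units R" using x y by (intro one_minus_unit) auto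
      ultimately show False using t unit_mult_zero by blast
    qed
    ultimately have "independent F (t # us)" using us t by (intro independent.li_Cons) auto
    moreover have "set (t # us) \<subseteq> PIdl t"
    proof -
      have "PIdl (y \<otimes> t) \<subseteq> PIdl t"
        using y t by (auto simp: cgenideal_def) (metis m_assoc m_closed)
      then show ?thesis using us cgenideal_self[OF t(1)] by auto
    qed
    ultimately show ?case using us(1) by (intro exI[of _ "t # us"]) auto
  qed (auto intro: exI[of _ "[]"])
  then obtain us where "length us = Suc ((dim over F) (carrier R))" "independent F us"
    using assms by blast
  then show False using independent_bound by fastforce
qed

lemma hasse_schmidt_deriv:
  assumes D: "D \<in> derK"
  shows "hasse_schmidt 1 (\<lambda>a. up_ring.monom (UP k) (\<pi> a) 0 \<oplus>\<^bsub>UP k\<^esub> up_ring.monom (UP k) (D a) 1)"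
proof -
  have Dl: "D \<in> linK" using D by (simp add: derK_def)
  note d = linKD(1)[OF Dl]
  have c: "cf (up_ring.monom (UP k) (\<pi> a) 0 \<oplus>\<^bsub>UP k\<^esub> up_ring.monom (UP k) (D a) 1) n
    = (if n = 0 then \<pi> a else if n = 1 then D a else \<zero>\<^bsub>k\<^esub>)" if "a \<in> carrier R" for a n
    using that d by simp
  have m: "up_ring.monom (UP k) (\<pi> a) 0 \<oplus>\<^bsub>UP k\<^esub> up_ring.monom (UP k) (D a) 1 \<in> carrier (UP k)" if "a \<in> carrier R" for a
    using that d by simp
  have l: "(\<lambda>a. cf (up_ring.monom (UP k) (\<pi> a) 0 \<oplus>\<^bsub>UP k\<^esub> up_ring.monom (UP k) (D a) 1) n) \<in> linK" for n
  proof (rule linK_comb[OF _ _ k.zero_closed])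
    show "(if n = 0 then \<pi> else if n = 1 then D else (\<lambda>_. \<zero>\<^bsub>k\<^esub>)) \<in> linK"
      using pi_linK Dl linK_zero by auto
    then show "(if n = 0 then \<pi> else if n = 1 then D else (\<lambda>_. \<zero>\<^bsub>k\<^esub>)) \<in> linK" .
  qed (use c d in auto)
  show ?thesis
    unfolding hasse_schmidt_def
  proof (intro conjI ballI allI impI l m)
    fix a b and n :: nat assume ab: "a \<in> carrier R" "b \<in> carrier R" and n: "n \<le> 1"
    have ab': "a \<otimes> b \<in> carrier R" using ab by simp
    have Dab: "D (a \<otimes> b) = \<pi> a \<otimes>\<^bsub>k\<^esub> D b \<oplus>\<^bsub>k\<^esub> \<pi> b \<otimes>\<^bsub>k\<^esub> D a" using D ab by (simp add: derK_def)
    show "cf (up_ring.monom (UP k) (\<pi> (a \<otimes> b)) 0 \<oplus>\<^bsub>UP k\<^esub> up_ring.monom (UP k) (D (a \<otimes> b)) 1) n =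
      cf ((up_ring.monom (UP k) (\<pi> a) 0 \<oplus>\<^bsub>UP k\<^esub> up_ring.monom (UP k) (D a) 1) \<otimes>\<^bsub>UP k\<^esub>
          (up_ring.monom (UP k) (\<pi> b) 0 \<oplus>\<^bsub>UP k\<^esub> up_ring.monom (UP k) (D b) 1)) n"
    proof (cases n)
      case 0
      then show ?thesis using ab d by (simp add: U.coeff_mult)
    next
      case (Suc j)
      then have "n = 1" using n by simp
      have "D b \<in> carrier k" "D a \<in> carrier k" "\<pi> a \<in> carrier k" "\<pi> b \<in> carrier k" using ab d by auto
      then show ?thesis using ab Dab unfolding \<open>n = 1\<close>
        by (simp add: U.coeff_mult k.m_comm k.a_comm)
    qed
  qed (use c d in auto)
qed

text \<open>The failure of multiplicativity is stated as an equation of polynomials, so that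
  associativity can be applied to products of three values.\<close>

lemma hasse_schmidt_mult:
  assumes hs: "hasse_schmidt N \<Phi>" and ab: "a \<in> carrier R" "b \<in> carrier R"
  shows "\<exists>E \<in> carrier (UP k). \<Phi> a \<otimes>\<^bsub>UP k\<^esub> \<Phi> b = \<Phi> (a \<otimes> b) \<oplus>\<^bsub>UP k\<^esub> E \<and> (\<forall>i<Suc N. cf E i = \<zero>\<^bsub>k\<^esub>) \<and>
    cf E (Suc N) = cf (\<Phi> a \<otimes>\<^bsub>UP k\<^esub> \<Phi> b) (Suc N)"
proof -
  have \<Phi>: "\<Phi> x \<in> carrier (UP k)" "\<And>n. n > N \<Longrightarrow> cf (\<Phi> x) n = \<zero>\<^bsub>k\<^esub>" if "x \<in> carrier R" for x
    using hs that by (auto simp: hasse_schmidt_def)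
  define E where "E = \<Phi> a \<otimes>\<^bsub>UP k\<^esub> \<Phi> b \<oplus>\<^bsub>UP k\<^esub> (\<ominus>\<^bsub>UP k\<^esub> \<Phi> (a \<otimes> b))"
  have c: "\<Phi> a \<in> carrier (UP k)" "\<Phi> b \<in> carrier (UP k)" "\<Phi> (a \<otimes> b) \<in> carrier (UP k)"
    using \<Phi> ab by auto
  have E: "E \<in> carrier (UP k)" unfolding E_def using c by simp
  have "\<Phi> a \<otimes>\<^bsub>UP k\<^esub> \<Phi> b = \<Phi> (a \<otimes> b) \<oplus>\<^bsub>UP k\<^esub> E"
    unfolding E_def using c by (simp del: U.coeff_mult add: U.P.a_comm[of _ "\<ominus>\<^bsub>UP k\<^esub> \<Phi> (a \<otimes> b)"] U.P.r_neg2)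
  moreover have "cf E i = \<zero>\<^bsub>k\<^esub>" if "i < Suc N" for i
  proof -
    have "cf (\<Phi> (a \<otimes> b)) i = cf (\<Phi> a \<otimes>\<^bsub>UP k\<^esub> \<Phi> b) i"
      using hs ab that by (auto simp: hasse_schmidt_def)
    then show ?thesis unfolding E_def using c by (simp del: U.coeff_mult add: k.r_neg)
  qed
  moreover have "cf E (Suc N) = cf (\<Phi> a \<otimes>\<^bsub>UP k\<^esub> \<Phi> b) (Suc N)"
    unfolding E_def using c \<Phi>(2) ab by (simp del: U.coeff_mult)
  ultimately show ?thesis using E by blast
qed

definition symcoc :: "('a \<Rightarrow> 'a \<Rightarrow> 'b) \<Rightarrow> bool" where
  "symcoc G \<longleftrightarrow> (\<forall>x \<in> carrier R. \<forall>y \<in> carrier R. G x y = G y x) \<and>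
     (\<forall>y \<in> carrier R. (\<lambda>x. G x y) \<in> linK) \<and>
     (\<forall>x \<in> carrier R. \<forall>y \<in> carrier R. \<forall>w \<in> carrier R.
        \<pi> x \<otimes>\<^bsub>k\<^esub> G y w \<oplus>\<^bsub>k\<^esub> G x (y \<otimes> w) = G (x \<otimes> y) w \<oplus>\<^bsub>k\<^esub> \<pi> w \<otimes>\<^bsub>k\<^esub> G x y)"

text \<open>Symmetry is the commutativity of the product of two values. The cocycle identity
  compares the two bracketings of a product of three values in degree N + 1, where an error term
  meets only the constant coefficient of its partner.\<close>

lemma hasse_schmidt_symcoc:
  assumes hs: "hasse_schmidt N \<Phi>"
  shows "symcoc (\<lambda>a b. cf (\<Phi> a \<otimes>\<^bsub>UP k\<^esub> \<Phi> b) (Suc N))"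
proof -
  have \<Phi>: "\<Phi> x \<in> carrier (UP k)" "cf (\<Phi> x) 0 = \<pi> x" if "x \<in> carrier R" for x
    using hs that by (auto simp: hasse_schmidt_def)
  have l: "(\<lambda>a. cf (\<Phi> a) n) \<in> linK" for n using hs by (auto simp: hasse_schmidt_def)
  have add: "\<Phi> (x \<oplus> y) = \<Phi> x \<oplus>\<^bsub>UP k\<^esub> \<Phi> y" if "x \<in> carrier R" "y \<in> carrier R" for x y
    using that \<Phi> linKD(2)[OF l] by (intro U.up_eqI) auto
  have smult: "\<Phi> (c \<otimes> x) = \<pi> c \<odot>\<^bsub>UP k\<^esub> \<Phi> x" if "x \<in> carrier R" "c \<in> F" for x c
    using that \<Phi> linKD(3)[OF l] FC by (intro U.up_eqI) auto
  have z: "\<And>i. i < 0 \<Longrightarrow> cf p i = \<zero>\<^bsub>k\<^esub>" for p by simp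
  have 1: "cf (\<Phi> x \<otimes>\<^bsub>UP k\<^esub> \<Phi> y) (Suc N) = cf (\<Phi> y \<otimes>\<^bsub>UP k\<^esub> \<Phi> x) (Suc N)"
    if "x \<in> carrier R" "y \<in> carrier R" for x y
    using that \<Phi> U.UP_m_comm by metis
  have 2: "(\<lambda>x. cf (\<Phi> x \<otimes>\<^bsub>UP k\<^esub> \<Phi> y) (Suc N)) \<in> linK" if y: "y \<in> carrier R" for y
  proof (rule linKI)
    fix x assume x: "x \<in> carrier R"
    show "cf (\<Phi> x \<otimes>\<^bsub>UP k\<^esub> \<Phi> y) (Suc N) \<in> carrier k" using x y \<Phi> by (simp del: U.coeff_mult)
    show "cf (\<Phi> (x \<oplus> w) \<otimes>\<^bsub>UP k\<^esub> \<Phi> y) (Suc N)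
        = cf (\<Phi> x \<otimes>\<^bsub>UP k\<^esub> \<Phi> y) (Suc N) \<oplus>\<^bsub>k\<^esub> cf (\<Phi> w \<otimes>\<^bsub>UP k\<^esub> \<Phi> y) (Suc N)"
      if "w \<in> carrier R" for w
      using x y that \<Phi> by (simp del: U.coeff_mult add: add U.UP_l_distr)
    show "cf (\<Phi> (c \<otimes> x) \<otimes>\<^bsub>UP k\<^esub> \<Phi> y) (Suc N) = \<pi> c \<otimes>\<^bsub>k\<^esub> cf (\<Phi> x \<otimes>\<^bsub>UP k\<^esub> \<Phi> y) (Suc N)"
      if "c \<in> F" for c
      using x y that \<Phi> FC by (auto simp del: U.coeff_mult simp add: smult U.UP_smult_assoc2 subset_iff)
  qed
  have 3: "\<pi> x \<otimes>\<^bsub>k\<^esub> cf (\<Phi> y \<otimes>\<^bsub>UP k\<^esub> \<Phi> w) (Suc N) \<oplus>\<^bsub>k\<^esub> cf (\<Phi> x \<otimes>\<^bsub>UP k\<^esub> \<Phi> (y \<otimes> w)) (Suc N)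
     = cf (\<Phi> (x \<otimes> y) \<otimes>\<^bsub>UP k\<^esub> \<Phi> w) (Suc N) \<oplus>\<^bsub>k\<^esub> \<pi> w \<otimes>\<^bsub>k\<^esub> cf (\<Phi> x \<otimes>\<^bsub>UP k\<^esub> \<Phi> y) (Suc N)"
    if xyw: "x \<in> carrier R" "y \<in> carrier R" "w \<in> carrier R" for x y w
  proof -
    have c: "\<Phi> x \<in> carrier (UP k)" "\<Phi> y \<in> carrier (UP k)" "\<Phi> w \<in> carrier (UP k)"
      "\<Phi> (x \<otimes> y) \<in> carrier (UP k)" "\<Phi> (y \<otimes> w) \<in> carrier (UP k)" using xyw \<Phi> by auto
    obtain A where A: "A \<in> carrier (UP k)" "\<Phi> x \<otimes>\<^bsub>UP k\<^esub> \<Phi> y = \<Phi> (x \<otimes> y) \<oplus>\<^bsub>UP k\<^esub> A"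
      "\<And>i. i < Suc N \<Longrightarrow> cf A i = \<zero>\<^bsub>k\<^esub>" "cf A (Suc N) = cf (\<Phi> x \<otimes>\<^bsub>UP k\<^esub> \<Phi> y) (Suc N)"
      using hasse_schmidt_mult[OF hs xyw(1,2)] by blast
    obtain B where B: "B \<in> carrier (UP k)" "\<Phi> y \<otimes>\<^bsub>UP k\<^esub> \<Phi> w = \<Phi> (y \<otimes> w) \<oplus>\<^bsub>UP k\<^esub> B"
      "\<And>i. i < Suc N \<Longrightarrow> cf B i = \<zero>\<^bsub>k\<^esub>" "cf B (Suc N) = cf (\<Phi> y \<otimes>\<^bsub>UP k\<^esub> \<Phi> w) (Suc N)"
      using hasse_schmidt_mult[OF hs xyw(2,3)] by blast
    have Aw: "cf (A \<otimes>\<^bsub>UP k\<^esub> \<Phi> w) (Suc N) = cf A (Suc N) \<otimes>\<^bsub>k\<^esub> \<pi> w"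
      using U.coeff_mult_low(2)[OF A(1) c(3), of "Suc N" 0, OF A(3) z] \<Phi>(2) xyw by simp
    have xB: "cf (\<Phi> x \<otimes>\<^bsub>UP k\<^esub> B) (Suc N) = \<pi> x \<otimes>\<^bsub>k\<^esub> cf B (Suc N)"
      using U.coeff_mult_low(2)[OF c(1) B(1), of 0 "Suc N", OF z B(3)] \<Phi>(2) xyw by simp
    have "cf (\<Phi> x \<otimes>\<^bsub>UP k\<^esub> \<Phi> y \<otimes>\<^bsub>UP k\<^esub> \<Phi> w) (Suc N)
       = cf (\<Phi> (x \<otimes> y) \<otimes>\<^bsub>UP k\<^esub> \<Phi> w) (Suc N) \<oplus>\<^bsub>k\<^esub> cf A (Suc N) \<otimes>\<^bsub>k\<^esub> \<pi> w"
      unfolding A(2) Aw[symmetric] using c A(1) by (simp del: U.coeff_mult add: U.UP_l_distr)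
    moreover have "cf (\<Phi> x \<otimes>\<^bsub>UP k\<^esub> (\<Phi> y \<otimes>\<^bsub>UP k\<^esub> \<Phi> w)) (Suc N)
       = cf (\<Phi> x \<otimes>\<^bsub>UP k\<^esub> \<Phi> (y \<otimes> w)) (Suc N) \<oplus>\<^bsub>k\<^esub> \<pi> x \<otimes>\<^bsub>k\<^esub> cf B (Suc N)"
      unfolding B(2) xB[symmetric] using c B(1) by (simp del: U.coeff_mult add: U.UP_r_distr)
    moreover have "\<Phi> x \<otimes>\<^bsub>UP k\<^esub> \<Phi> y \<otimes>\<^bsub>UP k\<^esub> \<Phi> w = \<Phi> x \<otimes>\<^bsub>UP k\<^esub> (\<Phi> y \<otimes>\<^bsub>UP k\<^esub> \<Phi> w)"
      using c U.UP_m_assoc by simp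
    ultimately have "cf (\<Phi> (x \<otimes> y) \<otimes>\<^bsub>UP k\<^esub> \<Phi> w) (Suc N) \<oplus>\<^bsub>k\<^esub> cf A (Suc N) \<otimes>\<^bsub>k\<^esub> \<pi> w
      = cf (\<Phi> x \<otimes>\<^bsub>UP k\<^esub> \<Phi> (y \<otimes> w)) (Suc N) \<oplus>\<^bsub>k\<^esub> \<pi> x \<otimes>\<^bsub>k\<^esub> cf B (Suc N)" by simp
    moreover have "cf A (Suc N) \<in> carrier k" "cf B (Suc N) \<in> carrier k" "\<pi> x \<in> carrier k" "\<pi> w \<in> carrier k"
      "cf (\<Phi> x \<otimes>\<^bsub>UP k\<^esub> \<Phi> (y \<otimes> w)) (Suc N) \<in> carrier k"
      using A B xyw c by (simp_all del: U.coeff_mult)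
    ultimately show ?thesis unfolding A(4)[symmetric] B(4)[symmetric] by (simp add: k.m_comm k.a_comm)
  qed
  show ?thesis unfolding symcoc_def using 1 2 3 by blast
qed

text \<open>The equation on h is the product rule for the coefficient of t^(N+1): in this degree the
  added monomials pair only with constant terms, and their mutual product has higher order.\<close>

lemma hasse_schmidt_extend:
  assumes hs: "hasse_schmidt N \<Phi>" and h: "h \<in> linK"
    and ext: "\<And>a b. a \<in> carrier R \<Longrightarrow> b \<in> carrier R \<Longrightarrow>
      h (a \<otimes> b) = \<pi> a \<otimes>\<^bsub>k\<^esub> h b \<oplus>\<^bsub>k\<^esub> \<pi> b \<otimes>\<^bsub>k\<^esub> h a \<oplus>\<^bsub>k\<^esub> cf (\<Phi> a \<otimes>\<^bsub>UP k\<^esub> \<Phi> b) (Suc N)"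
  shows "hasse_schmidt (Suc N) (\<lambda>a. \<Phi> a \<oplus>\<^bsub>UP k\<^esub> up_ring.monom (UP k) (h a) (Suc N))"
proof -
  have \<Phi>: "\<Phi> x \<in> carrier (UP k)" "cf (\<Phi> x) 0 = \<pi> x" "\<And>n. n > N \<Longrightarrow> cf (\<Phi> x) n = \<zero>\<^bsub>k\<^esub>" if "x \<in> carrier R" for x
    using hs that by (auto simp: hasse_schmidt_def)
  have l: "(\<lambda>a. cf (\<Phi> a) n) \<in> linK" for n using hs by (auto simp: hasse_schmidt_def)
  note hc = linKD(1)[OF h]
  define \<mu> where "\<mu> a = up_ring.monom (UP k) (h a) (Suc N)" for a
  have \<mu>: "\<mu> a \<in> carrier (UP k)" "cf (\<mu> a) n = (if n = Suc N then h a else \<zero>\<^bsub>k\<^esub>)" if "a \<in> carrier R" for a n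
    using that hc by (auto simp: \<mu>_def)
  have l': "(\<lambda>a. cf (\<Phi> a \<oplus>\<^bsub>UP k\<^esub> \<mu> a) n) \<in> linK" for n
  proof (rule linK_comb[OF l[of n] _ k.one_closed])
    show "(if n = Suc N then h else (\<lambda>_. \<zero>\<^bsub>k\<^esub>)) \<in> linK" using h linK_zero by auto
  qed (use \<Phi> \<mu> hc in auto)
  have "cf (\<Phi> (a \<otimes> b) \<oplus>\<^bsub>UP k\<^esub> \<mu> (a \<otimes> b)) n = cf ((\<Phi> a \<oplus>\<^bsub>UP k\<^esub> \<mu> a) \<otimes>\<^bsub>UP k\<^esub> (\<Phi> b \<oplus>\<^bsub>UP k\<^esub> \<mu> b)) n"
    if ab: "a \<in> carrier R" "b \<in> carrier R" and n: "n \<le> Suc N" for a b n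
  proof -
    have ab': "a \<otimes> b \<in> carrier R" using ab by simp
    note c = \<Phi>(1)[OF ab(1)] \<Phi>(1)[OF ab(2)] \<mu>(1)[OF ab(1)] \<mu>(1)[OF ab(2)]
    have z: "\<And>i. i < 0 \<Longrightarrow> cf p i = \<zero>\<^bsub>k\<^esub>" for p by simp
    have \<mu>z: "\<And>i. i < Suc N \<Longrightarrow> cf (\<mu> x) i = \<zero>\<^bsub>k\<^esub>" if "x \<in> carrier R" for x using \<mu> that by simp
    have "(\<Phi> a \<oplus>\<^bsub>UP k\<^esub> \<mu> a) \<otimes>\<^bsub>UP k\<^esub> (\<Phi> b \<oplus>\<^bsub>UP k\<^esub> \<mu> b)
       = (\<Phi> a \<otimes>\<^bsub>UP k\<^esub> \<Phi> b \<oplus>\<^bsub>UP k\<^esub> \<Phi> a \<otimes>\<^bsub>UP k\<^esub> \<mu> b) \<oplus>\<^bsub>UP k\<^esub> (\<mu> a \<otimes>\<^bsub>UP k\<^esub> \<Phi> b \<oplus>\<^bsub>UP k\<^esub> \<mu> a \<otimes>\<^bsub>UP k\<^esub> \<mu> b)"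
      using c by (simp add: U.UP_l_distr U.UP_r_distr U.P.a_ac)
    then have e: "cf ((\<Phi> a \<oplus>\<^bsub>UP k\<^esub> \<mu> a) \<otimes>\<^bsub>UP k\<^esub> (\<Phi> b \<oplus>\<^bsub>UP k\<^esub> \<mu> b)) n
       = (cf (\<Phi> a \<otimes>\<^bsub>UP k\<^esub> \<Phi> b) n \<oplus>\<^bsub>k\<^esub> cf (\<Phi> a \<otimes>\<^bsub>UP k\<^esub> \<mu> b) n) \<oplus>\<^bsub>k\<^esub> (cf (\<mu> a \<otimes>\<^bsub>UP k\<^esub> \<Phi> b) n \<oplus>\<^bsub>k\<^esub> cf (\<mu> a \<otimes>\<^bsub>UP k\<^esub> \<mu> b) n)"
      using c by (simp del: U.coeff_mult)
    note L1 = U.coeff_mult_low[OF c(1,4), of 0 "Suc N", OF z \<mu>z[OF ab(2)]]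
    note L2 = U.coeff_mult_low[OF c(3,2), of "Suc N" 0, OF \<mu>z[OF ab(1)] z]
    note L3 = U.coeff_mult_low(1)[OF c(3,4), of "Suc N" "Suc N", OF \<mu>z[OF ab(1)] \<mu>z[OF ab(2)]]
    have G: "cf (\<Phi> a \<otimes>\<^bsub>UP k\<^esub> \<Phi> b) n \<in> carrier k" using c by (simp del: U.coeff_mult)
    show ?thesis
    proof (cases "n = Suc N")
      case True
      have "cf (\<Phi> a \<otimes>\<^bsub>UP k\<^esub> \<mu> b) n = \<pi> a \<otimes>\<^bsub>k\<^esub> h b" "cf (\<mu> a \<otimes>\<^bsub>UP k\<^esub> \<Phi> b) n = h a \<otimes>\<^bsub>k\<^esub> \<pi> b"
        "cf (\<mu> a \<otimes>\<^bsub>UP k\<^esub> \<mu> b) n = \<zero>\<^bsub>k\<^esub>"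
        using L1(2) L2(2) L3[of n] True \<mu>(2) \<Phi>(2) ab by (simp_all del: U.coeff_mult)
      moreover have "cf (\<Phi> (a \<otimes> b) \<oplus>\<^bsub>UP k\<^esub> \<mu> (a \<otimes> b)) n = h (a \<otimes> b)"
        using True \<Phi>[OF ab'] \<mu>[OF ab'] hc[OF ab'] by simp
      moreover have "h a \<in> carrier k" "h b \<in> carrier k" "\<pi> a \<in> carrier k" "\<pi> b \<in> carrier k" using ab hc by auto
      ultimately show ?thesis unfolding e ext[OF ab] using G True
        by (simp del: U.coeff_mult add: k.a_ac k.m_comm)
    next
      case False
      then have "n < Suc N" using n by simp
      then have "cf (\<Phi> a \<otimes>\<^bsub>UP k\<^esub> \<mu> b) n = \<zero>\<^bsub>k\<^esub>" "cf (\<mu> a \<otimes>\<^bsub>UP k\<^esub> \<Phi> b) n = \<zero>\<^bsub>k\<^esub>"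
        "cf (\<mu> a \<otimes>\<^bsub>UP k\<^esub> \<mu> b) n = \<zero>\<^bsub>k\<^esub>"
        using L1(1) L2(1) L3 by (simp_all del: U.coeff_mult)
      moreover have "cf (\<Phi> (a \<otimes> b)) n = cf (\<Phi> a \<otimes>\<^bsub>UP k\<^esub> \<Phi> b) n"
        using hs ab \<open>n < Suc N\<close> by (auto simp: hasse_schmidt_def)
      ultimately show ?thesis unfolding e using G \<mu>[OF ab'] \<Phi>[OF ab'] False by (simp del: U.coeff_mult)
    qed
  qed
  then show ?thesis
    unfolding hasse_schmidt_def \<mu>_def[symmetric] using l' \<Phi> \<mu> by auto
qed

text \<open>Prolongation leaves the coefficient of t unchanged, so the nonzero value at a is carried
  along and the order stays below the dimension of R.\<close>

lemma maximal_hasse_schmidt: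
  assumes D: "D \<in> derK" "a \<in> carrier R" "D a \<noteq> \<zero>\<^bsub>k\<^esub>"
  shows "\<exists>G. symcoc G \<and> \<not> (\<exists>h \<in> linK. \<forall>x \<in> carrier R. \<forall>y \<in> carrier R.
     h (x \<otimes> y) = \<pi> x \<otimes>\<^bsub>k\<^esub> h y \<oplus>\<^bsub>k\<^esub> \<pi> y \<otimes>\<^bsub>k\<^esub> h x \<oplus>\<^bsub>k\<^esub> G x y)"
proof (rule ccontr)
  assume "\<not> ?thesis"
  then have ext: "\<exists>h \<in> linK. \<forall>x \<in> carrier R. \<forall>y \<in> carrier R.
     h (x \<otimes> y) = \<pi> x \<otimes>\<^bsub>k\<^esub> h y \<oplus>\<^bsub>k\<^esub> \<pi> y \<otimes>\<^bsub>k\<^esub> h x \<oplus>\<^bsub>k\<^esub> G x y" if "symcoc G" for G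
    using that by blast
  have Dl: "D \<in> linK" using D by (simp add: derK_def)
  have "\<exists>\<Phi>. hasse_schmidt (Suc N) \<Phi> \<and> cf (\<Phi> a) 1 \<noteq> \<zero>\<^bsub>k\<^esub>" for N
  proof (induction N)
    case 0
    show ?case using hasse_schmidt_deriv[OF D(1)] D linKD(1)[OF Dl]
      by (intro exI[of _ "\<lambda>a. up_ring.monom (UP k) (\<pi> a) 0 \<oplus>\<^bsub>UP k\<^esub> up_ring.monom (UP k) (D a) 1"]) auto
  next
    case (Suc N)
    then obtain \<Phi> where \<Phi>: "hasse_schmidt (Suc N) \<Phi>" "cf (\<Phi> a) 1 \<noteq> \<zero>\<^bsub>k\<^esub>" by blast
    obtain h where h: "h \<in> linK" "\<And>x y. x \<in> carrier R \<Longrightarrow> y \<in> carrier R \<Longrightarrow>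
       h (x \<otimes> y) = \<pi> x \<otimes>\<^bsub>k\<^esub> h y \<oplus>\<^bsub>k\<^esub> \<pi> y \<otimes>\<^bsub>k\<^esub> h x \<oplus>\<^bsub>k\<^esub> cf (\<Phi> x \<otimes>\<^bsub>UP k\<^esub> \<Phi> y) (Suc (Suc N))"
      using ext[OF hasse_schmidt_symcoc[OF \<Phi>(1)]] by blast
    have "\<Phi> a \<in> carrier (UP k)" using \<Phi>(1) D by (simp add: hasse_schmidt_def)
    then have "cf (\<Phi> a \<oplus>\<^bsub>UP k\<^esub> up_ring.monom (UP k) (h a) (Suc (Suc N))) 1 = cf (\<Phi> a) 1"
      using linKD(1)[OF h(1)] D by simp
    then show ?case using hasse_schmidt_extend[OF \<Phi>(1) h] \<Phi>(2)
      by (intro exI[of _ "\<lambda>a. \<Phi> a \<oplus>\<^bsub>UP k\<^esub> up_ring.monom (UP k) (h a) (Suc (Suc N))"]) auto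
  qed
  then obtain \<Phi> where "hasse_schmidt (Suc ((dim over F) (carrier R))) \<Phi>" "cf (\<Phi> a) 1 \<noteq> \<zero>\<^bsub>k\<^esub>" by blast
  then show False using hasse_schmidt_bound D(2) by fastforce
qed

end

section \<open>2-chains detecting a cocycle\<close>

context residue_alg
begin

context
  fixes G :: "'a \<Rightarrow> 'a \<Rightarrow> 'b"
  assumes G: "symcoc G"
begin

lemma symcocD:
  shows "x \<in> carrier R \<Longrightarrow> y \<in> carrier R \<Longrightarrow> G x y \<in> carrier k"
    and "x \<in> carrier R \<Longrightarrow> y \<in> carrier R \<Longrightarrow> G x y = G y x"
    and "y \<in> carrier R \<Longrightarrow> (\<lambda>x. G x y) \<in> linK"
    and "\<lbrakk>x \<in> carrier R; y \<in> carrier R; w \<in> carrier R\<rbrakk> \<Longrightarrow>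
        \<pi> x \<otimes>\<^bsub>k\<^esub> G y w \<oplus>\<^bsub>k\<^esub> G x (y \<otimes> w) = G (x \<otimes> y) w \<oplus>\<^bsub>k\<^esub> \<pi> w \<otimes>\<^bsub>k\<^esub> G x y"
proof -
  show "(\<lambda>x. G x y) \<in> linK" if "y \<in> carrier R" for y using G that unfolding symcoc_def by blast
  then show "G x y \<in> carrier k" if "x \<in> carrier R" "y \<in> carrier R" for x y
    using linKD(1)[of "\<lambda>x. G x y" x] that by blast
qed (use G in \<open>unfold symcoc_def, blast+\<close>)

abbreviation rG :: "'a \<Rightarrow> 'a \<Rightarrow> 'a" where "rG x y \<equiv> rep (G x y)"

lemma rG: "x \<in> carrier R \<Longrightarrow> y \<in> carrier R \<Longrightarrow> rG x y \<in> carrier R \<and> \<pi> (rG x y) = G x y"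
  using rep symcocD(1) by blast

text \<open>
  \<open>T\<close> is a functional on the linear endomorphisms; \<open>relation Z T c\<close> says that modulo boundaries it
  is an \<open>R\<close>-combination of the evaluations at the points of \<open>Z\<close>, and that \<open>G\<close> takes the value
  \<open>c\<close> on some 2-chain witnessing this.
\<close>

definition relation :: "'a set \<Rightarrow> (('a \<Rightarrow> 'a) \<Rightarrow> 'a) \<Rightarrow> 'b \<Rightarrow> bool" where
  "relation Z T c \<longleftrightarrow> (\<exists>V W. set V \<subseteq> carrier R \<times> Z \<and> chain2 W \<and>
     (\<forall>h \<in> lin F. T h = vsum V h \<oplus> wsum W (\<lambda>x y. leib x y h)) \<and> c = \<pi> (wsum W rG))"

lemma relation_carrier: "relation Z T c \<Longrightarrow> c \<in> carrier k"
  unfolding relation_def using rG by (auto intro!: pi.hom_closed wsum_closed)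

lemma relation_cong: "relation Z T c \<Longrightarrow> (\<And>h. h \<in> lin F \<Longrightarrow> T' h = T h) \<Longrightarrow> relation Z T' c"
  unfolding relation_def by simp

lemma relation_mono: "relation Z T c \<Longrightarrow> Z \<subseteq> Z' \<Longrightarrow> relation Z' T c"
  unfolding relation_def by blast

lemma relation_zero: "relation Z (\<lambda>h. \<zero>) \<zero>\<^bsub>k\<^esub>"
  unfolding relation_def by (intro exI[of _ "[]"]) simp

lemma relation_point: 
  assumes "a \<in> Z" "a \<in> carrier R" shows "relation Z (\<lambda>h. h a) \<zero>\<^bsub>k\<^esub>"
  unfolding relation_def
  by (intro exI[of _ "[(\<one>, a)]"] exI[of _ "[]"]) (use assms linD(1) in auto)

lemma relation_leib:
  assumes "x \<in> carrier R" "y \<in> carrier R"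
  shows "relation Z (\<lambda>h. leib x y h) (G x y)"
  unfolding relation_def
proof (intro exI[of _ "[(\<one>, x, y)]"] exI[of _ "[]"] conjI ballI)
  fix h assume "h \<in> lin F"
  then have "leib x y h \<in> carrier R" using assms linD(1) by (intro leib_closed) auto
  then show "leib x y h = vsum [] h \<oplus> wsum [(\<one>, x, y)] (\<lambda>x y. leib x y h)" by simp
qed (use assms rG in auto)

lemma relation_add:
  assumes "relation Z T c" "relation Z T' c'" "Z \<subseteq> carrier R"
  shows "relation Z (\<lambda>h. T h \<oplus> T' h) (c \<oplus>\<^bsub>k\<^esub> c')"
proof -
  obtain V W where 1: "set V \<subseteq> carrier R \<times> Z" "chain2 W"
    "\<And>h. h \<in> lin F \<Longrightarrow> T h = vsum V h \<oplus> wsum W (\<lambda>x y. leib x y h)" "c = \<pi> (wsum W rG)"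
    using assms(1) unfolding relation_def by blast
  obtain V' W' where 2: "set V' \<subseteq> carrier R \<times> Z" "chain2 W'"
    "\<And>h. h \<in> lin F \<Longrightarrow> T' h = vsum V' h \<oplus> wsum W' (\<lambda>x y. leib x y h)" "c' = \<pi> (wsum W' rG)"
    using assms(2) unfolding relation_def by blast
  have V: "set V \<subseteq> carrier R \<times> carrier R" "set V' \<subseteq> carrier R \<times> carrier R" using 1 2 assms(3) by blast+
  have "T h \<oplus> T' h = vsum (V @ V') h \<oplus> wsum (W @ W') (\<lambda>x y. leib x y h)" if h: "h \<in> lin F" for h
  proof -
    have c: "vsum V h \<in> carrier R" "vsum V' h \<in> carrier R"
      "wsum W (\<lambda>x y. leib x y h) \<in> carrier R" "wsum W' (\<lambda>x y. leib x y h) \<in> carrier R"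
      using V 1(2) 2(2) linD(1)[OF h] by auto
    show ?thesis
      using 1(3)[OF h] 2(3)[OF h] V 1(2) 2(2) linD(1)[OF h] c
      by (simp add: vsum_append wsum_append a_ac)
  qed
  moreover have "c \<oplus>\<^bsub>k\<^esub> c' = \<pi> (wsum (W @ W') rG)"
    using 1(2,4) 2(2,4) rG by (simp add: wsum_append)
  ultimately show ?thesis
    unfolding relation_def using 1(1,2) 2(1,2) by (intro exI[of _ "V @ V'"] exI[of _ "W @ W'"]) auto
qed

lemma relation_smult:
  assumes "relation Z T c" "r \<in> carrier R" "Z \<subseteq> carrier R"
  shows "relation Z (\<lambda>h. r \<otimes> T h) (\<pi> r \<otimes>\<^bsub>k\<^esub> c)"
proof -
  obtain V W where 1: "set V \<subseteq> carrier R \<times> Z" "chain2 W"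
    "\<And>h. h \<in> lin F \<Longrightarrow> T h = vsum V h \<oplus> wsum W (\<lambda>x y. leib x y h)" "c = \<pi> (wsum W rG)"
    using assms(1) unfolding relation_def by blast
  have V: "set V \<subseteq> carrier R \<times> carrier R" using 1 assms(3) by blast
  let ?V = "map (\<lambda>(s, p). (r \<otimes> s, p)) V" and ?W = "map (\<lambda>(s, p). (r \<otimes> s, p)) W"
  have "r \<otimes> T h = vsum ?V h \<oplus> wsum ?W (\<lambda>x y. leib x y h)" if h: "h \<in> lin F" for h
    using 1(3)[OF h] V 1(2) linD(1)[OF h] assms(2)
    by (simp add: vsum_scale wsum_scale r_distr)
  moreover have "\<pi> r \<otimes>\<^bsub>k\<^esub> c = \<pi> (wsum ?W rG)"
    using 1(2,4) rG assms(2) by (simp add: wsum_scale)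
  moreover have "set ?V \<subseteq> carrier R \<times> Z" "chain2 ?W" using 1(1,2) assms(2) by auto
  ultimately show ?thesis unfolding relation_def by blast
qed

lemma relation_diff:
  assumes "relation Z T c" "relation Z T' c'" "Z \<subseteq> carrier R" "\<And>h. h \<in> lin F \<Longrightarrow> T' h \<in> carrier R"
  shows "relation Z (\<lambda>h. T h \<ominus> T' h) (c \<ominus>\<^bsub>k\<^esub> c')"
proof -
  have "relation Z (\<lambda>h. T h \<oplus> (\<ominus> \<one>) \<otimes> T' h) (c \<oplus>\<^bsub>k\<^esub> \<pi> (\<ominus> \<one>) \<otimes>\<^bsub>k\<^esub> c')"
    using assms by (intro relation_add relation_smult) auto
  moreover have "c \<oplus>\<^bsub>k\<^esub> \<pi> (\<ominus> \<one>) \<otimes>\<^bsub>k\<^esub> c' = c \<ominus>\<^bsub>k\<^esub> c'"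
    using relation_carrier[OF assms(2)] by (simp add: k.minus_eq k.l_minus)
  ultimately show ?thesis
    by (simp, elim relation_cong) (use assms(4) in \<open>auto simp: minus_eq l_minus\<close>)
qed

text \<open>All occurrences of b in the combination are collected into a single coefficient
  s.\<close>

lemma relation_insert:
  assumes "relation (insert b Z) T c" "Z \<subseteq> carrier R" "b \<in> carrier R"
  shows "\<exists>s \<in> carrier R. relation Z (\<lambda>h. T h \<ominus> s \<otimes> h b) c"
proof -
  obtain V W where 1: "set V \<subseteq> carrier R \<times> insert b Z" "chain2 W"
    "\<And>h. h \<in> lin F \<Longrightarrow> T h = vsum V h \<oplus> wsum W (\<lambda>x y. leib x y h)" "c = \<pi> (wsum W rG)"
    using assms(1) unfolding relation_def by blast
  have "\<exists>s \<in> carrier R. \<exists>V'. set V' \<subseteq> carrier R \<times> Z \<and> (\<forall>h \<in> lin F. vsum V h = s \<otimes> h b \<oplus> vsum V' h)"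
    using 1(1)
  proof (induction V)
    case Nil
    then show ?case using linD(1) assms(3) by (intro bexI[of _ \<zero>] exI[of _ "[]"]) auto
  next
    case (Cons q V)
    obtain t a where q: "q = (t, a)" by (cases q)
    obtain s V' where s: "s \<in> carrier R" "set V' \<subseteq> carrier R \<times> Z" "\<And>h. h \<in> lin F \<Longrightarrow> vsum V h = s \<otimes> h b \<oplus> vsum V' h"
      using Cons by auto
    have t: "t \<in> carrier R" "a = b \<or> a \<in> Z" using Cons.prems q by auto
    have V': "set V' \<subseteq> carrier R \<times> carrier R" using s(2) assms(2) by auto
    show ?case
    proof (cases "a = b")
      case True
      have "vsum (q # V) h = (t \<oplus> s) \<otimes> h b \<oplus> vsum V' h" if h: "h \<in> lin F" for h
        using linD(1)[OF h] s t True V' assms(3) h unfolding q by (simp add: l_distr a_assoc)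
      then show ?thesis using s t by blast
    next
      case False
      then have a: "a \<in> Z" "a \<in> carrier R" using t assms by auto
      have "vsum (q # V) h = s \<otimes> h b \<oplus> vsum ((t, a) # V') h" if h: "h \<in> lin F" for h
        using linD(1)[OF h] s t a V' assms(3) h unfolding q by (simp add: a_lcomm)
      moreover have "set ((t, a) # V') \<subseteq> carrier R \<times> Z" using a t s by auto
      ultimately show ?thesis using s by blast
    qed
  qed
  then obtain s V' where s: "s \<in> carrier R" "set V' \<subseteq> carrier R \<times> Z" "\<And>h. h \<in> lin F \<Longrightarrow> vsum V h = s \<otimes> h b \<oplus> vsum V' h"
    by blast
  have V': "set V' \<subseteq> carrier R \<times> carrier R" using s(2) assms(2) by auto
  have "T h \<ominus> s \<otimes> h b = vsum V' h \<oplus> wsum W (\<lambda>x y. leib x y h)" if h: "h \<in> lin F" for h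
  proof -
    obtain v w x where d: "v = vsum V' h" "w = wsum W (\<lambda>x y. leib x y h)" "x = h b"
      and c: "v \<in> carrier R" "w \<in> carrier R" "x \<in> carrier R"
      using V' 1(2) linD(1)[OF h] assms(3) by auto
    show ?thesis unfolding 1(3)[OF h] s(3)[OF h] d[symmetric] using c s(1) by algebra
  qed
  then show ?thesis unfolding relation_def using s(1,2) 1(2,4) by blast
qed

text \<open>Substitution of relations for the points of Y into a relation over Y. The value attained
  by G changes on the way, and only its existence is recorded.\<close>

lemma relation_trans:
  assumes "\<And>b. b \<in> Y \<Longrightarrow> \<exists>c. relation Z (\<lambda>h. h b) c" "relation Y T c" "Z \<subseteq> carrier R" "Y \<subseteq> carrier R"
  shows "\<exists>c. relation Z T c"
proof -
  obtain V W where 1: "set V \<subseteq> carrier R \<times> Y" "chain2 W"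
    "\<And>h. h \<in> lin F \<Longrightarrow> T h = vsum V h \<oplus> wsum W (\<lambda>x y. leib x y h)" "c = \<pi> (wsum W rG)"
    using assms(2) unfolding relation_def by blast
  have "\<exists>c. relation Z (vsum V) c" using 1(1)
  proof (induction V)
    case Nil
    then show ?case using relation_zero relation_cong by fastforce
  next
    case (Cons q V)
    obtain t a where q: "q = (t, a)" by (cases q)
    have "a \<in> Y" and t: "t \<in> carrier R" and "set V \<subseteq> carrier R \<times> Y" using Cons.prems q by auto
    then obtain c c' where "relation Z (vsum V) c" "relation Z (\<lambda>h. h a) c'"
      using Cons.IH assms(1) by meson
    with t have "relation Z (\<lambda>h. t \<otimes> h a \<oplus> vsum V h) (\<pi> t \<otimes>\<^bsub>k\<^esub> c' \<oplus>\<^bsub>k\<^esub> c)"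
      using assms(3) by (intro relation_add relation_smult)
    then have "relation Z (vsum (q # V)) (\<pi> t \<otimes>\<^bsub>k\<^esub> c' \<oplus>\<^bsub>k\<^esub> c)"
      by (rule relation_cong) (simp add: q)
    then show ?case ..
  qed
  then obtain c1 where c1: "relation Z (vsum V) c1" by blast
  have "relation Z (\<lambda>h. wsum W (\<lambda>x y. leib x y h)) c"
    unfolding relation_def
    by (intro exI[of _ "[]"] exI[of _ W]) (use 1(2,4) linD(1) in auto)
  from relation_cong[OF relation_add[OF c1 this assms(3)], of T] 1(3) show ?thesis by blast
qed

text \<open>With evaluation at a read as the differential da and \<open>leib\<close> as the product
  rule, this says that the differentials of Z generate the module of Kaehler differentials of R over
  F.\<close>

definition full :: "'a set \<Rightarrow> bool" where
  "full Z \<longleftrightarrow> (\<forall>a \<in> carrier R. \<exists>c. relation Z (\<lambda>h. h a) c)"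

lemma fullD: "full Z \<Longrightarrow> a \<in> carrier R \<Longrightarrow> \<exists>c. relation Z (\<lambda>h. h a) c"
  by (simp add: full_def)

text \<open>The elements with a relation to Z form an F-subspace, so an F-basis of R will
  do.\<close>

lemma full_finite: "\<exists>Y. finite Y \<and> Y \<subseteq> carrier R \<and> full Y"
proof -
  obtain us where us: "set us \<subseteq> carrier R" "Span F us = carrier R"
    using exists_base[OF sf finite_dimensionE[OF sf fd]] by blast
  have sub: "subalgebra F {a \<in> carrier R. \<exists>c. relation (set us) (\<lambda>h. h a) c} R"
    unfolding subalgebra_def subalgebra_axioms_def
  proof (intro conjI allI impI add.subgroupI)
    have lz: "h \<zero> = \<zero>" if "h \<in> lin F" for h
      using linD(3)[OF that, of \<zero> \<zero>] linD(1)[OF that, of \<zero>] subringE(2)[OF subfieldE(1)[OF sf]] by simp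
    then have "relation (set us) (\<lambda>h. h \<zero>) \<zero>\<^bsub>k\<^esub>" by (intro relation_cong[OF relation_zero])
    then show "{a \<in> carrier R. \<exists>c. relation (set us) (\<lambda>h. h a) c} \<noteq> {}" by auto
    fix a assume a: "a \<in> {a \<in> carrier R. \<exists>c. relation (set us) (\<lambda>h. h a) c}"
    then obtain c where c: "relation (set us) (\<lambda>h. h a) c" and aC: "a \<in> carrier R" by auto
    have "relation (set us) (\<lambda>h. (\<ominus> \<one>) \<otimes> h a) (\<pi> (\<ominus> \<one>) \<otimes>\<^bsub>k\<^esub> c)"
      using c us by (intro relation_smult) auto
    moreover have "h (\<ominus> a) = (\<ominus> \<one>) \<otimes> h a" if h: "h \<in> lin F" for h
    proof -
      have c: "h a \<in> carrier R" "h (\<ominus> a) \<in> carrier R" using linD(1)[OF h] aC by auto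
      have "h a \<oplus> h (\<ominus> a) = \<zero>" using linD(2)[OF h, of a "\<ominus> a"] lz[OF h] aC by (simp add: r_neg)
      then have "h (\<ominus> a) = (\<ominus> h a) \<oplus> \<zero>" using r_neg1[OF c] by simp
      then show ?thesis using c by (simp add: l_minus)
    qed
    ultimately have "relation (set us) (\<lambda>h. h (\<ominus> a)) (\<pi> (\<ominus> \<one>) \<otimes>\<^bsub>k\<^esub> c)"
      by (rule relation_cong)
    then show "\<ominus> a \<in> {a \<in> carrier R. \<exists>c. relation (set us) (\<lambda>h. h a) c}"
      using aC by auto
    fix b assume "b \<in> {a \<in> carrier R. \<exists>c. relation (set us) (\<lambda>h. h a) c}"
    then obtain d where d: "relation (set us) (\<lambda>h. h b) d" and bC: "b \<in> carrier R" by auto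
    have "relation (set us) (\<lambda>h. h (a \<oplus> b)) (c \<oplus>\<^bsub>k\<^esub> d)"
      by (rule relation_cong[OF relation_add[OF c d us(1)]]) (use linD(2) aC bC in auto)
    then show "a \<oplus> b \<in> {a \<in> carrier R. \<exists>c. relation (set us) (\<lambda>h. h a) c}" using aC bC by auto
  next
    fix r a assume r: "r \<in> F" and "a \<in> {a \<in> carrier R. \<exists>c. relation (set us) (\<lambda>h. h a) c}"
    then obtain c where c: "relation (set us) (\<lambda>h. h a) c" and aC: "a \<in> carrier R" by auto
    have "r \<in> carrier R" using r FC by auto
    then have "relation (set us) (\<lambda>h. h (r \<otimes> a)) (\<pi> r \<otimes>\<^bsub>k\<^esub> c)"
      by (intro relation_cong[OF relation_smult[OF c _ us(1)]]) (use linD(3) aC r in auto)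
    then show "r \<otimes> a \<in> {a \<in> carrier R. \<exists>c. relation (set us) (\<lambda>h. h a) c}"
      using aC r FC by auto
  qed auto
  have "set us \<subseteq> {a \<in> carrier R. \<exists>c. relation (set us) (\<lambda>h. h a) c}"
    using us(1) relation_point by blast
  then have "full (set us)"
    using subalgebra_Span_incl[OF sf sub] us(2) unfolding full_def by auto
  then show ?thesis using us(1) by blast
qed

lemma lin_carrier: "h \<in> lin F \<Longrightarrow> x \<in> carrier R \<Longrightarrow> h x \<in> carrier R"
  by (rule linD(1))

text \<open>
  If \<open>b\<close> cannot be dropped from a set of generators modulo boundaries, then the coefficient of
  \<open>b\<close> modulo the maximal ideal is a derivation.
\<close>

lemma generators:
  assumes Z: "finite Z" "Z \<subseteq> carrier R"
    and max: "\<And>D. D \<in> derK \<Longrightarrow> (\<And>a. a \<in> Z \<Longrightarrow> D a = \<zero>\<^bsub>k\<^esub>) \<Longrightarrow> (\<And>a. a \<in> carrier R \<Longrightarrow> D a = \<zero>\<^bsub>k\<^esub>)"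
  shows "full Z"
proof -
  obtain Y0 where Y0: "finite Y0" "Y0 \<subseteq> carrier R" "full (Z \<union> Y0)"
  proof -
    obtain Y where "finite Y" "Y \<subseteq> carrier R" "full Y" using full_finite by blast
    moreover from this have "full (Z \<union> Y)" unfolding full_def using relation_mono by blast
    ultimately show ?thesis using that by blast
  qed
  then show ?thesis
  proof (induction Y0 rule: finite_induct)
    case (insert b Y)
    let ?Y = "Z \<union> Y"
    have YC: "?Y \<subseteq> carrier R" and b: "b \<in> carrier R" using insert.prems Z by auto
    have "full ?Y"
    proof (cases "\<exists>c. relation ?Y (\<lambda>h. h b) c")
      case True
      then have "\<exists>c. relation ?Y (\<lambda>h. h u) c" if "u \<in> Z \<union> insert b Y" for u
        using that relation_point[of u ?Y] YC by blast
      then have t: "\<exists>c. relation ?Y T c" if "relation (Z \<union> insert b Y) T c" for T c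
        using relation_trans[OF _ that YC] YC b by blast
      show ?thesis
        unfolding full_def using fullD[OF insert.prems(2)] t by meson
    next
      case False
      \<comment> \<open>In terms of differentials: da agrees with s db modulo the differentials of
        the other generators.\<close>
      define P where "P a s \<longleftrightarrow> s \<in> carrier R \<and> (\<exists>c. relation ?Y (\<lambda>h. h a \<ominus> s \<otimes> h b) c)" for a s
      have ex: "\<exists>s. P a s" if aC: "a \<in> carrier R" for a
      proof -
        obtain c where "relation (Z \<union> insert b Y) (\<lambda>h. h a) c"
          using fullD[OF insert.prems(2) aC] by blast
        then have "relation (insert b ?Y) (\<lambda>h. h a) c" by simp
        from relation_insert[OF this YC b] show ?thesis unfolding P_def by blast
      qed
      have uniq: "\<pi> s = \<pi> t" if "P a s" "P a t" "a \<in> carrier R" for a s t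
      proof (rule ccontr)
        assume "\<pi> s \<noteq> \<pi> t"
        \<comment> \<open>Two coefficients with distinct residues differ by a unit; subtracting and
          dividing expresses b through the other generators, contrary to the case
          assumption.\<close>
        then have u: "s \<ominus> t \<in> Units R" using that by (intro unit) (auto simp: P_def minus_eq k.minus_eq[symmetric] k.r_right_minus_eq)
        obtain c c' where "relation ?Y (\<lambda>h. h a \<ominus> t \<otimes> h b) c" "relation ?Y (\<lambda>h. h a \<ominus> s \<otimes> h b) c'"
          using \<open>P a s\<close> \<open>P a t\<close> unfolding P_def by blast
        then have "relation ?Y (\<lambda>h. (h a \<ominus> t \<otimes> h b) \<ominus> (h a \<ominus> s \<otimes> h b)) (c \<ominus>\<^bsub>k\<^esub> c')"
          using YC that b by (intro relation_diff) (auto simp: P_def lin_carrier)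
        then have "relation ?Y (\<lambda>h. inv (s \<ominus> t) \<otimes> ((h a \<ominus> t \<otimes> h b) \<ominus> (h a \<ominus> s \<otimes> h b))) (\<pi> (inv (s \<ominus> t)) \<otimes>\<^bsub>k\<^esub> (c \<ominus>\<^bsub>k\<^esub> c'))"
          using YC u by (intro relation_smult) auto
        then have "relation ?Y (\<lambda>h. h b) (\<pi> (inv (s \<ominus> t)) \<otimes>\<^bsub>k\<^esub> (c \<ominus>\<^bsub>k\<^esub> c'))"
        proof (rule relation_cong)
          fix h assume h: "h \<in> lin F"
          have c: "h a \<in> carrier R" "h b \<in> carrier R" "s \<in> carrier R" "t \<in> carrier R"
            using lin_carrier[OF h] that b by (auto simp: P_def)
          have "(h a \<ominus> t \<otimes> h b) \<ominus> (h a \<ominus> s \<otimes> h b) = (s \<ominus> t) \<otimes> h b" using c by algebra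
          moreover have "h b = inv (s \<ominus> t) \<otimes> ((s \<ominus> t) \<otimes> h b)"
            using u c(2) Units_closed[OF u] m_assoc[of "inv (s \<ominus> t)" "s \<ominus> t" "h b"] by simp
          ultimately show "h b = inv (s \<ominus> t) \<otimes> ((h a \<ominus> t \<otimes> h b) \<ominus> (h a \<ominus> s \<otimes> h b))" by simp
        qed
        then show False using False by blast
      qed
      define D where "D a = \<pi> (SOME s. P a s)" for a
      have D: "D a = \<pi> s" if "P a s" "a \<in> carrier R" for a s
        unfolding D_def using uniq[OF someI[of "P a", OF that(1)] that] .
      have Pb: "P b \<one>"
      proof -
        have "relation ?Y (\<lambda>h. h b \<ominus> \<one> \<otimes> h b) \<zero>\<^bsub>k\<^esub>"
          by (rule relation_cong[OF relation_zero]) (use lin_carrier b in \<open>auto simp: minus_eq r_neg\<close>)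
        then show ?thesis unfolding P_def by auto
      qed
      have PZ: "P a \<zero>" if "a \<in> Z" for a
      proof -
        have aC: "a \<in> carrier R" using that Z by auto
        have "relation ?Y (\<lambda>h. h a \<ominus> \<zero> \<otimes> h b) \<zero>\<^bsub>k\<^esub>"
          by (rule relation_cong[OF relation_point[of a]]) (use that lin_carrier b aC in \<open>auto simp: minus_eq\<close>)
        then show ?thesis unfolding P_def by auto
      qed
      have Padd: "P (a \<oplus> a') (s \<oplus> s')" if "P a s" "P a' s'" "a \<in> carrier R" "a' \<in> carrier R" for a a' s s'
      proof -
        obtain c c' where "relation ?Y (\<lambda>h. h a \<ominus> s \<otimes> h b) c" "relation ?Y (\<lambda>h. h a' \<ominus> s' \<otimes> h b) c'"
          using \<open>P a s\<close> \<open>P a' s'\<close> unfolding P_def by blast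
        from relation_add[OF this YC]
        have "relation ?Y (\<lambda>h. h (a \<oplus> a') \<ominus> (s \<oplus> s') \<otimes> h b) (c \<oplus>\<^bsub>k\<^esub> c')"
        proof (rule relation_cong)
          fix h assume h: "h \<in> lin F"
          have c: "h a \<in> carrier R" "h a' \<in> carrier R" "h b \<in> carrier R" "s \<in> carrier R" "s' \<in> carrier R"
            using lin_carrier[OF h] that b by (auto simp: P_def)
          show "h (a \<oplus> a') \<ominus> (s \<oplus> s') \<otimes> h b = h a \<ominus> s \<otimes> h b \<oplus> (h a' \<ominus> s' \<otimes> h b)"
            unfolding linD(2)[OF h that(3,4)] using c by algebra
        qed
        then show ?thesis using that unfolding P_def by auto
      qed
      have Psm: "P (r \<otimes> a) (r \<otimes> s)" if "P a s" "r \<in> F" "a \<in> carrier R" for a s r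
      proof -
        have r: "r \<in> carrier R" using that FC by auto
        obtain c where "relation ?Y (\<lambda>h. h a \<ominus> s \<otimes> h b) c" using \<open>P a s\<close> unfolding P_def by blast
        from relation_smult[OF this r YC]
        have "relation ?Y (\<lambda>h. h (r \<otimes> a) \<ominus> (r \<otimes> s) \<otimes> h b) (\<pi> r \<otimes>\<^bsub>k\<^esub> c)"
        proof (rule relation_cong)
          fix h assume h: "h \<in> lin F"
          have c: "h a \<in> carrier R" "h b \<in> carrier R" "s \<in> carrier R"
            using lin_carrier[OF h] that b by (auto simp: P_def)
          show "h (r \<otimes> a) \<ominus> (r \<otimes> s) \<otimes> h b = r \<otimes> (h a \<ominus> s \<otimes> h b)"
            unfolding linD(3)[OF h that(2,3)] using c r by algebra
        qed
        then show ?thesis using that r unfolding P_def by auto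
      qed
      have Pmul: "P (x \<otimes> y) (x \<otimes> t \<oplus> y \<otimes> s)" if "P x s" "P y t" "x \<in> carrier R" "y \<in> carrier R" for x y s t
      proof -
        obtain c c' where c: "relation ?Y (\<lambda>h. h x \<ominus> s \<otimes> h b) c" "relation ?Y (\<lambda>h. h y \<ominus> t \<otimes> h b) c'"
          using \<open>P x s\<close> \<open>P y t\<close> unfolding P_def by blast
        have "relation ?Y (\<lambda>h. (x \<otimes> (h y \<ominus> t \<otimes> h b) \<oplus> y \<otimes> (h x \<ominus> s \<otimes> h b)) \<ominus> leib x y h)
            ((\<pi> x \<otimes>\<^bsub>k\<^esub> c' \<oplus>\<^bsub>k\<^esub> \<pi> y \<otimes>\<^bsub>k\<^esub> c) \<ominus>\<^bsub>k\<^esub> G x y)"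
          using c that YC by (intro relation_diff relation_add relation_smult relation_leib) (auto simp: lin_carrier)
        then have "relation ?Y (\<lambda>h. h (x \<otimes> y) \<ominus> (x \<otimes> t \<oplus> y \<otimes> s) \<otimes> h b)
            ((\<pi> x \<otimes>\<^bsub>k\<^esub> c' \<oplus>\<^bsub>k\<^esub> \<pi> y \<otimes>\<^bsub>k\<^esub> c) \<ominus>\<^bsub>k\<^esub> G x y)"
        proof (rule relation_cong)
          fix h assume h: "h \<in> lin F"
          have c: "h x \<in> carrier R" "h y \<in> carrier R" "h b \<in> carrier R" "s \<in> carrier R" "t \<in> carrier R"
            "h (x \<otimes> y) \<in> carrier R"
            using lin_carrier[OF h] that b by (auto simp: P_def)
          show "h (x \<otimes> y) \<ominus> (x \<otimes> t \<oplus> y \<otimes> s) \<otimes> h b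
            = (x \<otimes> (h y \<ominus> t \<otimes> h b) \<oplus> y \<otimes> (h x \<ominus> s \<otimes> h b)) \<ominus> leib x y h"
            unfolding leib_def using c that(3,4) by algebra
        qed
        then show ?thesis using that unfolding P_def by auto
      qed
      have PC: "P a s \<Longrightarrow> s \<in> carrier R" for a s by (simp add: P_def)
      have "D \<in> derK"
        unfolding derK_def
      proof (intro CollectI conjI ballI linKI)
        fix x assume x: "x \<in> carrier R"
        obtain s where s: "P x s" using ex[OF x] by blast
        show "D x \<in> carrier k" using D[OF s x] PC[OF s] by simp
        show "D (c \<otimes> x) = \<pi> c \<otimes>\<^bsub>k\<^esub> D x" if "c \<in> F" for c
        proof -
          have "c \<in> carrier R" using that FC by auto
          then show ?thesis using D[OF Psm[OF s that x]] D[OF s x] PC[OF s] x by simp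
        qed
        fix y assume y: "y \<in> carrier R"
        obtain t where t: "P y t" using ex[OF y] by blast
        show "D (x \<oplus> y) = D x \<oplus>\<^bsub>k\<^esub> D y"
          using D[OF Padd[OF s t x y]] D[OF s x] D[OF t y] PC[OF s] PC[OF t] x y by simp
        show "D (x \<otimes> y) = \<pi> x \<otimes>\<^bsub>k\<^esub> D y \<oplus>\<^bsub>k\<^esub> \<pi> y \<otimes>\<^bsub>k\<^esub> D x"
          using D[OF Pmul[OF s t x y]] D[OF s x] D[OF t y] PC[OF s] PC[OF t] x y by simp
      qed
      moreover have "D a = \<zero>\<^bsub>k\<^esub>" if "a \<in> Z" for a
        using D[OF PZ[OF that]] that Z by auto
      \<comment> \<open>This D vanishes on Z, hence everywhere by \<open>max\<close>, although it
        takes the value 1 at b.\<close>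
      ultimately have "D b = \<zero>\<^bsub>k\<^esub>" using max b by blast
      then show ?thesis using D[OF Pb b] by simp
    qed
    then show ?case using insert by blast
  qed simp
qed

text \<open>If G vanished on all 2-chains with boundary supported on Z, the value c of a relation
  would depend on the functional alone. The values belonging to the evaluations at points then give,
  up to sign, a map whose coboundary is G.\<close>

lemma detecting_chain:
  assumes Z: "Z \<subseteq> carrier R" and full: "full Z"
    and ne: "\<not> (\<exists>h \<in> linK. \<forall>x \<in> carrier R. \<forall>y \<in> carrier R.
     h (x \<otimes> y) = \<pi> x \<otimes>\<^bsub>k\<^esub> h y \<oplus>\<^bsub>k\<^esub> \<pi> y \<otimes>\<^bsub>k\<^esub> h x \<oplus>\<^bsub>k\<^esub> G x y)"
  shows "\<exists>V W. set V \<subseteq> carrier R \<times> Z \<and> chain2 W \<and>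
     (\<forall>h \<in> lin F. wsum W (\<lambda>x y. leib x y h) = vsum V h) \<and> \<pi> (wsum W rG) \<noteq> \<zero>\<^bsub>k\<^esub>"
proof (rule ccontr)
  assume contra: "\<not> ?thesis"
  \<comment> \<open>A relation for the zero functional exhibits a 2-chain with boundary supported on
    Z, where G vanishes by the assumption made for contradiction.\<close>
  have zero: "c = \<zero>\<^bsub>k\<^esub>" if "relation Z (\<lambda>h. \<zero>) c" for c
  proof -
    obtain V W where 1: "set V \<subseteq> carrier R \<times> Z" "chain2 W"
      "\<And>h. h \<in> lin F \<Longrightarrow> \<zero> = vsum V h \<oplus> wsum W (\<lambda>x y. leib x y h)" "c = \<pi> (wsum W rG)"
      using \<open>relation Z (\<lambda>h. \<zero>) c\<close> unfolding relation_def by blast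
    let ?V = "map (\<lambda>(s, p). ((\<ominus> \<one>) \<otimes> s, p)) V"
    have V: "set V \<subseteq> carrier R \<times> carrier R" using 1 Z by blast
    have "wsum W (\<lambda>x y. leib x y h) = vsum ?V h" if h: "h \<in> lin F" for h
    proof -
      obtain v w where d: "v = vsum V h" "w = wsum W (\<lambda>x y. leib x y h)"
        and c: "v \<in> carrier R" "w \<in> carrier R" using V 1(2) lin_carrier[OF h] by auto
      have z: "v \<oplus> w = \<zero>" using 1(3)[OF h] d by simp
      have "w = (\<ominus> v) \<oplus> (v \<oplus> w)" using c by algebra
      also have "\<dots> = (\<ominus> \<one>) \<otimes> v" unfolding z using c by algebra
      also have "\<dots> = vsum ?V h" unfolding d using V lin_carrier[OF h] by (simp add: vsum_scale)
      finally show ?thesis using d by simp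
    qed
    moreover have "set ?V \<subseteq> carrier R \<times> Z" using 1(1) by auto
    ultimately show ?thesis using contra 1(2,4) by blast
  qed
  have uniq: "c = c'" if "relation Z T c" "relation Z T c'" "\<And>h. h \<in> lin F \<Longrightarrow> T h \<in> carrier R" for T c c'
  proof -
    have "relation Z (\<lambda>h. T h \<ominus> T h) (c \<ominus>\<^bsub>k\<^esub> c')" using that Z by (intro relation_diff)
    then have "relation Z (\<lambda>h. \<zero>) (c \<ominus>\<^bsub>k\<^esub> c')"
      by (rule relation_cong) (use that(3) in \<open>auto simp: minus_eq r_neg\<close>)
    then have "c \<ominus>\<^bsub>k\<^esub> c' = \<zero>\<^bsub>k\<^esub>" by (rule zero)
    then show ?thesis using relation_carrier[OF that(1)] relation_carrier[OF that(2)] by simp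
  qed
  define v where "v a = (SOME c. relation Z (\<lambda>h. h a) c)" for a
  have v: "relation Z (\<lambda>h. h a) (v a)" if "a \<in> carrier R" for a
    unfolding v_def using full that unfolding full_def by (meson someI)
  have veq: "v a = c" if "relation Z T c" "a \<in> carrier R" "\<And>h. h \<in> lin F \<Longrightarrow> h a = T h" for a T c
    using uniq[OF v[OF that(2)] relation_cong[OF that(1)]] that(2,3) lin_carrier by simp
  have vc: "v a \<in> carrier k" if "a \<in> carrier R" for a using relation_carrier[OF v[OF that]] .
  have vl: "v \<in> linK"
  proof (rule linKI)
    fix x assume x: "x \<in> carrier R"
    show "v (x \<oplus> y) = v x \<oplus>\<^bsub>k\<^esub> v y" if "y \<in> carrier R" for y
      using x that linD(2) by (intro veq[OF relation_add[OF v[OF x] v[OF that] Z]]) auto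
    show "v (c \<otimes> x) = \<pi> c \<otimes>\<^bsub>k\<^esub> v x" if "c \<in> F" for c
      using x that linD(3) FC by (intro veq[OF relation_smult[OF v[OF x] _ Z]]) auto
  qed (rule vc)
  \<comment> \<open>The relation \<open>leib x y\<close>, on which G takes the value G x y by
    definition, is solved for the evaluation at the product.\<close>
  have vm: "v (x \<otimes> y) = (\<pi> x \<otimes>\<^bsub>k\<^esub> v y \<oplus>\<^bsub>k\<^esub> \<pi> y \<otimes>\<^bsub>k\<^esub> v x) \<ominus>\<^bsub>k\<^esub> G x y"
    if xy: "x \<in> carrier R" "y \<in> carrier R" for x y
  proof (rule veq)
    show "relation Z (\<lambda>h. (x \<otimes> h y \<oplus> y \<otimes> h x) \<ominus> leib x y h) ((\<pi> x \<otimes>\<^bsub>k\<^esub> v y \<oplus>\<^bsub>k\<^esub> \<pi> y \<otimes>\<^bsub>k\<^esub> v x) \<ominus>\<^bsub>k\<^esub> G x y)"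
      using xy Z v by (intro relation_diff relation_add relation_smult relation_leib) (auto simp: lin_carrier)
    fix h assume h: "h \<in> lin F"
    have c: "h x \<in> carrier R" "h y \<in> carrier R" "h (x \<otimes> y) \<in> carrier R"
      using lin_carrier[OF h] xy by auto
    show "h (x \<otimes> y) = (x \<otimes> h y \<oplus> y \<otimes> h x) \<ominus> leib x y h"
      unfolding leib_def using c xy by algebra
  qed (use xy in auto)
  define h where "h x = \<ominus>\<^bsub>k\<^esub> v x" for x
  have "h \<in> linK"
    by (rule linK_comb[OF linK_zero[of "\<lambda>_. \<zero>\<^bsub>k\<^esub>"] vl, where c = "\<ominus>\<^bsub>k\<^esub> \<one>\<^bsub>k\<^esub>"]) (use vc in \<open>auto simp: h_def k.l_minus\<close>)
  moreover have "h (x \<otimes> y) = \<pi> x \<otimes>\<^bsub>k\<^esub> h y \<oplus>\<^bsub>k\<^esub> \<pi> y \<otimes>\<^bsub>k\<^esub> h x \<oplus>\<^bsub>k\<^esub> G x y"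
    if xy: "x \<in> carrier R" "y \<in> carrier R" for x y
  proof -
    have c: "v x \<in> carrier k" "v y \<in> carrier k" "\<pi> x \<in> carrier k" "\<pi> y \<in> carrier k" "G x y \<in> carrier k"
      using xy vc symcocD(1) by auto
    show ?thesis unfolding h_def vm[OF xy] using c by algebra
  qed
  ultimately show False using ne by blast
qed

end

end

section \<open>Nontrivial cocycles of a local algebra\<close>

text \<open>In positive length n, the values of \<open>ldiff g\<close> depend only on those of g in
  length n - 1; thus g may range over functions on lists of all lengths.\<close>

definition (in cring) nontrivial_cocycle :: "'a set \<Rightarrow> nat \<Rightarrow> ('a list \<Rightarrow> 'a) \<Rightarrow> bool" where
  "nontrivial_cocycle F n f \<longleftrightarrow> f \<in> mlin F \<and>
     (\<forall>bs. set bs \<subseteq> carrier R \<longrightarrow> ldiff f bs = \<zero>) \<and>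
     (\<forall>bs. set bs \<subseteq> carrier R \<longrightarrow> length bs \<noteq> n \<longrightarrow> f bs = \<zero>) \<and>
     \<not> (\<exists>g \<in> mlin F. \<forall>bs. set bs \<subseteq> carrier R \<longrightarrow> ldiff g bs = f bs)"

context residue_alg
begin

text \<open>Each D is required to vanish only on the elements after its own: a derivation that kills
  a given list can then be prepended without changing the older pairs.\<close>

fun dual_system :: "'a list \<Rightarrow> ('a \<Rightarrow> 'b) list \<Rightarrow> bool" where
  "dual_system [] [] \<longleftrightarrow> True"
| "dual_system (a # as) (D # Ds) \<longleftrightarrow> a \<in> carrier R \<and> D \<in> derK \<and> D a = \<one>\<^bsub>k\<^esub> \<and> (\<forall>b \<in> set as. D b = \<zero>\<^bsub>k\<^esub>) \<and> dual_system as Ds"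
| "dual_system _ _ \<longleftrightarrow> False"

lemma dual_system_props:
  "dual_system as Ds \<Longrightarrow> set as \<subseteq> carrier R \<and> set Ds \<subseteq> derK \<and> length Ds = length as \<and> independent F as"
proof (induction as Ds rule: dual_system.induct)
  case (2 a as D Ds)
  have "a \<notin> Span F as"
    using linK_Span_zero[of D as a] 2 by (auto simp: derK_def)
  then show ?case using 2 by (auto intro: independent.li_Cons)
qed auto

lemma dual_system_drop: "dual_system as Ds \<Longrightarrow> dual_system (drop n as) (drop n Ds)"
proof (induction as Ds arbitrary: n rule: dual_system.induct)
  case (2 a as D Ds)
  then show ?case by (cases n) auto
qed auto

lemma derK_scale:
  assumes D: "D \<in> derK" and c: "c \<in> carrier k"
  shows "(\<lambda>x. c \<otimes>\<^bsub>k\<^esub> D x) \<in> derK"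
proof -
  have Dl: "D \<in> linK" using D by (simp add: derK_def)
  note Dc = linKD(1)[OF Dl]
  have "(\<lambda>x. c \<otimes>\<^bsub>k\<^esub> D x) \<in> linK"
    by (rule linK_comb[OF linK_zero[of "\<lambda>_. \<zero>\<^bsub>k\<^esub>"] Dl c]) (use Dc c in auto)
  moreover have "c \<otimes>\<^bsub>k\<^esub> D (x \<otimes> y) = \<pi> x \<otimes>\<^bsub>k\<^esub> (c \<otimes>\<^bsub>k\<^esub> D y) \<oplus>\<^bsub>k\<^esub> \<pi> y \<otimes>\<^bsub>k\<^esub> (c \<otimes>\<^bsub>k\<^esub> D x)"
    if xy: "x \<in> carrier R" "y \<in> carrier R" for x y
  proof -
    have e: "D (x \<otimes> y) = \<pi> x \<otimes>\<^bsub>k\<^esub> D y \<oplus>\<^bsub>k\<^esub> \<pi> y \<otimes>\<^bsub>k\<^esub> D x" using D xy by (simp add: derK_def)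
    have cc: "\<pi> x \<in> carrier k" "\<pi> y \<in> carrier k" "D x \<in> carrier k" "D y \<in> carrier k" using Dc xy by auto
    show ?thesis unfolding e using cc c by algebra
  qed
  ultimately show ?thesis by (simp add: derK_def)
qed

text \<open>The elements of a dual system are linearly independent, which bounds its length. A
  nonzero derivation that kills all of them could be scaled to the value 1 somewhere and
  prepended.\<close>

lemma maximal_dual_system:
  "\<exists>as Ds. dual_system as Ds \<and>
     (\<forall>D \<in> derK. (\<forall>a \<in> set as. D a = \<zero>\<^bsub>k\<^esub>) \<longrightarrow> (\<forall>a \<in> carrier R. D a = \<zero>\<^bsub>k\<^esub>))"
proof -
  define P where "P e \<longleftrightarrow> (\<exists>as Ds. dual_system as Ds \<and> length as = e)" for e
  have "P 0" unfolding P_def by (intro exI[of _ "[]"]) simp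
  moreover have "e \<le> (dim over F) (carrier R)" if "P e" for e
    using that independent_bound dual_system_props unfolding P_def by blast
  ultimately obtain e where e: "P e" "\<And>e'. P e' \<Longrightarrow> e' \<le> e"
    using GreatestI_nat[of P 0] Greatest_le_nat[of P] by blast
  obtain as Ds where as: "dual_system as Ds" "length as = e" using e(1) unfolding P_def by blast
  have "D a = \<zero>\<^bsub>k\<^esub>" if D: "D \<in> derK" "\<forall>a \<in> set as. D a = \<zero>\<^bsub>k\<^esub>" and a: "a \<in> carrier R" for D a
  proof (rule ccontr)
    assume ne: "D a \<noteq> \<zero>\<^bsub>k\<^esub>"
    have "D \<in> linK" using D by (simp add: derK_def)
    then have Da: "D a \<in> carrier k" using a by (rule linKD(1))
    then have u: "D a \<in> Units k" using ne by (simp add: k.field_Units)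
    then have "dual_system (a # as) ((\<lambda>x. inv\<^bsub>k\<^esub> (D a) \<otimes>\<^bsub>k\<^esub> D x) # Ds)"
      using as D a derK_scale[OF D(1)] by simp
    then have "P (Suc e)" unfolding P_def using as(2) by (metis length_Cons)
    then show False using e(2) by fastforce
  qed
  then show ?thesis using as(1) by blast
qed

lemma rep_mult: "c \<in> carrier k \<Longrightarrow> y \<in> carrier R \<Longrightarrow> \<pi> y = c \<Longrightarrow> z \<in> ann \<Longrightarrow> rep c \<otimes> z = y \<otimes> z"
  using rep[of c] by (intro ann_cong) auto

lemma rep_dermod: "D \<in> derK \<Longrightarrow> (\<lambda>x. rep (D x)) \<in> dermod F ann"
proof -
  assume D: "D \<in> derK"
  then have Dl: "D \<in> linK" by (simp add: derK_def)
  have r: "rep (D x) \<in> carrier R" "\<pi> (rep (D x)) = D x" if "x \<in> carrier R" for x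
    using rep linKD(1)[OF Dl that] by auto
  have 1: "rep (D (x \<oplus> y)) \<otimes> z = rep (D x) \<otimes> z \<oplus> rep (D y) \<otimes> z"
    if "x \<in> carrier R" "y \<in> carrier R" "z \<in> ann" for x y z
  proof -
    have "rep (D (x \<oplus> y)) \<otimes> z = (rep (D x) \<oplus> rep (D y)) \<otimes> z"
      by (rule rep_mult) (use that r linKD[OF Dl] in auto)
    then show ?thesis using that r ann_carrier by (auto simp: l_distr subset_iff)
  qed
  have 2: "rep (D (c \<otimes> x)) \<otimes> z = c \<otimes> (rep (D x) \<otimes> z)"
    if "x \<in> carrier R" "c \<in> F" "z \<in> ann" for x c z
  proof -
    have c: "c \<in> carrier R" using that FC by auto
    have "rep (D (c \<otimes> x)) \<otimes> z = (c \<otimes> rep (D x)) \<otimes> z"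
      by (rule rep_mult) (use that c r linKD[OF Dl] in auto)
    then show ?thesis using that r c ann_carrier by (auto simp: m_assoc subset_iff)
  qed
  have 3: "rep (D (x \<otimes> y)) \<otimes> z = (x \<otimes> rep (D y) \<oplus> y \<otimes> rep (D x)) \<otimes> z"
    if "x \<in> carrier R" "y \<in> carrier R" "z \<in> ann" for x y z
    by (rule rep_mult) (use that r D linKD(1)[OF Dl] in \<open>auto simp: derK_def\<close>)
  show ?thesis by (rule dermodI[OF FC ann_carrier ann_mult r(1) 1 2 3])
qed

lemma rep_cocmod:
  assumes "symcoc G" shows "(\<lambda>x y. rep (G x y)) \<in> cocmod F ann"
proof -
  note G = symcocD[OF assms]
  have r: "rep (G x y) \<in> carrier R" "\<pi> (rep (G x y)) = G x y" if "x \<in> carrier R" "y \<in> carrier R" for x y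
    using rG[OF assms that] by auto
  have 1: "rep (G x y) \<otimes> z = rep (G y x) \<otimes> z"
    if "x \<in> carrier R" "y \<in> carrier R" "z \<in> ann" for x y z
    using that r G(2) by (intro ann_cong) auto
  have 2: "rep (G (x \<oplus> y) w) \<otimes> z = rep (G x w) \<otimes> z \<oplus> rep (G y w) \<otimes> z"
    if "x \<in> carrier R" "y \<in> carrier R" "w \<in> carrier R" "z \<in> ann" for x y w z
  proof -
    have "rep (G (x \<oplus> y) w) \<otimes> z = (rep (G x w) \<oplus> rep (G y w)) \<otimes> z"
      by (rule rep_mult) (use that r G(1) linKD[OF G(3)] in auto)
    then show ?thesis using that r ann_carrier by (auto simp: l_distr subset_iff)
  qed
  have 3: "rep (G (c \<otimes> x) w) \<otimes> z = c \<otimes> (rep (G x w) \<otimes> z)"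
    if "x \<in> carrier R" "c \<in> F" "w \<in> carrier R" "z \<in> ann" for x c w z
  proof -
    have c: "c \<in> carrier R" using that FC by auto
    have "rep (G (c \<otimes> x) w) \<otimes> z = (c \<otimes> rep (G x w)) \<otimes> z"
      by (rule rep_mult) (use that c r G(1) linKD[OF G(3)] in auto)
    then show ?thesis using that r c ann_carrier by (auto simp: m_assoc subset_iff)
  qed
  have 4: "(x \<otimes> rep (G y w) \<oplus> rep (G x (y \<otimes> w))) \<otimes> z = (rep (G (x \<otimes> y) w) \<oplus> w \<otimes> rep (G x y)) \<otimes> z"
    if "x \<in> carrier R" "y \<in> carrier R" "w \<in> carrier R" "z \<in> ann" for x y w z
    using that r G(4)[of x y w] by (intro ann_cong) auto
  show ?thesis by (rule cocmodI[OF FC ann_carrier ann_mult r(1) 1 2 3 4])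
qed

text \<open>In a dual system each D kills the later elements, in \<open>triang\<close> the later D
  kill the earlier elements; reversal exchanges the two conventions.\<close>

lemma dual_system_triang:
  "dual_system as Ds \<Longrightarrow> triang ann (rev as) (map (\<lambda>D x. rep (D x)) (rev Ds))"
proof (induction as Ds rule: dual_system.induct)
  case 1
  then show ?case using triang.simps(1)[OF FC ann_carrier ann_mult] by simp
next
  case (2 a as D Ds)
  have zC: "z \<in> carrier R" if "z \<in> ann" for z using that ann_carrier by auto
  have r: "rep (D a) \<in> carrier R" "\<pi> (rep (D a)) = \<one>\<^bsub>k\<^esub>" using rep[of "D a"] 2 by auto
  have "rep (D a) \<otimes> z = z" if "z \<in> ann" for z
    using ann_cong[OF r(1) one_closed _ that] r that zC by simp
  moreover have "rep (D b) \<otimes> z = \<zero>" if "b \<in> set as" "z \<in> ann" for b z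
    using ann_cong[OF _ zero_closed _ that(2), of "rep (D b)"] rep[of "D b"] 2 that zC by simp
  ultimately show ?case
    using triang_snoc[OF FC ann_carrier ann_mult, of "rev as" "map (\<lambda>D x. rep (D x)) (rev Ds)" "\<lambda>x. rep (D x)" a] 2 by simp
qed auto

lemma one_not_zero_R: "\<one> \<noteq> \<zero>"
  using pi.hom_one pi.hom_zero one_k by metis

lemma socle: "\<exists>s \<in> ann. s \<noteq> \<zero>"
proof -
  have "\<exists>t \<in> carrier R - {\<zero>}. \<forall>y \<in> carrier R. \<pi> y = \<zero>\<^bsub>k\<^esub> \<longrightarrow> y \<otimes> t \<notin> carrier R - {\<zero>}"
    using one_not_zero_R by (intro socle_element) auto
  then obtain t where "t \<in> carrier R" "t \<noteq> \<zero>" "\<And>y. y \<in> carrier R \<Longrightarrow> \<pi> y = \<zero>\<^bsub>k\<^esub> \<Longrightarrow> y \<otimes> t = \<zero>" by auto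
  then show ?thesis by (intro bexI[of _ t]) (auto simp: ann_def)
qed

text \<open>The unit condition keeps the test value G(W)^i s different from zero, for a nonzero s in
  the socle.\<close>

lemma cup_nontrivial:
  assumes as: "dual_system as Ds" and G: "symcoc G"
    and W: "set V \<subseteq> carrier R \<times> set as" "chain2 W"
      "\<And>h. h \<in> lin F \<Longrightarrow> wsum W (\<lambda>x y. leib x y h) = vsum V h"
    and u: "wsum W (\<lambda>x y. rep (G x y)) [^] i \<in> Units R"
  shows "\<exists>f. nontrivial_cocycle F (length as + 2 * i) f"
proof -
  define rG where "rG x y = rep (G x y)" for x y
  obtain s where s: "s \<in> ann" "s \<noteq> \<zero>" using socle by blast
  have sC: "s \<in> carrier R" using s ann_carrier by auto
  have rG: "rG \<in> cocmod F ann" using rep_cocmod[OF G] unfolding rG_def .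
  let ?Ds = "map (\<lambda>D x. rep (D x)) (rev Ds)"
  have Ds: "set ?Ds \<subseteq> dermod F ann" using dual_system_props[OF as] rep_dermod by auto
  have len: "length ?Ds = length as" using dual_system_props[OF as] by simp
  define f where "f = cupl ?Ds (gpow rG s i)"
  note gp = gpow_props[OF FC ann_carrier ann_mult rG s(1)]
  have f: "f \<in> mlin F" "\<And>bs. set bs \<subseteq> carrier R \<Longrightarrow> ldiff f bs = \<zero>"
    "\<And>bs. set bs \<subseteq> carrier R \<Longrightarrow> length bs \<noteq> length as + 2 * i \<Longrightarrow> f bs = \<zero>"
    using cupl_props[OF FC ann_carrier ann_mult Ds gp(1,2,3), of "2 * i"] gp(5) len
    unfolding f_def by auto
  have "\<not> (\<exists>g \<in> mlin F. \<forall>bs. set bs \<subseteq> carrier R \<longrightarrow> ldiff g bs = f bs)"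
  proof
    assume "\<exists>g \<in> mlin F. \<forall>bs. set bs \<subseteq> carrier R \<longrightarrow> ldiff g bs = f bs"
    then obtain g where g: "g \<in> mlin F" "\<And>bs. set bs \<subseteq> carrier R \<Longrightarrow> ldiff g bs = f bs" by blast
    have "(wsum W rG [^] i) \<otimes> s = \<zero>"
    proof (rule cup_not_coboundary[OF FC ann_carrier ann_mult])
      show "triang ann (rev as) ?Ds" by (rule dual_system_triang[OF as])
      show "set (rev as) \<subseteq> carrier R" using dual_system_props[OF as] by simp
      show "set V \<subseteq> carrier R \<times> set (rev as)" using W by simp
    qed (use Ds rG s W g f_def in auto)
    then show False using unit_mult_zero[of "wsum W rG [^] i" s] u sC s unfolding rG_def by blast
  qed
  then show ?thesis using f unfolding nontrivial_cocycle_def by blast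
qed

text \<open>
  With \<open>e\<close> derivations dual to \<open>e\<close> generators of the differentials, the cocycles are
  \<open>s D\<^sub>1 \<union> \<dots> \<union> D\<^sub>n\<close> for \<open>n \<le> e\<close> and \<open>s D\<^sub>1 \<union> \<dots> \<union> D\<^sub>e \<union> G\<^sup>i\<close> for \<open>n = e + 2 i\<close>.
\<close>

lemma nontrivial_cocycles:
  assumes D: "D \<in> derK" "a \<in> carrier R" "D a \<noteq> \<zero>\<^bsub>k\<^esub>"
  shows "\<exists>e. \<forall>n. n \<le> e \<or> (\<exists>i. n = e + 2 * i) \<longrightarrow> (\<exists>f. nontrivial_cocycle F n f)"
proof -
  obtain as Ds where as: "dual_system as Ds"
    and max: "\<forall>D \<in> derK. (\<forall>a \<in> set as. D a = \<zero>\<^bsub>k\<^esub>) \<longrightarrow> (\<forall>a \<in> carrier R. D a = \<zero>\<^bsub>k\<^esub>)"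
    using maximal_dual_system by blast
  obtain G where G: "symcoc G" and ne: "\<not> (\<exists>h \<in> linK. \<forall>x \<in> carrier R. \<forall>y \<in> carrier R.
     h (x \<otimes> y) = \<pi> x \<otimes>\<^bsub>k\<^esub> h y \<oplus>\<^bsub>k\<^esub> \<pi> y \<otimes>\<^bsub>k\<^esub> h x \<oplus>\<^bsub>k\<^esub> G x y)"
    using maximal_hasse_schmidt[OF D] by blast
  have asC: "set as \<subseteq> carrier R" "length Ds = length as" using dual_system_props[OF as] by auto
  have "full G (set as)" using max asC by (intro generators[OF G]) auto
  from detecting_chain[OF G asC(1) this ne]
  obtain V W where W: "set V \<subseteq> carrier R \<times> set as" "chain2 W"
    "\<forall>h \<in> lin F. wsum W (\<lambda>x y. leib x y h) = vsum V h" "\<pi> (wsum W (\<lambda>x y. rep (G x y))) \<noteq> \<zero>\<^bsub>k\<^esub>"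
    by blast
  have "wsum W (\<lambda>x y. rep (G x y)) \<in> carrier R" using W(2) rG[OF G] by (intro wsum_closed) auto
  then have u: "wsum W (\<lambda>x y. rep (G x y)) [^] i \<in> Units R" for i :: nat
    using W(4) by (intro Units_pow_closed unit)
  have 1: "\<exists>f. nontrivial_cocycle F (length as + 2 * i) f" for i
    using cup_nontrivial[OF as G W(1,2) _ u] W(3) by blast
  have 2: "\<exists>f. nontrivial_cocycle F n f" if "n \<le> length as" for n
  proof -
    \<comment> \<open>For i = 0 the power is 1 whatever the chain, so the empty chain, whose
      boundary is zero, serves every suffix of the dual system.\<close>
    have "wsum [] (\<lambda>x y. rep (G x y)) [^] (0::nat) \<in> Units R" by simp
    from cup_nontrivial[OF dual_system_drop[OF as, of "length as - n"] G, of "[]" "[]", OF _ _ _ this]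
    show ?thesis using that by simp
  qed
  show ?thesis using 1 2 by blast
qed

end

section \<open>Differential operators into the residue field\<close>

text \<open>The subfield is left general since the projection is taken over F in one application and
  over a larger subfield in another.\<close>

lemma (in ring) projection_exists:
  assumes K: "subfield K R" and fd: "finite_dimension K (carrier R)" and U: "subalgebra K U R"
  shows "\<exists>p. (\<forall>x \<in> carrier R. p x \<in> U) \<and> (\<forall>u \<in> U. p u = u) \<and>
    (\<forall>x \<in> carrier R. \<forall>y \<in> carrier R. p (x \<oplus> y) = p x \<oplus> p y) \<and>
    (\<forall>c \<in> K. \<forall>x \<in> carrier R. p (c \<otimes> x) = c \<otimes> p x)"
proof -
  have "finite_dimension K U"
    using subalbegra_incl_imp_finite_dimension[OF K fd U subalgebra_in_carrier[OF U]] .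
  then obtain us where us: "independent K us" "Span K us = U" "set us \<subseteq> carrier R"
    using exists_base[OF K finite_dimensionE[OF K]] by metis
  obtain vs where vs: "independent K (vs @ us)" "Span K (vs @ us) = carrier R"
    using complete_base[OF K finite_dimensionE[OF K fd] us(1,3)] by blast
  have vsC: "set vs \<subseteq> carrier R" using independent_in_carrier[OF vs(1)] by simp
  note sV = Span_subgroup_props[OF K vsC] Span_smult_closed[OF K vsC]
  note sU = Span_subgroup_props[OF K us(3), unfolded us(2)] Span_smult_closed[OF K us(3), unfolded us(2)]
  have UC: "U \<subseteq> carrier R" and VC: "Span K vs \<subseteq> carrier R"
    using subalgebra_in_carrier[OF U] Span_in_carrier[OF subfieldE(3)[OF K] vsC] by auto
  have ex: "\<exists>u. u \<in> U \<and> (\<exists>v \<in> Span K vs. x = v \<oplus> u)" if "x \<in> carrier R" for x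
  proof -
    have "x \<in> Span K vs <+>\<^bsub>R\<^esub> U" using that Span_append_eq_set_add[OF K vsC us(3)] vs(2) us(2) by simp
    then show ?thesis unfolding set_add_def' by blast
  qed
  have zero: "u = \<zero>" if "u \<in> U" "u \<in> Span K vs" for u
    using independent_split(3)[OF K vs(1)] that us(2) by auto
  have uniq: "u = u'" if a: "u \<in> U" "u' \<in> U" "v \<in> Span K vs" "v' \<in> Span K vs" "v \<oplus> u = v' \<oplus> u'" for u u' v v'
  proof -
    have c: "u \<in> carrier R" "u' \<in> carrier R" "v \<in> carrier R" "v' \<in> carrier R" using a UC VC by auto
    have "u \<ominus> u' = (\<ominus> v) \<oplus> (v \<oplus> u) \<ominus> u'" using c by algebra
    also have "\<dots> = v' \<ominus> v" unfolding a(5) using c by algebra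
    finally have "u \<ominus> u' = v' \<ominus> v" .
    moreover have "u \<ominus> u' \<in> U" "v' \<ominus> v \<in> Span K vs"
      unfolding minus_eq using sU(3)[OF a(1) sU(4)[OF a(2)]] sV(3)[OF a(4) sV(4)[OF a(3)]] by -
    ultimately have "u \<ominus> u' = \<zero>" using zero by simp
    then show ?thesis using c by simp
  qed
  define p where "p x = (THE u. u \<in> U \<and> (\<exists>v \<in> Span K vs. x = v \<oplus> u))" for x
  have p: "p (v \<oplus> u) = u" if "u \<in> U" "v \<in> Span K vs" for u v
    unfolding p_def
  proof (rule the_equality)
    show "u \<in> U \<and> (\<exists>w \<in> Span K vs. v \<oplus> u = w \<oplus> u)" using that by blast
    fix u' assume "u' \<in> U \<and> (\<exists>w \<in> Span K vs. v \<oplus> u = w \<oplus> u')"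
    then obtain w where "u' \<in> U" "w \<in> Span K vs" "v \<oplus> u = w \<oplus> u'" by blast
    then show "u' = u" using uniq[of u u' v w] that by simp
  qed
  have "p x \<in> U" if x: "x \<in> carrier R" for x
  proof -
    obtain u v where 1: "u \<in> U" "v \<in> Span K vs" "x = v \<oplus> u" using ex[OF x] by blast
    show ?thesis unfolding 1(3) p[OF 1(1,2)] by (rule 1(1))
  qed
  moreover have "p u = u" if "u \<in> U" for u
  proof -
    have "p (\<zero> \<oplus> u) = u" by (rule p[OF that sV(2)])
    moreover have "u \<in> carrier R" using that UC by blast
    ultimately show ?thesis by simp
  qed
  moreover have "p (x \<oplus> y) = p x \<oplus> p y" if "x \<in> carrier R" "y \<in> carrier R" for x y
  proof -
    obtain u v where 1: "u \<in> U" "v \<in> Span K vs" "x = v \<oplus> u" using ex[OF \<open>x \<in> carrier R\<close>] by blast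
    obtain u' v' where 2: "u' \<in> U" "v' \<in> Span K vs" "y = v' \<oplus> u'" using ex[OF \<open>y \<in> carrier R\<close>] by blast
    have c: "u \<in> carrier R" "u' \<in> carrier R" "v \<in> carrier R" "v' \<in> carrier R" using 1 2 UC VC by (blast+)
    have "x \<oplus> y = (v \<oplus> v') \<oplus> (u \<oplus> u')" unfolding 1 2 using c by algebra
    moreover have "u \<oplus> u' \<in> U" "v \<oplus> v' \<in> Span K vs" using sU(3)[OF 1(1) 2(1)] sV(3)[OF 1(2) 2(2)] by -
    ultimately show ?thesis using p[of "u \<oplus> u'" "v \<oplus> v'"] p[OF 1(1,2)] p[OF 2(1,2)] 1(3) 2(3) by simp
  qed
  moreover have "p (c \<otimes> x) = c \<otimes> p x" if "c \<in> K" "x \<in> carrier R" for c x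
  proof -
    obtain u v where 1: "u \<in> U" "v \<in> Span K vs" "x = v \<oplus> u" using ex[OF \<open>x \<in> carrier R\<close>] by blast
    have c: "c \<in> carrier R" "u \<in> carrier R" "v \<in> carrier R" using 1(1,2) that(1) UC VC subfieldE(3)[OF K] by blast+
    have "c \<otimes> x = c \<otimes> v \<oplus> c \<otimes> u" unfolding 1 using c by (simp add: r_distr)
    moreover have "c \<otimes> u \<in> U" "c \<otimes> v \<in> Span K vs" using sU(5)[OF that(1) 1(1)] sV(5)[OF that(1) 1(2)] by -
    ultimately show ?thesis using p[of "c \<otimes> u" "c \<otimes> v"] p[OF 1(1,2)] 1(3) by simp
  qed
  ultimately show ?thesis by blast
qed

context residue_alg
begin

text \<open>The commutator with multiplication by x, where x acts on the residue field through
  \<pi>; its iterated vanishing is Grothendieck's definition of a differential operator.\<close>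

definition ad :: "'a \<Rightarrow> ('a \<Rightarrow> 'b) \<Rightarrow> 'a \<Rightarrow> 'b" where
  "ad x T v = \<pi> x \<otimes>\<^bsub>k\<^esub> T v \<ominus>\<^bsub>k\<^esub> T (x \<otimes> v)"

text \<open>These are the R-linear maps from R to the residue field, that is, the operators of order
  0.\<close>

definition scalar :: "('a \<Rightarrow> 'b) \<Rightarrow> bool" where
  "scalar T \<longleftrightarrow> (\<exists>c \<in> carrier k. \<forall>v \<in> carrier R. T v = c \<otimes>\<^bsub>k\<^esub> \<pi> v)"

section \<open>Commutators with multiplications and their commutation\<close>

lemma ad_closed: "T \<in> linK \<Longrightarrow> x \<in> carrier R \<Longrightarrow> v \<in> carrier R \<Longrightarrow> ad x T v \<in> carrier k"
  unfolding ad_def using linKD(1)[of T] by simp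

lemma ad_linK:
  assumes T: "T \<in> linK" and x: "x \<in> carrier R"
  shows "ad x T \<in> linK"
proof (rule linKI)
  fix v assume v: "v \<in> carrier R"
  show "ad x T v \<in> carrier k" by (rule ad_closed[OF T x v])
  have c: "\<pi> x \<in> carrier k" "T v \<in> carrier k" "T (x \<otimes> v) \<in> carrier k" using linKD(1)[OF T] x v by auto
  { fix w assume w: "w \<in> carrier R"
    have c': "T w \<in> carrier k" "T (x \<otimes> w) \<in> carrier k" using linKD(1)[OF T] x w by auto
    have e: "T (v \<oplus> w) = T v \<oplus>\<^bsub>k\<^esub> T w" "T (x \<otimes> (v \<oplus> w)) = T (x \<otimes> v) \<oplus>\<^bsub>k\<^esub> T (x \<otimes> w)"
      using linKD(2)[OF T] x v w by (auto simp: r_distr)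
    show "ad x T (v \<oplus> w) = ad x T v \<oplus>\<^bsub>k\<^esub> ad x T w" unfolding ad_def e using c c' by algebra }
  { fix d assume d: "d \<in> F"
    then have dC: "d \<in> carrier R" "\<pi> d \<in> carrier k" using FC by auto
    have e: "T (d \<otimes> v) = \<pi> d \<otimes>\<^bsub>k\<^esub> T v" "T (x \<otimes> (d \<otimes> v)) = \<pi> d \<otimes>\<^bsub>k\<^esub> T (x \<otimes> v)"
      using linKD(3)[OF T d] x v dC m_lcomm[OF x dC(1) v] by auto
    show "ad x T (d \<otimes> v) = \<pi> d \<otimes>\<^bsub>k\<^esub> ad x T v" unfolding ad_def e using c dC by algebra }
qed

lemma ad_pow_linK: "T \<in> linK \<Longrightarrow> x \<in> carrier R \<Longrightarrow> (ad x ^^ n) T \<in> linK"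
  by (induction n) (auto intro: ad_linK)

lemma ad_cong: "(\<And>v. v \<in> carrier R \<Longrightarrow> S v = T v) \<Longrightarrow> x \<in> carrier R \<Longrightarrow> v \<in> carrier R \<Longrightarrow> ad x S v = ad x T v"
  by (simp add: ad_def)

lemma ad_pow_cong:
  "(\<And>v. v \<in> carrier R \<Longrightarrow> S v = T v) \<Longrightarrow> x \<in> carrier R \<Longrightarrow> v \<in> carrier R
    \<Longrightarrow> (ad x ^^ n) S v = (ad x ^^ n) T v"
  by (induction n arbitrary: v) (auto intro: ad_cong)

lemma ad_commute:
  assumes T: "T \<in> linK" and xyv: "x \<in> carrier R" "y \<in> carrier R" "v \<in> carrier R"
  shows "ad x (ad y T) v = ad y (ad x T) v"
proof -
  have c: "\<pi> x \<in> carrier k" "\<pi> y \<in> carrier k" "T v \<in> carrier k" "T (x \<otimes> v) \<in> carrier k"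
    "T (y \<otimes> v) \<in> carrier k" "T (x \<otimes> (y \<otimes> v)) \<in> carrier k"
    using linKD(1)[OF T] xyv by auto
  have e: "y \<otimes> (x \<otimes> v) = x \<otimes> (y \<otimes> v)" using xyv by (simp add: m_lcomm)
  show ?thesis unfolding ad_def e using c by algebra
qed

lemma ad_pow_commute:
  assumes T: "T \<in> linK" and xyv: "x \<in> carrier R" "y \<in> carrier R" "v \<in> carrier R"
  shows "(ad x ^^ n) (ad y T) v = ad y ((ad x ^^ n) T) v"
  using xyv(3)
proof (induction n arbitrary: v)
  case (Suc n)
  have "ad x ((ad x ^^ n) (ad y T)) v = ad x (ad y ((ad x ^^ n) T)) v"
    using Suc xyv by (intro ad_cong) auto
  also have "\<dots> = ad y (ad x ((ad x ^^ n) T)) v"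
    using T xyv Suc.prems by (intro ad_commute ad_pow_linK)
  finally show ?case by simp
qed simp

lemma ad_pow_pow_commute:
  assumes T: "T \<in> linK" and xyv: "x \<in> carrier R" "y \<in> carrier R" "v \<in> carrier R"
  shows "(ad x ^^ n) ((ad y ^^ m) T) v = (ad y ^^ m) ((ad x ^^ n) T) v"
  using xyv(3)
proof (induction m arbitrary: v)
  case (Suc m)
  have "(ad x ^^ n) ((ad y ^^ Suc m) T) v = ad y ((ad x ^^ n) ((ad y ^^ m) T)) v"
    using ad_pow_commute[OF ad_pow_linK[OF T xyv(2)] xyv(1,2) Suc.prems, of n m] by simp
  also have "\<dots> = ad y ((ad y ^^ m) ((ad x ^^ n) T)) v"
    using Suc xyv by (intro ad_cong) auto
  finally show ?case by simp
qed simp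

lemma scalar_cong: "(\<And>v. v \<in> carrier R \<Longrightarrow> S v = T v) \<Longrightarrow> scalar S = scalar T"
  unfolding scalar_def by simp

lemma scalar_zero: "(\<And>v. v \<in> carrier R \<Longrightarrow> S v = \<zero>\<^bsub>k\<^esub>) \<Longrightarrow> scalar S"
  unfolding scalar_def by (intro bexI[of _ "\<zero>\<^bsub>k\<^esub>"]) auto

lemma scalar_ad:
  assumes "scalar T" "x \<in> carrier R" shows "scalar (ad x T)"
proof (rule scalar_zero)
  obtain c where c: "c \<in> carrier k" "\<And>v. v \<in> carrier R \<Longrightarrow> T v = c \<otimes>\<^bsub>k\<^esub> \<pi> v"
    using assms unfolding scalar_def by blast
  fix v assume v: "v \<in> carrier R"
  have cc: "\<pi> x \<in> carrier k" "\<pi> v \<in> carrier k" using v assms by auto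
  have e: "T (x \<otimes> v) = c \<otimes>\<^bsub>k\<^esub> (\<pi> x \<otimes>\<^bsub>k\<^esub> \<pi> v)" "T v = c \<otimes>\<^bsub>k\<^esub> \<pi> v" using c v assms by auto
  show "ad x T v = \<zero>\<^bsub>k\<^esub>" unfolding ad_def e using c(1) cc by algebra
qed

lemma scalar_ad_pow: "scalar T \<Longrightarrow> x \<in> carrier R \<Longrightarrow> scalar ((ad x ^^ n) T)"
  by (induction n) (auto intro: scalar_ad)

text \<open>The list \<open>ws\<close> holds the elements already treated. Applying
  \<open>ad u\<close> for as long as the result is not scalar makes the next commutator with u
  scalar; since all commutators commute, what is known about the other elements survives.\<close>

lemma last_nonscalar:
  assumes "set us \<subseteq> carrier R" "set ws \<subseteq> carrier R" "T \<in> linK" "\<not> scalar T"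
    and "\<And>u. u \<in> set us \<Longrightarrow> \<exists>n. scalar ((ad u ^^ n) T)"
    and "\<And>w. w \<in> set ws \<Longrightarrow> scalar (ad w T)"
  shows "\<exists>S \<in> linK. \<not> scalar S \<and> (\<forall>u \<in> set us \<union> set ws. scalar (ad u S))"
  using assms
proof (induction us arbitrary: ws T)
  case (Cons u us)
  then have u: "u \<in> carrier R" by simp
  define n where "n = (LEAST n. scalar ((ad u ^^ n) T))"
  have n: "scalar ((ad u ^^ n) T)" unfolding n_def using Cons.prems(5)[of u] by (auto intro: LeastI)
  then have "n \<noteq> 0" using Cons.prems(4) by (intro notI) simp
  then obtain m where m: "n = Suc m" by (cases n) auto
  define S where "S = (ad u ^^ m) T"
  have S: "S \<in> linK" unfolding S_def using Cons.prems u by (intro ad_pow_linK) auto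
  have nS: "\<not> scalar S" using not_less_Least[of m "\<lambda>n. scalar ((ad u ^^ n) T)"] m unfolding S_def n_def by simp
  have 1: "scalar (ad u S)" using n unfolding m S_def by simp
  have 2: "scalar (ad w S)" if w: "w \<in> set ws" for w
  proof -
    have wC: "w \<in> carrier R" using w Cons.prems by auto
    have "scalar ((ad u ^^ m) (ad w T))" using Cons.prems(6)[OF w] u by (rule scalar_ad_pow)
    then show ?thesis unfolding S_def
      using ad_pow_commute[OF Cons.prems(3) u wC] scalar_cong[of "(ad u ^^ m) (ad w T)"] by simp
  qed
  have 3: "\<exists>n. scalar ((ad u' ^^ n) S)" if u': "u' \<in> set us" for u'
  proof -
    have uC: "u' \<in> carrier R" using u' Cons.prems by auto
    obtain j where "scalar ((ad u' ^^ j) T)" using Cons.prems(5)[of u'] u' by auto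
    then have "scalar ((ad u ^^ m) ((ad u' ^^ j) T))" using u by (rule scalar_ad_pow)
    then have "scalar ((ad u' ^^ j) S)" unfolding S_def
      using ad_pow_pow_commute[OF Cons.prems(3) u uC, of _ m j] scalar_cong[of "(ad u ^^ m) ((ad u' ^^ j) T)"] by simp
    then show ?thesis ..
  qed
  have "\<exists>S' \<in> linK. \<not> scalar S' \<and> (\<forall>v \<in> set us \<union> set (u # ws). scalar (ad v S'))"
    using Cons.prems(1,2) S nS 1 2 3 by (intro Cons.IH) auto
  then show ?case by auto
qed auto

text \<open>
  A functional that is annihilated by powers of all \<open>ad x\<close> is a differential operator from \<open>R\<close> to
  the residue field; if it is not a multiple of \<open>\<pi>\<close>, iterated commutators lead to one of order 1.
\<close>

lemma derivation_if_ad_nilpotent: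
  assumes us: "set us \<subseteq> carrier R" "Span F us = carrier R" and T: "T \<in> linK" "\<not> scalar T"
    and nil: "\<And>u. u \<in> set us \<Longrightarrow> \<exists>n. scalar ((ad u ^^ n) T)"
  shows "\<exists>D \<in> derK. \<exists>a \<in> carrier R. D a \<noteq> \<zero>\<^bsub>k\<^esub>"
proof -
  obtain S where S: "S \<in> linK" "\<not> scalar S" "\<And>u. u \<in> set us \<Longrightarrow> scalar (ad u S)"
    using last_nonscalar[OF us(1) _ T nil, of "[]"] by auto
  note Sc = linKD(1)[OF S(1)]
  have S1: "S \<one> \<in> carrier k" using Sc by simp
  \<comment> \<open>Removal of the order-0 part, so that D vanishes at 1.\<close>
  define D where "D v = S v \<ominus>\<^bsub>k\<^esub> S \<one> \<otimes>\<^bsub>k\<^esub> \<pi> v" for v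
  have Dl: "D \<in> linK"
    by (rule linK_comb[OF S(1) pi_linK, where c = "\<ominus>\<^bsub>k\<^esub> S \<one>"]) (use S1 Sc in \<open>auto simp: D_def k.minus_eq k.l_minus\<close>)
  note Dc = linKD(1)[OF Dl]
  have ne: "\<exists>a \<in> carrier R. D a \<noteq> \<zero>\<^bsub>k\<^esub>"
  proof (rule ccontr)
    assume "\<not> ?thesis"
    then have z: "S v \<ominus>\<^bsub>k\<^esub> S \<one> \<otimes>\<^bsub>k\<^esub> \<pi> v = \<zero>\<^bsub>k\<^esub>" if "v \<in> carrier R" for v
      using that unfolding D_def by blast
    have "S v = S \<one> \<otimes>\<^bsub>k\<^esub> \<pi> v" if "v \<in> carrier R" for v
      using z[OF that] Sc[OF that] S1 that k.r_right_minus_eq[of "S v" "S \<one> \<otimes>\<^bsub>k\<^esub> \<pi> v"] by simp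
    then show False using S(2) S1 unfolding scalar_def by blast
  qed
  \<comment> \<open>The product rule is available for generators only. With v universally
    quantified, the x satisfying it form an F-subspace.\<close>
  define L where "L = {x \<in> carrier R. \<forall>v \<in> carrier R. D (x \<otimes> v) = \<pi> x \<otimes>\<^bsub>k\<^esub> D v \<oplus>\<^bsub>k\<^esub> \<pi> v \<otimes>\<^bsub>k\<^esub> D x}"
  have D0: "D \<zero> = \<zero>\<^bsub>k\<^esub>"
    using linKD(3)[OF Dl, of \<zero> \<zero>] Dc[of \<zero>] subringE(2)[OF subfieldE(1)[OF sf]] by simp
  have Dm: "D (\<ominus> x) = \<ominus>\<^bsub>k\<^esub> D x" if "x \<in> carrier R" for x
  proof -
    have "D x \<oplus>\<^bsub>k\<^esub> D (\<ominus> x) = \<zero>\<^bsub>k\<^esub>" using linKD(2)[OF Dl, of x "\<ominus> x"] that D0 by (simp add: r_neg)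
    then show ?thesis using Dc that by (simp add: k.sum_zero_eq_neg k.a_comm)
  qed
  have "subalgebra F L R"
    unfolding subalgebra_def subalgebra_axioms_def
  proof (intro conjI allI impI add.subgroupI)
    show "L \<subseteq> carrier R" by (auto simp: L_def)
    show "L \<noteq> {}" using D0 Dc by (auto simp: L_def intro!: exI[of _ \<zero>])
    fix x assume x: "x \<in> L"
    then have xC: "x \<in> carrier R" by (simp add: L_def)
    show "\<ominus> x \<in> L" unfolding L_def
    proof (intro CollectI conjI ballI)
      fix v assume v: "v \<in> carrier R"
      have e: "\<ominus> x \<otimes> v = \<ominus> (x \<otimes> v)" using xC v by (simp add: l_minus)
      have c: "D v \<in> carrier k" "D x \<in> carrier k" "\<pi> x \<in> carrier k" "\<pi> v \<in> carrier k" using xC v Dc by auto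
      have Dxv: "D (x \<otimes> v) = \<pi> x \<otimes>\<^bsub>k\<^esub> D v \<oplus>\<^bsub>k\<^esub> \<pi> v \<otimes>\<^bsub>k\<^esub> D x" using x v by (simp add: L_def)
      have p: "\<pi> (\<ominus> x) = \<ominus>\<^bsub>k\<^esub> \<pi> x" using xC by simp
      show "D (\<ominus> x \<otimes> v) = \<pi> (\<ominus> x) \<otimes>\<^bsub>k\<^esub> D v \<oplus>\<^bsub>k\<^esub> \<pi> v \<otimes>\<^bsub>k\<^esub> D (\<ominus> x)"
        unfolding e Dm[OF m_closed[OF xC v]] Dm[OF xC] Dxv p using c by algebra
    qed (use xC in simp)
    fix y assume y: "y \<in> L"
    then have yC: "y \<in> carrier R" by (simp add: L_def)
    show "x \<oplus> y \<in> L" unfolding L_def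
    proof (intro CollectI conjI ballI)
      fix v assume v: "v \<in> carrier R"
      have e: "(x \<oplus> y) \<otimes> v = x \<otimes> v \<oplus> y \<otimes> v" using xC yC v by (simp add: l_distr)
      have c: "D v \<in> carrier k" "D x \<in> carrier k" "D y \<in> carrier k" "\<pi> x \<in> carrier k" "\<pi> y \<in> carrier k" "\<pi> v \<in> carrier k"
        using xC yC v Dc by auto
      have Dxv: "D (x \<otimes> v) = \<pi> x \<otimes>\<^bsub>k\<^esub> D v \<oplus>\<^bsub>k\<^esub> \<pi> v \<otimes>\<^bsub>k\<^esub> D x" "D (y \<otimes> v) = \<pi> y \<otimes>\<^bsub>k\<^esub> D v \<oplus>\<^bsub>k\<^esub> \<pi> v \<otimes>\<^bsub>k\<^esub> D y"
        using x y v by (auto simp: L_def)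
      have p: "\<pi> (x \<oplus> y) = \<pi> x \<oplus>\<^bsub>k\<^esub> \<pi> y" using xC yC by simp
      show "D ((x \<oplus> y) \<otimes> v) = \<pi> (x \<oplus> y) \<otimes>\<^bsub>k\<^esub> D v \<oplus>\<^bsub>k\<^esub> \<pi> v \<otimes>\<^bsub>k\<^esub> D (x \<oplus> y)"
        unfolding e linKD(2)[OF Dl m_closed[OF xC v] m_closed[OF yC v]] linKD(2)[OF Dl xC yC] Dxv p using c by algebra
    qed (use xC yC in simp)
  next
    fix d x assume d: "d \<in> F" and x: "x \<in> L"
    then have xC: "x \<in> carrier R" and dC: "d \<in> carrier R" using FC by (auto simp: L_def)
    show "d \<otimes> x \<in> L" unfolding L_def
    proof (intro CollectI conjI ballI)
      fix v assume v: "v \<in> carrier R"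
      have e: "(d \<otimes> x) \<otimes> v = d \<otimes> (x \<otimes> v)" using xC dC v by (simp add: m_assoc)
      have c: "D v \<in> carrier k" "D x \<in> carrier k" "\<pi> d \<in> carrier k" "\<pi> x \<in> carrier k" "\<pi> v \<in> carrier k"
        using xC dC v Dc by auto
      have Dxv: "D (x \<otimes> v) = \<pi> x \<otimes>\<^bsub>k\<^esub> D v \<oplus>\<^bsub>k\<^esub> \<pi> v \<otimes>\<^bsub>k\<^esub> D x" using x v by (auto simp: L_def)
      have p: "\<pi> (d \<otimes> x) = \<pi> d \<otimes>\<^bsub>k\<^esub> \<pi> x" using xC dC by simp
      show "D ((d \<otimes> x) \<otimes> v) = \<pi> (d \<otimes> x) \<otimes>\<^bsub>k\<^esub> D v \<oplus>\<^bsub>k\<^esub> \<pi> v \<otimes>\<^bsub>k\<^esub> D (d \<otimes> x)"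
        unfolding e linKD(3)[OF Dl d m_closed[OF xC v]] linKD(3)[OF Dl d xC] Dxv p using c by algebra
    qed (use xC dC in simp)
  qed
  moreover have "set us \<subseteq> L"
  proof
    fix u assume u: "u \<in> set us"
    then have uC: "u \<in> carrier R" using us by auto
    obtain c where c: "c \<in> carrier k" "\<And>v. v \<in> carrier R \<Longrightarrow> ad u S v = c \<otimes>\<^bsub>k\<^esub> \<pi> v"
      using S(3)[OF u] unfolding scalar_def by blast
    have cc: "S u \<in> carrier k" "\<pi> u \<in> carrier k" using Sc uC by auto
    \<comment> \<open>Evaluation at 1 identifies the scalar as minus the value of D at u.\<close>
    have "c = ad u S \<one>" using c by simp
    then have ce: "c = \<pi> u \<otimes>\<^bsub>k\<^esub> S \<one> \<ominus>\<^bsub>k\<^esub> S u" unfolding ad_def using uC by simp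
    show "u \<in> L" unfolding L_def
    proof (intro CollectI conjI ballI uC)
      fix v assume v: "v \<in> carrier R"
      have c': "S v \<in> carrier k" "\<pi> v \<in> carrier k" "S (u \<otimes> v) \<in> carrier k" using Sc v uC by auto
      have "S (u \<otimes> v) = \<pi> u \<otimes>\<^bsub>k\<^esub> S v \<ominus>\<^bsub>k\<^esub> ad u S v" unfolding ad_def using c' cc by algebra
      then have Suv: "S (u \<otimes> v) = \<pi> u \<otimes>\<^bsub>k\<^esub> S v \<ominus>\<^bsub>k\<^esub> (\<pi> u \<otimes>\<^bsub>k\<^esub> S \<one> \<ominus>\<^bsub>k\<^esub> S u) \<otimes>\<^bsub>k\<^esub> \<pi> v"
        unfolding c(2)[OF v] ce .
      have p: "\<pi> (u \<otimes> v) = \<pi> u \<otimes>\<^bsub>k\<^esub> \<pi> v" using uC v by simp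
      show "D (u \<otimes> v) = \<pi> u \<otimes>\<^bsub>k\<^esub> D v \<oplus>\<^bsub>k\<^esub> \<pi> v \<otimes>\<^bsub>k\<^esub> D u"
        unfolding D_def Suv p using c' cc S1 by algebra
    qed
  qed
  ultimately have "carrier R \<subseteq> L" using subalgebra_Span_incl[OF sf] us(2) by blast
  then have "D \<in> derK" using Dl unfolding derK_def L_def by auto
  then show ?thesis using ne by blast
qed

text \<open>A polynomial in the operator \<open>ad u\<close>, applied to T; the constant coefficient
  comes first.\<close>

fun horner :: "'a \<Rightarrow> 'b list \<Rightarrow> ('a \<Rightarrow> 'b) \<Rightarrow> 'a \<Rightarrow> 'b" where
  "horner u [] T v = \<zero>\<^bsub>k\<^esub>"
| "horner u (c # cs) T v = c \<otimes>\<^bsub>k\<^esub> T v \<oplus>\<^bsub>k\<^esub> ad u (horner u cs T) v"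

context
  fixes u assumes u: "u \<in> carrier R"
begin

text \<open>Induction over polynomials in \<open>ad u\<close>: a set of functionals stable under
  \<open>ad u\<close> and under combinations contains them all.\<close>

lemma horner_invariant:
  assumes "\<And>S. S \<in> Z \<Longrightarrow> ad u S \<in> Z"
    and "\<And>S S' c Q. S \<in> Z \<Longrightarrow> S' \<in> Z \<Longrightarrow> c \<in> carrier k \<Longrightarrow> (\<And>v. Q v = c \<otimes>\<^bsub>k\<^esub> S v \<oplus>\<^bsub>k\<^esub> S' v) \<Longrightarrow> Q \<in> Z"
    and "(\<lambda>_. \<zero>\<^bsub>k\<^esub>) \<in> Z"
    and "T \<in> Z" "set cs \<subseteq> carrier k"
  shows "horner u cs T \<in> Z"
  using assms(5)
proof (induction cs)
  case Nil
  have "horner u [] T = (\<lambda>_. \<zero>\<^bsub>k\<^esub>)" by auto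
  then show ?case using assms(3) by simp
next
  case (Cons c cs)
  have "ad u (horner u cs T) \<in> Z" "c \<in> carrier k" using Cons assms(1) by auto
  from assms(2)[OF assms(4) this] show ?case by simp
qed

lemma horner_linK: "T \<in> linK \<Longrightarrow> set cs \<subseteq> carrier k \<Longrightarrow> horner u cs T \<in> linK"
proof (rule horner_invariant)
  fix S S' Q c assume a: "S \<in> linK" "S' \<in> linK" "c \<in> carrier k" "\<And>v. Q v = c \<otimes>\<^bsub>k\<^esub> S v \<oplus>\<^bsub>k\<^esub> S' v"
  show "Q \<in> linK" using linKD(1)[OF a(1)] linKD(1)[OF a(2)] a
    by (intro linK_comb[OF a(2,1,3)]) (auto simp: k.a_comm)
qed (auto intro: ad_linK u linK_zero)

lemma horner_snoc:
  assumes "T \<in> linK" "set cs \<subseteq> carrier k" "c \<in> carrier k" "v \<in> carrier R"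
  shows "horner u (cs @ [c]) T v = horner u cs T v \<oplus>\<^bsub>k\<^esub> c \<otimes>\<^bsub>k\<^esub> (ad u ^^ length cs) T v"
  using assms(2,4)
proof (induction cs arbitrary: v)
  case Nil
  then show ?case using assms linKD(1)[OF assms(1)] u by (simp add: ad_def k.minus_eq)
next
  case (Cons d cs)
  have l: "horner u cs T \<in> linK" "(ad u ^^ length cs) T \<in> linK"
    using Cons assms horner_linK ad_pow_linK u by auto
  have "ad u (horner u (cs @ [c]) T) v
      = ad u (\<lambda>v. horner u cs T v \<oplus>\<^bsub>k\<^esub> c \<otimes>\<^bsub>k\<^esub> (ad u ^^ length cs) T v) v"
    using Cons u by (intro ad_cong) auto
  also have "\<dots> = ad u (horner u cs T) v \<oplus>\<^bsub>k\<^esub> c \<otimes>\<^bsub>k\<^esub> ad u ((ad u ^^ length cs) T) v"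
  proof -
    have uv: "u \<otimes> v \<in> carrier R" using u Cons by simp
    have cc: "horner u cs T v \<in> carrier k" "horner u cs T (u \<otimes> v) \<in> carrier k"
      "(ad u ^^ length cs) T v \<in> carrier k" "(ad u ^^ length cs) T (u \<otimes> v) \<in> carrier k" "\<pi> u \<in> carrier k"
      using linKD(1)[OF l(1)] linKD(1)[OF l(2)] uv u Cons by auto
    show ?thesis unfolding ad_def[of u "\<lambda>v. horner u cs T v \<oplus>\<^bsub>k\<^esub> c \<otimes>\<^bsub>k\<^esub> (ad u ^^ length cs) T v"]
        ad_def[of u "horner u cs T"] ad_def[of u "(ad u ^^ length cs) T"]
      using cc assms(3) by algebra
  qed
  finally have e: "ad u (horner u (cs @ [c]) T) v = ad u (horner u cs T) v \<oplus>\<^bsub>k\<^esub> c \<otimes>\<^bsub>k\<^esub> ad u ((ad u ^^ length cs) T) v" .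
  have "d \<otimes>\<^bsub>k\<^esub> T v \<in> carrier k" "ad u (horner u cs T) v \<in> carrier k" "c \<otimes>\<^bsub>k\<^esub> ad u ((ad u ^^ length cs) T) v \<in> carrier k"
    using Cons.prems assms linKD(1)[OF assms(1)] ad_closed l u by auto
  then show ?case using e by (simp add: k.a_assoc)
qed

lemma horner_sum:
  assumes "T \<in> linK" "l \<in> {..<j} \<rightarrow> carrier k" "v \<in> carrier R"
  shows "horner u (map l [0..<j]) T v = (\<Oplus>\<^bsub>k\<^esub>i\<in>{..<j}. l i \<otimes>\<^bsub>k\<^esub> (ad u ^^ i) T v)"
  using assms(2)
proof (induction j)
  case (Suc j)
  have c: "(ad u ^^ i) T v \<in> carrier k" for i using ad_pow_linK[OF assms(1) u] linKD(1) assms(3) by blast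
  have "(\<Oplus>\<^bsub>k\<^esub>i\<in>{..<Suc j}. l i \<otimes>\<^bsub>k\<^esub> (ad u ^^ i) T v)
     = l j \<otimes>\<^bsub>k\<^esub> (ad u ^^ j) T v \<oplus>\<^bsub>k\<^esub> (\<Oplus>\<^bsub>k\<^esub>i\<in>{..<j}. l i \<otimes>\<^bsub>k\<^esub> (ad u ^^ i) T v)"
    unfolding lessThan_Suc using Suc.prems c by (subst k.finsum_insert) (auto simp: Pi_def)
  moreover have "(\<Oplus>\<^bsub>k\<^esub>i\<in>{..<j}. l i \<otimes>\<^bsub>k\<^esub> (ad u ^^ i) T v) \<in> carrier k"
    using Suc.prems c by (intro k.finsum_closed) (auto simp: Pi_def)
  moreover have "horner u (map l [0..<Suc j]) T v
      = horner u (map l [0..<j]) T v \<oplus>\<^bsub>k\<^esub> l j \<otimes>\<^bsub>k\<^esub> (ad u ^^ j) T v"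
    using Suc.prems horner_snoc[OF assms(1) _ _ assms(3), of "map l [0..<j]" "l j"] by (auto simp: Pi_def image_subset_iff)
  ultimately show ?case using Suc c by (simp add: k.a_comm Pi_def)
qed simp

lemma horner_scale:
  assumes "T \<in> linK" "set cs \<subseteq> carrier k" "c \<in> carrier k" "v \<in> carrier R"
  shows "horner u (map ((\<otimes>\<^bsub>k\<^esub>) c) cs) T v = c \<otimes>\<^bsub>k\<^esub> horner u cs T v"
  using assms(2,4)
proof (induction cs arbitrary: v)
  case (Cons d cs)
  have l: "horner u cs T \<in> linK" using Cons assms horner_linK by auto
  have "ad u (horner u (map ((\<otimes>\<^bsub>k\<^esub>) c) cs) T) v = ad u (\<lambda>v. c \<otimes>\<^bsub>k\<^esub> horner u cs T v) v"
    using Cons u by (intro ad_cong) auto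
  also have "\<dots> = c \<otimes>\<^bsub>k\<^esub> ad u (horner u cs T) v"
  proof -
    have cc: "horner u cs T v \<in> carrier k" "horner u cs T (u \<otimes> v) \<in> carrier k" "\<pi> u \<in> carrier k"
      using linKD(1)[OF l] u Cons by auto
    show ?thesis unfolding ad_def[of u "\<lambda>v. c \<otimes>\<^bsub>k\<^esub> horner u cs T v"] ad_def[of u "horner u cs T"]
      using cc assms(3) by algebra
  qed
  finally have e: "ad u (horner u (map ((\<otimes>\<^bsub>k\<^esub>) c) cs) T) v = c \<otimes>\<^bsub>k\<^esub> ad u (horner u cs T) v" .
  have cc: "d \<in> carrier k" "T v \<in> carrier k" "ad u (horner u cs T) v \<in> carrier k"
    using Cons.prems linKD(1)[OF assms(1)] ad_closed[OF l u] by auto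
  show ?case unfolding list.map horner.simps e using cc assms(3) by algebra
qed (use assms in auto)

text \<open>Leading zeros of the coefficient list are traded for powers of \<open>ad u\<close>, and
  the first nonzero coefficient is divided out.\<close>

lemma horner_normalize:
  assumes T: "T \<in> linK" and "set rs \<subseteq> carrier k" "\<not> set rs \<subseteq> {\<zero>\<^bsub>k\<^esub>}"
    and "\<And>v. v \<in> carrier R \<Longrightarrow> (ad u ^^ n) (horner u rs T) v = \<zero>\<^bsub>k\<^esub>"
  shows "\<exists>cs n. set cs \<subseteq> carrier k \<and> (\<forall>v \<in> carrier R. (ad u ^^ n) (horner u (\<one>\<^bsub>k\<^esub> # cs) T) v = \<zero>\<^bsub>k\<^esub>)"
  using assms(2-4)
proof (induction rs arbitrary: n)
  case (Cons r rs)
  show ?case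
  proof (cases "r = \<zero>\<^bsub>k\<^esub>")
    case True
    have l: "horner u rs T \<in> linK" using Cons horner_linK T by auto
    have e: "horner u (r # rs) T v = ad u (horner u rs T) v" if "v \<in> carrier R" for v
      using True linKD(1)[OF T that] ad_closed[OF l u that] by simp
    have "(ad u ^^ Suc n) (horner u rs T) v = \<zero>\<^bsub>k\<^esub>" if "v \<in> carrier R" for v
    proof -
      have "(ad u ^^ n) (ad u (horner u rs T)) v = (ad u ^^ n) (horner u (r # rs) T) v"
        using e u that by (intro ad_pow_cong) auto
      then show ?thesis using Cons.prems(3)[OF that] by (simp add: funpow_swap1)
    qed
    then show ?thesis using Cons.prems True by (intro Cons.IH[of "Suc n"]) auto
  next
    case False
    have r: "r \<in> carrier k" "r \<in> Units k" using Cons.prems False by (auto simp: k.field_Units)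
    let ?cs = "map ((\<otimes>\<^bsub>k\<^esub>) (inv\<^bsub>k\<^esub> r)) rs"
    have cs: "set ?cs \<subseteq> carrier k" using Cons.prems r by auto
    have e: "horner u (\<one>\<^bsub>k\<^esub> # ?cs) T v = inv\<^bsub>k\<^esub> r \<otimes>\<^bsub>k\<^esub> horner u (r # rs) T v" if "v \<in> carrier R" for v
      using horner_scale[OF T Cons.prems(1), of "inv\<^bsub>k\<^esub> r" v] r that by simp
    have l: "horner u (r # rs) T \<in> linK" using Cons.prems horner_linK T by auto
    have "(ad u ^^ n) (horner u (\<one>\<^bsub>k\<^esub> # ?cs) T) v = \<zero>\<^bsub>k\<^esub>" if v: "v \<in> carrier R" for v
    proof -
      have "(ad u ^^ n) (horner u (\<one>\<^bsub>k\<^esub> # ?cs) T) v = (ad u ^^ n) (\<lambda>v. inv\<^bsub>k\<^esub> r \<otimes>\<^bsub>k\<^esub> horner u (r # rs) T v) v"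
        using e u v by (intro ad_pow_cong) auto
      also have "\<dots> = inv\<^bsub>k\<^esub> r \<otimes>\<^bsub>k\<^esub> (ad u ^^ n) (horner u (r # rs) T) v"
        using v
      proof (induction n arbitrary: v)
        case (Suc n)
        have l': "(ad u ^^ n) (horner u (r # rs) T) \<in> linK" using l u by (rule ad_pow_linK)
        have "ad u ((ad u ^^ n) (\<lambda>v. inv\<^bsub>k\<^esub> r \<otimes>\<^bsub>k\<^esub> horner u (r # rs) T v)) v
           = ad u (\<lambda>v. inv\<^bsub>k\<^esub> r \<otimes>\<^bsub>k\<^esub> (ad u ^^ n) (horner u (r # rs) T) v) v"
          by (rule ad_cong) (use Suc.IH u Suc.prems in blast)+
        also have "\<dots> = inv\<^bsub>k\<^esub> r \<otimes>\<^bsub>k\<^esub> ad u ((ad u ^^ n) (horner u (r # rs) T)) v"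
        proof -
          define Q where "Q = (ad u ^^ n) (horner u (r # rs) T)"
          have cc: "Q v \<in> carrier k" "Q (u \<otimes> v) \<in> carrier k" "\<pi> u \<in> carrier k" "inv\<^bsub>k\<^esub> r \<in> carrier k"
            using linKD(1)[OF l'] u r Suc.prems unfolding Q_def by auto
          have "ad u (\<lambda>v. inv\<^bsub>k\<^esub> r \<otimes>\<^bsub>k\<^esub> Q v) v = inv\<^bsub>k\<^esub> r \<otimes>\<^bsub>k\<^esub> ad u Q v"
            unfolding ad_def using cc by algebra
          then show ?thesis unfolding Q_def .
        qed
        finally show ?case unfolding funpow.simps o_apply .
      qed simp
      also have "\<dots> = \<zero>\<^bsub>k\<^esub>" unfolding Cons.prems(3)[OF v] using r by simp
      finally show ?thesis .
    qed
    then show ?thesis using cs by blast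
  qed
qed simp

text \<open>The iterates of \<open>ad u\<close> on T satisfy a linear relation, for interpolation
  would turn too many independent functionals into too many independent elements of R.\<close>

lemma ad_power_relation:
  assumes T: "T \<in> linK"
  shows "\<exists>cs n. set cs \<subseteq> carrier k \<and> (\<forall>v \<in> carrier R. (ad u ^^ n) (horner u (\<one>\<^bsub>k\<^esub> # cs) T) v = \<zero>\<^bsub>k\<^esub>)"
proof -
  define N where "N = Suc ((dim over F) (carrier R))"
  have "\<exists>j<N. \<exists>l \<in> {..<j} \<rightarrow> carrier k. \<forall>x \<in> carrier R. (ad u ^^ j) T x = (\<Oplus>\<^bsub>k\<^esub>i\<in>{..<j}. l i \<otimes>\<^bsub>k\<^esub> (ad u ^^ i) T x)"
  proof (rule ccontr)
    assume contra: "\<not> ?thesis"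
    have "\<exists>us. length us = N \<and> independent F us \<and>
      (\<forall>\<psi> \<in> linK. \<exists>l \<in> {..<N} \<rightarrow> carrier k. \<forall>w \<in> set us. \<psi> w = (\<Oplus>\<^bsub>k\<^esub>i\<in>{..<N}. l i \<otimes>\<^bsub>k\<^esub> (ad u ^^ i) T w))"
    proof (rule linK_interpolate)
      show "(ad u ^^ i) T \<in> linK" for i using T u by (rule ad_pow_linK)
    qed (use contra in blast)
    then show False using independent_bound unfolding N_def by fastforce
  qed
  then obtain j l where l: "l \<in> {..<j} \<rightarrow> carrier k"
    "\<And>x. x \<in> carrier R \<Longrightarrow> (ad u ^^ j) T x = (\<Oplus>\<^bsub>k\<^esub>i\<in>{..<j}. l i \<otimes>\<^bsub>k\<^esub> (ad u ^^ i) T x)" by blast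
  \<comment> \<open>The final coefficient -1 ensures that the polynomial is not zero.\<close>
  let ?rs = "map l [0..<j] @ [\<ominus>\<^bsub>k\<^esub> \<one>\<^bsub>k\<^esub>]"
  have lc: "set (map l [0..<j]) \<subseteq> carrier k" using l(1) by auto
  have "(ad u ^^ 0) (horner u ?rs T) v = \<zero>\<^bsub>k\<^esub>" if v: "v \<in> carrier R" for v
  proof -
    have c: "(ad u ^^ j) T v \<in> carrier k" using ad_pow_linK[OF T u] linKD(1) v by blast
    have "horner u ?rs T v = horner u (map l [0..<j]) T v \<oplus>\<^bsub>k\<^esub> (\<ominus>\<^bsub>k\<^esub> \<one>\<^bsub>k\<^esub>) \<otimes>\<^bsub>k\<^esub> (ad u ^^ j) T v"
      using horner_snoc[OF T lc _ v, of "\<ominus>\<^bsub>k\<^esub> \<one>\<^bsub>k\<^esub>"] by simp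
    also have "horner u (map l [0..<j]) T v = (ad u ^^ j) T v"
      using horner_sum[OF T l(1) v] l(2)[OF v] by simp
    finally show ?thesis using c by (simp add: k.l_minus k.r_neg)
  qed
  moreover have "set ?rs \<subseteq> carrier k" using lc by simp
  moreover have "\<ominus>\<^bsub>k\<^esub> \<one>\<^bsub>k\<^esub> \<noteq> \<zero>\<^bsub>k\<^esub>" using one_k k.l_neg[of "\<one>\<^bsub>k\<^esub>"] by auto
  ultimately show ?thesis using horner_normalize[OF T, of ?rs 0] by simp
qed

end

text \<open>
  Fitting's lemma for the commuting operators \<open>ad x\<close>: a functional can be corrected by a
  polynomial in \<open>ad x\<close> with constant term 1 such that a power of \<open>ad x\<close> annihilates it. Functionals
  that are \<open>R\<close>-linear on the ideal generated by \<open>t\<close> keep their values there.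
\<close>

lemma fitting:
  assumes t: "t \<in> carrier R" and "set us \<subseteq> carrier R" "T \<in> linK" "\<And>r. r \<in> carrier R \<Longrightarrow> T (r \<otimes> t) = \<pi> r"
  shows "\<exists>S \<in> linK. (\<forall>r \<in> carrier R. S (r \<otimes> t) = \<pi> r) \<and>
    (\<forall>u \<in> set us. \<exists>n. \<forall>v \<in> carrier R. (ad u ^^ n) S v = \<zero>\<^bsub>k\<^esub>)"
  using assms(2-4)
proof (induction us)
  case (Cons u us)
  then obtain S where S: "S \<in> linK" "\<And>r. r \<in> carrier R \<Longrightarrow> S (r \<otimes> t) = \<pi> r"
    "\<And>u. u \<in> set us \<Longrightarrow> \<exists>n. \<forall>v \<in> carrier R. (ad u ^^ n) S v = \<zero>\<^bsub>k\<^esub>" by auto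
  have u: "u \<in> carrier R" using Cons.prems by simp
  obtain cs n where cs: "set cs \<subseteq> carrier k" "\<And>v. v \<in> carrier R \<Longrightarrow> (ad u ^^ n) (horner u (\<one>\<^bsub>k\<^esub> # cs) S) v = \<zero>\<^bsub>k\<^esub>"
    using ad_power_relation[OF u S(1)] by blast
  define S' where "S' = horner u (\<one>\<^bsub>k\<^esub> # cs) S"
  have cs1: "set (\<one>\<^bsub>k\<^esub> # cs) \<subseteq> carrier k" using cs by simp
  have S'l: "S' \<in> linK" unfolding S'_def using horner_linK[OF u S(1) cs1] .
  \<comment> \<open>On the ideal of t these functionals are multiples of \<pi>, so their commutators
    vanish there; only the constant coefficient 1 influences the values on that ideal.\<close>
  define Z where "Z = {Q \<in> linK. \<exists>c \<in> carrier k. \<forall>r \<in> carrier R. Q (r \<otimes> t) = c \<otimes>\<^bsub>k\<^esub> \<pi> r}"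
  have adZ: "ad u Q (r \<otimes> t) = \<zero>\<^bsub>k\<^esub>" if Q: "Q \<in> Z" and r: "r \<in> carrier R" for Q r
  proof -
    obtain c where c: "c \<in> carrier k" "\<And>r. r \<in> carrier R \<Longrightarrow> Q (r \<otimes> t) = c \<otimes>\<^bsub>k\<^esub> \<pi> r" using Q unfolding Z_def by blast
    have e: "Q (u \<otimes> (r \<otimes> t)) = c \<otimes>\<^bsub>k\<^esub> (\<pi> u \<otimes>\<^bsub>k\<^esub> \<pi> r)"
      using c(2)[of "u \<otimes> r"] u r t by (simp add: m_assoc)
    have cc: "\<pi> u \<in> carrier k" "\<pi> r \<in> carrier k" using u r by auto
    show ?thesis unfolding ad_def e c(2)[OF r] using c(1) cc by algebra
  qed
  have "horner u cs S \<in> Z"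
  proof (rule horner_invariant[OF u _ _ _ _ cs(1)])
    show "ad u Q \<in> Z" if "Q \<in> Z" for Q
      using adZ[OF that] that ad_linK u unfolding Z_def by (auto intro!: bexI[of _ "\<zero>\<^bsub>k\<^esub>"])
    show "S \<in> Z" unfolding Z_def using S by (auto intro!: bexI[of _ "\<one>\<^bsub>k\<^esub>"])
    show "(\<lambda>_. \<zero>\<^bsub>k\<^esub>) \<in> Z" unfolding Z_def using linK_zero by (auto intro!: bexI[of _ "\<zero>\<^bsub>k\<^esub>"])
    fix A B c Q assume a: "A \<in> Z" "B \<in> Z" "c \<in> carrier k" "\<And>v. Q v = c \<otimes>\<^bsub>k\<^esub> A v \<oplus>\<^bsub>k\<^esub> B v"
    obtain d where d: "d \<in> carrier k" "\<And>r. r \<in> carrier R \<Longrightarrow> A (r \<otimes> t) = d \<otimes>\<^bsub>k\<^esub> \<pi> r" using a(1) unfolding Z_def by blast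
    obtain e where e: "e \<in> carrier k" "\<And>r. r \<in> carrier R \<Longrightarrow> B (r \<otimes> t) = e \<otimes>\<^bsub>k\<^esub> \<pi> r" using a(2) unfolding Z_def by blast
    have AB: "A \<in> linK" "B \<in> linK" using a unfolding Z_def by auto
    have "Q \<in> linK" using linKD(1)[OF AB(1)] linKD(1)[OF AB(2)] a
      by (intro linK_comb[OF AB(2,1) a(3)]) (auto simp: k.a_comm)
    moreover have "Q (r \<otimes> t) = (c \<otimes>\<^bsub>k\<^esub> d \<oplus>\<^bsub>k\<^esub> e) \<otimes>\<^bsub>k\<^esub> \<pi> r" if r: "r \<in> carrier R" for r
    proof -
      have "\<pi> r \<in> carrier k" using r by simp
      then show ?thesis unfolding a(4) d(2)[OF r] e(2)[OF r] using a(3) d(1) e(1) by algebra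
    qed
    ultimately show "Q \<in> Z" unfolding Z_def using a(3) d(1) e(1) by blast
  qed
  then have 1: "S' (r \<otimes> t) = \<pi> r" if "r \<in> carrier R" for r
    unfolding S'_def using adZ[OF _ that] S(2)[OF that] that by simp
  have 2: "\<exists>n. \<forall>v \<in> carrier R. (ad w ^^ n) S' v = \<zero>\<^bsub>k\<^esub>" if w: "w \<in> set us" for w
  proof -
    have wC: "w \<in> carrier R" using w Cons.prems by auto
    obtain m where m: "\<forall>v \<in> carrier R. (ad w ^^ m) S v = \<zero>\<^bsub>k\<^esub>" using S(3)[OF w] by blast
    \<comment> \<open>A polynomial in \<open>ad u\<close> commutes with \<open>ad w\<close> and
      therefore preserves what has been achieved for w.\<close>
    define Y where "Y = {Q \<in> linK. \<forall>v \<in> carrier R. (ad w ^^ m) Q v = \<zero>\<^bsub>k\<^esub>}"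
    have zero: "(ad w ^^ i) (\<lambda>_. \<zero>\<^bsub>k\<^esub>) v = \<zero>\<^bsub>k\<^esub>" if "v \<in> carrier R" for v i
      using that
    proof (induction i arbitrary: v)
      case (Suc i)
      then show ?case using wC by (simp add: ad_def k.minus_eq)
    qed simp
    have comb: "(ad w ^^ i) Q v = c \<otimes>\<^bsub>k\<^esub> (ad w ^^ i) A v \<oplus>\<^bsub>k\<^esub> (ad w ^^ i) B v"
      if "A \<in> linK" "B \<in> linK" "c \<in> carrier k" "\<And>v. Q v = c \<otimes>\<^bsub>k\<^esub> A v \<oplus>\<^bsub>k\<^esub> B v" "v \<in> carrier R" for A B Q c v i
      using that(5)
    proof (induction i arbitrary: v)
      case (Suc i)
      define A' B' where AB': "A' = (ad w ^^ i) A" "B' = (ad w ^^ i) B"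
      have l: "A' \<in> linK" "B' \<in> linK" unfolding AB' using that wC by (auto intro: ad_pow_linK)
      have wv: "w \<otimes> v \<in> carrier R" using wC Suc.prems by simp
      have cc: "A' v \<in> carrier k" "B' v \<in> carrier k" "A' (w \<otimes> v) \<in> carrier k" "B' (w \<otimes> v) \<in> carrier k" "\<pi> w \<in> carrier k"
        using linKD(1)[OF l(1)] linKD(1)[OF l(2)] wv wC Suc.prems by auto
      have "ad w ((ad w ^^ i) Q) v = ad w (\<lambda>v. c \<otimes>\<^bsub>k\<^esub> A' v \<oplus>\<^bsub>k\<^esub> B' v) v"
        using Suc wC unfolding AB' by (intro ad_cong) auto
      also have "\<dots> = c \<otimes>\<^bsub>k\<^esub> ad w A' v \<oplus>\<^bsub>k\<^esub> ad w B' v"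
        unfolding ad_def using cc that(3) by algebra
      finally show ?case unfolding AB' by simp
    qed (simp add: that)
    have "S' \<in> Y" unfolding S'_def
    proof (rule horner_invariant[OF u _ _ _ _ cs1])
      show "S \<in> Y" unfolding Y_def using S m by simp
      show "(\<lambda>_. \<zero>\<^bsub>k\<^esub>) \<in> Y" unfolding Y_def using linK_zero zero by simp
      show "ad u Q \<in> Y" if Q: "Q \<in> Y" for Q
      proof -
        have Ql: "Q \<in> linK" and Qz: "\<And>v. v \<in> carrier R \<Longrightarrow> (ad w ^^ m) Q v = \<zero>\<^bsub>k\<^esub>" using Q unfolding Y_def by auto
        have "(ad w ^^ m) (ad u Q) v = \<zero>\<^bsub>k\<^esub>" if v: "v \<in> carrier R" for v
        proof -
          have "(ad w ^^ m) (ad u Q) v = ad u ((ad w ^^ m) Q) v" using ad_pow_commute[OF Ql wC u v] .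
          also have "\<dots> = \<zero>\<^bsub>k\<^esub>"
            using Qz[OF v] Qz[of "u \<otimes> v"] u v by (simp add: ad_def[of u] k.minus_eq)
          finally show ?thesis .
        qed
        then show ?thesis unfolding Y_def using Ql u ad_linK by simp
      qed
      fix A B c Q assume a: "A \<in> Y" "B \<in> Y" "c \<in> carrier k" "\<And>v. Q v = c \<otimes>\<^bsub>k\<^esub> A v \<oplus>\<^bsub>k\<^esub> B v"
      have AB: "A \<in> linK" "B \<in> linK" using a unfolding Y_def by auto
      have "Q \<in> linK" using linKD(1)[OF AB(1)] linKD(1)[OF AB(2)] a
        by (intro linK_comb[OF AB(2,1) a(3)]) (auto simp: k.a_comm)
      moreover have "(ad w ^^ m) Q v = \<zero>\<^bsub>k\<^esub>" if "v \<in> carrier R" for v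
        using comb[OF AB a(3,4) that, of m] a(1,2,3) that unfolding Y_def by simp
      ultimately show "Q \<in> Y" unfolding Y_def by simp
    qed
    then show ?thesis unfolding Y_def by blast
  qed
  have "\<forall>w \<in> set (u # us). \<exists>n. \<forall>v \<in> carrier R. (ad w ^^ n) S' v = \<zero>\<^bsub>k\<^esub>"
    using 2 cs(2) unfolding S'_def by auto
  then show ?case using S'l 1 by blast
qed auto

text \<open>The functional r t -> \<pi> r on the ideal of a socle element t inside the maximal ideal
  is extended by a projection and made nilpotent under commutators by
  \<open>fitting\<close>.\<close>

lemma derivation_if_not_reduced:
  assumes y: "y \<in> carrier R" "y \<noteq> \<zero>" "\<pi> y = \<zero>\<^bsub>k\<^esub>"
  shows "\<exists>D \<in> derK. \<exists>a \<in> carrier R. D a \<noteq> \<zero>\<^bsub>k\<^esub>"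
proof -
  \<comment> \<open>Restricting to nonzero elements of the maximal ideal puts the socle element t
    into that ideal, so that \<pi> t = 0.\<close>
  define Q where "Q = {y \<in> carrier R. y \<noteq> \<zero> \<and> \<pi> y = \<zero>\<^bsub>k\<^esub>}"
  obtain t where t: "t \<in> Q" "\<forall>y \<in> carrier R. \<pi> y = \<zero>\<^bsub>k\<^esub> \<longrightarrow> y \<otimes> t \<notin> Q"
    using socle_element[of Q] y unfolding Q_def by blast
  have tC: "t \<in> carrier R" "t \<noteq> \<zero>" "\<pi> t = \<zero>\<^bsub>k\<^esub>" using t unfolding Q_def by auto
  have tann: "y \<otimes> t = \<zero>" if "y \<in> carrier R" "\<pi> y = \<zero>\<^bsub>k\<^esub>" for y
    using t(2) that tC unfolding Q_def by auto
  have wd: "\<pi> r = \<pi> r'" if "r \<in> carrier R" "r' \<in> carrier R" "r \<otimes> t = r' \<otimes> t" for r r'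
  proof (rule ccontr)
    assume "\<pi> r \<noteq> \<pi> r'"
    then have "r \<ominus> r' \<in> Units R" using that by (intro unit) (auto simp: minus_eq k.minus_eq[symmetric])
    moreover have "(r \<ominus> r') \<otimes> t = r \<otimes> t \<ominus> r' \<otimes> t" using that(1,2) tC(1) by algebra
    then have "(r \<ominus> r') \<otimes> t = \<zero>" using that tC by (simp add: minus_eq r_neg)
    ultimately show False using unit_mult_zero tC by blast
  qed
  have "\<exists>p. (\<forall>x \<in> carrier R. p x \<in> PIdl t) \<and> (\<forall>u \<in> PIdl t. p u = u) \<and>
      (\<forall>x \<in> carrier R. \<forall>y \<in> carrier R. p (x \<oplus> y) = p x \<oplus> p y) \<and>
      (\<forall>c \<in> F. \<forall>x \<in> carrier R. p (c \<otimes> x) = c \<otimes> p x)"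
    by (intro projection_exists sf fd ideal_is_subalgebra FC cgenideal_ideal tC(1))
  then obtain p where P: "(\<forall>x \<in> carrier R. p x \<in> PIdl t) \<and> (\<forall>u \<in> PIdl t. p u = u) \<and>
      (\<forall>x \<in> carrier R. \<forall>y \<in> carrier R. p (x \<oplus> y) = p x \<oplus> p y) \<and>
      (\<forall>c \<in> F. \<forall>x \<in> carrier R. p (c \<otimes> x) = c \<otimes> p x)" ..
  have p: "\<And>x. x \<in> carrier R \<Longrightarrow> p x \<in> PIdl t" "\<And>u. u \<in> PIdl t \<Longrightarrow> p u = u"
    "\<And>x y. x \<in> carrier R \<Longrightarrow> y \<in> carrier R \<Longrightarrow> p (x \<oplus> y) = p x \<oplus> p y"
    "\<And>c x. c \<in> F \<Longrightarrow> x \<in> carrier R \<Longrightarrow> p (c \<otimes> x) = c \<otimes> p x"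
    using P by simp_all
  \<comment> \<open>The coefficient is determined only modulo the maximal ideal; by
    \<open>wd\<close> its residue class does not depend on the choice.\<close>
  define co where "co z = (SOME r. r \<in> carrier R \<and> z = r \<otimes> t)" for z
  have co: "co z \<in> carrier R \<and> z = co z \<otimes> t" if "z \<in> PIdl t" for z
  proof -
    have "\<exists>r. r \<in> carrier R \<and> z = r \<otimes> t" using that unfolding cgenideal_def by auto
    from someI_ex[OF this] show ?thesis unfolding co_def .
  qed
  have \<tau>: "\<pi> (co z) = \<pi> r" if "z = r \<otimes> t" "r \<in> carrier R" for z r
  proof -
    have "z \<in> PIdl t" using that unfolding cgenideal_def by auto
    then have c: "co z \<in> carrier R" "z = co z \<otimes> t" using co by blast+
    then show ?thesis using wd[OF c(1) that(2)] that(1) by simp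
  qed
  define T where "T x = \<pi> (co (p x))" for x
  have "T \<in> linK"
  proof (rule linKI)
    fix x assume x: "x \<in> carrier R"
    note cx = co[OF p(1)[OF x]]
    show "T x \<in> carrier k" unfolding T_def using cx by simp
    show "T (x \<oplus> y) = T x \<oplus>\<^bsub>k\<^esub> T y" if y: "y \<in> carrier R" for y
    proof -
      note cy = co[OF p(1)[OF y]]
      have "p (x \<oplus> y) = co (p x) \<otimes> t \<oplus> co (p y) \<otimes> t" using p(3)[OF x y] cx cy by simp
      also have "\<dots> = (co (p x) \<oplus> co (p y)) \<otimes> t" using cx cy tC by (simp add: l_distr)
      finally show ?thesis unfolding T_def using \<tau>[of "p (x \<oplus> y)" "co (p x) \<oplus> co (p y)"] cx cy by simp
    qed
    show "T (c \<otimes> x) = \<pi> c \<otimes>\<^bsub>k\<^esub> T x" if c: "c \<in> F" for c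
    proof -
      have cC: "c \<in> carrier R" using c FC by auto
      have "p (c \<otimes> x) = c \<otimes> (co (p x) \<otimes> t)" using p(4)[OF c x] cx by simp
      also have "\<dots> = (c \<otimes> co (p x)) \<otimes> t" using cx tC cC by (simp add: m_assoc)
      finally show ?thesis unfolding T_def using \<tau>[of "p (c \<otimes> x)" "c \<otimes> co (p x)"] cx cC by simp
    qed
  qed
  moreover have "T (r \<otimes> t) = \<pi> r" if "r \<in> carrier R" for r
  proof -
    have "r \<otimes> t \<in> PIdl t" using that unfolding cgenideal_def by auto
    then show ?thesis unfolding T_def using p(2) \<tau>[of "r \<otimes> t" r] that by simp
  qed
  moreover obtain us where us: "set us \<subseteq> carrier R" "Span F us = carrier R"
    using exists_base[OF sf finite_dimensionE[OF sf fd]] by blast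
  ultimately obtain S where S: "S \<in> linK" "\<And>r. r \<in> carrier R \<Longrightarrow> S (r \<otimes> t) = \<pi> r"
    "\<And>u. u \<in> set us \<Longrightarrow> \<exists>n. \<forall>v \<in> carrier R. (ad u ^^ n) S v = \<zero>\<^bsub>k\<^esub>"
    using fitting[OF tC(1), of us T] by blast
  \<comment> \<open>A multiple of \<pi> vanishes at t, whereas S takes the value 1 there.\<close>
  have "\<not> scalar S"
  proof
    assume "scalar S"
    then obtain c where "c \<in> carrier k" "S t = c \<otimes>\<^bsub>k\<^esub> \<pi> t" unfolding scalar_def using tC by blast
    then have "S t = \<zero>\<^bsub>k\<^esub>" using tC by simp
    moreover have "S t = \<one>\<^bsub>k\<^esub>" using S(2)[of \<one>] tC by simp
    ultimately show False using one_k by simp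
  qed
  moreover have "\<exists>n. scalar ((ad u ^^ n) S)" if "u \<in> set us" for u
    using S(3)[OF that] scalar_zero by blast
  ultimately show ?thesis using derivation_if_ad_nilpotent[OF us S(1)] by blast
qed

end

section \<open>Frobenius in characteristic \<open>p\<close>\<close>

text \<open>A binomial expansion for any array that obeys Pascal's rule. The abstraction covers both
  powers of a sum in a ring and iterated commutators of an operator.\<close>

lemma (in abelian_group) pascal:
  assumes cl: "\<And>n a. n + a \<le> N \<Longrightarrow> Y n a \<in> carrier G"
    and step: "\<And>n a. Suc n + a \<le> N \<Longrightarrow> Y (Suc n) a = Y n a \<oplus> Y n (Suc a)"
  shows "n + a \<le> N \<Longrightarrow> Y n a = (\<Oplus>i\<in>{..n}. [(n choose i)] \<cdot> Y 0 (a + i))"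
proof (induction n arbitrary: a)
  case 0
  then show ?case using cl by simp
next
  case (Suc n)
  have c: "Y 0 (a + i) \<in> carrier G" if "i \<le> Suc n" for i using cl that Suc.prems by simp
  have c': "Y 0 (Suc (a + i)) \<in> carrier G" if "i \<le> n" for i using c[of "Suc i"] that by simp
  let ?h = "\<lambda>i. Y 0 (a + i)"
  have 1: "Y n a = (\<Oplus>i\<in>{..n}. [(n choose i)] \<cdot> ?h i)" using Suc by simp
  have 2: "Y n (Suc a) = (\<Oplus>i\<in>{..n}. [(n choose i)] \<cdot> ?h (Suc i))" using Suc by simp
  have "(\<Oplus>i\<in>{..Suc n}. [(Suc n choose i)] \<cdot> ?h i)
     = (\<Oplus>i\<in>{..n}. [(Suc n choose Suc i)] \<cdot> ?h (Suc i)) \<oplus> [(Suc n choose 0)] \<cdot> ?h 0"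
    using c by (intro finsum_Suc2) auto
  also have "(\<Oplus>i\<in>{..n}. [(Suc n choose Suc i)] \<cdot> ?h (Suc i))
     = (\<Oplus>i\<in>{..n}. [(n choose i)] \<cdot> ?h (Suc i) \<oplus> [(n choose Suc i)] \<cdot> ?h (Suc i))"
  proof (rule finsum_cong')
    fix i assume i: "i \<in> {..n}"
    then have "?h (Suc i) \<in> carrier G" using c[of "Suc i"] by simp
    then show "[(Suc n choose Suc i)] \<cdot> ?h (Suc i) = [(n choose i)] \<cdot> ?h (Suc i) \<oplus> [(n choose Suc i)] \<cdot> ?h (Suc i)"
      by (simp only: binomial_Suc_Suc add.nat_pow_mult)
  qed (use c' in auto)
  also have "\<dots> = Y n (Suc a) \<oplus> (\<Oplus>i\<in>{..n}. [(n choose Suc i)] \<cdot> ?h (Suc i))"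
    unfolding 2 using c' by (intro finsum_addf) auto
  also have "\<dots> \<oplus> [(Suc n choose 0)] \<cdot> ?h 0
     = Y n (Suc a) \<oplus> ((\<Oplus>i\<in>{..n}. [(n choose Suc i)] \<cdot> ?h (Suc i)) \<oplus> [(n choose 0)] \<cdot> ?h 0)"
  proof -
    have "Y n (Suc a) \<in> carrier G" "?h 0 \<in> carrier G" "(\<Oplus>i\<in>{..n}. [(n choose Suc i)] \<cdot> ?h (Suc i)) \<in> carrier G"
      using c cl Suc.prems by (auto intro!: finsum_closed)
    then show ?thesis by (simp add: a_assoc)
  qed
  also have "(\<Oplus>i\<in>{..n}. [(n choose Suc i)] \<cdot> ?h (Suc i)) \<oplus> [(n choose 0)] \<cdot> ?h 0
     = (\<Oplus>i\<in>{..Suc n}. [(n choose i)] \<cdot> ?h i)"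
    using c by (intro finsum_Suc2[symmetric]) auto
  also have "\<dots> = [(n choose Suc n)] \<cdot> ?h (Suc n) \<oplus> (\<Oplus>i\<in>{..n}. [(n choose i)] \<cdot> ?h i)"
    using c by (intro finsum_Suc) auto
  also have "\<dots> = Y n a"
    unfolding 1 using c by (simp add: finsum_closed Pi_def binomial_eq_0)
  finally show ?case
    using step[of n a] cl[of n a] cl[of n "Suc a"] Suc.prems by (simp add: a_comm)
qed

text \<open>The inner binomial coefficients of a prime row are divisible by p; only the two ends
  remain.\<close>

lemma (in abelian_group) pascal_prime:
  assumes p: "Factorial_Ring.prime (p :: nat)" and char: "\<And>y. y \<in> carrier G \<Longrightarrow> [p] \<cdot> y = \<zero>"
    and cl: "\<And>n a. n + a \<le> p \<Longrightarrow> Y n a \<in> carrier G"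
    and step: "\<And>n a. Suc n + a \<le> p \<Longrightarrow> Y (Suc n) a = Y n a \<oplus> Y n (Suc a)"
  shows "Y p 0 = Y 0 0 \<oplus> Y 0 p"
proof -
  have "p \<ge> 2" using p by (rule prime_ge_2_nat)
  then obtain m where m: "p = Suc (Suc m)" by (metis add_2_eq_Suc le_Suc_ex)
  let ?f = "\<lambda>i. [(p choose i)] \<cdot> Y 0 i"
  have c: "Y 0 i \<in> carrier G" if "i \<le> p" for i using cl that by simp
  have mid: "?f (Suc i) = \<zero>" if "i \<le> m" for i
  proof -
    have "p dvd (p choose Suc i)" using that m p by (intro dvd_choose_prime) auto
    then obtain q where "p choose Suc i = p * q" by (auto simp: dvd_def)
    moreover have y: "Y 0 (Suc i) \<in> carrier G" using c that m by simp
    ultimately have "?f (Suc i) = [q] \<cdot> ([p] \<cdot> Y 0 (Suc i))" by (simp only: add.nat_pow_pow)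
    then show ?thesis using char[OF y] by simp
  qed
  have "Y p 0 = (\<Oplus>i\<in>{..p}. ?f i)"
    using pascal[where N = p and Y = Y and n = p and a = 0, OF cl step] by simp
  also have "\<dots> = ?f p \<oplus> (\<Oplus>i\<in>{..Suc m}. ?f i)"
    using c unfolding m by (intro finsum_Suc) auto
  also have "(\<Oplus>i\<in>{..Suc m}. ?f i) = (\<Oplus>i\<in>{..m}. ?f (Suc i)) \<oplus> ?f 0"
    using c m by (intro finsum_Suc2) auto
  also have "(\<Oplus>i\<in>{..m}. ?f (Suc i)) = \<zero>"
    using mid by (intro finsum_eq_zero) auto
  finally show ?thesis using c by (simp add: a_comm)
qed

lemma (in cring) frobenius_add:
  assumes p: "Factorial_Ring.prime (p :: nat)" and char: "\<And>y. y \<in> carrier R \<Longrightarrow> [p] \<cdot> y = \<zero>"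
    and xy: "x \<in> carrier R" "y \<in> carrier R"
  shows "(x \<oplus> y) [^] p = x [^] p \<oplus> y [^] p"
proof -
  \<comment> \<open>The factors x + y of the p-th power are expanded one at a time, n of them being
    still unexpanded.\<close>
  define Y where "Y n a = (x \<oplus> y) [^] n \<otimes> (x [^] (p - n - a) \<otimes> y [^] a)" for n a
  have "Y p 0 = Y 0 0 \<oplus> Y 0 p"
  proof (rule pascal_prime[OF p char])
    fix n a assume n: "Suc n + a \<le> p"
    then have s: "p - n - a = Suc (p - Suc n - a)" by simp
    obtain u v w where uvw: "u = (x \<oplus> y) [^] n" "v = x [^] (p - Suc n - a)" "w = y [^] a"
      and c: "u \<in> carrier R" "v \<in> carrier R" "w \<in> carrier R" using xy by auto
    have s': "p - n - Suc a = p - Suc n - a" by simp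
    show "Y (Suc n) a = Y n a \<oplus> Y n (Suc a)"
      unfolding Y_def s s' nat_pow_Suc uvw[symmetric] using c xy by algebra
  qed (use xy in \<open>auto simp: Y_def\<close>)
  then show ?thesis using xy by (simp add: Y_def)
qed

lemma (in domain) characteristic:
  "(\<forall>n > (0 :: nat). [n] \<cdot> \<one> \<noteq> \<zero>) \<or> (\<exists>p. Factorial_Ring.prime (p :: nat) \<and> [p] \<cdot> \<one> = \<zero>)"
proof (rule disjCI)
  assume nex: "\<not> (\<exists>p. Factorial_Ring.prime (p :: nat) \<and> [p] \<cdot> \<one> = \<zero>)"
  have mult: "[(a * b)] \<cdot> \<one> = ([a] \<cdot> \<one>) \<otimes> ([b] \<cdot> \<one>)" for a b :: nat
    by (simp add: add_pow_ldistr add_pow_rdistr add.nat_pow_pow mult.commute)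
  have "[n] \<cdot> \<one> \<noteq> \<zero>" if "n > 0" for n :: nat
    using that
  proof (induction n rule: less_induct)
    case (less n)
    show ?case
    proof (cases "n = 1")
      case False
      then obtain q where q: "Factorial_Ring.prime q" "q dvd n" using prime_factor_nat by blast
      then obtain m where m: "n = q * m" by (auto simp: dvd_def)
      then have "m > 0" "m < n" using less.prems q prime_gt_1_nat[of q] by auto
      then have "[m] \<cdot> \<one> \<noteq> \<zero>" using less.IH by blast
      moreover have "[q] \<cdot> \<one> \<noteq> \<zero>" using nex q by blast
      ultimately show ?thesis unfolding m mult by (simp add: integral_iff)
    qed simp
  qed
  then show "\<forall>n > (0 :: nat). [n] \<cdot> \<one> \<noteq> \<zero>" by simp
qed

lemma (in cring) char_mult:
  "[n] \<cdot> \<one> = \<zero> \<Longrightarrow> y \<in> carrier R \<Longrightarrow> [(n :: nat)] \<cdot> y = \<zero>"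
  using add_pow_ldistr[of \<one> y n] by simp

locale char_p_alg = R?: cring R for R (structure) +
  fixes F :: "'a set" and p :: nat
  assumes sfp: "subfield F R" and prime_p: "Factorial_Ring.prime p" and char_p: "[p] \<cdot> \<one> = \<zero>"
begin

lemma frob: "x \<in> carrier R \<Longrightarrow> y \<in> carrier R \<Longrightarrow> (x \<oplus> y) [^] p = x [^] p \<oplus> y [^] p"
  using frobenius_add[OF prime_p] char_mult[OF char_p] by blast

lemma FCp: "F \<subseteq> carrier R" using sfp by (rule subfieldE(3))

lemma F_pow: "c \<in> F \<Longrightarrow> c [^] (n :: nat) \<in> F"
  using subringE(3,6)[OF subfieldE(1)[OF sfp]] by (induction n) simp_all

text \<open>The p-th power map is additive and turns a scalar c into c^p, which is again in F;
  preimages of subspaces are thus subspaces, and p-th powers can be tested on a spanning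
  list.\<close>

lemma frob_preimage:
  assumes V: "subalgebra F V R"
  shows "subalgebra F {x \<in> carrier R. x [^] p \<in> V} R"
proof -
  have sub: "subgroup V (add_monoid R)" using V by (rule subalgebra.axioms)
  have z: "\<zero> \<in> V" and a: "\<And>x y. x \<in> V \<Longrightarrow> y \<in> V \<Longrightarrow> x \<oplus> y \<in> V"
    using subgroup.one_closed[OF sub] subgroup.m_closed[OF sub] by auto
  have s: "c \<otimes> v \<in> V" if "c \<in> F" "v \<in> V" for c v using subalgebra.smult_closed[OF V] that by blast
  have p0: "\<zero> [^] p = \<zero>" using prime_p by (auto simp: nat_pow_zero prime_gt_0_nat)
  have m1: "\<ominus> \<one> \<in> F" using subringE(3,5)[OF subfieldE(1)[OF sfp]] by blast
  have mul: "c \<otimes> x \<in> {x \<in> carrier R. x [^] p \<in> V}" if "c \<in> F" "x \<in> {x \<in> carrier R. x [^] p \<in> V}" for c x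
    using that FCp s[OF F_pow[OF that(1)]] by (auto simp: nat_pow_distrib subset_iff)
  show ?thesis
    unfolding subalgebra_def subalgebra_axioms_def
  proof (intro conjI allI impI add.subgroupI mul)
    show "{x \<in> carrier R. x [^] p \<in> V} \<noteq> {}" using z p0 by (auto intro!: exI[of _ \<zero>])
    show "\<ominus> x \<in> {x \<in> carrier R. x [^] p \<in> V}" if "x \<in> {x \<in> carrier R. x [^] p \<in> V}" for x
      using mul[OF m1 that] that by (auto simp: l_minus)
  qed (use frob a in auto)
qed

lemma frob_span:
  assumes us: "set us \<subseteq> carrier R" "Span F us = carrier R" and x: "x \<in> carrier R"
  shows "x [^] p \<in> Span F (map (\<lambda>u. u [^] p) us)"
proof -
  have C: "set (map (\<lambda>u. u [^] p) us) \<subseteq> carrier R" using us by auto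
  have "set us \<subseteq> {x \<in> carrier R. x [^] p \<in> Span F (map (\<lambda>u. u [^] p) us)}"
    using Span_base_incl[OF sfp C] us by auto
  from subalgebra_Span_incl[OF sfp frob_preimage[OF Span_is_subalgebra[OF sfp C]] this]
  show ?thesis using us x by auto
qed

lemma mult_preimage:
  assumes V: "subalgebra F V R" and b: "b \<in> carrier R"
  shows "subalgebra F {x \<in> carrier R. b \<otimes> x \<in> V} R"
proof -
  have sub: "subgroup V (add_monoid R)" using V by (rule subalgebra.axioms)
  have z: "\<zero> \<in> V" and a: "\<And>x y. x \<in> V \<Longrightarrow> y \<in> V \<Longrightarrow> x \<oplus> y \<in> V" and i: "\<And>x. x \<in> V \<Longrightarrow> \<ominus> x \<in> V"
    using subgroup.one_closed[OF sub] subgroup.m_closed[OF sub] subgroup.m_inv_closed[OF sub] by (auto simp: a_inv_def)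
  have s: "c \<otimes> v \<in> V" if "c \<in> F" "v \<in> V" for c v using subalgebra.smult_closed[OF V] that by blast
  show ?thesis
    unfolding subalgebra_def subalgebra_axioms_def
  proof (intro conjI allI impI add.subgroupI)
    show "{x \<in> carrier R. b \<otimes> x \<in> V} \<noteq> {}" using z b by (auto intro!: exI[of _ \<zero>])
    show "c \<otimes> x \<in> {x \<in> carrier R. b \<otimes> x \<in> V}" if "c \<in> F" "x \<in> {x \<in> carrier R. b \<otimes> x \<in> V}" for c x
      using that s[of c "b \<otimes> x"] b FCp by (auto simp: m_lcomm subset_iff)
  qed (use a i b in \<open>auto simp: r_distr r_minus\<close>)
qed

text \<open>Multiplication by w^p maps u^p to (w u)^p and hence preserves the span; the general case
  follows by linearity in each factor.\<close>

lemma frob_span_mult: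
  assumes us: "set us \<subseteq> carrier R" "Span F us = carrier R"
    and xy: "x \<in> Span F (map (\<lambda>u. u [^] p) us)" "y \<in> Span F (map (\<lambda>u. u [^] p) us)"
  shows "x \<otimes> y \<in> Span F (map (\<lambda>u. u [^] p) us)"
proof -
  let ?B = "Span F (map (\<lambda>u. u [^] p) us)"
  have C: "set (map (\<lambda>u. u [^] p) us) \<subseteq> carrier R" using us by auto
  note B = Span_is_subalgebra[OF sfp C]
  have BC: "?B \<subseteq> carrier R" by (rule subalgebra_in_carrier[OF B])
  have 1: "w [^] p \<otimes> z \<in> ?B" if w: "w \<in> carrier R" and z: "z \<in> ?B" for w z
  proof -
    have "set (map (\<lambda>u. u [^] p) us) \<subseteq> {x \<in> carrier R. w [^] p \<otimes> x \<in> ?B}"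
      using us frob_span[OF us] w by (auto simp: nat_pow_distrib[symmetric] simp del: Span.simps)
    from subalgebra_Span_incl[OF sfp mult_preimage[OF B] this] w z show ?thesis by auto
  qed
  have "set (map (\<lambda>u. u [^] p) us) \<subseteq> {z \<in> carrier R. x \<otimes> z \<in> ?B}"
    using 1[OF _ xy(1)] us BC xy m_comm[of x] by (auto simp del: Span.simps simp: subset_iff)
  from subalgebra_Span_incl[OF sfp mult_preimage[OF B] this] xy BC show ?thesis by auto
qed

end

context residue_alg
begin

lemma field_if_inj:
  assumes inj: "\<And>y. y \<in> carrier R \<Longrightarrow> \<pi> y = \<zero>\<^bsub>k\<^esub> \<Longrightarrow> y = \<zero>"
  shows "field R"
proof (rule cring_fieldI)
  show "Units R = carrier R - {\<zero>}"
  proof (intro equalityI subsetI)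
    fix x assume x: "x \<in> Units R"
    then have "x \<noteq> \<zero>" using one_not_zero_R unit_mult_zero[OF x one_closed] by auto
    then show "x \<in> carrier R - {\<zero>}" using Units_closed[OF x] by simp
  next
    fix x assume x: "x \<in> carrier R - {\<zero>}"
    then show "x \<in> Units R" using unit[of x] inj[of x] by blast
  qed
qed

text \<open>The span B of the p-th powers is a proper subfield. A B-linear projection onto B,
  followed by \<pi>, has vanishing p-fold commutators: in characteristic p, the p-th power of
  \<open>ad x\<close> is the commutator with x^p, and x^p lies in B.\<close>

lemma derivation_if_frob_not_full:
  assumes inj: "\<And>y. y \<in> carrier R \<Longrightarrow> \<pi> y = \<zero>\<^bsub>k\<^esub> \<Longrightarrow> y = \<zero>"
    and p: "Factorial_Ring.prime (p :: nat)" "[p] \<cdot> \<one> = \<zero>"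
    and us: "set us \<subseteq> carrier R" "Span F us = carrier R"
    and ne: "Span F (map (\<lambda>u. u [^] p) us) \<noteq> carrier R"
  shows "\<exists>D \<in> derK. \<exists>a \<in> carrier R. D a \<noteq> \<zero>\<^bsub>k\<^esub>"
proof -
  interpret Rf: field R by (rule field_if_inj[OF inj])
  interpret P: char_p_alg R F p by (intro char_p_alg.intro char_p_alg_axioms.intro is_cring sf p)
  let ?B = "Span F (map (\<lambda>u. u [^] p) us)"
  have C: "set (map (\<lambda>u. u [^] p) us) \<subseteq> carrier R" using us by auto
  note B = Span_is_subalgebra[OF sf C]
  have BC: "?B \<subseteq> carrier R" by (rule subalgebra_in_carrier[OF B])
  note sp = Span_subgroup_props[OF sf C]
  have oneB: "\<one> \<in> ?B" using P.frob_span[OF us one_closed] by simp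
  have FB: "F \<subseteq> ?B" using Span_smult_closed[OF sf C _ oneB] FC by (auto simp del: Span.simps simp: subset_iff)
  have "subring ?B R"
    using BC oneB sp P.frob_span_mult[OF us] by (intro subringI) (auto simp del: Span.simps)
  then have Bf: "subfield ?B R"
  proof (rule Rf.subfieldI')
    fix b assume b: "b \<in> ?B - {\<zero>}"
    then have bC: "b \<in> carrier R" "b \<in> Units R" using BC by (auto simp: Rf.field_Units simp del: Span.simps)
    have pow: "b [^] n \<in> ?B" for n :: nat
      using b oneB P.frob_span_mult[OF us] by (induction n) (auto simp del: Span.simps)
    have iC: "inv b \<in> carrier R" using bC by simp
    obtain q where q: "p = Suc q" using prime_gt_0_nat[OF p(1)] gr0_implies_Suc by blast
    \<comment> \<open>B is closed under inverses because the inverse of b is its own p-th power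
      times b^(p-1).\<close>
    have "inv b [^] p \<otimes> b [^] q = inv b \<otimes> (inv b [^] q \<otimes> b [^] q)"
      unfolding q using iC bC by (simp add: m_ac)
    also have "inv b [^] q \<otimes> b [^] q = \<one>" using nat_pow_distrib[OF iC bC(1), of q, symmetric] bC by simp
    finally have "inv b = inv b [^] p \<otimes> b [^] q" using iC bC by simp
    then show "inv b \<in> ?B" using P.frob_span_mult[OF us P.frob_span[OF us iC] pow] by metis
  qed
  have fdB: "finite_dimension ?B (carrier R)"
  proof -
    have "carrier R \<subseteq> Span ?B us"
    proof -
      have "subalgebra F (Span ?B us) R"
        using Span_is_subalgebra[OF Bf us(1)] FB unfolding subalgebra_def subalgebra_axioms_def by blast
      then have "Span F us \<subseteq> Span ?B us" using Span_base_incl[OF Bf us(1)] by (intro subalgebra_Span_incl[OF sf])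
      then show ?thesis using us by simp
    qed
    then have "Span ?B us = carrier R" using Span_in_carrier[OF BC us(1)] by blast
    then show ?thesis using Span_finite_dimension[OF Bf us(1)] by simp
  qed
  have "subalgebra ?B ?B R"
    using B P.frob_span_mult[OF us] unfolding subalgebra_def subalgebra_axioms_def by blast
  from projection_exists[OF Bf fdB this]
  obtain q where Q: "(\<forall>x \<in> carrier R. q x \<in> ?B) \<and> (\<forall>u \<in> ?B. q u = u) \<and>
    (\<forall>x \<in> carrier R. \<forall>y \<in> carrier R. q (x \<oplus> y) = q x \<oplus> q y) \<and>
    (\<forall>c \<in> ?B. \<forall>x \<in> carrier R. q (c \<otimes> x) = c \<otimes> q x)" ..
  have q: "q x \<in> ?B" "q x \<in> carrier R" if "x \<in> carrier R" for x using Q that BC by blast+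
  define T where "T x = \<pi> (q x)" for x
  have Tl: "T \<in> linK"
  proof (rule linKI)
    fix x assume x: "x \<in> carrier R"
    show "T x \<in> carrier k" unfolding T_def using q[OF x] by simp
    show "T (x \<oplus> y) = T x \<oplus>\<^bsub>k\<^esub> T y" if y: "y \<in> carrier R" for y
    proof -
      have "q (x \<oplus> y) = q x \<oplus> q y" using Q x y by blast
      then show ?thesis unfolding T_def using q(2)[OF x] q(2)[OF y] by simp
    qed
    show "T (c \<otimes> x) = \<pi> c \<otimes>\<^bsub>k\<^esub> T x" if c: "c \<in> F" for c
    proof -
      have "q (c \<otimes> x) = c \<otimes> q x" using Q x c FB by blast
      then show ?thesis unfolding T_def using q(2)[OF x] c FC by auto
    qed
  qed
  have TB: "T (b \<otimes> x) = \<pi> b \<otimes>\<^bsub>k\<^esub> T x" if b: "b \<in> ?B" and x: "x \<in> carrier R" for b x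
  proof -
    have bC: "b \<in> carrier R" using b BC by blast
    have "q (b \<otimes> x) = b \<otimes> q x" using Q x b by blast
    then show ?thesis unfolding T_def using q(2)[OF x] bC by simp
  qed
  have nsc: "\<not> scalar T"
  proof
    assume "scalar T"
    then obtain c where c: "c \<in> carrier k" "\<And>v. v \<in> carrier R \<Longrightarrow> T v = c \<otimes>\<^bsub>k\<^esub> \<pi> v" unfolding scalar_def by blast
    obtain v where v: "v \<in> carrier R" "v \<notin> ?B" using ne BC by blast
    \<comment> \<open>The projection kills w; if T were a multiple of \<pi>, necessarily \<pi>
      itself, then w would be zero and v an element of B.\<close>
    define w where "w = v \<ominus> q v"
    have wC: "w \<in> carrier R" unfolding w_def using v q by simp
    have "q \<one> = \<one>" using Q oneB by blast
    then have "T \<one> = \<one>\<^bsub>k\<^esub>" unfolding T_def by simp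
    then have c1: "c = \<one>\<^bsub>k\<^esub>" using c(2)[of \<one>] c(1) by simp
    have "v = w \<oplus> q v" unfolding w_def using v(1) q(2)[OF v(1)] by algebra
    then have "q v = q w \<oplus> q (q v)" using Q wC q(2)[OF v(1)] by metis
    moreover have "q (q v) = q v" using Q q(1)[OF v(1)] by blast
    ultimately have "q w \<oplus> q v = q v" by simp
    then have "q w = \<zero>" using q(2)[OF wC] q(2)[OF v(1)] by simp
    then have "\<pi> w = \<zero>\<^bsub>k\<^esub>" using c(2)[OF wC] c1 wC unfolding T_def by simp
    then have "w = \<zero>" using inj wC by blast
    then have "v = q v" unfolding w_def using v(1) q(2)[OF v(1)] by simp
    then show False using v(2) q(1)[OF v(1)] by simp
  qed
  have kchar: "[p] \<cdot>\<^bsub>k\<^esub> y = \<zero>\<^bsub>k\<^esub>" if yk: "y \<in> carrier k" for y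
  proof -
    have "[p] \<cdot>\<^bsub>k\<^esub> \<pi> r = \<pi> ([p] \<cdot> r)" if "r \<in> carrier R" for r :: 'a and p :: nat
      using that by (induction p) auto
    moreover obtain r where "r \<in> carrier R" "y = \<pi> r" using yk unfolding surj[symmetric] by (rule imageE)
    ultimately show ?thesis using char_mult[OF p(2)] by simp
  qed
  \<comment> \<open>Obtained from the Frobenius identity for 1 + (-1), which treats p = 2 together
    with odd p.\<close>
  have sign: "\<one>\<^bsub>k\<^esub> \<oplus>\<^bsub>k\<^esub> (\<ominus>\<^bsub>k\<^esub> \<one>\<^bsub>k\<^esub>) [^]\<^bsub>k\<^esub> p = \<zero>\<^bsub>k\<^esub>"
  proof -
    have "(\<one>\<^bsub>k\<^esub> \<oplus>\<^bsub>k\<^esub> (\<ominus>\<^bsub>k\<^esub> \<one>\<^bsub>k\<^esub>)) [^]\<^bsub>k\<^esub> p = \<one>\<^bsub>k\<^esub> [^]\<^bsub>k\<^esub> p \<oplus>\<^bsub>k\<^esub> (\<ominus>\<^bsub>k\<^esub> \<one>\<^bsub>k\<^esub>) [^]\<^bsub>k\<^esub> p"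
      by (rule k.frobenius_add[OF p(1) kchar]) simp_all
    moreover have "\<zero>\<^bsub>k\<^esub> [^]\<^bsub>k\<^esub> p = \<zero>\<^bsub>k\<^esub>" using prime_gt_0_nat[OF p(1)] by (simp add: k.nat_pow_zero)
    ultimately show ?thesis by (simp add: k.r_neg)
  qed
  have nil: "(ad x ^^ p) T v = \<zero>\<^bsub>k\<^esub>" if x: "x \<in> carrier R" and v: "v \<in> carrier R" for x v
  proof -
    \<comment> \<open>Pascal's rule in this array is the definition of the commutator; its last row
      is the p-fold commutator, and its first row involves only T with \<pi> x and the arguments x^a
      v.\<close>
    define Y where "Y n a = (\<ominus>\<^bsub>k\<^esub> \<one>\<^bsub>k\<^esub>) [^]\<^bsub>k\<^esub> a \<otimes>\<^bsub>k\<^esub> (\<pi> x [^]\<^bsub>k\<^esub> (p - n - a) \<otimes>\<^bsub>k\<^esub> (ad x ^^ n) T (x [^] a \<otimes> v))" for n a :: nat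
    have al: "(ad x ^^ n) T w \<in> carrier k" if "w \<in> carrier R" for n w
      using linKD(1)[OF ad_pow_linK[OF Tl x]] that .
    have "Y p 0 = Y 0 0 \<oplus>\<^bsub>k\<^esub> Y 0 p"
    proof (rule k.pascal_prime[OF p(1) kchar])
      fix n a assume n: "Suc n + a \<le> p"
      then have s: "p - n - a = Suc (p - Suc n - a)" by simp
      have s': "p - n - Suc a = p - Suc n - a" by simp
      define w where "w = x [^] a \<otimes> v"
      have wC: "w \<in> carrier R" unfolding w_def using x v by simp
      have xw: "x [^] Suc a \<otimes> v = x \<otimes> w" unfolding w_def using x v by (simp add: m_ac)
      define A where "A = (ad x ^^ n) T"
      have c: "A w \<in> carrier k" "A (x \<otimes> w) \<in> carrier k" using al wC x unfolding A_def by auto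
      have e: "(ad x ^^ Suc n) T w = \<pi> x \<otimes>\<^bsub>k\<^esub> A w \<ominus>\<^bsub>k\<^esub> A (x \<otimes> w)" unfolding A_def by (simp add: ad_def)
      define u t where ut: "u = \<pi> x [^]\<^bsub>k\<^esub> (p - Suc n - a)" "t = (\<ominus>\<^bsub>k\<^esub> \<one>\<^bsub>k\<^esub>) [^]\<^bsub>k\<^esub> a"
      have c': "u \<in> carrier k" "t \<in> carrier k" "\<pi> x \<in> carrier k" unfolding ut using x by auto
      show "Y (Suc n) a = Y n a \<oplus>\<^bsub>k\<^esub> Y n (Suc a)"
        unfolding Y_def s s' xw w_def[symmetric] e A_def[symmetric] k.nat_pow_Suc ut[symmetric]
        using c c' by algebra
    qed (use x v al in \<open>auto simp: Y_def\<close>)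
    moreover have "Y p 0 = (ad x ^^ p) T v" unfolding Y_def using x v al by simp
    moreover have "Y 0 0 \<oplus>\<^bsub>k\<^esub> Y 0 p = (\<one>\<^bsub>k\<^esub> \<oplus>\<^bsub>k\<^esub> (\<ominus>\<^bsub>k\<^esub> \<one>\<^bsub>k\<^esub>) [^]\<^bsub>k\<^esub> p) \<otimes>\<^bsub>k\<^esub> (\<pi> x [^]\<^bsub>k\<^esub> p \<otimes>\<^bsub>k\<^esub> T v)"
    proof -
      have pw: "\<pi> (x [^] n) = \<pi> x [^]\<^bsub>k\<^esub> n" for n :: nat using x by (induction n) simp_all
      have e: "T (x [^] p \<otimes> v) = \<pi> x [^]\<^bsub>k\<^esub> p \<otimes>\<^bsub>k\<^esub> T v"
        using TB[OF P.frob_span[OF us x] v] pw by (simp del: Span.simps)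
      have c: "\<pi> x [^]\<^bsub>k\<^esub> p \<otimes>\<^bsub>k\<^esub> T v \<in> carrier k" "(\<ominus>\<^bsub>k\<^esub> \<one>\<^bsub>k\<^esub>) [^]\<^bsub>k\<^esub> p \<in> carrier k"
        using linKD(1)[OF Tl v] x by auto
      show ?thesis unfolding Y_def using v e c by (simp add: k.l_distr)
    qed
    moreover have "\<pi> x [^]\<^bsub>k\<^esub> p \<otimes>\<^bsub>k\<^esub> T v \<in> carrier k" using linKD(1)[OF Tl v] x by simp
    ultimately show ?thesis using sign by simp
  qed
  show ?thesis
  proof (rule derivation_if_ad_nilpotent[OF us Tl nsc])
    fix u assume "u \<in> set us"
    then have "u \<in> carrier R" using us by auto
    then have "scalar ((ad u ^^ p) T)" using nil by (intro scalar_zero)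
    then show "\<exists>n. scalar ((ad u ^^ n) T)" ..
  qed
qed

end

section \<open>Separability\<close>

lemma (in ring) eval_mem:
  assumes V: "subgroup V (add_monoid R)" and x: "x \<in> carrier R"
  shows "set q \<subseteq> carrier R \<Longrightarrow> (\<And>i. i < length q \<Longrightarrow> q ! i \<otimes> x [^] (length q - 1 - i) \<in> V) \<Longrightarrow> eval q x \<in> V"
proof (induction q)
  case Nil
  then show ?case using subgroup.one_closed[OF V] by simp
next
  case (Cons a q)
  have "eval q x \<in> V"
  proof (rule Cons.IH)
    show "set q \<subseteq> carrier R" using Cons.prems by simp
    show "q ! i \<otimes> x [^] (length q - 1 - i) \<in> V" if "i < length q" for i
      using Cons.prems(2)[of "Suc i"] that by simp
  qed
  moreover have "a \<otimes> x [^] length q \<in> V" using Cons.prems(2)[of 0] by simp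
  ultimately show ?case using subgroup.m_closed[OF V] by simp
qed

lemma (in ring) Span_Cons_mem:
  assumes K: "subfield K R" and C: "set ws \<subseteq> carrier R" "w \<in> carrier R" and w: "w \<in> Span K ws"
  shows "Span K (w # ws) = Span K ws"
proof
  have "set (w # ws) \<subseteq> Span K ws" using Span_base_incl[OF K C(1)] w by simp
  then show "Span K (w # ws) \<subseteq> Span K ws" using mono_Span_subset[OF K _ C(1)] by blast
  show "Span K ws \<subseteq> Span K (w # ws)" by (rule mono_Span[OF K C])
qed

lemma (in ring) shorter_base:
  assumes K: "subfield K R"
  shows "set ws \<subseteq> carrier R \<Longrightarrow> \<exists>us. independent K us \<and> Span K us = Span K ws \<and>
    length us \<le> length ws \<and> (\<not> independent K ws \<longrightarrow> length us < length ws)"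
proof (induction ws)
  case Nil
  then show ?case by (auto intro!: exI[of _ "[]"])
next
  case (Cons w ws)
  then have C: "set ws \<subseteq> carrier R" "w \<in> carrier R" by auto
  obtain us where us: "independent K us \<and> Span K us = Span K ws \<and>
    length us \<le> length ws \<and> (\<not> independent K ws \<longrightarrow> length us < length ws)" using Cons.IH[OF C(1)] ..
  show ?case
  proof (cases "w \<in> Span K ws")
    case True
    then have "Span K (w # ws) = Span K us" using Span_Cons_mem[OF K C] us by simp
    moreover have "length us < length (w # ws)" using us by simp
    ultimately show ?thesis using us by (intro exI[of _ us]) (simp del: Span.simps)
  next
    case False
    have "Span K (w # us) = Span K (w # ws)" using us by simp
    moreover have "independent K (w # us)" using False us C by (intro independent.li_Cons) auto
    moreover have "independent K ws \<Longrightarrow> independent K (w # ws)" using False C by (intro independent.li_Cons)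
    ultimately show ?thesis using us by (intro exI[of _ "w # us"]) (auto simp del: Span.simps)
  qed
qed

text \<open>Otherwise discarding redundant members would leave a basis shorter than the
  dimension.\<close>

lemma (in ring) spanning_independent:
  assumes K: "subfield K R" and ws: "set ws \<subseteq> carrier R" and d: "dimension (length ws) K (Span K ws)"
  shows "independent K ws"
proof (rule ccontr)
  assume "\<not> independent K ws"
  then obtain us where us: "independent K us" "Span K us = Span K ws" "length us < length ws"
    using shorter_base[OF K ws] by blast
  have "dimension (length us) K (Span K ws)" using dimension_independent[OF us(1)] unfolding us(2) .
  then show False using dimension_is_inj[OF K d] us(3) by simp
qed

lemma (in domain) characteristic_dvd:
  assumes p: "Factorial_Ring.prime (p :: nat)" "[p] \<cdot> \<one> = \<zero>" and c: "c \<in> carrier R" "c \<noteq> \<zero>" "[n] \<cdot> c = \<zero>"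
  shows "p dvd n"
proof (rule ccontr)
  assume nd: "\<not> p dvd n"
  then have n: "n \<noteq> 0" by (intro notI) simp
  have "coprime p n" using p(1) nd by (rule prime_imp_coprime)
  then have g: "gcd n p = 1" by (simp add: coprime_iff_gcd_eq_1 gcd.commute)
  obtain a b where ab: "n * a = p * b + gcd n p" using bezout_nat[OF n] by blast
  have "[(n * a)] \<cdot> c = [a] \<cdot> ([n] \<cdot> c)" using c(1) by (simp add: add.nat_pow_pow mult.commute)
  then have 1: "[(n * a)] \<cdot> c = \<zero>" unfolding c(3) by simp
  have "[(p * b)] \<cdot> c = [b] \<cdot> ([p] \<cdot> c)" using c(1) by (simp add: add.nat_pow_pow mult.commute)
  then have 2: "[(p * b)] \<cdot> c = \<zero>" unfolding char_mult[OF p(2) c(1)] by simp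
  have "[(n * a)] \<cdot> c = [(p * b)] \<cdot> c \<oplus> c"
    unfolding ab g using c(1) by (simp add: add.nat_pow_mult[symmetric])
  then show False using 1 2 c by simp
qed

lemma (in ring) normalize_eq_Nil: "normalize p = [] \<Longrightarrow> set p \<subseteq> {\<zero>}"
  by (induction p) (auto split: if_splits)

text \<open>If the derivative of the minimal polynomial vanished, its exponents would be multiples
  of p, and its degree n = p m. The powers of x up to x^m are independent and extend to a basis; the
  p-th powers of that basis span by \<open>full\<close>, hence are independent. But the minimal
  polynomial is a relation among the powers of x^p up to x^(p m).\<close>

lemma (in field) formal_derivative_nonzero:
  assumes sf: "subfield F R" and fd: "finite_dimension F (carrier R)"
    and full: "\<And>p us. Factorial_Ring.prime (p :: nat) \<Longrightarrow> [p] \<cdot> \<one> = \<zero> \<Longrightarrow> set us \<subseteq> carrier R \<Longrightarrow>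
      Span F us = carrier R \<Longrightarrow> Span F (map (\<lambda>u. u [^] p) us) = carrier R"
    and x: "x \<in> carrier R" and alg: "(algebraic over F) x"
  shows "1 \<le> degree (Irr F x) \<and> formal_derivative (Irr F x) \<noteq> []"
proof -
  define f n where fn: "f = Irr F x" "n = degree (Irr F x)"
  note I = IrrE[OF sf x alg, folded fn]
  have FC: "F \<subseteq> carrier R" using sf by (rule subfieldE(3))
  have ne: "f \<noteq> []" using pirreducibleE(1)[OF subfieldE(1)[OF sf] I(1,2)] .
  have len: "length f = Suc n" using ne unfolding fn by simp
  have fF: "set f \<subseteq> F" using I(1) unfolding univ_poly_carrier[symmetric] polynomial_def by auto
  have fC: "set f \<subseteq> carrier R" using fF FC by blast
  have fi: "f ! i \<in> F" "f ! i \<in> carrier R" if "i \<le> n" for i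
  proof -
    have "f ! i \<in> set f" using that len by simp
    then show "f ! i \<in> F" "f ! i \<in> carrier R" using fF FC by blast+
  qed
  obtain g where g: "f = \<one> # g" using ne I(3) by (cases f) auto
  have n1: "1 \<le> n"
  proof (rule ccontr)
    assume "\<not> 1 \<le> n"
    then have "f = [\<one>]" using len g by (cases g) auto
    then show False using I(4) x by simp
  qed
  have "formal_derivative f \<noteq> []"
  proof
    assume "formal_derivative f = []"
    then have z: "set (map (\<lambda>i. [(n - i)] \<cdot> f ! i) [0..<n]) \<subseteq> {\<zero>}"
      unfolding formal_derivative_def fn by (rule normalize_eq_Nil)
    have z: "[(n - i)] \<cdot> f ! i = \<zero>" if "i < n" for i
    proof -
      have "[(n - i)] \<cdot> f ! i \<in> set (map (\<lambda>i. [(n - i)] \<cdot> f ! i) [0..<n])" using that by simp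
      then show ?thesis using z by blast
    qed
    \<comment> \<open>The leading coefficient is 1, so its contribution to the derivative shows that
      the characteristic is positive.\<close>
    have nz: "[n] \<cdot> \<one> = \<zero>" using z[of 0] n1 g by simp
    have nall: "\<not> (\<forall>n > (0 :: nat). [n] \<cdot> \<one> \<noteq> \<zero>)"
    proof
      assume a: "\<forall>n > (0 :: nat). [n] \<cdot> \<one> \<noteq> \<zero>"
      have "[n] \<cdot> \<one> \<noteq> \<zero>" using n1 by (intro a[rule_format]) simp
      then show False using nz by (rule notE)
    qed
    have "\<exists>p. Factorial_Ring.prime (p :: nat) \<and> [p] \<cdot> \<one> = \<zero>"
      by (rule disjE[OF characteristic], erule notE[OF nall], assumption)
    then obtain p where p0: "Factorial_Ring.prime (p :: nat) \<and> [p] \<cdot> \<one> = \<zero>" ..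
    note p = conjunct1[OF p0] conjunct2[OF p0]
    have dv: "p dvd n - i" if "i \<le> n" "f ! i \<noteq> \<zero>" for i
    proof (cases "i = n")
      case False
      then show ?thesis using characteristic_dvd[OF p fi(2)[OF that(1)] that(2) z] that(1) by simp
    qed simp
    have "p dvd n" using dv[of 0] g by simp
    then obtain m where m: "n = p * m" by (auto simp: dvd_def)
    have p2: "p \<ge> 2" using p(1) by (rule prime_ge_2_nat)
    have m1: "1 \<le> m" using n1 m by (cases m) auto
    have "2 * m \<le> p * m" using p2 by (rule mult_le_mono1)
    then have mn: "Suc m \<le> n" unfolding m using m1 by linarith
    define ys where "ys = map (\<lambda>u. u [^] p) (exp_base x m)"
    have ysC: "set ys \<subseteq> carrier R" unfolding ys_def using exp_base_closed[OF x, of m] by auto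
    have "independent F (exp_base x n)" using exp_base_independent[OF sf x alg] unfolding fn .
    \<comment> \<open>The highest power comes first in \<open>exp_base\<close>, so the powers up to
      x^m form a suffix; they belong to the independent list because m < n.\<close>
    moreover have "exp_base x n = take (n - Suc m) (exp_base x n) @ exp_base x (Suc m)"
      using append_take_drop_id[of "n - Suc m" "exp_base x n"] drop_exp_base[of "n - Suc m" x n] mn by simp
    ultimately have ind: "independent F (exp_base x (Suc m))" using independent_split(1)[OF sf] by metis
    obtain vs where vs: "length (vs @ exp_base x (Suc m)) = (dim over F) (carrier R)"
        "independent F (vs @ exp_base x (Suc m))" "Span F (vs @ exp_base x (Suc m)) = carrier R"
      using complete_base[OF sf finite_dimensionE[OF sf fd] ind exp_base_closed[OF x]] by blast
    let ?ws = "map (\<lambda>u. u [^] p) (vs @ exp_base x (Suc m))"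
    have C: "set (vs @ exp_base x (Suc m)) \<subseteq> carrier R" using independent_in_carrier[OF vs(2)] .
    then have wC: "set ?ws \<subseteq> carrier R" by auto
    have S: "Span F ?ws = carrier R" by (rule full[OF p C vs(3)])
    have "dimension (length ?ws) F (Span F ?ws)"
      unfolding S length_map vs(1) by (rule finite_dimensionE[OF sf fd])
    then have "independent F ?ws" by (rule spanning_independent[OF sf wC])
    moreover have "?ws = map (\<lambda>u. u [^] p) vs @ ((x [^] m) [^] p # ys)"
      unfolding ys_def exp_base_def by simp
    ultimately have "independent F ((x [^] m) [^] p # ys)" using independent_split(1)[OF sf] by metis
    then have notin: "(x [^] m) [^] p \<notin> Span F ys" by (rule independent_backwards(1))
    have V: "subgroup (Span F ys) (add_monoid R)" by (rule Span_is_add_subgroup[OF sf ysC])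
    \<comment> \<open>Without its leading term the minimal polynomial involves only powers of x^p
      below x^(p m), and these are the members of \<open>ys\<close>.\<close>
    have "eval g x \<in> Span F ys"
    proof (rule eval_mem[OF V x])
      show "set g \<subseteq> carrier R" using fC g by simp
      fix i assume i: "i < length g"
      have lg: "length g = n" using len g by simp
      define j where "j = Suc i"
      have j: "g ! i = f ! j" "j \<le> n" "length g - 1 - i = n - j" using i lg g unfolding j_def by auto
      show "g ! i \<otimes> x [^] (length g - 1 - i) \<in> Span F ys"
      proof (cases "f ! j = \<zero>")
        case True
        then show ?thesis unfolding j using x Span_subgroup_props(2)[OF sf ysC] by (simp del: Span.simps)
      next
        case False
        then obtain l where l: "n - j = p * l" using dv[OF j(2)] by (auto simp: dvd_def)
        have "p * l < p * m" using l m j(2) mn unfolding j_def by linarith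
        then have lm: "l < m" by simp
        have "x [^] (n - j) = (x [^] l) [^] p" unfolding l using x by (simp add: nat_pow_pow mult.commute)
        moreover have "(x [^] l) [^] p \<in> set ys" using lm unfolding ys_def exp_base_def by auto
        ultimately have "x [^] (n - j) \<in> Span F ys" using Span_base_incl[OF sf ysC] by auto
        then show ?thesis unfolding j using Span_smult_closed[OF sf ysC fi(1)[OF j(2)]] by blast
      qed
    qed
    then have "\<ominus> eval g x \<in> Span F ys" by (rule Span_subgroup_props(4)[OF sf ysC])
    moreover have "\<ominus> eval g x = (x [^] m) [^] p"
    proof -
      have e: "eval g x \<in> carrier R" using eval_in_carrier[of g x] fC g x by simp
      have lg: "length g = n" using len g by simp
      have "x [^] n \<oplus> eval g x = \<zero>" using I(4) x unfolding g by (simp add: lg)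
      then have "\<ominus> eval g x = x [^] n" using e x by (simp add: minus_equality)
      then show ?thesis unfolding m using x by (simp add: nat_pow_pow mult.commute)
    qed
    ultimately show False using notin by simp
  qed
  then show ?thesis using n1 unfolding fn by simp
qed

text \<open>A common divisor that is not a unit is associated to the irreducible polynomial f, which
  would then divide its derivative, a nonzero polynomial of smaller degree.\<close>

lemma (in field) separable_if_frob_full:
  assumes sf: "subfield F R" and fd: "finite_dimension F (carrier R)"
    and full: "\<And>p us. Factorial_Ring.prime (p :: nat) \<Longrightarrow> [p] \<cdot> \<one> = \<zero> \<Longrightarrow> set us \<subseteq> carrier R \<Longrightarrow>
      Span F us = carrier R \<Longrightarrow> Span F (map (\<lambda>u. u [^] p) us) = carrier R"
    and x: "x \<in> carrier R"
  shows "separable_over F x"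
proof -
  have alg: "(algebraic over F) x" using finite_dimension_imp_algebraic[OF sf carrier_is_subring fd x] .
  define f where "f = Irr F x"
  note I = IrrE[OF sf x alg, folded f_def]
  have fd': "1 \<le> degree f" "formal_derivative f \<noteq> []"
    using formal_derivative_nonzero[OF sf fd full x alg] unfolding f_def by blast+
  interpret UP: cring "F[X]" using univ_poly_is_cring[OF subfieldE(1)[OF sf]] .
  have len: "length (formal_derivative f) \<le> degree f"
    unfolding formal_derivative_def using normalize_length_le[of "map (\<lambda>i. [(degree f - i)] \<cdot> f ! i) [0..<degree f]"] by simp
  have "d \<in> Units (F[X])"
    if d: "d \<in> carrier (F[X])" "d divides\<^bsub>F[X]\<^esub> f" "d divides\<^bsub>F[X]\<^esub> formal_derivative f" for d
  proof (rule ccontr)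
    assume nu: "d \<notin> Units (F[X])"
    obtain c where c: "c \<in> carrier (F[X])" "f = d \<otimes>\<^bsub>F[X]\<^esub> c" using d(2) unfolding factor_def by blast
    obtain e where e: "e \<in> carrier (F[X])" "formal_derivative f = d \<otimes>\<^bsub>F[X]\<^esub> e" using d(3) unfolding factor_def by blast
    have cU: "c \<in> Units (F[X])" using pirreducibleE(3)[OF subfieldE(1)[OF sf] I(1,2) d(1) c] nu by blast
    let ?i = "inv\<^bsub>F[X]\<^esub> c"
    have i: "?i \<in> carrier (F[X])" "c \<otimes>\<^bsub>F[X]\<^esub> ?i = \<one>\<^bsub>F[X]\<^esub>" using cU by (simp_all add: UP.Units_r_inv)
    have "f \<otimes>\<^bsub>F[X]\<^esub> (?i \<otimes>\<^bsub>F[X]\<^esub> e) = d \<otimes>\<^bsub>F[X]\<^esub> (c \<otimes>\<^bsub>F[X]\<^esub> ?i) \<otimes>\<^bsub>F[X]\<^esub> e"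
      unfolding c(2) using d(1) c(1) i(1) e(1) by (simp add: UP.m_assoc)
    then have "formal_derivative f = f \<otimes>\<^bsub>F[X]\<^esub> (?i \<otimes>\<^bsub>F[X]\<^esub> e)" unfolding i(2) e(2) using d(1) by simp
    then have dv: "f divides\<^bsub>F[X]\<^esub> formal_derivative f" unfolding factor_def using i(1) e(1) by blast
    have fC: "formal_derivative f \<in> carrier (F[X])" unfolding e(2) using d(1) e(1) by simp
    have "degree f \<le> degree (formal_derivative f)"
      using pdivides_imp_degree_le[OF subfieldE(1)[OF sf] I(1) fC fd'(2)] pdivides_iff_shell[OF sf I(1) fC] dv by blast
    then show False using len fd' by (cases "formal_derivative f") auto
  qed
  then show ?thesis using alg unfolding separable_over_def separable_polynomial_def f_def by blast
qed

context residue_alg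
begin

lemma separable_if_no_derivation:
  assumes D: "\<not> (\<exists>D \<in> derK. \<exists>a \<in> carrier R. D a \<noteq> \<zero>\<^bsub>k\<^esub>)"
  shows "field R \<and> (\<forall>x \<in> carrier R. separable_over F x)"
proof -
  have inj: "y = \<zero>" if "y \<in> carrier R" "\<pi> y = \<zero>\<^bsub>k\<^esub>" for y
    using derivation_if_not_reduced[OF that(1) _ that(2)] D by blast
  interpret Rf: field R by (rule field_if_inj[OF inj])
  have "Span F (map (\<lambda>u. u [^] p) us) = carrier R"
    if "Factorial_Ring.prime (p :: nat)" "[p] \<cdot> \<one> = \<zero>" "set us \<subseteq> carrier R" "Span F us = carrier R" for p us
    using derivation_if_frob_not_full[OF inj that] D by blast
  from Rf.separable_if_frob_full[OF sf fd this] show ?thesis using Rf.field_axioms by blast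
qed

end

section \<open>Algebras without idempotents are local\<close>

context cring
begin

text \<open>The constant coefficient comes last in the list: trailing zeros are absorbed into the
  power of x, and the last nonzero coefficient is inverted to solve for that power.\<close>

lemma power_stable:
  assumes sf: "subfield F R" and x: "x \<in> carrier R"
  shows "set p \<subseteq> F \<Longrightarrow> \<not> set p \<subseteq> {\<zero>} \<Longrightarrow> x [^] (s :: nat) \<otimes> eval p x = \<zero> \<Longrightarrow>
    \<exists>r y. y \<in> carrier R \<and> x [^] (r :: nat) = x [^] Suc r \<otimes> y"
proof (induction p arbitrary: s rule: rev_induct)
  case (snoc c p)
  have FC: "F \<subseteq> carrier R" using sf by (rule subfieldE(3))
  have C: "set p \<subseteq> carrier R" "c \<in> carrier R" "c \<in> F" using snoc.prems FC by auto
  have e: "eval p x \<in> carrier R" by (rule eval_in_carrier[OF C(1) x])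
  have ap: "eval (p @ [c]) x = eval p x \<otimes> x \<oplus> c" by (rule eval_append_aux[OF C(1,2) x])
  show ?case
  proof (cases "c = \<zero>")
    case True
    have "x [^] Suc s \<otimes> eval p x = x [^] s \<otimes> eval (p @ [c]) x"
      unfolding ap using True e x by (simp add: m_ac)
    then have "x [^] Suc s \<otimes> eval p x = \<zero>" using snoc.prems(3) by simp
    moreover have "set p \<subseteq> F" "\<not> set p \<subseteq> {\<zero>}" using snoc.prems True by auto
    ultimately show ?thesis by (intro snoc.IH)
  next
    case False
    have c: "inv c \<in> carrier R" "inv c \<otimes> c = \<one>"
      using subfield_m_inv[OF sf, of c] C False FC by auto
    define y where "y = (\<ominus> (inv c)) \<otimes> eval p x"
    have "x [^] s = x [^] s \<otimes> (inv c \<otimes> c)" using c x by simp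
    also have "\<dots> = inv c \<otimes> (x [^] s \<otimes> (eval p x \<otimes> x \<oplus> c)) \<oplus> x [^] s \<otimes> x \<otimes> ((\<ominus> (inv c)) \<otimes> eval p x)"
      using c(1) C(2) e x nat_pow_closed[OF x, of s] by algebra
    also have "\<dots> = x [^] Suc s \<otimes> y"
      unfolding ap[symmetric] snoc.prems(3) y_def using c x e by simp
    finally show ?thesis using c e unfolding y_def by (intro exI[of _ s] exI[of _ y]) (simp add: y_def)
  qed
qed simp

text \<open>From x^r = x^(r+1) y one obtains the idempotent e = x^r y^r with x^r e = x^r. If e = 0
  then x is nilpotent, and if e = 1 it is a unit.\<close>

lemma unit_or_nilpotent:
  assumes sf: "subfield F R" and fd: "finite_dimension F (carrier R)"
    and idem: "\<And>e. e \<in> carrier R \<Longrightarrow> e \<otimes> e = e \<Longrightarrow> e = \<zero> \<or> e = \<one>" and x: "x \<in> carrier R"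
  shows "x \<in> Units R \<or> (\<exists>r :: nat. x [^] r = \<zero>)"
proof -
  obtain n where n: "dimension n F (carrier R)" using fd by blast
  have eb: "set (exp_base x (Suc n)) \<subseteq> carrier R" by (rule exp_base_closed[OF x])
  have "dependent F (exp_base x (Suc n))"
    using independent_length_le_dimension[OF sf n _ eb] by (auto simp: exp_base_def)
  then obtain Ks where Ks: "length Ks = length (exp_base x (Suc n))" "combine Ks (exp_base x (Suc n)) = \<zero>"
      "set Ks \<subseteq> F" "set Ks \<noteq> {\<zero>}"
    using dependent_imp_non_trivial_combine[OF sf eb] by blast
  have l: "length Ks = Suc n" using Ks(1) by (simp add: exp_base_def)
  have "eval Ks x = \<zero>" using combine_eq_eval[of Ks x] Ks(2) l by simp
  then have "x [^] (0::nat) \<otimes> eval Ks x = \<zero>" by simp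
  moreover have "\<not> set Ks \<subseteq> {\<zero>}" using Ks(4) l by (cases Ks) auto
  ultimately obtain r y where y: "y \<in> carrier R" "x [^] (r :: nat) = x [^] Suc r \<otimes> y"
    using power_stable[OF sf x Ks(3)] by blast
  have pw: "x [^] r = x [^] (r + j) \<otimes> y [^] j" for j :: nat
  proof (induction j)
    case (Suc j)
    have c: "x [^] j \<in> carrier R" "x [^] r \<in> carrier R" "y [^] j \<in> carrier R" using x y(1) by simp_all
    have "x [^] r = x [^] r \<otimes> x [^] j \<otimes> y [^] j" using Suc nat_pow_mult[OF x, of r j] by simp
    also have "\<dots> = (x [^] r \<otimes> x \<otimes> y) \<otimes> x [^] j \<otimes> y [^] j" using y(2) by simp
    also have "\<dots> = x [^] r \<otimes> x [^] j \<otimes> x \<otimes> (y [^] j \<otimes> y)" using c x y(1) by (simp add: m_ac)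
    finally show ?case using nat_pow_mult[OF x, of r j] by simp
  qed (use x in simp)
  define e where "e = x [^] r \<otimes> y [^] r"
  have c: "x [^] r \<in> carrier R" "y [^] r \<in> carrier R" using x y(1) by simp_all
  have eC: "e \<in> carrier R" unfolding e_def using c by simp
  have xe: "x [^] r \<otimes> e = x [^] r"
    using pw[of r] c x unfolding e_def by (simp add: nat_pow_mult[symmetric] m_assoc)
  have "e \<otimes> e = (x [^] r \<otimes> e) \<otimes> y [^] r" using c eC by (simp add: e_def m_ac)
  then have "e \<otimes> e = e" unfolding xe by (simp add: e_def)
  then consider "e = \<zero>" | "e = \<one>" using idem[OF eC] by blast
  then show ?thesis
  proof cases
    case 1
    then show ?thesis using xe c by (intro disjI2 exI[of _ r]) simp
  next
    case 2
    have "x [^] r \<otimes> y [^] r = x \<otimes> (x [^] r \<otimes> y \<otimes> y [^] r)"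
    proof -
      have "x [^] r \<otimes> y [^] r = (x [^] r \<otimes> x \<otimes> y) \<otimes> y [^] r" using y(2) by simp
      also have "\<dots> = x \<otimes> (x [^] r \<otimes> y \<otimes> y [^] r)" using c x y(1) by (simp add: m_ac)
      finally show ?thesis .
    qed
    then have "x \<otimes> (x [^] r \<otimes> y \<otimes> y [^] r) = \<one>" using 2 unfolding e_def by simp
    moreover have "x [^] r \<otimes> y \<otimes> y [^] r \<in> carrier R" using c y(1) by simp
    ultimately have "x \<in> Units R" using unit_factor[of x "x [^] r \<otimes> y \<otimes> y [^] r"] x by simp
    then show ?thesis ..
  qed
qed

lemma one_minus_nilpotent:
  assumes x: "x \<in> carrier R"
  shows "\<exists>z \<in> carrier R. (\<one> \<ominus> x) \<otimes> z = \<one> \<ominus> x [^] (n :: nat)"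
proof (induction n)
  case 0
  then show ?case using x by (intro bexI[of _ \<zero>]) (auto simp: minus_eq r_neg)
next
  case (Suc n)
  then obtain z where z: "z \<in> carrier R" "(\<one> \<ominus> x) \<otimes> z = \<one> \<ominus> x [^] n" by blast
  define w where "w = x [^] n"
  have c: "w \<in> carrier R" unfolding w_def using x by simp
  have "(\<one> \<ominus> x) \<otimes> (z \<oplus> w) = (\<one> \<ominus> x) \<otimes> z \<oplus> (\<one> \<ominus> x) \<otimes> w" using x c z(1) by algebra
  also have "\<dots> = \<one> \<ominus> w \<otimes> x" unfolding z(2) w_def[symmetric] using x c by algebra
  finally show ?case using z(1) c unfolding w_def by (intro bexI[of _ "z \<oplus> w"]) (auto simp: w_def)
qed

text \<open>The residue field is the quotient by the set of non-units. Only closure under addition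
  needs an argument, and this uses that a non-unit is nilpotent.\<close>

lemma local_residue_alg:
  assumes sf: "subfield F R" and fd: "finite_dimension F (carrier R)" and one: "\<one> \<noteq> \<zero>"
    and un: "\<And>x. x \<in> carrier R \<Longrightarrow> x \<in> Units R \<or> (\<exists>r :: nat. x [^] r = \<zero>)"
  shows "\<exists>(k :: 'a set ring) \<pi>. residue_alg R k F \<pi>"
proof -
  define M where "M = carrier R - Units R"
  have MC: "M \<subseteq> carrier R" unfolding M_def by blast
  have M_mult: "x \<otimes> y \<in> M" if "x \<in> carrier R" "y \<in> M" for x y
    using that unit_factor[of y x] unfolding M_def by (auto simp: m_comm)
  have M_add: "x \<oplus> y \<in> M" if x: "x \<in> M" and y: "y \<in> M" for x y
  proof (rule ccontr)
    assume "x \<oplus> y \<notin> M"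
    then have u: "x \<oplus> y \<in> Units R" using x y unfolding M_def by auto
    have C: "x \<in> carrier R" "y \<in> carrier R" using x y MC by auto
    define i where "i = inv (x \<oplus> y)"
    have i: "i \<in> carrier R" "i \<otimes> (x \<oplus> y) = \<one>" unfolding i_def using u by (auto simp: Units_l_inv)
    \<comment> \<open>Scaling by the inverse of the unit x + y reduces the claim to two non-units a
      and 1 - a; nilpotency of a makes 1 - a a unit.\<close>
    define a where "a = i \<otimes> x"
    have a: "a \<in> M" "i \<otimes> y \<in> M" unfolding a_def using M_mult i x y by auto
    have aC: "a \<in> carrier R" using a MC by blast
    have "i \<otimes> y = i \<otimes> (x \<oplus> y) \<ominus> a" unfolding a_def using i(1) C by algebra
    then have yy: "\<one> \<ominus> a \<in> M" using a(2) i(2) by simp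
    obtain r :: nat where r: "a [^] r = \<zero>" using un[OF aC] a(1) unfolding M_def by blast
    obtain z where z: "z \<in> carrier R" "(\<one> \<ominus> a) \<otimes> z = \<one> \<ominus> a [^] r" using one_minus_nilpotent[OF aC] by blast
    have "(\<one> \<ominus> a) \<otimes> z = \<one>" unfolding z(2) r by (simp add: minus_eq)
    then have "\<one> \<in> M" using M_mult[OF z(1) yy] z(1) aC by (simp add: m_comm)
    then show False unfolding M_def by simp
  qed
  have zeroM: "\<zero> \<in> M"
  proof -
    have "\<zero> \<notin> Units R" using one Units_l_inv[of \<zero>] Units_inv_closed[of \<zero>] by (metis r_null)
    then show ?thesis unfolding M_def by simp
  qed
  have M: "ideal M R"
  proof (rule idealI[OF ring_axioms])
    show "subgroup M (add_monoid R)"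
    proof (rule add.subgroupI)
      show "M \<subseteq> carrier R" by (rule MC)
      show "M \<noteq> {}" using zeroM by blast
      show "\<ominus> x \<in> M" if "x \<in> M" for x
      proof -
        have "(\<ominus> \<one>) \<otimes> x \<in> M" using M_mult that by simp
        moreover have "(\<ominus> \<one>) \<otimes> x = \<ominus> x" using that MC by (auto simp: l_minus)
        ultimately show ?thesis by simp
      qed
    qed (rule M_add)
    show "x \<otimes> a \<in> M" if "a \<in> M" "x \<in> carrier R" for a x using M_mult that by blast
    show "a \<otimes> x \<in> M" if "a \<in> M" "x \<in> carrier R" for a x
      using M_mult[OF that(2,1)] m_comm[of a x] that MC by auto
  qed
  interpret M: ideal M R by (rule M)
  have max: "maximalideal M R"
  proof (rule maximalidealI[OF M])
    show "carrier R \<noteq> M" using one_closed unfolding M_def by auto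
    fix J assume J: "ideal J R" "M \<subseteq> J" "J \<subseteq> carrier R"
    interpret J: ideal J R by (rule J)
    show "J = M \<or> J = carrier R"
    proof (cases "J = M")
      case False
      then obtain u where u: "u \<in> J" "u \<in> Units R" using J unfolding M_def by blast
      have "inv u \<otimes> u \<in> J" using J.I_l_closed[OF u(1) Units_inv_closed[OF u(2)]] .
      then have "\<one> \<in> J" using u(2) by (simp add: Units_l_inv)
      then show ?thesis using J.one_imp_carrier by blast
    qed simp
  qed
  have "residue_alg R (R Quot M) F ((+>) M)"
  proof (intro residue_alg.intro residue_alg_axioms.intro is_cring sf fd)
    show "field (R Quot M)" by (rule maximalideal.quotient_is_field[OF max is_cring])
    show "(+>) M \<in> ring_hom R (R Quot M)" by (rule M.rcos_ring_hom)
    show "(+>) M ` carrier R = carrier (R Quot M)" unfolding FactRing_def A_RCOSETS_def' by auto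
    show "x \<in> Units R" if "x \<in> carrier R" "M +> x \<noteq> \<zero>\<^bsub>R Quot M\<^esub>" for x
    proof (rule ccontr)
      assume "x \<notin> Units R"
      then have "M +> x = M" using that(1) M.a_rcos_const[of x] unfolding M_def by blast
      then show False using that(2) by (simp add: FactRing_def)
    qed
  qed
  then show ?thesis by blast
qed

end

section \<open>Hochschild cohomology\<close>

lemma (in abelian_monoid) finsum_lessThan_Suc:
  assumes "\<And>i. i \<le> n \<Longrightarrow> h i \<in> carrier G"
  shows "(\<Oplus>i\<in>{..<Suc n}. h i) = h 0 \<oplus> (\<Oplus>i\<in>{..<n}. h (Suc i))"
proof -
  have "(\<Oplus>i\<in>insert 0 (Suc ` {..<n}). h i) = h 0 \<oplus> (\<Oplus>i\<in>Suc ` {..<n}. h i)"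
    using assms by (intro finsum_insert) auto
  also have "(\<Oplus>i\<in>Suc ` {..<n}. h i) = (\<Oplus>i\<in>{..<n}. h (Suc i))"
    using assms by (intro finsum_reindex) auto
  finally show ?thesis unfolding lessThan_Suc_eq_insert_0 .
qed

context cring
begin

definition contract :: "nat \<Rightarrow> 'a list \<Rightarrow> 'a list" where
  "contract i bs = take i bs @ (bs ! i \<otimes> bs ! Suc i) # drop (Suc (Suc i)) bs"

lemma contract_closed:
  assumes "set bs \<subseteq> carrier R" "Suc i < length bs"
  shows "set (contract i bs) \<subseteq> carrier R"
proof -
  have "bs ! i \<in> carrier R" "bs ! Suc i \<in> carrier R" using assms nth_mem[of i bs] nth_mem[of "Suc i" bs] by auto
  moreover have "set (take i bs) \<subseteq> carrier R" "set (drop (Suc (Suc i)) bs) \<subseteq> carrier R"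
    using assms(1) set_take_subset[of i bs] set_drop_subset[of "Suc (Suc i)" bs] by auto
  ultimately show ?thesis unfolding contract_def by simp
qed

lemma contract_Cons: "contract (Suc i) (x # bs) = x # contract i bs"
  by (simp add: contract_def)

text \<open>The induction undoes the telescoping in \<open>ldiff\<close>: the recursive call loses
  its first term, and its inner sum is shifted by one index with a change of sign.\<close>

lemma ldiff_eq_hochschild:
  assumes "f \<in> lfun" "set bs \<subseteq> carrier R" "length bs = Suc n"
  shows "ldiff f bs = bs ! 0 \<otimes> f (tl bs)
    \<oplus> (\<Oplus>i\<in>{..<n}. (\<ominus> \<one>) [^] Suc i \<otimes> f (contract i bs))
    \<oplus> (\<ominus> \<one>) [^] Suc n \<otimes> (f (butlast bs) \<otimes> bs ! n)"
  using assms
proof (induction n arbitrary: f bs)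
  case 0
  then obtain x where x: "bs = [x]" by (cases bs) auto
  have c: "x \<in> carrier R" "f [] \<in> carrier R" using 0 x by auto
  have "x \<otimes> f [] \<oplus> \<zero> \<oplus> (\<ominus> \<one>) \<otimes> (f [] \<otimes> x) = \<zero>" using c by algebra
  then show ?case unfolding x using c by simp
next
  case (Suc n)
  then obtain x b bs' where x: "bs = x # b # bs'" by (cases bs; cases "tl bs") auto
  define cs where "cs = b # bs'"
  have cs: "set cs \<subseteq> carrier R" "length cs = Suc n" "x \<in> carrier R" "b \<in> carrier R" "set bs' \<subseteq> carrier R"
    using Suc.prems x unfolding cs_def by auto
  have bl: "set (butlast cs) \<subseteq> carrier R" using cs(1) by (meson in_set_butlastD subset_iff)
  have fc: "f ds \<in> carrier R" if "set ds \<subseteq> carrier R" for ds using Suc.prems(1) that by simp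
  define h where "h i = (\<ominus> \<one>) [^] Suc i \<otimes> f (contract i bs)" for i
  have hC: "h i \<in> carrier R" if "i \<le> n" for i
    unfolding h_def using contract_closed[OF Suc.prems(2), of i] Suc.prems(3) that fc by simp
  define u v w where uvw: "u = f cs" "v = f ((x \<otimes> b) # bs')" "w = f (x # bs')"
  define s l where sl: "s = (\<ominus> \<one>) [^] Suc n" "l = cs ! n"
  define z where "z = f (x # butlast cs)"
  have c: "u \<in> carrier R" "v \<in> carrier R" "w \<in> carrier R" "s \<in> carrier R" "l \<in> carrier R" "z \<in> carrier R"
    unfolding uvw sl z_def using cs nth_mem[of n cs] bl by (auto intro!: fc)
  define S where "S = (\<Oplus>i\<in>{..<n}. (\<ominus> \<one>) [^] Suc i \<otimes> lp x f (contract i cs))"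
  have a: "(\<ominus> \<one>) [^] Suc i \<otimes> lp x f (contract i cs) \<in> carrier R" if "i < n" for i
  proof -
    have d: "set (contract i cs) \<subseteq> carrier R" using contract_closed[OF cs(1), of i] cs that by simp
    have "f (x # contract i cs) \<in> carrier R" using d cs by (intro fc) simp
    then show ?thesis using d by simp
  qed
  have Sh: "(\<Oplus>i\<in>{..<n}. h (Suc i)) = \<ominus> S"
  proof -
    have "(\<ominus> \<one>) \<otimes> S = (\<Oplus>i\<in>{..<n}. (\<ominus> \<one>) \<otimes> ((\<ominus> \<one>) [^] Suc i \<otimes> lp x f (contract i cs)))"
      unfolding S_def using a by (intro finsum_rdistr) auto
    also have "\<dots> = (\<Oplus>i\<in>{..<n}. h (Suc i))"
    proof (rule finsum_cong')
      show "(\<lambda>i. h (Suc i)) \<in> {..<n} \<rightarrow> carrier R" using hC by auto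
      fix i assume "i \<in> {..<n}"
      then have i: "i < n" by simp
      have d: "set (contract i cs) \<subseteq> carrier R" using contract_closed[OF cs(1), of i] cs i by simp
      have fd: "f (x # contract i cs) \<in> carrier R" using d cs by (intro fc) simp
      show "(\<ominus> \<one>) \<otimes> ((\<ominus> \<one>) [^] Suc i \<otimes> lp x f (contract i cs)) = h (Suc i)"
        unfolding h_def x cs_def[symmetric] contract_Cons lp_apply[OF d] using fd by (simp add: m_ac)
    qed simp
    finally have "(\<ominus> \<one>) \<otimes> S = (\<Oplus>i\<in>{..<n}. h (Suc i))" .
    moreover have "S \<in> carrier R" unfolding S_def using a by (intro finsum_closed) auto
    ultimately show ?thesis by (simp add: l_minus)
  qed
  have SC: "S \<in> carrier R" unfolding S_def using a by (intro finsum_closed) auto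
  have IH: "ldiff (lp x f) cs = b \<otimes> w \<oplus> S \<oplus> s \<otimes> (z \<otimes> l)"
  proof -
    have "ldiff (lp x f) cs = cs ! 0 \<otimes> lp x f (tl cs) \<oplus> S \<oplus> s \<otimes> (lp x f (butlast cs) \<otimes> cs ! n)"
      unfolding S_def sl using Suc.prems(1) cs by (intro Suc.IH) auto
    then show ?thesis unfolding sl z_def uvw using cs bl by (simp add: cs_def)
  qed
  have h0: "h 0 = \<ominus> v"
    unfolding h_def uvw contract_def x using c(2) uvw by (simp add: l_minus)
  have "ldiff f bs = pdiff x f cs \<ominus> ldiff (lp x f) cs" unfolding x cs_def by simp
  also have "pdiff x f cs = x \<otimes> u \<ominus> v \<oplus> b \<otimes> w" unfolding uvw cs_def by simp
  also have "x \<otimes> u \<ominus> v \<oplus> b \<otimes> w \<ominus> ldiff (lp x f) cs = x \<otimes> u \<oplus> (\<ominus> v \<oplus> \<ominus> S) \<oplus> (s \<otimes> (\<ominus> \<one>)) \<otimes> (z \<otimes> l)"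
    unfolding IH using c SC cs(3,4) by algebra
  also have "\<ominus> v \<oplus> \<ominus> S = (\<Oplus>i\<in>{..<Suc n}. h i)"
    unfolding h0[symmetric] Sh[symmetric] using hC by (intro finsum_lessThan_Suc[symmetric])
  also have "x \<otimes> u = bs ! 0 \<otimes> f (tl bs)" unfolding x uvw cs_def by simp
  also have "z \<otimes> l = f (butlast bs) \<otimes> bs ! Suc n" unfolding x z_def sl cs_def by simp
  also have "s \<otimes> (\<ominus> \<one>) = (\<ominus> \<one>) [^] Suc (Suc n)" unfolding sl by simp
  finally show ?case unfolding h_def .
qed

lemma ldiff_eq_zero:
  assumes "f \<in> lfun" "set bs \<subseteq> carrier R"
    and "\<And>cs. set cs \<subseteq> carrier R \<Longrightarrow> Suc (length cs) = length bs \<Longrightarrow> f cs = \<zero>"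
  shows "ldiff f bs = \<zero>"
  using assms
proof (induction f bs rule: ldiff.induct)
  case (3 f x b bs)
  have "ldiff (lp x f) (b # bs) = \<zero>" using "3.prems" by (intro "3.IH") auto
  moreover have "f (b # bs) = \<zero>" "f ((x \<otimes> b) # bs) = \<zero>" "f (x # bs) = \<zero>" using 3 by auto
  ultimately show ?case using 3 by (simp add: minus_eq)
qed simp_all

end

section \<open>Algebras over a field and the two forms of cochains\<close>

locale field_algebra = algebra K S + K: field K
  for K :: "('k, 'r) ring_scheme" and S :: "('k, 'a, 'm) module_scheme" (structure)
begin

definition scal :: "'k \<Rightarrow> 'a" where "scal c = c \<odot> \<one>"

definition scals :: "'a set" where "scals = scal ` carrier K"

lemma scal_closed: "c \<in> carrier K \<Longrightarrow> scal c \<in> carrier S" unfolding scal_def by simp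

lemma smult_scal: "c \<in> carrier K \<Longrightarrow> x \<in> carrier S \<Longrightarrow> c \<odot> x = scal c \<otimes> x"
  unfolding scal_def by (simp add: smult_assoc2)

lemma scal_hom: "scal \<in> ring_hom K S"
proof (rule ring_hom_memI)
  fix c d assume "c \<in> carrier K" "d \<in> carrier K"
  then show "scal (c \<otimes>\<^bsub>K\<^esub> d) = scal c \<otimes> scal d" "scal (c \<oplus>\<^bsub>K\<^esub> d) = scal c \<oplus> scal d"
    using smult_scal[of c "scal d"] by (simp_all add: scal_def smult_assoc1 smult_l_distr)
qed (simp_all add: scal_def)

lemma scals_subfield: "\<one> \<noteq> \<zero> \<Longrightarrow> subfield scals S"
proof -
  assume one: "\<one> \<noteq> \<zero>"
  interpret h: ring_hom_ring K S scal
    by (intro ring_hom_ringI2 R.ring_axioms ring_axioms scal_hom)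
  show "subfield scals S" unfolding scals_def by (rule h.img_is_subfield(2)[OF K.carrier_is_subfield one])
qed

abbreviation tuples :: "nat \<Rightarrow> (nat \<Rightarrow> 'a) set" where "tuples n \<equiv> {..<n} \<rightarrow>\<^sub>E carrier S"

definition to_fun :: "nat \<Rightarrow> ('a list \<Rightarrow> 'a) \<Rightarrow> (nat \<Rightarrow> 'a) \<Rightarrow> 'a" where
  "to_fun n f = (\<lambda>a \<in> tuples n. f (map a [0..<n]))"

definition of_fun :: "nat \<Rightarrow> ((nat \<Rightarrow> 'a) \<Rightarrow> 'a) \<Rightarrow> 'a list \<Rightarrow> 'a" where
  "of_fun n g bs = (if length bs = n then g (\<lambda>j\<in>{..<n}. bs ! j) else \<zero>)"

lemma map_closed: "a \<in> tuples n \<Longrightarrow> set (map a [0..<n]) \<subseteq> carrier S"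
  by (auto simp: PiE_iff)

lemma nth_tuple: "set bs \<subseteq> carrier S \<Longrightarrow> length bs = n \<Longrightarrow> (\<lambda>j\<in>{..<n}. bs ! j) \<in> tuples n"
  by (auto simp: subset_iff)

lemma map_nth_tuple: "length bs = n \<Longrightarrow> map (\<lambda>j\<in>{..<n}. bs ! j) [0..<n] = bs"
  by (intro nth_equalityI) auto

lemma tuple_map: "a \<in> tuples n \<Longrightarrow> (\<lambda>j\<in>{..<n}. map a [0..<n] ! j) = a"
  by (intro ext) (auto simp: PiE_iff extensional_def)

lemma map_upd:
  "i < n \<Longrightarrow> map (a(i := x)) [0..<n] = take i (map a [0..<n]) @ x # drop (Suc i) (map a [0..<n])"
  by (intro nth_equalityI) (auto simp: nth_append nth_Cons')

lemma to_fun_cochain: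
  assumes f: "f \<in> mlin scals"
  shows "to_fun n f \<in> hochschild_cochains K S n"
proof -
  have fl: "f \<in> lfun" using f by simp
  have cl: "to_fun n f \<in> tuples n \<rightarrow>\<^sub>E carrier S"
    unfolding to_fun_def using fl map_closed by (auto simp: PiE_iff)
  have "to_fun n f (a(i := x \<oplus> y)) = to_fun n f (a(i := x)) \<oplus> to_fun n f (a(i := y))
      \<and> (\<forall>c \<in> carrier K. to_fun n f (a(i := c \<odot> x)) = c \<odot> to_fun n f (a(i := x)))"
    if a: "a \<in> tuples n" and i: "i < n" and x: "x \<in> carrier S" and y: "y \<in> carrier S" for a i x y
  proof -
    define p q where pq: "p = take i (map a [0..<n])" "q = drop (Suc i) (map a [0..<n])"
    have C: "set p \<subseteq> carrier S" "set q \<subseteq> carrier S" unfolding pq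
      using map_closed[OF a] set_take_subset[of i "map a [0..<n]"] set_drop_subset[of "Suc i" "map a [0..<n]"] by auto
    have e: "to_fun n f (a(i := u)) = f (p @ u # q)" if u: "u \<in> carrier S" for u
    proof -
      have "a(i := u) \<in> tuples n" using a i u by (auto simp: PiE_iff extensional_def)
      then show ?thesis unfolding to_fun_def pq map_upd[OF i, symmetric] by simp
    qed
    note l = linD[OF mlinD[OF f C]]
    have "to_fun n f (a(i := c \<odot> x)) = c \<odot> to_fun n f (a(i := x))" if c: "c \<in> carrier K" for c
    proof -
      have F: "scal c \<in> scals" unfolding scals_def using c by blast
      have "f (p @ x # q) \<in> carrier S" using l(1)[OF x] .
      then show ?thesis using l(3)[OF F x] c x scal_closed[OF c] by (simp add: e smult_scal)
    qed
    then show ?thesis using l(2)[OF x y] x y by (simp add: e)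
  qed
  then show ?thesis using cl unfolding hochschild_cochains_def by blast
qed

lemma of_fun_mlin:
  assumes g: "g \<in> hochschild_cochains K S n"
  shows "of_fun n g \<in> mlin scals"
proof (rule mlinI)
  have gC: "g a \<in> carrier S" if "a \<in> tuples n" for a
    using g that unfolding hochschild_cochains_def by (auto simp: PiE_iff)
  show "of_fun n g \<in> lfun" using gC nth_tuple by (intro lfunI) (auto simp: of_fun_def)
  fix bs cs :: "'a list" assume bs: "set bs \<subseteq> carrier S" and cs: "set cs \<subseteq> carrier S"
  show "(\<lambda>u. of_fun n g (bs @ u # cs)) \<in> lin scals"
  proof (cases "length bs + Suc (length cs) = n")
    case True
    define a where "a = (\<lambda>j\<in>{..<n}. (bs @ \<zero> # cs) ! j)"
    have a: "a \<in> tuples n" unfolding a_def using bs cs True by (intro nth_tuple) auto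
    define i where "i = length bs"
    have i: "i < n" unfolding i_def using True by simp
    have e: "of_fun n g (bs @ u # cs) = g (a(i := u))" for u
    proof -
      have "(\<lambda>j\<in>{..<n}. (bs @ u # cs) ! j) = a(i := u)"
        unfolding a_def i_def using True by (intro ext) (auto simp: nth_append nth_Cons')
      then show ?thesis unfolding of_fun_def using True by simp
    qed
    have up: "a(i := u) \<in> tuples n" if "u \<in> carrier S" for u using a i that by (auto simp: PiE_iff extensional_def)
    have G: "(\<forall>x \<in> carrier S. \<forall>y \<in> carrier S. g (a(i := x \<oplus> y)) = g (a(i := x)) \<oplus> g (a(i := y))) \<and>
          (\<forall>c \<in> carrier K. \<forall>x \<in> carrier S. g (a(i := c \<odot> x)) = c \<odot> g (a(i := x)))"
      using g a i unfolding hochschild_cochains_def by blast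
    show ?thesis unfolding e
    proof (rule linI)
      show "g (a(i := x)) \<in> carrier S" if "x \<in> carrier S" for x using gC up that by blast
      show "g (a(i := x \<oplus> y)) = g (a(i := x)) \<oplus> g (a(i := y))" if "x \<in> carrier S" "y \<in> carrier S" for x y
        using G that by blast
      fix c x assume c: "c \<in> scals" and x: "x \<in> carrier S"
      obtain d where d: "d \<in> carrier K" "c = scal d" using c unfolding scals_def by blast
      have "g (a(i := d \<odot> x)) = d \<odot> g (a(i := x))" using G d x by blast
      then show "g (a(i := c \<otimes> x)) = c \<otimes> g (a(i := x))"
        using smult_scal[OF d(1) x] smult_scal[OF d(1) gC[OF up[OF x]]] d(2) by simp
    qed
  next
    case False
    have "c \<otimes> \<zero> = \<zero>" if "c \<in> scals" for c using that scal_closed unfolding scals_def by auto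
    then show ?thesis using False by (intro linI) (auto simp: of_fun_def)
  qed
qed

lemma differential_to_fun:
  assumes f: "f \<in> lfun" and a: "a \<in> tuples (Suc n)"
  shows "hochschild_differential S n (to_fun n f) a = ldiff f (map a [0..<Suc n])"
proof -
  define L where "L = map a [0..<Suc n]"
  have L: "set L \<subseteq> carrier S" "length L = Suc n" unfolding L_def using map_closed[OF a] by simp_all
  have nth: "L ! i = a i" if "i \<le> n" for i unfolding L_def using that by (simp add: nth_append del: upt_Suc)
  have aC: "a i \<in> carrier S" if "i \<le> n" for i using a that by (auto simp: PiE_iff)
  have e: "to_fun n f (restrict b {..<n}) = f (map b [0..<n])" if "\<And>j. j < n \<Longrightarrow> b j \<in> carrier S" for b
  proof -
    have "map (restrict b {..<n}) [0..<n] = map b [0..<n]" by (intro map_cong) auto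
    moreover have "to_fun n f (restrict b {..<n}) = f (map (restrict b {..<n}) [0..<n])"
      unfolding to_fun_def using that by (simp add: PiE_iff)
    ultimately show ?thesis by (simp only:)
  qed
  have 1: "to_fun n f (\<lambda>j\<in>{..<n}. a (Suc j)) = f (tl L)"
  proof -
    have "map (\<lambda>j. a (Suc j)) [0..<n] = tl L"
      by (intro nth_equalityI) (auto simp: L(2) nth_tl nth)
    then show ?thesis using e[of "\<lambda>j. a (Suc j)"] aC by simp
  qed
  have 2: "to_fun n f (restrict a {..<n}) = f (butlast L)"
  proof -
    have "map a [0..<n] = butlast L"
      by (intro nth_equalityI) (auto simp: L(2) nth_butlast nth)
    then show ?thesis using e[of a] aC by simp
  qed
  have 3: "to_fun n f (\<lambda>j\<in>{..<n}. if j < i then a j else if j = i then a i \<otimes> a (Suc i) else a (Suc j)) = f (contract i L)"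
    if i: "i < n" for i
  proof -
    have "map (\<lambda>j. if j < i then a j else if j = i then a i \<otimes> a (Suc i) else a (Suc j)) [0..<n] = contract i L"
      using i by (intro nth_equalityI) (auto simp: contract_def L(2) nth_append nth_Cons' nth)
    then show ?thesis
      using e[of "\<lambda>j. if j < i then a j else if j = i then a i \<otimes> a (Suc i) else a (Suc j)"] aC i by simp
  qed
  have fC: "f (contract i L) \<in> carrier S" if "i < n" for i
    using contract_closed[OF L(1), of i] L(2) that f by simp
  have "hochschild_differential S n (to_fun n f) a = a 0 \<otimes> f (tl L)
    \<oplus> (\<Oplus>i\<in>{..<n}. (\<ominus> \<one>) [^] Suc i \<otimes> to_fun n f (\<lambda>j\<in>{..<n}. if j < i then a j
        else if j = i then a i \<otimes> a (Suc i) else a (Suc j))) \<oplus> (\<ominus> \<one>) [^] Suc n \<otimes> (f (butlast L) \<otimes> a n)"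
    unfolding hochschild_differential_def using a by (simp add: 1 2)
  also have "(\<Oplus>i\<in>{..<n}. (\<ominus> \<one>) [^] Suc i \<otimes> to_fun n f (\<lambda>j\<in>{..<n}. if j < i then a j
        else if j = i then a i \<otimes> a (Suc i) else a (Suc j))) = (\<Oplus>i\<in>{..<n}. (\<ominus> \<one>) [^] Suc i \<otimes> f (contract i L))"
    by (rule finsum_cong') (use fC 3 in auto)
  also have "a 0 \<otimes> f (tl L) \<oplus> \<dots> \<oplus> (\<ominus> \<one>) [^] Suc n \<otimes> (f (butlast L) \<otimes> a n) = ldiff f L"
    unfolding ldiff_eq_hochschild[OF f L] nth[of 0, simplified] nth[of n, simplified] ..
  finally show ?thesis unfolding L_def .
qed

lemma to_fun_of_fun:
  assumes g: "g \<in> hochschild_cochains K S n"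
  shows "to_fun n (of_fun n g) = g"
proof
  fix a
  show "to_fun n (of_fun n g) a = g a"
    using g tuple_map[of a n] unfolding to_fun_def of_fun_def hochschild_cochains_def
    by (cases "a \<in> tuples n") (auto simp: PiE_iff extensional_def)
qed

lemma zero_mlin: "(\<lambda>_. \<zero>) \<in> mlin scals"
  using scal_closed by (intro mlinI lfunI linI) (auto simp: scals_def)

lemma differential_eq:
  assumes f: "f \<in> lfun" and e: "\<And>bs. set bs \<subseteq> carrier S \<Longrightarrow> ldiff f bs = h bs"
  shows "hochschild_differential S n (to_fun n f) = to_fun (Suc n) h"
proof
  fix a
  show "hochschild_differential S n (to_fun n f) a = to_fun (Suc n) h a"
  proof (cases "a \<in> tuples (Suc n)")
    case True
    then show ?thesis using differential_to_fun[OF f True] e[OF map_closed[OF True]] by (simp add: to_fun_def)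
  next
    case False
    then show ?thesis by (simp add: hochschild_differential_def to_fun_def)
  qed
qed

text \<open>Triviality makes the coset of g equal to the set of coboundaries; as the zero cochain is
  a coboundary, g = 0 + g lies in that coset.\<close>

lemma coboundary_if_trivial:
  assumes triv: "trivial_group (hochschild_cohomology K S n)" and g: "g \<in> hochschild_cocycles K S n"
  shows "g \<in> hochschild_coboundaries K S n"
proof -
  let ?C = "(hochschild_cochain_group K S n)\<lparr>carrier := hochschild_cocycles K S n\<rparr>"
  let ?B = "hochschild_coboundaries K S n"
  have "carrier (?C Mod ?B) = {?B}"
    using triv unfolding trivial_group_def hochschild_cohomology_def by simp
  then have "?B #>\<^bsub>?C\<^esub> g = ?B" using g unfolding carrier_FactGroup by auto
  moreover have "to_fun n (\<lambda>_. \<zero>) \<in> ?B"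
  proof (cases n)
    case (Suc m)
    have "ldiff (\<lambda>_. \<zero>) bs = \<zero>" if "set bs \<subseteq> carrier S" for bs
      using ldiff_eq_zero[of "\<lambda>_. \<zero>", OF _ that] by (simp add: lfunI)
    then have "hochschild_differential S m (to_fun m (\<lambda>_. \<zero>)) = to_fun (Suc m) (\<lambda>_. \<zero>)"
      by (intro differential_eq lfunI) auto
    then show ?thesis unfolding Suc using to_fun_cochain[OF zero_mlin, of m] by (auto intro: rev_image_eqI)
  qed (simp add: hochschild_cochain_group_def to_fun_def)
  moreover have "to_fun n (\<lambda>_. \<zero>) \<otimes>\<^bsub>?C\<^esub> g = g"
  proof
    fix a
    have "g \<in> tuples n \<rightarrow>\<^sub>E carrier S" using g unfolding hochschild_cocycles_def hochschild_cochains_def by blast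
    then show "(to_fun n (\<lambda>_. \<zero>) \<otimes>\<^bsub>?C\<^esub> g) a = g a"
      by (cases "a \<in> tuples n") (auto simp: hochschild_cochain_group_def to_fun_def PiE_iff extensional_def)
  qed
  ultimately show ?thesis unfolding r_coset_def by blast
qed

lemma not_trivial_if_nontrivial:
  assumes nt: "nontrivial_cocycle scals n f"
  shows "\<not> trivial_group (hochschild_cohomology K S n)"
proof
  assume triv: "trivial_group (hochschild_cohomology K S n)"
  have f: "f \<in> mlin scals" and z: "\<And>bs. set bs \<subseteq> carrier S \<Longrightarrow> ldiff f bs = \<zero>"
    and len: "\<And>bs. set bs \<subseteq> carrier S \<Longrightarrow> length bs \<noteq> n \<Longrightarrow> f bs = \<zero>"
    and nex: "\<And>g. g \<in> mlin scals \<Longrightarrow> (\<And>bs. set bs \<subseteq> carrier S \<Longrightarrow> ldiff g bs = f bs) \<Longrightarrow> False"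
    using nt unfolding nontrivial_cocycle_def by blast+
  have fl: "f \<in> lfun" using f by simp
  have "hochschild_differential S n (to_fun n f) = to_fun (Suc n) (\<lambda>_. \<zero>)"
    using z by (intro differential_eq[OF fl])
  then have "to_fun n f \<in> hochschild_cocycles K S n"
    unfolding hochschild_cocycles_def using to_fun_cochain[OF f] by (simp add: hochschild_cochain_group_def to_fun_def)
  then have cob: "to_fun n f \<in> hochschild_coboundaries K S n" by (rule coboundary_if_trivial[OF triv])
  show False
  proof (cases n)
    \<comment> \<open>In degree 0 the only coboundary is zero, so f vanishes on all lists and is the
      differential of the zero function.\<close>
    case 0
    have "to_fun 0 f (\<lambda>_. undefined) = \<zero>" using cob unfolding 0 by (simp add: hochschild_cochain_group_def)
    then have "f [] = \<zero>" unfolding to_fun_def by simp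
    then have "f bs = \<zero>" if "set bs \<subseteq> carrier S" for bs using len[OF that] 0 by (cases "bs = []") auto
    then show False using ldiff_eq_zero[of "\<lambda>_. \<zero>"] by (intro nex[OF zero_mlin]) (simp add: lfunI)
  next
    case (Suc m)
    then obtain g where g: "g \<in> hochschild_cochains K S m" "to_fun n f = hochschild_differential S m g" using cob by auto
    have gl: "of_fun m g \<in> lfun" using of_fun_mlin[OF g(1)] by simp
    show False
    proof (rule nex[OF of_fun_mlin[OF g(1)]])
      fix bs assume bs: "set bs \<subseteq> carrier S"
      show "ldiff (of_fun m g) bs = f bs"
      proof (cases "length bs = n")
        case True
        define a where "a = (\<lambda>j\<in>{..<n}. bs ! j)"
        have a: "a \<in> tuples n" "map a [0..<n] = bs" unfolding a_def using nth_tuple[OF bs True] map_nth_tuple[OF True] by blast+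
        have "f bs = to_fun n f a" unfolding to_fun_def using a by simp
        also have "\<dots> = hochschild_differential S m (to_fun m (of_fun m g)) a" unfolding g(2) to_fun_of_fun[OF g(1)] ..
        also have "\<dots> = ldiff (of_fun m g) bs" using differential_to_fun[OF gl, of a m] a Suc by simp
        finally show ?thesis ..
      next
        case False
        then have "ldiff (of_fun m g) bs = \<zero>" using Suc by (intro ldiff_eq_zero[OF gl bs]) (simp add: of_fun_def)
        then show ?thesis using len[OF bs False] by simp
      qed
    qed
  qed
qed

text \<open>The map v is the inclusion of a basis for the algebra itself and multiplication by an
  idempotent for a corner, where the images still span but may be dependent.\<close>

lemma finite_dimension_scals:
  assumes B: "finite B" "v \<in> B \<rightarrow> carrier S" and one: "\<one> \<noteq> \<zero>"
    and gen: "\<And>x. x \<in> carrier S \<Longrightarrow> \<exists>c \<in> B \<rightarrow> carrier K. x = (\<Oplus>b\<in>B. c b \<odot> v b)"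
  shows "finite_dimension scals (carrier S)"
proof -
  obtain us where us: "set us = v ` B" using finite_list[of "v ` B"] B(1) by blast
  note sf = scals_subfield[OF one]
  have C: "set us \<subseteq> carrier S" using us B by auto
  have sp: "(\<Oplus>b\<in>A. c b \<odot> v b) \<in> Span scals us" if "A \<subseteq> B" "c \<in> B \<rightarrow> carrier K" for A c
  proof -
    have cC: "c b \<odot> v b \<in> carrier S" if "b \<in> B" for b using \<open>c \<in> B \<rightarrow> carrier K\<close> B(2) that by auto
    have "finite A" using that B finite_subset by blast
    then show ?thesis using that(1)
    proof (induction A)
      case (insert b A)
      have b: "b \<in> B" "v b \<in> carrier S" "v b \<in> set us" "c b \<in> carrier K" using insert that B us by auto
      have "scal (c b) \<otimes> v b \<in> Span scals us"
        using Span_smult_closed[OF sf C] Span_base_incl[OF sf C] b unfolding scals_def by blast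
      then have 1: "c b \<odot> v b \<in> Span scals us" using smult_scal b by simp
      have "(\<Oplus>b\<in>insert b A. c b \<odot> v b) = c b \<odot> v b \<oplus> (\<Oplus>b\<in>A. c b \<odot> v b)"
        using insert cC by (intro finsum_insert) auto
      moreover have "(\<Oplus>b\<in>A. c b \<odot> v b) \<in> Span scals us" using insert by blast
      ultimately show ?case using Span_subgroup_props(3)[OF sf C 1] by simp
    qed (use Span_subgroup_props(2)[OF sf C] in simp)
  qed
  have "carrier S \<subseteq> Span scals us"
  proof
    fix x assume "x \<in> carrier S"
    then obtain c where "c \<in> B \<rightarrow> carrier K" "x = (\<Oplus>b\<in>B. c b \<odot> v b)" using gen by blast
    then show "x \<in> Span scals us" using sp[of B c] by simp
  qed
  then have "Span scals us = carrier S" using Span_subgroup_props(1)[OF sf C] by blast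
  then show ?thesis using Span_finite_dimension[OF sf C] by simp
qed

end

section \<open>Corner rings and primitive idempotents\<close>

context cring
begin

text \<open>The projection x -> e x is multiplicative, and y and e y act alike on values that e
  fixes.\<close>

lemma ldiff_idempotent:
  assumes e: "e \<in> carrier R" "e \<otimes> e = e"
    and "\<And>cs. set cs \<subseteq> carrier R \<Longrightarrow> f (map ((\<otimes>) e) cs) \<in> carrier R \<and> e \<otimes> f (map ((\<otimes>) e) cs) = f (map ((\<otimes>) e) cs)"
    and "set bs \<subseteq> carrier R"
  shows "ldiff (\<lambda>cs. f (map ((\<otimes>) e) cs)) bs = ldiff f (map ((\<otimes>) e) bs)"
  using assms(3,4)
proof (induction bs arbitrary: f)
  case (Cons x bs)
  show ?case
  proof (cases bs)
    case Nil
    then show ?thesis by simp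
  next
    case (Cons b bs')
    have C: "set bs' \<subseteq> carrier R" "x \<in> carrier R" "b \<in> carrier R" "set bs \<subseteq> carrier R" using Cons.prems Cons by auto
    have l: "ldiff (\<lambda>cs. lp (e \<otimes> x) f (map ((\<otimes>) e) cs)) bs = ldiff (lp (e \<otimes> x) f) (map ((\<otimes>) e) bs)"
    proof (rule Cons.IH[OF _ C(4)])
      fix cs assume "set cs \<subseteq> carrier R"
      then show "lp (e \<otimes> x) f (map ((\<otimes>) e) cs) \<in> carrier R \<and>
          e \<otimes> lp (e \<otimes> x) f (map ((\<otimes>) e) cs) = lp (e \<otimes> x) f (map ((\<otimes>) e) cs)"
        using Cons.prems(1)[of "x # cs"] C(2) by (simp add: lp.simps)
    qed
    have lp: "lp x (\<lambda>cs. f (map ((\<otimes>) e) cs)) = (\<lambda>cs. lp (e \<otimes> x) f (map ((\<otimes>) e) cs))"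
      by (intro ext) (simp add: lp.simps)
    have e1: "e \<otimes> (x \<otimes> b) = (e \<otimes> x) \<otimes> (e \<otimes> b)"
    proof -
      have "(e \<otimes> x) \<otimes> (e \<otimes> b) = (e \<otimes> e) \<otimes> (x \<otimes> b)" using e(1) C by (simp add: m_ac)
      then show ?thesis using e(2) by simp
    qed
    have sc: "y \<otimes> f (map ((\<otimes>) e) cs) = (e \<otimes> y) \<otimes> f (map ((\<otimes>) e) cs)" if "y \<in> carrier R" "set cs \<subseteq> carrier R" for y cs
    proof -
      define z where "z = f (map ((\<otimes>) e) cs)"
      have z: "z \<in> carrier R" "e \<otimes> z = z" unfolding z_def using Cons.prems(1)[OF that(2)] by blast+
      have "y \<otimes> z = y \<otimes> (e \<otimes> z)" using z(2) by simp
      also have "\<dots> = (e \<otimes> y) \<otimes> z" using z(1) that(1) e(1) by (simp add: m_ac)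
      finally show ?thesis unfolding z_def .
    qed
    show ?thesis
      using l sc[of x "b # bs'"] sc[of b "x # bs'"] C
      unfolding Cons list.map ldiff.simps pdiff.simps lp e1 by simp
  qed
qed simp

end

context field_algebra
begin

text \<open>Operations and zero are those of S, so that elements and cochains pass between S and eS
  without transport.\<close>

definition corner :: "'a \<Rightarrow> ('k, 'a) module" where
  "corner e = \<lparr>carrier = (\<lambda>x. e \<otimes> x) ` carrier S, monoid.mult = (\<otimes>), one = e,
     ring.zero = \<zero>, add = (\<oplus>), smult = (\<odot>)\<rparr>"

lemma corner_simps [simp]:
  "monoid.mult (corner e) = (\<otimes>)" "one (corner e) = e" "ring.zero (corner e) = \<zero>"
  "add (corner e) = (\<oplus>)" "smult (corner e) = (\<odot>)"
  by (simp_all add: corner_def)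

lemma smult_mult: "c \<in> carrier K \<Longrightarrow> x \<in> carrier S \<Longrightarrow> y \<in> carrier S \<Longrightarrow> x \<otimes> (c \<odot> y) = c \<odot> (x \<otimes> y)"
  using smult_assoc2[of c y x] by (simp add: m_comm)

context
  fixes e assumes e: "e \<in> carrier S" "e \<otimes> e = e"
begin

lemma corner_mem: "y \<in> carrier (corner e) \<longleftrightarrow> y \<in> carrier S \<and> e \<otimes> y = y"
proof
  assume "y \<in> carrier (corner e)"
  then obtain x where x: "x \<in> carrier S" "y = e \<otimes> x" by (auto simp: corner_def)
  have "e \<otimes> (e \<otimes> x) = (e \<otimes> e) \<otimes> x" using e(1) x(1) by (simp add: m_assoc)
  then show "y \<in> carrier S \<and> e \<otimes> y = y" using e x by simp
next
  assume "y \<in> carrier S \<and> e \<otimes> y = y"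
  then show "y \<in> carrier (corner e)" unfolding corner_def by (auto intro!: rev_image_eqI)
qed

lemma corner_carrier: "carrier (corner e) \<subseteq> carrier S" using corner_mem by blast

lemma corner_mult: "x \<in> carrier S \<Longrightarrow> e \<otimes> x \<in> carrier (corner e)" by (auto simp: corner_def)

lemma corner_cring: "cring (corner e)"
proof (rule cringI)
  show "abelian_group (corner e)"
  proof (rule abelian_groupI)
    fix x assume "x \<in> carrier (corner e)"
    then have x: "x \<in> carrier S" "e \<otimes> x = x" using corner_mem by blast+
    have "\<ominus> x \<in> carrier (corner e)" using x e by (simp add: corner_mem r_minus)
    then show "\<exists>y \<in> carrier (corner e). y \<oplus>\<^bsub>corner e\<^esub> x = \<zero>\<^bsub>corner e\<^esub>"
      using x by (intro bexI[of _ "\<ominus> x"]) (simp_all add: l_neg)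
  qed (auto simp: corner_mem e r_distr a_ac)
  show "comm_monoid (corner e)"
  proof (rule comm_monoidI)
    fix x y assume "x \<in> carrier (corner e)" "y \<in> carrier (corner e)"
    then have x: "x \<in> carrier S" "e \<otimes> x = x" "y \<in> carrier S" using corner_mem by blast+
    have "e \<otimes> (x \<otimes> y) = (e \<otimes> x) \<otimes> y" using x(1,3) e(1) by (simp add: m_assoc)
    then show "x \<otimes>\<^bsub>corner e\<^esub> y \<in> carrier (corner e)" using x by (simp add: corner_mem)
  qed (auto simp: corner_mem e m_ac)
qed (auto simp: corner_mem l_distr)

lemma corner_algebra: "algebra K (corner e)"
proof (rule algebraI)
  fix c x assume c: "c \<in> carrier K" and "x \<in> carrier (corner e)"
  then have x: "x \<in> carrier S" "e \<otimes> x = x" using corner_mem by blast+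
  show "c \<odot>\<^bsub>corner e\<^esub> x \<in> carrier (corner e)" using c x e smult_mult[OF c e(1) x(1)] by (simp add: corner_mem)
qed (auto simp: corner_mem smult_l_distr smult_r_distr smult_assoc1 smult_assoc2 R.cring_axioms corner_cring)

lemma corner_field_algebra: "field_algebra K (corner e)"
  by (intro field_algebra.intro corner_algebra K.field_axioms)

interpretation T: field_algebra K "corner e" by (rule corner_field_algebra)

lemma corner_a_inv: "x \<in> carrier (corner e) \<Longrightarrow> \<ominus>\<^bsub>corner e\<^esub> x = \<ominus> x"
proof -
  assume x: "x \<in> carrier (corner e)"
  then have x': "x \<in> carrier S" "e \<otimes> x = x" using corner_mem by blast+
  then have m: "\<ominus> x \<in> carrier (corner e)" using e by (simp add: corner_mem r_minus)
  have "\<ominus> x \<oplus>\<^bsub>corner e\<^esub> x = \<zero>\<^bsub>corner e\<^esub>" using x' by (simp add: l_neg)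
  from T.minus_equality[OF this x m] show ?thesis .
qed

lemma corner_minus:
  "x \<in> carrier (corner e) \<Longrightarrow> y \<in> carrier (corner e) \<Longrightarrow> x \<ominus>\<^bsub>corner e\<^esub> y = x \<ominus> y"
  by (simp add: a_minus_def corner_a_inv)

lemma corner_ldiff:
  assumes "f \<in> T.lfun" "set bs \<subseteq> carrier (corner e)"
  shows "T.ldiff f bs = ldiff f bs"
  using assms
proof (induction f bs rule: T.ldiff.induct)
  case (3 f x b bs)
  have C: "set bs \<subseteq> carrier (corner e)" "x \<in> carrier (corner e)" "b \<in> carrier (corner e)" using "3.prems" by auto
  have xb: "x \<otimes> b \<in> carrier (corner e)" using T.m_closed[OF C(2,3)] by simp
  have IH: "T.ldiff (lp x f) (b # bs) = ldiff (lp x f) (b # bs)"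
    using "3.prems" by (intro "3.IH") auto
  have f: "f (b # bs) \<in> carrier (corner e)" "f ((x \<otimes> b) # bs) \<in> carrier (corner e)" "f (x # bs) \<in> carrier (corner e)"
    using "3.prems"(1) C xb by (auto intro!: T.lfunD)
  have m: "x \<otimes> f (b # bs) \<in> carrier (corner e)" "b \<otimes> f (x # bs) \<in> carrier (corner e)"
    using T.m_closed[OF C(2) f(1)] T.m_closed[OF C(3) f(3)] by simp_all
  have d: "T.ldiff (lp x f) (b # bs) \<in> carrier (corner e)" using "3.prems" C by (intro T.ldiff_closed T.lp_lfun) auto
  have p: "x \<otimes> f (b # bs) \<ominus> f ((x \<otimes> b) # bs) \<in> carrier (corner e)"
    using T.minus_closed[OF m(1) f(2)] corner_minus[OF m(1) f(2)] by simp
  have q: "x \<otimes> f (b # bs) \<ominus> f ((x \<otimes> b) # bs) \<oplus> b \<otimes> f (x # bs) \<in> carrier (corner e)"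
    using T.a_closed[OF p m(2)] by simp
  show ?case
    unfolding T.ldiff.simps T.pdiff.simps ldiff.simps pdiff.simps corner_simps corner_minus[OF m(1) f(2)]
      IH corner_minus[OF q d[unfolded IH]] ..
qed simp_all

lemma corner_scal: "c \<in> carrier K \<Longrightarrow> T.scal c = e \<otimes> scal c"
  unfolding T.scal_def scal_def using e smult_mult[of c e \<one>] by simp

text \<open>The projection of S onto eS transports a cocycle to S. A cochain g bounding it there
  would, multiplied by e and restricted to eS, bound the original cocycle.\<close>

lemma corner_nontrivial_cocycle:
  assumes nt: "T.nontrivial_cocycle T.scals n f"
  shows "\<exists>f. nontrivial_cocycle scals n f"
proof -
  have f: "f \<in> T.mlin T.scals" and z: "\<And>bs. set bs \<subseteq> carrier (corner e) \<Longrightarrow> T.ldiff f bs = \<zero>"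
    and len: "\<And>bs. set bs \<subseteq> carrier (corner e) \<Longrightarrow> length bs \<noteq> n \<Longrightarrow> f bs = \<zero>"
    and nex: "\<And>g. g \<in> T.mlin T.scals \<Longrightarrow> (\<And>bs. set bs \<subseteq> carrier (corner e) \<Longrightarrow> T.ldiff g bs = f bs) \<Longrightarrow> False"
    using nt unfolding T.nontrivial_cocycle_def by auto
  have fl: "f \<in> T.lfun" using f by simp
  let ?m = "map ((\<otimes>) e)"
  have mC: "set (?m bs) \<subseteq> carrier (corner e)" if "set bs \<subseteq> carrier S" for bs
    using that corner_mult by auto
  have fT: "f (?m bs) \<in> carrier S" "e \<otimes> f (?m bs) = f (?m bs)" if "set bs \<subseteq> carrier S" for bs
    using T.lfunD[OF fl mC[OF that]] corner_mem by blast+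
  define h where "h bs = f (?m bs)" for bs
  have hl: "h \<in> lfun" unfolding h_def using fT by (intro lfunI)
  have "h \<in> mlin scals"
  proof (rule mlinI[OF hl])
    fix bs cs :: "'a list" assume bs: "set bs \<subseteq> carrier S" and cs: "set cs \<subseteq> carrier S"
    note l = T.linD[OF T.mlinD[OF f mC[OF bs] mC[OF cs]]]
    show "(\<lambda>u. h (bs @ u # cs)) \<in> lin scals"
    proof (rule linI)
      fix x assume x: "x \<in> carrier S"
      note ex = corner_mult[OF x]
      show "h (bs @ x # cs) \<in> carrier S" using hl bs cs x by simp
      show "h (bs @ (x \<oplus> y) # cs) = h (bs @ x # cs) \<oplus> h (bs @ y # cs)" if y: "y \<in> carrier S" for y
        using l(2)[OF ex corner_mult[OF y]] x y e by (simp add: h_def r_distr)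
      fix c assume "c \<in> scals"
      then obtain d where d: "d \<in> carrier K" "c = scal d" unfolding scals_def by blast
      have cC: "c \<in> carrier S" using d scal_closed by simp
      have "e \<otimes> c \<in> T.scals" unfolding T.scals_def using d corner_scal by auto
      from l(3)[OF this ex]
      have "f (?m bs @ ((e \<otimes> c) \<otimes> (e \<otimes> x)) # ?m cs) = (e \<otimes> c) \<otimes> h (bs @ x # cs)" by (simp add: h_def)
      moreover have "(e \<otimes> c) \<otimes> (e \<otimes> x) = e \<otimes> (c \<otimes> x)"
      proof -
        have "(e \<otimes> c) \<otimes> (e \<otimes> x) = (e \<otimes> e) \<otimes> (c \<otimes> x)" using e(1) cC x by (simp add: m_ac)
        then show ?thesis using e(2) by simp
      qed
      moreover have "(e \<otimes> c) \<otimes> h (bs @ x # cs) = c \<otimes> h (bs @ x # cs)"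
      proof -
        define w where "w = h (bs @ x # cs)"
        have w: "w \<in> carrier S" "e \<otimes> w = w" unfolding w_def h_def using fT[of "bs @ x # cs"] bs cs x by auto
        have "(e \<otimes> c) \<otimes> w = c \<otimes> (e \<otimes> w)" using w(1) cC e(1) by (simp add: m_ac)
        then show ?thesis using w(2) unfolding w_def by simp
      qed
      ultimately show "h (bs @ (c \<otimes> x) # cs) = c \<otimes> h (bs @ x # cs)" by (simp add: h_def)
    qed
  qed
  moreover have "ldiff h bs = \<zero>" if bs: "set bs \<subseteq> carrier S" for bs
  proof -
    have "ldiff h bs = ldiff f (?m bs)"
      unfolding h_def using fT by (intro ldiff_idempotent[OF e _ bs]) blast
    also have "\<dots> = \<zero>" using corner_ldiff[OF fl mC[OF bs]] z[OF mC[OF bs]] by simp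
    finally show ?thesis .
  qed
  moreover have "h bs = \<zero>" if "set bs \<subseteq> carrier S" "length bs \<noteq> n" for bs
    unfolding h_def using len[OF mC[OF that(1)]] that(2) by simp
  moreover have False if g: "g \<in> mlin scals" and gh: "\<And>bs. set bs \<subseteq> carrier S \<Longrightarrow> ldiff g bs = h bs" for g
  proof -
    have gl: "g \<in> lfun" using g by simp
    have CC: "set bs \<subseteq> carrier S" if "set bs \<subseteq> carrier (corner e)" for bs using that corner_carrier by blast
    define g' where "g' bs = e \<otimes> g bs" for bs
    have g'l: "g' \<in> T.lfun" unfolding g'_def using gl CC corner_mult by (intro T.lfunI) auto
    have "g' \<in> T.mlin T.scals"
    proof (rule T.mlinI[OF g'l])
      fix bs cs :: "'a list" assume bs: "set bs \<subseteq> carrier (corner e)" and cs: "set cs \<subseteq> carrier (corner e)"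
      note l = linD[OF mlinD[OF g CC[OF bs] CC[OF cs]]]
      show "(\<lambda>u. g' (bs @ u # cs)) \<in> T.lin T.scals"
      proof (rule T.linI)
        fix x assume x: "x \<in> carrier (corner e)"
        have xS: "x \<in> carrier S" "e \<otimes> x = x" using x corner_mem by blast+
        show "g' (bs @ x # cs) \<in> carrier (corner e)" unfolding g'_def using l(1)[OF xS(1)] corner_mult by blast
        show "g' (bs @ (x \<oplus>\<^bsub>corner e\<^esub> y) # cs) = g' (bs @ x # cs) \<oplus>\<^bsub>corner e\<^esub> g' (bs @ y # cs)"
          if y: "y \<in> carrier (corner e)" for y
        proof -
          have yS: "y \<in> carrier S" using y corner_carrier by blast
          show ?thesis unfolding g'_def using l(2)[OF xS(1) yS] l(1)[OF xS(1)] l(1)[OF yS] e by (simp add: r_distr)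
        qed
        fix c assume "c \<in> T.scals"
        then obtain d where d: "d \<in> carrier K" "c = e \<otimes> scal d" unfolding T.scals_def using corner_scal by auto
        have dC: "scal d \<in> carrier S" using d scal_closed by simp
        have "c \<otimes> x = scal d \<otimes> (e \<otimes> x)" unfolding d(2) using e(1) dC xS(1) by (simp add: m_ac)
        then have "c \<otimes> x = scal d \<otimes> x" using xS(2) by simp
        moreover have "scal d \<in> scals" unfolding scals_def using d(1) by blast
        ultimately have 1: "g (bs @ (c \<otimes> x) # cs) = scal d \<otimes> g (bs @ x # cs)" using l(3)[of "scal d" x] xS(1) by simp
        define w where "w = g (bs @ x # cs)"
        have w: "w \<in> carrier S" unfolding w_def using l(1)[OF xS(1)] .
        have "e \<otimes> (scal d \<otimes> w) = (e \<otimes> e) \<otimes> (scal d \<otimes> w)" using e(2) by simp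
        also have "\<dots> = (e \<otimes> scal d) \<otimes> (e \<otimes> w)" using e(1) dC w by (simp add: m_ac)
        finally have "e \<otimes> (scal d \<otimes> w) = c \<otimes> (e \<otimes> w)" unfolding d(2)[symmetric] .
        then show "g' (bs @ (c \<otimes>\<^bsub>corner e\<^esub> x) # cs) = c \<otimes>\<^bsub>corner e\<^esub> g' (bs @ x # cs)"
          unfolding g'_def corner_simps 1 w_def[symmetric] .
      qed
    qed
    moreover have "T.ldiff g' bs = f bs" if bs: "set bs \<subseteq> carrier (corner e)" for bs
    proof -
      have mb: "?m bs = bs" using bs corner_mem by (intro map_idI) blast
      have "T.ldiff g' bs = ldiff g' bs" by (rule corner_ldiff[OF g'l bs])
      also have "\<dots> = e \<otimes> ldiff g bs" using gl e CC[OF bs] by (intro ldiff_smult) (auto simp: g'_def)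
      also have "\<dots> = f bs" using gh[OF CC[OF bs]] fT(2)[OF CC[OF bs]] unfolding h_def mb by simp
      finally show ?thesis .
    qed
    ultimately show False by (rule nex)
  qed
  ultimately have "nontrivial_cocycle scals n h" unfolding nontrivial_cocycle_def by blast
  then show ?thesis by (rule exI[of _ h])
qed

lemma corner_finsum: "finite A \<Longrightarrow> h \<in> A \<rightarrow> carrier (corner e) \<Longrightarrow> finsum (corner e) h A = finsum S h A"
proof (induction A rule: finite_induct)
  case (insert a A)
  then have "h \<in> A \<rightarrow> carrier S" "h a \<in> carrier S" using corner_carrier by auto
  then show ?case using insert by (simp add: Pi_def)
qed simp

lemma corner_finite_dimension:
  assumes fd: "finite_dimensional K S" and ne: "e \<noteq> \<zero>"
  shows "T.finite_dimension T.scals (carrier (corner e))"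
proof -
  obtain B where B: "finite B" "B \<subseteq> carrier S"
    "\<forall>x \<in> carrier S. \<exists>!c. c \<in> B \<rightarrow>\<^sub>E carrier K \<and> x = (\<Oplus>b\<in>B. c b \<odot> b)"
    using fd unfolding finite_dimensional_def by blast
  show ?thesis
  proof (rule T.finite_dimension_scals[OF B(1), of "(\<otimes>) e"])
    show "(\<otimes>) e \<in> B \<rightarrow> carrier (corner e)" using B(2) corner_mult by auto
    show "\<one>\<^bsub>corner e\<^esub> \<noteq> \<zero>\<^bsub>corner e\<^esub>" using ne by simp
    fix x assume "x \<in> carrier (corner e)"
    then have x: "x \<in> carrier S" "e \<otimes> x = x" using corner_mem by blast+
    obtain c where c: "c \<in> B \<rightarrow>\<^sub>E carrier K" "x = (\<Oplus>b\<in>B. c b \<odot> b)" using B(3) x(1) by blast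
    have cK: "c b \<in> carrier K" "b \<in> carrier S" if "b \<in> B" for b using c(1) that B(2) by auto
    have "x = e \<otimes> (\<Oplus>b\<in>B. c b \<odot> b)" using x(2) unfolding c(2)[symmetric] by simp
    also have "\<dots> = (\<Oplus>b\<in>B. e \<otimes> (c b \<odot> b))" using B(1) e(1) cK by (intro finsum_rdistr) auto
    also have "\<dots> = (\<Oplus>b\<in>B. c b \<odot> (e \<otimes> b))"
      using e(1) cK smult_mult by (intro finsum_cong') auto
    also have "\<dots> = finsum (corner e) (\<lambda>b. c b \<odot> (e \<otimes> b)) B"
    proof (rule corner_finsum[OF B(1), symmetric], rule Pi_I)
      fix b assume "b \<in> B"
      then show "c b \<odot> (e \<otimes> b) \<in> carrier (corner e)" using T.smult_closed[of "c b" "e \<otimes> b"] cK corner_mult by simp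
    qed
    finally have "x = (\<Oplus>\<^bsub>corner e\<^esub>b\<in>B. c b \<odot>\<^bsub>corner e\<^esub> (e \<otimes> b))" by simp
    moreover have "c \<in> B \<rightarrow> carrier K" using c(1) by auto
    ultimately show "\<exists>c \<in> B \<rightarrow> carrier K. x = (\<Oplus>\<^bsub>corner e\<^esub>b\<in>B. c b \<odot>\<^bsub>corner e\<^esub> (e \<otimes> b))" by blast
  qed
qed

text \<open>
  By the parity of the number \<open>E\<close> of dual derivations, one of \<open>m\<close> and \<open>n\<close> is at most \<open>E\<close> or
  of the form \<open>E + 2 i\<close>.
\<close>

lemma corner_separable:
  assumes fd: "finite_dimensional K S" and ne: "e \<noteq> \<zero>"
    and prim: "\<And>f. f \<in> carrier S \<Longrightarrow> f \<otimes> f = f \<Longrightarrow> e \<otimes> f = f \<Longrightarrow> f = \<zero> \<or> f = e"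
    and mn: "even m" "odd n" "trivial_group (hochschild_cohomology K S m)" "trivial_group (hochschild_cohomology K S n)"
  shows "separable_field_extension K (corner e)"
proof -
  note fdT = corner_finite_dimension[OF fd ne]
  have one: "\<one>\<^bsub>corner e\<^esub> \<noteq> \<zero>\<^bsub>corner e\<^esub>" using ne by simp
  note sf = T.scals_subfield[OF one]
  have un: "x \<in> Units (corner e) \<or> (\<exists>r :: nat. x [^]\<^bsub>corner e\<^esub> r = \<zero>\<^bsub>corner e\<^esub>)" if "x \<in> carrier (corner e)" for x
    using that prim corner_mem by (intro T.unit_or_nilpotent[OF sf fdT]) auto
  obtain k :: "'a set ring" and \<pi> where "residue_alg (corner e) k T.scals \<pi>"
    using T.local_residue_alg[OF sf fdT one un] by blast
  then interpret A: residue_alg "corner e" k T.scals \<pi> .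
  have "\<not> (\<exists>D \<in> A.derK. \<exists>a \<in> carrier (corner e). D a \<noteq> \<zero>\<^bsub>k\<^esub>)"
  proof
    assume "\<exists>D \<in> A.derK. \<exists>a \<in> carrier (corner e). D a \<noteq> \<zero>\<^bsub>k\<^esub>"
    then obtain E where E: "\<forall>N. N \<le> E \<or> (\<exists>i. N = E + 2 * i) \<longrightarrow> (\<exists>f. T.nontrivial_cocycle T.scals N f)"
      using A.nontrivial_cocycles by blast
    define N where "N = (if even E then m else n)"
    have "even N = even E" unfolding N_def using mn(1,2) by simp
    then have "N \<le> E \<or> (\<exists>i. N = E + 2 * i)" by presburger
    then obtain f where "T.nontrivial_cocycle T.scals N f" using E by blast
    then have "\<not> trivial_group (hochschild_cohomology K S N)"
      using corner_nontrivial_cocycle not_trivial_if_nontrivial by blast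
    then show False unfolding N_def using mn(3,4) by (simp split: if_splits)
  qed
  from A.separable_if_no_derivation[OF this]
  show ?thesis
    using corner_algebra unfolding separable_field_extension_def T.scals_def T.scal_def by simp
qed

end

section \<open>Families of orthogonal idempotents\<close>

definition orthogonal :: "'a set \<Rightarrow> bool" where
  "orthogonal E \<longleftrightarrow> E \<subseteq> carrier S \<and> (\<forall>e \<in> E. e \<noteq> \<zero> \<and> e \<otimes> e = e) \<and> (\<forall>e \<in> E. \<forall>f \<in> E. e \<noteq> f \<longrightarrow> e \<otimes> f = \<zero>)"

text \<open>The kernel of multiplication by e is a subspace that contains the other members of the
  family but not e.\<close>

lemma orthogonal_independent:
  assumes one: "\<one> \<noteq> \<zero>"
  shows "distinct es \<Longrightarrow> orthogonal (set es) \<Longrightarrow> independent scals es"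
proof (induction es)
  case (Cons e es)
  note sf = scals_subfield[OF one]
  have o: "orthogonal (set es)" using Cons.prems(2) unfolding orthogonal_def by simp
  have C: "set es \<subseteq> carrier S" "e \<in> carrier S" "e \<noteq> \<zero>" "e \<otimes> e = e" using Cons.prems(2) unfolding orthogonal_def by simp_all
  have FC: "scals \<subseteq> carrier S" using sf by (rule subfieldE(3))
  have mul: "c \<otimes> x \<in> {x \<in> carrier S. e \<otimes> x = \<zero>}" if "c \<in> carrier S" "x \<in> {x \<in> carrier S. e \<otimes> x = \<zero>}" for c x
  proof -
    have "e \<otimes> (c \<otimes> x) = c \<otimes> (e \<otimes> x)" using that C(2) by (simp add: m_lcomm)
    then show ?thesis using that by simp
  qed
  have "subalgebra scals {x \<in> carrier S. e \<otimes> x = \<zero>} S"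
    unfolding subalgebra_def subalgebra_axioms_def
  proof (intro conjI allI impI add.subgroupI)
    show "{x \<in> carrier S. e \<otimes> x = \<zero>} \<noteq> {}" using C(2) by (auto intro!: exI[of _ \<zero>])
    show "c \<otimes> x \<in> {x \<in> carrier S. e \<otimes> x = \<zero>}" if "c \<in> scals" "x \<in> {x \<in> carrier S. e \<otimes> x = \<zero>}" for c x
      using mul that FC by blast
  qed (use C(2) in \<open>auto simp: r_distr r_minus\<close>)
  moreover have "set es \<subseteq> {x \<in> carrier S. e \<otimes> x = \<zero>}"
    using Cons.prems C unfolding orthogonal_def by auto
  ultimately have "Span scals es \<subseteq> {x \<in> carrier S. e \<otimes> x = \<zero>}" by (rule subalgebra_Span_incl[OF sf])
  then have "e \<notin> Span scals es" using C(3,4) by auto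
  then show ?case using Cons.IH o Cons.prems(1) C(2) by (intro independent.li_Cons) auto
qed simp

text \<open>The member e is split as f + (e - f). Both parts are fixed by e, hence annihilate the
  other members, and as they are nonzero they differ from these; the family therefore grows by
  one.\<close>

lemma orthogonal_refine:
  assumes E: "finite E" "orthogonal E" and e: "e \<in> E"
    and f: "f \<in> carrier S" "f \<otimes> f = f" "e \<otimes> f = f" "f \<noteq> \<zero>" "f \<noteq> e"
  defines "E' \<equiv> insert f (insert (e \<ominus> f) (E - {e}))"
  shows "finite E' \<and> orthogonal E' \<and> card E' = Suc (card E) \<and> (\<Oplus>x\<in>E'. x) = (\<Oplus>x\<in>E. x)"
proof -
  have EC: "E \<subseteq> carrier S" and ee: "e \<otimes> e = e" "e \<in> carrier S"
    and orth: "\<And>x. x \<in> E - {e} \<Longrightarrow> e \<otimes> x = \<zero>" using E(2) e unfolding orthogonal_def by auto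
  define g where "g = e \<ominus> f"
  have g: "g \<in> carrier S" "g \<noteq> \<zero>" "f \<oplus> g = e" unfolding g_def using ee f by (auto, algebra)
  have fg: "f \<otimes> g = \<zero>"
  proof -
    have "f \<otimes> g = e \<otimes> f \<ominus> f \<otimes> f" unfolding g_def using ee(2) f(1) by algebra
    then show ?thesis unfolding f(2,3) using f(1) by simp
  qed
  have eg: "e \<otimes> g = g"
  proof -
    have "e \<otimes> g = e \<otimes> e \<ominus> e \<otimes> f" unfolding g_def using ee(2) f(1) by algebra
    then show ?thesis unfolding ee(1) f(3) g_def .
  qed
  have gg: "g \<otimes> g = g"
  proof -
    have "g \<otimes> g = e \<otimes> g \<ominus> f \<otimes> g" unfolding g_def using ee(2) f(1) by algebra
    then show ?thesis unfolding eg fg using g(1) by (simp add: minus_eq)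
  qed
  have kill: "y \<otimes> x = \<zero>" if "y \<in> carrier S" "e \<otimes> y = y" "x \<in> E - {e}" for x y
  proof -
    have xC: "x \<in> carrier S" using that EC by blast
    have "y \<otimes> x = (e \<otimes> y) \<otimes> x" using that by simp
    also have "\<dots> = y \<otimes> (e \<otimes> x)" using that(1) xC ee(2) by (simp add: m_ac)
    finally show ?thesis using orth[OF that(3)] that by simp
  qed
  have notin: "y \<notin> E - {e}" if "y \<in> carrier S" "e \<otimes> y = y" "y \<noteq> \<zero>" for y
    using kill[OF that(1,2)] that orth by metis
  have fne: "f \<noteq> g" using fg f by auto
  have E'eq: "E' = insert f (insert g (E - {e}))" unfolding E'_def g_def ..
  have n1: "g \<notin> E - {e}" "f \<notin> insert g (E - {e})" using notin g f eg fne by auto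
  have fin: "finite E'" unfolding E'eq using E(1) by simp
  have card: "card E' = Suc (card E)"
  proof -
    have "card E' = Suc (Suc (card (E - {e})))" unfolding E'eq using E(1) n1 by simp
    also have "Suc (card (E - {e})) = card E" using card_Suc_Diff1[OF E(1) e] .
    finally show ?thesis .
  qed
  have sC: "(\<Oplus>x\<in>E - {e}. x) \<in> carrier S" using EC by (intro finsum_closed) auto
  have "(\<Oplus>x\<in>E'. x) = f \<oplus> (g \<oplus> (\<Oplus>x\<in>E - {e}. x))"
  proof -
    have 1: "(\<Oplus>x\<in>insert f (insert g (E - {e})). x) = f \<oplus> (\<Oplus>x\<in>insert g (E - {e}). x)"
      using n1(2) f g(1) EC E(1) by (intro finsum_insert) auto
    have 2: "(\<Oplus>x\<in>insert g (E - {e}). x) = g \<oplus> (\<Oplus>x\<in>E - {e}. x)"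
      using n1(1) g(1) EC E(1) by (intro finsum_insert) auto
    show ?thesis unfolding E'eq 1 2 ..
  qed
  also have "\<dots> = e \<oplus> (\<Oplus>x\<in>E - {e}. x)" using f(1) g sC by (simp add: a_assoc[symmetric])
  also have "\<dots> = (\<Oplus>x\<in>insert e (E - {e}). x)" using EC E(1) ee by (intro finsum_insert[symmetric]) auto
  also have "insert e (E - {e}) = E" using e by blast
  finally have sum: "(\<Oplus>x\<in>E'. x) = (\<Oplus>x\<in>E. x)" .
  have "orthogonal E'"
    unfolding orthogonal_def
  proof (intro conjI ballI impI)
    show "E' \<subseteq> carrier S" unfolding E'eq using f g EC by auto
    show "x \<noteq> \<zero>" "x \<otimes> x = x" if "x \<in> E'" for x
      using that f g gg E(2) unfolding E'eq orthogonal_def by auto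
    fix x y assume xy: "x \<in> E'" "y \<in> E'" "x \<noteq> y"
    have C: "x \<in> carrier S" "y \<in> carrier S" using xy f g EC unfolding E'eq by auto
    have *: "u \<otimes> v = \<zero>" if "u \<in> {f, g}" "v \<in> E'" "u \<noteq> v" for u v
    proof (cases "v \<in> E - {e}")
      case True
      then show ?thesis using kill[of u v] that(1) f g eg by blast
    next
      case False
      then have "v \<in> {f, g}" using that(2) unfolding E'eq by blast
      then show ?thesis using that(1,3) fg m_comm[of f g] f g by auto
    qed
    show "x \<otimes> y = \<zero>"
    proof (cases "x \<in> {f, g}")
      case True
      then show ?thesis using * xy by blast
    next
      case False
      show ?thesis
      proof (cases "y \<in> {f, g}")
        case True
        then show ?thesis using *[of y x] xy m_comm[OF C] by auto
      next
        case y: False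
        have "x \<in> E" "y \<in> E" using xy False y unfolding E'eq by auto
        then show ?thesis using E(2) xy(3) unfolding orthogonal_def by blast
      qed
    qed
  qed
  then show ?thesis using fin card sum by blast
qed

text \<open>A family of maximal size, bounded by the dimension, cannot be refined, so its members
  are primitive. In the zero ring the empty family has sum 1.\<close>

lemma primitive_idempotents:
  assumes fd: "finite_dimensional K S"
  shows "\<exists>E. finite E \<and> orthogonal E \<and> (\<Oplus>x\<in>E. x) = \<one> \<and>
    (\<forall>e \<in> E. \<forall>f \<in> carrier S. f \<otimes> f = f \<longrightarrow> e \<otimes> f = f \<longrightarrow> f = \<zero> \<or> f = e)"
proof (cases "\<one> = \<zero>")
  case True
  then show ?thesis by (intro exI[of _ "{}"]) (simp add: orthogonal_def)
next
  case one: False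
  note sf = scals_subfield[OF one]
  obtain B where B: "finite B" "B \<subseteq> carrier S"
    "\<forall>x \<in> carrier S. \<exists>!c. c \<in> B \<rightarrow>\<^sub>E carrier K \<and> x = (\<Oplus>b\<in>B. c b \<odot> b)"
    using fd unfolding finite_dimensional_def by blast
  have "finite_dimension scals (carrier S)"
  proof (rule finite_dimension_scals[OF B(1) _ one, of "\<lambda>b. b"])
    fix x assume "x \<in> carrier S"
    then obtain c where "c \<in> B \<rightarrow>\<^sub>E carrier K" "x = (\<Oplus>b\<in>B. c b \<odot> b)" using B(3) by blast
    then show "\<exists>c \<in> B \<rightarrow> carrier K. x = (\<Oplus>b\<in>B. c b \<odot> b)" by (intro bexI[of _ c]) auto
  qed (use B in auto)
  then obtain d where d: "dimension d scals (carrier S)" by blast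
  define P where "P E \<longleftrightarrow> finite E \<and> orthogonal E \<and> (\<Oplus>x\<in>E. x) = \<one>" for E
  have bound: "card E < Suc d" if PE: "P E" for E
  proof -
    have "finite E" using PE unfolding P_def by simp
    then obtain es where es: "set es = E" "distinct es" using finite_distinct_list by blast
    have "independent scals es" using orthogonal_independent[OF one es(2)] es(1) that unfolding P_def by simp
    moreover have "set es \<subseteq> carrier S" using that es unfolding P_def orthogonal_def by simp
    ultimately have "length es \<le> d" using independent_length_le_dimension[OF sf d] by blast
    then show ?thesis using distinct_card[OF es(2)] es(1) by simp
  qed
  have "P {\<one>}" unfolding P_def orthogonal_def using one by simp
  then have "\<exists>E. P E \<and> (\<forall>E'. P E' \<longrightarrow> card E' \<le> card E)"
    using bound by (intro ex_has_greatest_nat[of P _ card "Suc d"]) auto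
  then obtain E where E0: "P E \<and> (\<forall>E'. P E' \<longrightarrow> card E' \<le> card E)" ..
  then have E: "P E" "\<And>E'. P E' \<Longrightarrow> card E' \<le> card E" by simp_all
  have "f = \<zero> \<or> f = e" if "e \<in> E" "f \<in> carrier S" "f \<otimes> f = f" "e \<otimes> f = f" for e f
  proof (rule ccontr)
    assume ne: "\<not> (f = \<zero> \<or> f = e)"
    define E' where "E' = insert f (insert (e \<ominus> f) (E - {e}))"
    have "finite E' \<and> orthogonal E' \<and> card E' = Suc (card E) \<and> (\<Oplus>x\<in>E'. x) = (\<Oplus>x\<in>E. x)"
      unfolding E'_def using E(1) that ne unfolding P_def by (intro orthogonal_refine) auto
    then have "P E'" "card E' = Suc (card E)" using E(1) unfolding P_def by auto
    then show False using E(2)[of E'] by simp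
  qed
  then show ?thesis using E(1) unfolding P_def by blast
qed

lemma iso_product_corners:
  fixes l :: nat
  assumes fin: "finite E" and E: "orthogonal E" and sum: "(\<Oplus>x\<in>E. x) = \<one>" and b: "bij_betw b {..<l} E"
  shows "(\<lambda>x. \<lambda>i\<in>{..<l}. b i \<otimes> x) \<in> algebra_iso K S (product_algebra {..<l} (\<lambda>i. corner (b i)))"
proof -
  define h where "h = (\<lambda>x. \<lambda>i\<in>{..<l}. b i \<otimes> x)"
  let ?P = "product_algebra {..<l} (\<lambda>i. corner (b i))"
  have bE: "b i \<in> E" if "i < l" for i using b that unfolding bij_betw_def by auto
  have bC: "b i \<in> carrier S" and bb: "b i \<otimes> b i = b i" if "i < l" for i
    using bE[OF that] E unfolding orthogonal_def by auto
  have b0: "b i \<otimes> b j = \<zero>" if "i < l" "j < l" "i \<noteq> j" for i j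
    using bE[OF that(1)] bE[OF that(2)] E that b unfolding orthogonal_def bij_betw_def inj_on_def by blast
  have sum1: "(\<Oplus>i\<in>{..<l}. b i) = \<one>"
  proof -
    have "(\<Oplus>x\<in>b ` {..<l}. x) = (\<Oplus>i\<in>{..<l}. b i)"
      using b bC by (intro finsum_reindex) (auto simp: bij_betw_def)
    then show ?thesis using b sum unfolding bij_betw_def by simp
  qed
  have rec: "(\<Oplus>i\<in>{..<l}. b i \<otimes> x) = x" if x: "x \<in> carrier S" for x
  proof -
    have "(\<Oplus>i\<in>{..<l}. b i \<otimes> x) = (\<Oplus>i\<in>{..<l}. b i) \<otimes> x"
      using bC x by (intro finsum_ldistr[symmetric]) auto
    then show ?thesis using sum1 x by simp
  qed
  have hC: "h x \<in> carrier ?P" if "x \<in> carrier S" for x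
    using that corner_mult[OF bC bb] unfolding h_def product_algebra_def by auto
  have hom: "h \<in> ring_hom S ?P"
  proof (rule ring_hom_memI)
    fix x assume x: "x \<in> carrier S"
    show "h x \<in> carrier ?P" by (rule hC[OF x])
    fix y assume y: "y \<in> carrier S"
    have "b i \<otimes> (x \<otimes> y) = (b i \<otimes> x) \<otimes> (b i \<otimes> y)" if "i < l" for i
    proof -
      have "(b i \<otimes> x) \<otimes> (b i \<otimes> y) = (b i \<otimes> b i) \<otimes> (x \<otimes> y)" using bC[OF that] x y by (simp add: m_ac)
      then show ?thesis using bb[OF that] by simp
    qed
    then show "h (x \<otimes> y) = h x \<otimes>\<^bsub>?P\<^esub> h y" unfolding h_def product_algebra_def by (auto intro!: ext)
    show "h (x \<oplus> y) = h x \<oplus>\<^bsub>?P\<^esub> h y"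
      unfolding h_def product_algebra_def using x y bC by (auto intro!: ext simp: r_distr)
  next
    show "h \<one> = \<one>\<^bsub>?P\<^esub>" unfolding h_def product_algebra_def using bC by (auto intro!: ext)
  qed
  have inj: "inj_on h (carrier S)"
  proof (rule inj_onI)
    fix x y assume xy: "x \<in> carrier S" "y \<in> carrier S" "h x = h y"
    have "b i \<otimes> x = b i \<otimes> y" if "i < l" for i using fun_cong[OF xy(3), of i] that unfolding h_def by simp
    then have "(\<Oplus>i\<in>{..<l}. b i \<otimes> x) = (\<Oplus>i\<in>{..<l}. b i \<otimes> y)" using bC xy by (intro finsum_cong') auto
    then show "x = y" using rec xy by simp
  qed
  have surj: "carrier ?P \<subseteq> h ` carrier S"
  proof
    fix y assume y: "y \<in> carrier ?P"
    have yi: "y i \<in> carrier S" "b i \<otimes> y i = y i" if "i < l" for i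
    proof -
      have "y i \<in> carrier (corner (b i))" using y that unfolding product_algebra_def by auto
      then show "y i \<in> carrier S" "b i \<otimes> y i = y i" using corner_mem[OF bC[OF that] bb[OF that]] by blast+
    qed
    \<comment> \<open>The inverse of the decomposition adds up the components; multiplication by b j
      recovers the j-th one by orthogonality.\<close>
    define x where "x = (\<Oplus>i\<in>{..<l}. y i)"
    have x: "x \<in> carrier S" unfolding x_def using yi by (intro finsum_closed) auto
    have "b j \<otimes> x = y j" if j: "j < l" for j
    proof -
      have "b j \<otimes> x = (\<Oplus>i\<in>{..<l}. b j \<otimes> y i)" unfolding x_def using bC[OF j] yi by (intro finsum_rdistr) auto
      also have "\<dots> = (\<Oplus>i\<in>{..<l}. if j = i then y i else \<zero>)"
      proof (rule finsum_cong')
        fix i assume "i \<in> {..<l}"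
        then have i: "i < l" by simp
        show "b j \<otimes> y i = (if j = i then y i else \<zero>)"
        proof (cases "j = i")
          case False
          have "b j \<otimes> y i = b j \<otimes> (b i \<otimes> y i)" using yi(2)[OF i] by simp
          also have "\<dots> = (b j \<otimes> b i) \<otimes> y i" using bC i j yi by (simp add: m_assoc)
          finally show ?thesis using b0[OF j i False] yi[OF i] False by simp
        qed (use yi[OF i] in simp)
      qed (use yi in auto)
      also have "\<dots> = y j" using j yi by (intro add.finprod_singleton) auto
      finally show ?thesis .
    qed
    moreover have "y \<in> extensional {..<l}" using y unfolding product_algebra_def by (simp add: PiE_def)
    ultimately have "y = h x" unfolding h_def by (intro ext) (auto simp: extensional_def)
    then show "y \<in> h ` carrier S" using x by blast
  qed
  have "bij_betw h (carrier S) (carrier ?P)" using inj surj hC unfolding bij_betw_def by blast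
  moreover have "h (c \<odot> x) = c \<odot>\<^bsub>?P\<^esub> h x" if "c \<in> carrier K" "x \<in> carrier S" for c x
    unfolding h_def product_algebra_def using that bC smult_mult by (auto intro!: ext)
  ultimately show ?thesis using hom unfolding algebra_iso_def ring_iso_def h_def by blast
qed

end

text \<open>Of two degrees of different parity one is even and the other odd, whence the form of the
  hypotheses. The zero ring gives an empty family of idempotents and thus the empty product.\<close>

theorem mainTheorem2:
  fixes K :: "('k, 'r) ring_scheme" and S :: "('k, 'a, 'm) module_scheme" and m n :: nat
  assumes "field K" and "algebra K S" and "finite_dimensional K S"
    and "even m" and "odd n"
    and "trivial_group (hochschild_cohomology K S m)"
    and "trivial_group (hochschild_cohomology K S n)"
  shows "product_of_separable_field_extensions K S"
proof -
  interpret field_algebra K S using assms(1,2) by (intro field_algebra.intro)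
  obtain E where E: "finite E" "orthogonal E" "(\<Oplus>\<^bsub>S\<^esub>x\<in>E. x) = \<one>\<^bsub>S\<^esub>"
    and prim: "\<forall>e \<in> E. \<forall>f \<in> carrier S. f \<otimes>\<^bsub>S\<^esub> f = f \<longrightarrow> e \<otimes>\<^bsub>S\<^esub> f = f \<longrightarrow> f = \<zero>\<^bsub>S\<^esub> \<or> f = e"
    using primitive_idempotents[OF assms(3)] by blast
  obtain b where b: "bij_betw b {..<card E} E"
    using ex_bij_betw_nat_finite[OF E(1)] unfolding atLeast0LessThan by blast
  have "separable_field_extension K (corner (b i))" if "i < card E" for i
  proof -
    have bE: "b i \<in> E" using b that unfolding bij_betw_def by auto
    have e: "b i \<in> carrier S" "b i \<otimes>\<^bsub>S\<^esub> b i = b i" "b i \<noteq> \<zero>\<^bsub>S\<^esub>" using E(2) bE unfolding orthogonal_def by auto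
    show ?thesis by (rule corner_separable[OF e(1,2) assms(3) e(3) _ assms(4-7)]) (use prim bE in blast)
  qed
  then show ?thesis
    unfolding product_of_separable_field_extensions_def
    using iso_product_corners[OF E b] by (intro exI[of _ "card E"] exI[of _ "\<lambda>i. corner (b i)"]) blast
qed

end
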